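(* Let $(\mu_t)_{t>0}$ be a family of Borel probability measures on $\mathbb R^d$. Assume: (1) for every $\varphi\in C_c^\infty(\mathbb R^d)$, the limit $\lim_{h\downarrow0}\int_{\mathbb R^d}\frac{\varphi(y)-\varphi(0)}{h}\,\mu_h(dy)\in\mathbb R$ exists; (2) for every $\varepsilon>0$ there exists $M_\varepsilon>0$ such that $\limsup_{h\downarrow0}\frac1h\,\mu_h(\{y\in\mathbb R^d:|y|>M_\varepsilon\})<\varepsilon$. Then there exists a unique (in law) Lévy process $(Y_t)_{t\ge0}$ on some probability space $(\Omega,\mathcal F,\mathbb P)$ such that: (i) for every null sequence $(h_n)_{n\in\mathbb N}\subset(0,\infty)$, all $p\in[1,\infty)$, $t\ge0$, $f\in L_p(\mathbb R^d)$, $(k_n)_{n\in\mathbb N}\subset\mathbb N$ with $k_nh_n\to t$, and $(f_n)_{n\in\mathbb N}\subset L_p(\mathbb R^d)$ with $f_n\to f$ in $L_p(\mathbb R^d)$, $$\lim_{n\to\infty}\Big\|\int_{\mathbb R^d}f_n(\,\cdot+y)\,\mu_{h_n}^{\ast k_n}(dy)-\mathbb E_{\mathbb P}[f(\,\cdot+Y_t)]\Big\|_p=0;$$ (ii) for every null sequence $(h_n)_{n\in\mathbb N}\subset(0,\infty)$, all $t\ge0$, $f\in \mathrm{UC}_b(\mathbb R^d)$, $(k_n)_{n\in\mathbb N}\subset\mathbb N$ with $k_nh_n\to t$, and $(f_n)_{n\in\mathbb N}\subset \mathrm{UC}_b(\mathbb R^d)$ with $\|f_n-f\|_\infty\to0$,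 $$\lim_{n\to\infty}\Big\|\int_{\mathbb R^d}f_n(\,\cdot+y)\,\mu_{h_n}^{\ast k_n}(dy)-\mathbb E_{\mathbb P}[f(\,\cdot+Y_t)]\Big\|_\infty=0.$$ Moreover, if $p\in[1,\infty)$ and $f\in L_p(\mathbb R^d)$ is such that $\lim_{h\downarrow0}\int_{\mathbb R^d}\frac{f(\,\cdot+y)-f}{h}\,\mu_h(dy)$ exists in $L_p(\mathbb R^d)$, then $$\lim_{h\downarrow0}\frac1h\Big\|\int_{\mathbb R^d}f(\,\cdot+y)\,\mu_h(dy)-\mathbb E_{\mathbb P}[f(\,\cdot+Y_h)]\Big\|_p=0,$$ and if $f\in \mathrm{UC}_b(\mathbb R^d)$ is such that $\lim_{h\downarrow0}\int_{\mathbb R^d}\frac{f(\,\cdot+y)-f}{h}\,\mu_h(dy)$ exists in $\mathrm{UC}_b(\mathbb R^d)$ (with respect to $\|\cdot\|_\infty$), then $$\lim_{h\downarrow0}\frac1h\Big\|\int_{\mathbb R^d}f(\,\cdot+y)\,\mu_h(dy)-\mathbb E_{\mathbb P}[f(\,\cdot+Y_h)]\Big\|_\infty=0.$$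
   Context: $d\in\mathbb N$; $|\cdot|$ is the Euclidean norm. $C_c^\infty(\mathbb R^d)$ is the space of smooth compactly supported real functions. $\mathrm{UC}_b(\mathbb R^d)$ is the space of bounded uniformly continuous functions $\mathbb R^d\to\mathbb R$ with the supremum norm $\|\cdot\|_\infty$. $L_p(\mathbb R^d)$ is the usual Lebesgue space (Lebesgue measure) with norm $\|\cdot\|_p$. A null sequence is a sequence converging to $0$. $\mu^{\ast k}$ denotes the $k$-fold convolution $\mu\ast\cdots\ast\mu$. A Lévy process $(Y_t)_{t\ge0}$ is an $\mathbb R^d$-valued process with $Y_0=0$ a.s., stationary independent increments, stochastically continuous, with a.s. càdlàg paths. *)

theory Defs
  imports "HOL-Probability.Probability"
begin

section \<open>Function spaces\<close>

primrec C_k :: "nat \<Rightarrow> ('a::euclidean_space \<Rightarrow> real) \<Rightarrow> bool" where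
  "C_k 0 f \<longleftrightarrow> continuous_on UNIV f"
| "C_k (Suc k) f \<longleftrightarrow>
     f differentiable_on UNIV \<and> (\<forall>i\<in>Basis. C_k k (\<lambda>x. frechet_derivative f (at x) i))"

definition Cc_infinity :: "('a::euclidean_space \<Rightarrow> real) set" where
  "Cc_infinity = {f. (\<forall>k. C_k k f) \<and> compact (closure {x. f x \<noteq> 0})}"

text \<open>The sup norm and the \<open>L\<^sub>p\<close> norm take values in \<open>[0, \<infinity>]\<close>. Hence convergence of a norm to \<open>0\<close>
  includes the assertion that the norms are eventually finite; with a real-valued (Bochner) integral
  a non-integrable function would get norm \<open>0\<close>.\<close>

definition sup_norm :: "('a \<Rightarrow> real) \<Rightarrow> ennreal" where
  "sup_norm f = (SUP x. ennreal \<bar>f x\<bar>)"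

definition UC_b :: "('a::euclidean_space \<Rightarrow> real) set" where
  "UC_b = {f. bounded (range f) \<and> uniformly_continuous_on UNIV f}"

definition Lp_norm :: "real \<Rightarrow> ('a::euclidean_space \<Rightarrow> real) \<Rightarrow> ennreal" where
  "Lp_norm p f =
     (let I = \<integral>\<^sup>+x. ennreal (\<bar>f x\<bar> powr p) \<partial>lborel
      in if I = \<infinity> then \<infinity> else ennreal (enn2real I powr (1 / p)))"

text \<open>Elements of \<open>L\<^sub>p\<close> are represented by Borel functions. Every Lebesgue class contains one, and Borel
  measurability is what makes \<open>y \<mapsto> f (x + y)\<close> measurable for an arbitrary Borel measure. The function
  \<open>x \<mapsto> \<integral>y. f (x + y) \<partial>\<nu>\<close> depends, up to Lebesgue null sets, only on the class of \<open>f\<close>;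
  for a probability measure \<open>\<nu>\<close> the integral exists for almost every \<open>x\<close>, and at the remaining
  points it has the default value \<open>0\<close>.\<close>

definition Lp :: "real \<Rightarrow> ('a::euclidean_space \<Rightarrow> real) set" where
  "Lp p = {f \<in> borel_measurable borel. Lp_norm p f < \<infinity>}"

section \<open>Convolution powers\<close>

text \<open>The empty convolution is the Dirac measure at \<open>0\<close>.\<close>

primrec conv_power :: "'a::ordered_euclidean_space measure \<Rightarrow> nat \<Rightarrow> 'a measure" where
  "conv_power M 0 = return borel 0"
| "conv_power M (Suc k) = convolution M (conv_power M k)"

section \<open>Levy processes\<close>

definition cadlag :: "(real \<Rightarrow> 'a::topological_space) \<Rightarrow> bool" where
  "cadlag y \<longleftrightarrow>
     (\<forall>t\<ge>0. (y \<longlongrightarrow> y t) (at_right t)) \<and> (\<forall>t>0. \<exists>l. (y \<longlongrightarrow> l) (at_left t))"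

text \<open>The time set is \<open>[0, \<infinity>)\<close>: the values of \<open>Y\<close> at negative times play no role.\<close>

definition levy_process ::
    "'w measure \<Rightarrow> (real \<Rightarrow> 'w \<Rightarrow> 'a::euclidean_space) \<Rightarrow> bool" where
  "levy_process P Y \<longleftrightarrow>
     prob_space P \<and>
     (\<forall>t\<ge>0. Y t \<in> borel_measurable P) \<and>
     (AE \<omega> in P. Y 0 \<omega> = 0) \<and>
     (\<forall>s\<ge>0. \<forall>t\<ge>0.
        distr P borel (\<lambda>\<omega>. Y (s + t) \<omega> - Y s \<omega>) = distr P borel (\<lambda>\<omega>. Y t \<omega> - Y 0 \<omega>)) \<and>
     (\<forall>n::nat. \<forall>\<tau>::nat \<Rightarrow> real. 0 \<le> \<tau> 0 \<longrightarrow> (\<forall>i<n. \<tau> i < \<tau> (Suc i)) \<longrightarrow>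
        prob_space.indep_vars P (\<lambda>_. borel) (\<lambda>i \<omega>. Y (\<tau> (Suc i)) \<omega> - Y (\<tau> i) \<omega>) {..<n}) \<and>
     (\<forall>t\<ge>0. \<forall>\<epsilon>>0.
        ((\<lambda>s. measure P {\<omega> \<in> space P. norm (Y s \<omega> - Y t \<omega>) > \<epsilon>}) \<longlongrightarrow> 0) (at t within {0..})) \<and>
     (AE \<omega> in P. cadlag (\<lambda>t. Y t \<omega>))"

text \<open>The law of a process on the product space, equivalently the collection of all its
  finite-dimensional distributions.\<close>

definition process_law ::
    "'w measure \<Rightarrow> (real \<Rightarrow> 'w \<Rightarrow> 'a::euclidean_space) \<Rightarrow> (real \<Rightarrow> 'a) measure" where
  "process_law P Y = distr P (Pi\<^sub>M {0..} (\<lambda>_. borel)) (\<lambda>\<omega>. \<lambda>t\<in>{0..}. Y t \<omega>)"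

section \<open>Approximation by convolution powers\<close>

definition Lp_approximation ::
    "(real \<Rightarrow> 'a::ordered_euclidean_space measure) \<Rightarrow> 'w measure \<Rightarrow> (real \<Rightarrow> 'w \<Rightarrow> 'a) \<Rightarrow> bool" where
  "Lp_approximation \<mu> P Y \<longleftrightarrow>
     (\<forall>(h::nat \<Rightarrow> real) (p::real) (t::real) f (k::nat \<Rightarrow> nat) (fs::nat \<Rightarrow> 'a \<Rightarrow> real).
        (\<forall>n. h n > 0) \<longrightarrow> h \<longlonglongrightarrow> 0 \<longrightarrow> p \<ge> 1 \<longrightarrow> t \<ge> 0 \<longrightarrow> f \<in> Lp p \<longrightarrow>
        (\<lambda>n. real (k n) * h n) \<longlonglongrightarrow> t \<longrightarrow>
        (\<forall>n. fs n \<in> Lp p) \<longrightarrow> (\<lambda>n. Lp_norm p (\<lambda>x. fs n x - f x)) \<longlonglongrightarrow> 0 \<longrightarrow>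
        (\<lambda>n. Lp_norm p (\<lambda>x.
           (\<integral>y. fs n (x + y) \<partial>conv_power (\<mu> (h n)) (k n)) - (\<integral>\<omega>. f (x + Y t \<omega>) \<partial>P)))
          \<longlonglongrightarrow> 0)"

definition UC_b_approximation ::
    "(real \<Rightarrow> 'a::ordered_euclidean_space measure) \<Rightarrow> 'w measure \<Rightarrow> (real \<Rightarrow> 'w \<Rightarrow> 'a) \<Rightarrow> bool" where
  "UC_b_approximation \<mu> P Y \<longleftrightarrow>
     (\<forall>(h::nat \<Rightarrow> real) (t::real) f (k::nat \<Rightarrow> nat) (fs::nat \<Rightarrow> 'a \<Rightarrow> real).
        (\<forall>n. h n > 0) \<longrightarrow> h \<longlonglongrightarrow> 0 \<longrightarrow> t \<ge> 0 \<longrightarrow> f \<in> UC_b \<longrightarrow>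
        (\<lambda>n. real (k n) * h n) \<longlonglongrightarrow> t \<longrightarrow>
        (\<forall>n. fs n \<in> UC_b) \<longrightarrow> (\<lambda>n. sup_norm (\<lambda>x. fs n x - f x)) \<longlonglongrightarrow> 0 \<longrightarrow>
        (\<lambda>n. sup_norm (\<lambda>x.
           (\<integral>y. fs n (x + y) \<partial>conv_power (\<mu> (h n)) (k n)) - (\<integral>\<omega>. f (x + Y t \<omega>) \<partial>P)))
          \<longlonglongrightarrow> 0)"

end

theory Submission
  imports Defs
begin

text \<open>Characteristic functions turn convolution powers into powers of \<open>1 + h a\<^sub>h\<close>. The generator
  hypothesis on test functions and the tail hypothesis make \<open>a\<^sub>h\<close> converge to some \<open>\<psi>\<close>, so that the
  characteristic functions of \<open>\<mu>\<^sub>h\<close> to the power \<open>k\<close> tend to \<open>exp (t \<psi>)\<close> when \<open>k h\<close> tends to \<open>t\<close>.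
  The function \<open>\<Sum>\<^sub>i x\<^sub>i\<^sup>2 / (R\<^sup>2 + x\<^sub>i\<^sup>2)\<close> grows at most linearly in \<open>k h\<close> along the powers, which gives tightness;
  hence the powers converge weakly to a convolution semigroup \<open>\<nu>\<^sub>t\<close>, and couplings with small
  distance in probability exist. Continuity of translation in \<open>L\<^sub>p\<close> and in the supremum norm turns
  these couplings into convergence of the convolution operators, and the statement on the generator
  follows by telescoping.

  The process is built from the increments at dyadic times. A greedy count of the moves larger
  than \<open>\<epsilon>\<close> has finite expectation uniformly in the mesh, so almost surely the dyadic path
  oscillates finitely often and its right limits form a cadlag process. Its law is determined by
  the one-dimensional distributions, and these by convergence on sines and cosines.\<close>

section \<open>Smooth functions\<close>

text \<open>The argument stays with measures: no domains or cores of operators enter. The first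
  hypothesis concerns compactly supported functions only; it is the tail hypothesis that carries it
  over to sines and cosines, since a cutoff at a large radius changes the difference quotients by a
  small multiple of the sup norm. Pointwise limits of characteristic functions do not by themselves
  give a limit measure, so tightness is proved separately; limits along subsequences are then
  identified by their characteristic functions, and since they all agree the whole sequence
  converges. The Lyapunov function is bounded with bounded slope because second moments of the
  measures may be infinite; this makes its one-step growth bound uniform in the starting point. Used
  with \<open>R\<close> large it gives tightness; used with \<open>R\<close> proportional to
  \<delta> it gives mass at most \<open>c * t\<close> beyond distance \<delta> for the limit laws.
  That linear bound is behind both stochastic continuity and the regularity of the paths.\<close>

lemma C_k_continuous: "C_k k f \<Longrightarrow> continuous_on UNIV f"
  by (cases k) (auto simp: differentiable_imp_continuous_on)

lemma C_k_Suc_I: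
  fixes f :: "'a::euclidean_space \<Rightarrow> real"
  assumes "\<And>x. (f has_derivative f' x) (at x)" and "\<And>i. i \<in> Basis \<Longrightarrow> C_k k (\<lambda>x. f' x i)"
  shows "C_k (Suc k) f"
proof -
  have "frechet_derivative f (at x) = f' x" for x
    using frechet_derivative_at[OF assms(1)[of x]] by simp
  moreover have "f differentiable_on UNIV"
    using assms(1) by (auto simp: differentiable_on_def differentiable_def)
  ultimately show ?thesis
    using assms(2) by simp
qed

lemma C_k_Suc_has_derivative:
  "C_k (Suc k) f \<Longrightarrow> (f has_derivative frechet_derivative f (at x)) (at x)"
  by (simp add: differentiable_on_def frechet_derivative_works)

declare C_k.simps(2) [simp del]

lemma C_k_mono: "C_k (Suc k) f \<Longrightarrow> C_k k f"
proof (induction k arbitrary: f)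
  case (Suc k)
  then show ?case
    using C_k.simps(2)[of "Suc k" f] C_k.simps(2)[of k f] by blast
qed (simp add: C_k.simps(2) differentiable_imp_continuous_on)

lemma C_k_const [simp]: "C_k k (\<lambda>x::'a::euclidean_space. c)"
proof (induction k arbitrary: c)
  case (Suc k)
  show ?case
    by (rule C_k_Suc_I[where f' = "\<lambda>_ _. 0"]) (auto simp: Suc)
qed simp

lemma C_k_inner [simp]: "C_k k (\<lambda>x::'a::euclidean_space. x \<bullet> v)"
proof (cases k)
  case (Suc k)
  have "C_k (Suc k) (\<lambda>x::'a. x \<bullet> v)"
    by (rule C_k_Suc_I[where f' = "\<lambda>_ y. y \<bullet> v"]) (auto intro!: derivative_eq_intros)
  then show ?thesis by (simp only: Suc)
qed (auto intro!: continuous_intros)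

lemma C_k_add: "C_k k f \<Longrightarrow> C_k k g \<Longrightarrow> C_k k (\<lambda>x. f x + g x)"
proof (induction k arbitrary: f g)
  case (Suc k)
  note f = C_k_Suc_has_derivative[OF Suc.prems(1)] and g = C_k_Suc_has_derivative[OF Suc.prems(2)]
  show ?case
    by (rule C_k_Suc_I, rule has_derivative_add[OF f g], rule Suc.IH) (use Suc.prems in \<open>auto simp: C_k.simps(2)\<close>)
qed (auto intro: continuous_intros)

lemma C_k_mult: "C_k k f \<Longrightarrow> C_k k g \<Longrightarrow> C_k k (\<lambda>x. f x * g x)"
proof (induction k arbitrary: f g)
  case (Suc k)
  note f = C_k_Suc_has_derivative[OF Suc.prems(1)] and g = C_k_Suc_has_derivative[OF Suc.prems(2)]
  show ?case
    by (rule C_k_Suc_I, rule has_derivative_mult[OF f g], rule C_k_add; rule Suc.IH)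
       (use Suc.prems C_k_mono[OF Suc.prems(1)] C_k_mono[OF Suc.prems(2)] in \<open>auto simp: C_k.simps(2)\<close>)
qed (auto intro: continuous_intros)

lemma C_k_prod: "(\<And>i. i \<in> I \<Longrightarrow> C_k k (f i)) \<Longrightarrow> C_k k (\<lambda>x. \<Prod>i\<in>I. f i x)"
  by (induction I rule: infinite_finite_induct) (auto intro: C_k_mult)

lemma frechet_derivative_real:
  fixes f :: "real \<Rightarrow> real"
  assumes "f differentiable at x"
  shows "frechet_derivative f (at x) y = y * frechet_derivative f (at x) 1"
proof -
  have "linear (frechet_derivative f (at x))"
    using assms by (rule linear_frechet_derivative)
  from linear_scale[OF this, of y 1] show ?thesis by simp
qed

text \<open>For an affine inner function the chain rule only produces a constant times a composition
  of the same kind, so the induction closes without a general chain rule. Cosines, sines and cutoffs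
  need no more.\<close>

lemma C_k_compose_affine:
  fixes f :: "real \<Rightarrow> real" and v :: "'a::euclidean_space"
  shows "C_k k f \<Longrightarrow> C_k k (\<lambda>x. f (x \<bullet> v + c))"
proof (induction k arbitrary: f)
  case 0
  then have "continuous_on UNIV f" by simp
  then have "continuous_on UNIV (\<lambda>x::'a. f (x \<bullet> v + c))"
    by (rule continuous_on_compose2) (auto intro!: continuous_intros)
  then show ?case by simp
next
  case (Suc k)
  have d: "f differentiable at x" for x
    using Suc.prems by (simp add: C_k.simps(2) differentiable_on_def)
  have D: "((\<lambda>x::'a. f (x \<bullet> v + c)) has_derivative
      (\<lambda>y. (y \<bullet> v) * frechet_derivative f (at (x \<bullet> v + c)) 1)) (at x)" for x
  proof -
    have "((\<lambda>x::'a. x \<bullet> v + c) has_derivative (\<lambda>y. y \<bullet> v)) (at x)"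
      by (auto intro!: derivative_eq_intros)
    from has_derivative_compose[OF this C_k_Suc_has_derivative[OF Suc.prems]] show ?thesis
      by (subst frechet_derivative_real[OF d, symmetric])
  qed
  show ?case
    by (rule C_k_Suc_I[OF D], rule C_k_mult[OF C_k_const], rule Suc.IH)
       (use Suc.prems in \<open>auto simp: C_k.simps(2)\<close>)
qed

lemma C_k_real_Suc_I:
  fixes f :: "real \<Rightarrow> real"
  assumes "\<And>x. (f has_real_derivative f' x) (at x)" "C_k k f'"
  shows "C_k (Suc k) f"
  by (rule C_k_Suc_I[where f' = "\<lambda>x. (*) (f' x)"]) (use assms in \<open>auto simp: has_field_derivative_def\<close>)

text \<open>No formula for higher derivatives is needed: it suffices to name a sequence in which
  each member is the derivative of the previous one, and to do the induction for all members at
  once.\<close>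

lemma C_k_derivative_sequence:
  fixes F :: "nat \<Rightarrow> real \<Rightarrow> real"
  assumes "\<And>n x. (F n has_real_derivative F (Suc n) x) (at x)"
  shows "C_k k (F n)"
proof (induction k arbitrary: n)
  case 0
  then show ?case
    using assms[of n] by (auto simp: continuous_on_eq_continuous_at intro: DERIV_isCont)
next
  case (Suc k)
  then show ?case
    by (intro C_k_real_Suc_I[OF assms])
qed

lemma C_k_cos: "C_k k (\<lambda>x::real. cos (x + c))"
proof -
  \<comment> \<open>Differentiating the cosine shifts its argument by a quarter period, so its
    derivatives are the translates by multiples of \<open>pi / 2\<close>.\<close>
  define a where "a n = c + real n * (pi / 2)" for n
  have a: "x + a n + pi / 2 = x + a (Suc n)" for x n
    by (simp add: a_def distrib_right)
  have "((\<lambda>x. cos (x + a n)) has_real_derivative cos (x + a (Suc n))) (at x)" for n x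
  proof -
    have "((\<lambda>x. cos (x + a n)) has_real_derivative - sin (x + a n) * 1) (at x)"
      by (rule DERIV_chain2[OF DERIV_cos]) (auto intro!: derivative_eq_intros)
    moreover have "- sin (x + a n) * 1 = cos (x + a (Suc n))"
      by (simp only: mult_1_right minus_sin_cos_eq of_real_eq_id id_apply a)
    ultimately show ?thesis by (rule DERIV_cong)
  qed
  then have "C_k k (\<lambda>x. cos (x + a 0))"
    by (rule C_k_derivative_sequence[where F = "\<lambda>n x. cos (x + a n)"])
  then show ?thesis by (simp only: a_def of_nat_0 mult_zero_left add_0_right)
qed

lemma C_k_cos_inner: "C_k k (\<lambda>x. cos (x \<bullet> v))"
  using C_k_compose_affine[of k cos v 0] C_k_cos[of k 0] by (simp only: add_0_right)

lemma C_k_sin_inner: "C_k k (\<lambda>x. sin (x \<bullet> v))"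
proof -
  have "cos (y + - (pi / 2)) = sin y" for y :: real
    using cos_diff[of y "pi / 2"] by simp
  then show ?thesis
    using C_k_compose_affine[of k cos v "- (pi / 2)"] C_k_cos[of k 0] by (simp only: add_0_right)
qed

section \<open>Smooth step and cutoff functions\<close>

definition exp_bump :: "real poly \<Rightarrow> real \<Rightarrow> real" where
  "exp_bump p x = (if x > 0 then poly p (1 / x) * exp (- (1 / x)) else 0)"

text \<open>The functions \<open>p (1/x) * exp (-1/x)\<close> form a class closed under
  differentiation: the derivative replaces \<open>p\<close> by \<open>X^2 * (p - p')\<close>. Away
  from 0 this is calculus; at 0 both one-sided difference quotients must tend to 0.\<close>

lemma exp_bump_has_derivative:
  "(exp_bump p has_real_derivative exp_bump ([:0, 0, 1:] * (p - pderiv p)) x) (at x)"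
proof -
  consider "x > 0" | "x < 0" | "x = 0" by linarith
  then show ?thesis
  proof cases
    case 1
    have "((\<lambda>x. poly p (1 / x) * exp (- (1 / x))) has_real_derivative
       exp_bump ([:0, 0, 1:] * (p - pderiv p)) x) (at x)"
      using 1
      by (auto intro!: derivative_eq_intros poly_DERIV[THEN DERIV_chain2]
          simp: exp_bump_def field_simps power2_eq_square)
    then show ?thesis
      by (rule has_field_derivative_transform_within_open[where S = "{0<..}"])
         (use 1 in \<open>auto simp: exp_bump_def\<close>)
  next
    case 2
    have "((\<lambda>x. 0) has_real_derivative exp_bump ([:0, 0, 1:] * (p - pderiv p)) x) (at x)"
      using 2 by (auto simp: exp_bump_def)
    then show ?thesis
      by (rule has_field_derivative_transform_within_open[where S = "{..<0}"])
         (use 2 in \<open>auto simp: exp_bump_def\<close>)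
  next
    case 3
    \<comment> \<open>With \<open>y\<close> replaced by its inverse the right difference quotient at
      0 becomes a polynomial divided by the exponential, at infinity.\<close>
    have lim: "((\<lambda>y. poly p y / exp y) \<longlongrightarrow> 0) at_top" for p :: "real poly"
      unfolding poly_altdef sum_divide_distrib times_divide_eq_right[symmetric]
      by (intro tendsto_null_sum tendsto_mult_right_zero tendsto_power_div_exp_0)
    have "((\<lambda>y. exp_bump p y / y) \<longlongrightarrow> 0) (at_right 0)"
    proof (rule Lim_transform_eventually)
      show "((\<lambda>y. poly ([:0, 1:] * p) (inverse y) / exp (inverse y)) \<longlongrightarrow> 0) (at_right (0::real))"
        by (rule filterlim_compose[OF lim filterlim_inverse_at_top_right])
      show "\<forall>\<^sub>F y in at_right 0. poly ([:0, 1:] * p) (inverse y) / exp (inverse y) = exp_bump p y / y"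
        by (auto simp: eventually_at_filter exp_bump_def exp_minus field_simps)
    qed
    moreover have "((\<lambda>y. exp_bump p y / y) \<longlongrightarrow> 0) (at_left 0)"
      by (rule Lim_transform_eventually[OF tendsto_const])
         (auto simp: eventually_at_filter exp_bump_def)
    ultimately have "((\<lambda>y. exp_bump p y / y) \<longlongrightarrow> 0) (at 0)"
      by (simp add: filterlim_split_at)
    with 3 show ?thesis
      by (simp add: has_field_derivative_iff exp_bump_def)
  qed
qed

lemma C_k_exp_bump: "C_k k (exp_bump p)"
proof -
  define F where "F n = exp_bump (((\<lambda>p. [:0, 0, 1:] * (p - pderiv p)) ^^ n) p)" for n
  have "C_k k (F 0)"
    by (rule C_k_derivative_sequence) (simp add: F_def exp_bump_has_derivative del: mult_pCons_left)
  then show ?thesis by (simp add: F_def)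
qed

text \<open>The step is the normalised primitive of a smooth bump living on the unit
  interval.\<close>

lemma smooth_step:
  obtains \<zeta> :: "real \<Rightarrow> real" where "\<And>k. C_k k \<zeta>" "\<And>x. x \<le> 0 \<Longrightarrow> \<zeta> x = 0" "\<And>x. x \<ge> 1 \<Longrightarrow> \<zeta> x = 1"
    "\<And>x. 0 \<le> \<zeta> x" "\<And>x. \<zeta> x \<le> 1"
proof -
  define \<beta> where "\<beta> x = exp_bump 1 x * exp_bump 1 (1 - x)" for x
  have C\<beta>: "C_k k \<beta>" for k
  proof -
    have "x \<bullet> (- 1) + 1 = 1 - x" for x :: real
      by (simp add: inner_real_def)
    then have "C_k k (\<lambda>x::real. exp_bump 1 (1 - x))"
      using C_k_compose_affine[OF C_k_exp_bump[of k 1], of "-1::real" 1] by (simp only:)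
    then show ?thesis
      unfolding \<beta>_def by (intro C_k_mult C_k_exp_bump)
  qed
  have cont: "continuous_on A \<beta>" for A
    using C\<beta>[of 0] continuous_on_subset by auto
  have nn: "\<beta> x \<ge> 0" for x
    by (simp add: \<beta>_def exp_bump_def)
  have z: "\<beta> x = 0" if "x \<le> 0 \<or> x \<ge> 1" for x
    using that by (auto simp: \<beta>_def exp_bump_def)
  \<comment> \<open>The integral starts at -1, not at 0, so that every \<open>x\<close> with
    \<open>x \<ge> 0\<close> is interior to \<open>{-1..x+1}\<close> and the one-sided fundamental
    theorem gives a two-sided derivative. For \<open>x\<close> below -1 the interval is empty and
    the integral is 0, as it should be.\<close>
  define I where "I x = integral {-1..x} \<beta>" for x
  have int: "\<beta> integrable_on {a..b}" for a b
    by (intro integrable_continuous_real cont)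
  have I0: "I x = 0" if "x \<le> 0" for x
    unfolding I_def using that z by (intro integral_eq_0_iff[THEN iffD2] integral_unique[OF has_integral_is_0]) auto
  have D: "(I has_real_derivative \<beta> x) (at x)" for x
  proof (cases "x < 0")
    case True
    have "((\<lambda>x. 0) has_real_derivative \<beta> x) (at x)"
      using True by (simp add: z)
    then show ?thesis
      by (rule has_field_derivative_transform_within_open[where S = "{..<0}"])
         (use True in \<open>auto simp: I0\<close>)
  next
    case False
    have "(I has_real_derivative \<beta> x) (at x within {-1..x+1})"
      unfolding I_def using False by (intro integral_has_real_derivative cont) auto
    then show ?thesis
      using False by (subst (asm) at_within_interior) auto
  qed
  have mono: "I x \<le> I y" if "x \<le> y" for x y
    by (rule DERIV_nonneg_imp_nondecreasing[OF that]) (use D nn in blast)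
  have const: "I x = I 1" if "x \<ge> 1" for x
  proof (cases "x = 1")
    case False
    show ?thesis
    proof (rule DERIV_isconst2[of 1 x])
      show "1 < x" using that False by simp
      show "continuous_on {1..x} I"
        using D by (auto intro!: continuous_at_imp_continuous_on DERIV_isCont)
      show "(I has_real_derivative 0) (at y)" if "1 < y" for y
        using D[of y] z[of y] that by simp
    qed (use that in auto)
  qed simp
  \<comment> \<open>If the total mass were 0, monotonicity would make the primitive vanish on the
    unit interval, against the positive value of \<beta> at \<open>1/2\<close>.\<close>
  have pos: "I 1 > 0"
  proof (rule ccontr)
    assume "\<not> I 1 > 0"
    then have "I 1 = 0" "I 0 = 0" using mono[of 0 1] I0[of 0] by auto
    have "I x = 0" if "x \<in> {0<..<1}" for x
      using mono[of 0 x] mono[of x 1] that \<open>I 1 = 0\<close> \<open>I 0 = 0\<close> by auto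
    then have "((\<lambda>x. 0) has_real_derivative \<beta> (1/2)) (at (1/2))"
      by (intro has_field_derivative_transform_within_open[OF D, where S = "{0<..<1}"]) auto
    then have "\<beta> (1/2) = 0" by (rule DERIV_unique) simp
    then show False by (simp add: \<beta>_def exp_bump_def)
  qed
  show ?thesis
  proof (rule that[of "\<lambda>x. I x / I 1"])
    show "C_k k (\<lambda>x. I x / I 1)" for k
    proof (rule C_k_mono, rule C_k_real_Suc_I)
      show "((\<lambda>x. I x / I 1) has_real_derivative 1 / I 1 * \<beta> x) (at x)" for x
        using D pos by (auto intro!: derivative_eq_intros)
    qed (rule C_k_mult[OF C_k_const C\<beta>])
    show "x \<ge> 1 \<Longrightarrow> I x / I 1 = 1" for x
      using const[of x] pos by simp
    show "0 \<le> I x / I 1" for x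
      using mono[of "min x 0" x] I0[of "min x 0"] pos by simp
    show "I x / I 1 \<le> 1" for x
      using mono[of x "max x 1"] const[of "max x 1"] pos by simp
  qed (simp add: I0)
qed

text \<open>A product of one-dimensional steps in the coordinates avoids differentiating the norm.
  On the ball of radius \<open>M\<close> all arguments of \<zeta> are at least 1; outside the cube
  of half side \<open>M + 1\<close> one of them is negative.\<close>

lemma smooth_cutoff:
  fixes M :: real
  obtains \<kappa> :: "'a::euclidean_space \<Rightarrow> real" where "\<kappa> \<in> Cc_infinity" "\<And>x. norm x \<le> M \<Longrightarrow> \<kappa> x = 1"
    "\<And>x. 0 \<le> \<kappa> x" "\<And>x. \<kappa> x \<le> 1"
proof -
  obtain \<zeta> :: "real \<Rightarrow> real" where \<zeta>: "\<And>k. C_k k \<zeta>" "\<And>x. x \<le> 0 \<Longrightarrow> \<zeta> x = 0" "\<And>x. x \<ge> 1 \<Longrightarrow> \<zeta> x = 1"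
    "\<And>x. 0 \<le> \<zeta> x" "\<And>x. \<zeta> x \<le> 1"
    using smooth_step by blast
  define \<kappa> :: "'a \<Rightarrow> real" where
    "\<kappa> x = (\<Prod>b\<in>Basis. \<zeta> (x \<bullet> b + (M + 1)) * \<zeta> (x \<bullet> (- b) + (M + 1)))" for x
  have "C_k k \<kappa>" for k
    unfolding \<kappa>_def by (intro C_k_prod C_k_mult C_k_compose_affine \<zeta>)
  moreover have "x \<in> cbox (- (\<Sum>b\<in>Basis. (M + 1) *\<^sub>R b)) (\<Sum>b\<in>Basis. (M + 1) *\<^sub>R b)" if "\<kappa> x \<noteq> 0" for x
  proof -
    have "\<zeta> (x \<bullet> b + (M + 1)) \<noteq> 0 \<and> \<zeta> (x \<bullet> (- b) + (M + 1)) \<noteq> 0" if "b \<in> Basis" for b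
      using \<open>\<kappa> x \<noteq> 0\<close> that unfolding \<kappa>_def by auto
    then have "\<bar>x \<bullet> b\<bar> \<le> M + 1" if "b \<in> Basis" for b
      using \<zeta>(2)[of "x \<bullet> b + (M + 1)"] \<zeta>(2)[of "x \<bullet> (- b) + (M + 1)"] that
      by (fastforce simp: abs_le_iff inner_minus_right)
    then show ?thesis
      by (fastforce simp: mem_box abs_le_iff)
  qed
  then have "bounded {x. \<kappa> x \<noteq> 0}"
    by (intro bounded_subset[OF bounded_cbox]) auto
  ultimately have "\<kappa> \<in> Cc_infinity"
    by (auto simp: Cc_infinity_def)
  moreover have "\<kappa> x = 1" if "norm x \<le> M" for x
  proof -
    have "\<bar>x \<bullet> b\<bar> \<le> M" if "b \<in> Basis" for b
      using Basis_le_norm[OF that, of x] \<open>norm x \<le> M\<close> by simp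
    then show ?thesis
      unfolding \<kappa>_def
      by (intro prod.neutral) (force simp: abs_le_iff \<zeta>(3) inner_minus_right)
  qed
  ultimately show ?thesis
    by (rule that) (auto simp: \<kappa>_def intro!: prod_nonneg prod_le_1 mult_nonneg_nonneg mult_le_one \<zeta>)
qed

lemma Cc_infinity_mult:
  assumes "\<kappa> \<in> Cc_infinity" "\<And>k. C_k k f"
  shows "(\<lambda>x. \<kappa> x * f x) \<in> Cc_infinity"
proof -
  have "closure {x. \<kappa> x * f x \<noteq> 0} \<subseteq> closure {x. \<kappa> x \<noteq> 0}"
    by (intro closure_mono) auto
  then have "compact (closure {x. \<kappa> x * f x \<noteq> 0})"
    using assms by (metis (mono_tags, lifting) Cc_infinity_def Int_absorb1 closed_closure compact_Int_closed mem_Collect_eq)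
  then show ?thesis
    using assms by (auto simp: Cc_infinity_def intro: C_k_mult)
qed

section \<open>Weak compactness in Euclidean space\<close>

text \<open>A Borel injection of \<open>\<real>\<^sup>d\<close> into \<open>\<real>\<close> whose inverse is uniformly continuous: the parities of
  \<open>\<lfloor>2\<^sup>m x\<^sub>i\<rfloor>\<close> are written as ternary digits, and the integer parts are encoded by a natural number.
  It carries the one-dimensional theorems of Helly and Skorohod over to \<open>\<real>\<^sup>d\<close>.\<close>

definition ternary_code :: "(nat \<Rightarrow> 'a set) \<Rightarrow> 'a \<Rightarrow> real" where
  "ternary_code B x = (\<Sum>n. indicator (B n) x * (1 / 3) ^ Suc n)"

lemma
  fixes B :: "nat \<Rightarrow> 'a set"
  shows summable_ternary_code: "summable (\<lambda>n. indicator (B n) x * (1 / 3) ^ Suc n :: real)" (is ?A)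
    and ternary_code_nonneg: "0 \<le> ternary_code B x" (is ?B)
    and ternary_code_le: "ternary_code B x \<le> 1 / 2" (is ?C)
proof -
  have s: "(\<lambda>n. (1 / 3) ^ Suc n :: real) sums (1 / 2)"
    using sums_mult[OF geometric_sums[of "1/3::real"], of "1/3"] by simp
  show A: ?A
    by (rule summable_comparison_test'[OF sums_summable[OF s], of 0]) (auto simp: indicator_def)
  show ?B
    unfolding ternary_code_def by (intro suminf_nonneg A) auto
  show ?C
    unfolding ternary_code_def
    by (subst sums_unique[OF s], intro suminf_le A sums_summable[OF s]) (auto simp: indicator_def)
qed

lemma ternary_code_shift:
  "ternary_code B x = (\<Sum>i<n. indicator (B i) x * (1 / 3) ^ Suc i)
     + (1 / 3) ^ n * ternary_code (\<lambda>i. B (i + n)) x"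
proof -
  have "ternary_code B x = (\<Sum>i. indicator (B (i + n)) x * (1 / 3) ^ Suc (i + n))
      + (\<Sum>i<n. indicator (B i) x * (1 / 3) ^ Suc i)"
    unfolding ternary_code_def by (rule suminf_split_initial_segment[OF summable_ternary_code])
  also have "(\<Sum>i. indicator (B (i + n)) x * (1 / 3 :: real) ^ Suc (i + n))
      = (1 / 3) ^ n * ternary_code (\<lambda>i. B (i + n)) x"
    unfolding ternary_code_def
    by (subst suminf_mult[OF summable_ternary_code, symmetric]) (simp add: power_add mult_ac)
  finally show ?thesis by simp
qed

text \<open>With digits 0 and 1 in base three, all later digits together weigh at most half of the
  current one. Codes that first differ at digit \<open>k\<close> are therefore at least
  \<open>(1/3) ^ Suc k / 2\<close> apart; in base two this gap would vanish.\<close>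

lemma ternary_code_separates:
  assumes "\<bar>ternary_code B x - ternary_code B y\<bar> < (1 / 3) ^ Suc N / 2" and "n \<le> N"
  shows "x \<in> B n \<longleftrightarrow> y \<in> B n"
proof (rule ccontr)
  assume neq: "\<not> (x \<in> B n \<longleftrightarrow> y \<in> B n)"
  define k where "k = (LEAST k. \<not> (x \<in> B k \<longleftrightarrow> y \<in> B k))"
  have k: "\<not> (x \<in> B k \<longleftrightarrow> y \<in> B k)"
    unfolding k_def by (rule LeastI[where P = "\<lambda>k. \<not> (x \<in> B k \<longleftrightarrow> y \<in> B k)", OF neq])
  have less: "x \<in> B i \<longleftrightarrow> y \<in> B i" if "i < k" for i
    using not_less_Least[of i "\<lambda>k. \<not> (x \<in> B k \<longleftrightarrow> y \<in> B k)"] that by (auto simp: k_def)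
  have "k \<le> N"
    unfolding k_def using Least_le[of "\<lambda>k. \<not> (x \<in> B k \<longleftrightarrow> y \<in> B k)", OF neq] assms(2) by simp
  define d where "d z = ternary_code (\<lambda>i. B (i + Suc k)) z" for z
  have d: "\<bar>d x - d y\<bar> \<le> 1 / 2"
    using ternary_code_nonneg[of "\<lambda>i. B (i + Suc k)" x] ternary_code_le[of "\<lambda>i. B (i + Suc k)" x]
      ternary_code_nonneg[of "\<lambda>i. B (i + Suc k)" y] ternary_code_le[of "\<lambda>i. B (i + Suc k)" y]
    unfolding d_def by linarith
  have "(\<Sum>i<k. indicator (B i) x * (1 / 3) ^ Suc i) = (\<Sum>i<k. indicator (B i) y * (1 / 3) ^ Suc i :: real)"
    by (intro sum.cong) (auto simp: indicator_def less)
  then have "ternary_code B x - ternary_code B y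
      = (1 / 3) ^ Suc k * ((indicator (B k) x - indicator (B k) y) + (d x - d y))"
    unfolding ternary_code_shift[of B x "Suc k"] ternary_code_shift[of B y "Suc k"]
    by (simp add: d_def algebra_simps)
  then have "\<bar>ternary_code B x - ternary_code B y\<bar>
      = (1 / 3) ^ Suc k * \<bar>(indicator (B k) x - indicator (B k) y) + (d x - d y)\<bar>"
    by (simp only: abs_mult) simp
  moreover have "\<bar>(indicator (B k) x - indicator (B k) y) + (d x - d y)\<bar> \<ge> 1 / 2"
    using k d by (auto simp: indicator_def abs_if split: if_splits)
  moreover have "(1 / 3 :: real) ^ Suc k \<ge> (1 / 3) ^ Suc N"
    using \<open>k \<le> N\<close> by (intro power_decreasing) auto
  ultimately have "\<bar>ternary_code B x - ternary_code B y\<bar> \<ge> (1 / 3) ^ Suc N * (1 / 2)"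
    by (simp only:) (intro mult_mono, simp_all)
  then show False using assms(1) by simp
qed

definition space_code :: "real ^ 'd \<Rightarrow> real" where
  "space_code x = real (to_nat (\<lambda>i. \<lfloor>x $ i\<rfloor>))
     + ternary_code (\<lambda>n. case from_nat n of (i, m) \<Rightarrow> {x. odd \<lfloor>2 ^ m * x $ i\<rfloor>}) x"

lemma measurable_space_code [measurable]: "space_code \<in> borel_measurable borel"
proof -
  have A: "(\<lambda>x::real^'d. \<lambda>i. \<lfloor>x $ i\<rfloor>) \<in> borel \<rightarrow>\<^sub>M count_space UNIV"
  proof (subst measurable_count_space_eq_countable)
    have "(\<lambda>x::real^'d. \<lambda>i. \<lfloor>x $ i\<rfloor>) -` {v} \<inter> space borel = {x. \<forall>i. \<lfloor>x $ i\<rfloor> = v i}" for v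
      by auto
    then show "(\<lambda>x::real^'d. \<lambda>i. \<lfloor>x $ i\<rfloor>) \<in> space borel \<rightarrow> UNIV \<and>
        (\<forall>v\<in>UNIV. (\<lambda>x::real^'d. \<lambda>i. \<lfloor>x $ i\<rfloor>) -` {v} \<inter> space borel \<in> sets borel)"
      by auto
  qed auto
  have "(case from_nat n of (i, m) \<Rightarrow> {x::real^'d. odd \<lfloor>2 ^ m * x $ i\<rfloor>}) \<in> sets borel" for n
    by (auto split: prod.split)
  then show ?thesis
    unfolding space_code_def[abs_def] ternary_code_def
    by (intro borel_measurable_add measurable_compose[OF A] borel_measurable_suminf
          borel_measurable_times borel_measurable_indicator) auto
qed

text \<open>A bounded set meets only finitely many integer cubes, so the integer parts of its codes
  are bounded no matter how \<open>to_nat\<close> enumerates the cubes. This is what lets tightness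
  survive the encoding.\<close>

lemma space_code_bounded:
  "bounded S \<Longrightarrow> bounded (space_code ` S)"
proof -
  assume "bounded S"
  then obtain B where B: "\<And>x. x \<in> S \<Longrightarrow> norm x \<le> B"
    by (auto simp: bounded_iff)
  have "(\<lambda>x i. \<lfloor>x $ i\<rfloor>) ` S \<subseteq> (UNIV \<rightarrow>\<^sub>E {\<lfloor>- B\<rfloor>..\<lfloor>B\<rfloor>})"
  proof safe
    fix x i assume "x \<in> S"
    then have "\<bar>x $ i\<bar> \<le> B" using B component_le_norm_cart[of x i] by fastforce
    then show "\<lfloor>x $ i\<rfloor> \<in> {\<lfloor>- B\<rfloor>..\<lfloor>B\<rfloor>}"
      by (auto intro!: floor_mono)
  qed auto
  then have "finite ((\<lambda>x i. \<lfloor>x $ i\<rfloor>) ` S)"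
    by (rule finite_subset) (auto intro: finite_PiE)
  then have "finite ((\<lambda>v. real (to_nat v)) ` ((\<lambda>x i. \<lfloor>x $ i\<rfloor>) ` S))" by (rule finite_imageI)
  then obtain K where K: "\<And>x. x \<in> S \<Longrightarrow> real (to_nat (\<lambda>i. \<lfloor>x $ i\<rfloor>)) \<le> K"
    by (force simp: image_image dest!: finite_imp_bounded simp: bounded_iff)
  show ?thesis
  proof (rule boundedI[of _ "K + 1"], safe)
    fix x assume "x \<in> S"
    define c where "c = ternary_code (\<lambda>n. case from_nat n of (i, m) \<Rightarrow> {x. odd \<lfloor>2 ^ m * x $ i\<rfloor>}) x"
    have "0 \<le> c" "c \<le> 1 / 2"
      unfolding c_def by (rule ternary_code_nonneg ternary_code_le)+
    then show "norm (space_code x) \<le> K + 1"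
      using K[OF \<open>x \<in> S\<close>] unfolding space_code_def c_def[symmetric] by simp
  qed
qed

text \<open>This is the passage from one binary level to the next: the integer part together with
  the parities determines \<open>\<lfloor>2 ^ m * u\<rfloor>\<close> for all
  \<open>m\<close>.\<close>

lemma floor_double_parity:
  fixes u v :: real
  assumes "\<lfloor>u\<rfloor> = \<lfloor>v\<rfloor>" "odd \<lfloor>2 * u\<rfloor> \<longleftrightarrow> odd \<lfloor>2 * v\<rfloor>"
  shows "\<lfloor>2 * u\<rfloor> = \<lfloor>2 * v\<rfloor>"
proof -
  have "\<lfloor>2 * u\<rfloor> \<in> {2 * \<lfloor>u\<rfloor>, 2 * \<lfloor>u\<rfloor> + 1}" for u :: real
    by simp linarith
  from this[of u] this[of v] show ?thesis using assms by auto
qed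

lemma space_code_inverse_uniformly_continuous:
  fixes e :: real
  assumes "e > 0"
  shows "\<exists>d>0. \<forall>x y :: real ^ 'd. \<bar>space_code x - space_code y\<bar> < d \<longrightarrow> norm (x - y) < e"
proof -
  define D where "D = real CARD('d)"
  have "D > 0" by (simp add: D_def)
  obtain M :: nat where "D / e < 2 ^ M"
    using real_arch_pow[of 2 "D / e"] by auto
  then have M: "D / 2 ^ M < e"
    using assms by (simp add: field_simps)
  \<comment> \<open>Accuracy \<open>1 / 2 ^ M\<close> in every coordinate needs only finitely many
    parities; \<open>N\<close> is the last ternary place at which one of them is stored.\<close>
  define N where "N = Max (to_nat ` (UNIV \<times> {..M} :: ('d \<times> nat) set))"
  have N: "to_nat (i, m) \<le> N" if "m \<le> M" for i :: 'd and m
    unfolding N_def using that by (intro Max_ge) auto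
  define B where "B n = (case from_nat n of (i, m) \<Rightarrow> {x::real^'d. odd \<lfloor>2 ^ m * x $ i\<rfloor>})" for n
  have "norm (x - y) < e" if xy: "\<bar>space_code x - space_code y\<bar> < (1 / 3) ^ Suc N / 2"
    for x y :: "real^'d"
  proof -
    have c: "0 \<le> ternary_code B z" "ternary_code B z \<le> 1 / 2" for z
      by (rule ternary_code_nonneg ternary_code_le)+
    have "(1 / 3 :: real) ^ Suc N / 2 \<le> 1 / 2"
      using power_le_one[of "1 / 3 :: real" "Suc N"] by simp
    then have *: "\<bar>space_code x - space_code y\<bar> < 1 / 2" using xy by simp
    have code: "space_code z = real (to_nat (\<lambda>i. \<lfloor>z $ i\<rfloor>)) + ternary_code B z" for z
      by (simp add: space_code_def B_def[abs_def])
    \<comment> \<open>Both ternary parts lie between 0 and \<open>1/2\<close>, so codes closer than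
      \<open>1/2\<close> have natural parts less than 1 apart, hence equal.\<close>
    have "to_nat (\<lambda>i. \<lfloor>x $ i\<rfloor>) = to_nat (\<lambda>i. \<lfloor>y $ i\<rfloor>)"
      using * c[of x] c[of y] unfolding code by linarith
    then have floor: "\<lfloor>x $ i\<rfloor> = \<lfloor>y $ i\<rfloor>" for i
      by (simp add: fun_eq_iff)
    have "\<bar>ternary_code B x - ternary_code B y\<bar> < (1 / 3) ^ Suc N / 2"
      using xy \<open>to_nat (\<lambda>i. \<lfloor>x $ i\<rfloor>) = to_nat (\<lambda>i. \<lfloor>y $ i\<rfloor>)\<close> unfolding code by simp
    from ternary_code_separates[OF this N]
    have par: "odd \<lfloor>2 ^ m * x $ i\<rfloor> \<longleftrightarrow> odd \<lfloor>2 ^ m * y $ i\<rfloor>" if "m \<le> M" for i m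
      using that by (auto simp: B_def)
    have fl: "\<lfloor>2 ^ m * x $ i\<rfloor> = \<lfloor>2 ^ m * y $ i\<rfloor>" if "m \<le> M" for i m
      using that
    proof (induction m)
      case (Suc m)
      then show ?case
        using floor_double_parity[of "2 ^ m * x $ i" "2 ^ m * y $ i"] par[of "Suc m" i]
        by (simp add: mult.assoc)
    qed (simp add: floor)
    have "\<bar>(x - y) $ i\<bar> \<le> 1 / 2 ^ M" for i
    proof -
      have "\<bar>2 ^ M * x $ i - 2 ^ M * y $ i\<bar> \<le> 1"
        using fl[of M i] by linarith
      then have "2 ^ M * \<bar>(x - y) $ i\<bar> \<le> 1"
        by (simp add: abs_mult flip: right_diff_distrib)
      then show ?thesis by (simp add: field_simps)
    qed
    then have "norm (x - y) \<le> (\<Sum>i\<in>(UNIV::'d set). 1 / 2 ^ M)"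
      by (intro order_trans[OF norm_le_l1_cart] sum_mono) auto
    then show ?thesis using M by (simp add: D_def)
  qed
  then show ?thesis by (intro exI[of _ "(1 / 3) ^ Suc N / 2"]) auto
qed

text \<open>Limits of codes may leave the range of the code. The inverse therefore has to be
  extended: to the closure by uniform continuity, and to the whole line by Tietze.\<close>

lemma space_code_continuous_left_inverse:
  obtains g :: "real \<Rightarrow> real ^ 'd" where "continuous_on UNIV g" "\<And>x. g (space_code x) = x"
proof -
  define s :: "real ^ 'd \<Rightarrow> real" where "s = space_code"
  have inj: "inj s"
  proof (rule injI, rule ccontr)
    fix x y assume "s x = s y" "x \<noteq> y"
    with space_code_inverse_uniformly_continuous[of "norm (x - y)", where 'd = 'd]
    obtain d where "d > 0" "\<And>u v::real^'d. \<bar>s u - s v\<bar> < d \<Longrightarrow> norm (u - v) < norm (x - y)"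
      by (auto simp: s_def)
    from this(2)[of x y] this(1) \<open>s x = s y\<close> show False by simp
  qed
  have "uniformly_continuous_on (range s) (inv s)"
    unfolding uniformly_continuous_on_def
  proof (intro allI impI)
    fix e :: real assume "e > 0"
    from space_code_inverse_uniformly_continuous[OF this, where 'd='d]
    show "\<exists>d>0. \<forall>x\<in>range s. \<forall>x'\<in>range s. dist x' x < d \<longrightarrow> dist (inv s x') (inv s x) < e"
      by (force simp: dist_norm s_def[symmetric] inv_f_f[OF inj])
  qed
  then obtain g0 where g0: "uniformly_continuous_on (closure (range s)) g0"
      "\<And>x. x \<in> range s \<Longrightarrow> inv s x = g0 x"
    by (rule uniformly_continuous_on_extension_on_closure) blast
  obtain g where g: "continuous_on UNIV g" "\<And>x. x \<in> closure (range s) \<Longrightarrow> g x = g0 x"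
    using Tietze_unbounded[OF uniformly_continuous_imp_continuous[OF g0(1)], of UNIV] by auto
  show thesis
  proof (rule that[OF g(1)])
    fix x
    have "s x \<in> range s" by simp
    then have "g (s x) = inv s (s x)"
      using g(2) g0(2) closure_subset by (metis subsetD)
    then show "g (space_code x) = x" by (simp add: s_def[symmetric] inv_f_f[OF inj])
  qed
qed

text \<open>Selection and almost sure representation take place on the line, after pushing the
  measures forward; the variables found there are pulled back with \<open>g\<close>. The code itself
  is discontinuous, which is harmless because only \<open>g\<close> is applied to convergent
  sequences.\<close>

theorem tight_imp_convergent_coupling:
  fixes M :: "nat \<Rightarrow> (real ^ 'd) measure"
  assumes prob: "\<And>n. prob_space (M n)" and sets: "\<And>n. sets (M n) = sets borel"
    and tight: "\<And>e. e > 0 \<Longrightarrow> \<exists>R. \<forall>n. measure (M n) {x. norm x > R} < e"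
  obtains r :: "nat \<Rightarrow> nat" and \<Omega> :: "real measure" and X X'
  where "strict_mono r" "prob_space \<Omega>" "\<And>n. X n \<in> borel_measurable \<Omega>" "X' \<in> borel_measurable \<Omega>"
    "\<And>n. distr \<Omega> borel (X n) = M (r n)" "\<And>\<omega>. \<omega> \<in> space \<Omega> \<Longrightarrow> (\<lambda>n. X n \<omega>) \<longlonglongrightarrow> X' \<omega>"
proof -
  obtain g :: "real \<Rightarrow> real^'d" where g: "continuous_on UNIV g" "\<And>x. g (space_code x) = x"
    by (rule space_code_continuous_left_inverse) blast
  have [measurable]: "g \<in> borel_measurable borel"
    using g(1) by (rule borel_measurable_continuous_onI)
  note sets[measurable_cong]
  define L where "L n = distr (M n) borel space_code" for n
  have real: "real_distribution (L n)" for n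
    unfolding L_def by (intro prob_space.real_distribution_distr prob) simp
  have "tight L"
    unfolding tight_def
  proof (intro conjI allI impI real)
    fix e :: real assume "e > 0"
    then obtain R where R: "\<And>n. measure (M n) {x. norm x > R} < e" using tight by blast
    have "bounded {x::real^'d. norm x \<le> R}" by (auto simp: bounded_iff)
    from space_code_bounded[OF this] obtain K where
      K: "\<And>x::real^'d. norm x \<le> R \<Longrightarrow> \<bar>space_code x\<bar> \<le> K"
      by (auto simp: bounded_iff)
    have "measure (L n) {- (\<bar>K\<bar> + 1)<..\<bar>K\<bar> + 1} > 1 - e" for n
    proof -
      interpret prob_space "M n" by (rule prob)
      have "1 - e < 1 - prob {x. norm x > R}" using R[of n] by simp
      also have "\<dots> = prob {x. norm x \<le> R}"
        by (subst prob_compl[symmetric])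
           (auto simp: sets_eq_imp_space_eq[OF sets] sets intro!: arg_cong[where f = prob])
      also have "\<dots> \<le> prob (space_code -` {- (\<bar>K\<bar> + 1)<..\<bar>K\<bar> + 1} \<inter> space (M n))"
        using K by (intro finite_measure_mono measurable_sets[of _ _ borel])
          (fastforce simp: sets_eq_imp_space_eq[OF sets] abs_le_iff)+
      also have "\<dots> = measure (L n) {- (\<bar>K\<bar> + 1)<..\<bar>K\<bar> + 1}"
        unfolding L_def by (subst measure_distr) auto
      finally show ?thesis .
    qed
    then show "\<exists>a b. a < b \<and> (\<forall>n. 1 - e < measure (L n) {a<..b})"
      by (intro exI[of _ "- (\<bar>K\<bar> + 1)"] exI[of _ "\<bar>K\<bar> + 1"]) auto
  qed
  from tight_imp_convergent_subsubsequence[OF this strict_mono_id] obtain r L'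
    where r: "strict_mono r" "real_distribution L'" "weak_conv_m (L \<circ> id \<circ> r) L'" by blast
  obtain \<Omega> :: "real measure" and Y Y' where Y: "prob_space \<Omega>" "\<And>n. Y n \<in> borel_measurable \<Omega>"
     "\<And>n. distr \<Omega> borel (Y n) = L (r n)" "Y' \<in> borel_measurable \<Omega>"
     "\<And>x. x \<in> space \<Omega> \<Longrightarrow> (\<lambda>n. Y n x) \<longlonglongrightarrow> Y' x"
    using Skorohod[OF real r(2), of r] r(3) unfolding comp_def id_apply measurable_lborel1
    by blast
  note Y(2,4)[measurable]
  show thesis
  proof (rule that[OF r(1) Y(1), of "\<lambda>n \<omega>. g (Y n \<omega>)" "\<lambda>\<omega>. g (Y' \<omega>)"])
    show "distr \<Omega> borel (\<lambda>\<omega>. g (Y n \<omega>)) = M (r n)" for n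
    proof -
      have "distr \<Omega> borel (\<lambda>\<omega>. g (Y n \<omega>)) = distr (distr \<Omega> borel (Y n)) borel g"
        by (subst distr_distr) (auto simp: comp_def)
      also have "\<dots> = distr (M (r n)) borel (\<lambda>x. x)"
        unfolding Y(3) L_def by (subst distr_distr) (auto simp: comp_def g)
      also have "\<dots> = M (r n)"
        by (rule distr_id2) (simp add: sets)
      finally show ?thesis .
    qed
    show "(\<lambda>n. g (Y n \<omega>)) \<longlonglongrightarrow> g (Y' \<omega>)" if "\<omega> \<in> space \<Omega>" for \<omega>
      using g(1) Y(5)[OF that] by (auto intro: continuous_on_tendsto_compose)
  qed auto
qed

section \<open>Measures determined by their characteristic functions\<close>

definition bump :: "'a::metric_space set \<Rightarrow> nat \<Rightarrow> 'a \<Rightarrow> real" where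
  "bump C n x = max 0 (1 - real n * infdist x C)"

lemma bump_bounds: "0 \<le> bump C n x" "bump C n x \<le> 1"
  by (auto simp: bump_def infdist_nonneg)

lemma continuous_on_bump [continuous_intros]: "continuous_on A (bump C n)"
  unfolding bump_def[abs_def] by (intro continuous_intros)

lemma borel_measurable_bump [measurable]: "bump C n \<in> borel_measurable borel"
  by (intro borel_measurable_continuous_onI continuous_on_bump)

text \<open>The distance to the empty set is 0 by convention, so its bumps are constantly 1 instead
  of 0; empty sets have to be treated apart wherever this lemma is used.\<close>

lemma bump_tendsto_indicator:
  assumes "closed C" "C \<noteq> {}"
  shows "(\<lambda>n. bump C n x) \<longlonglongrightarrow> indicator C x"
proof (cases "x \<in> C")
  case True
  then show ?thesis by (simp add: bump_def)
next
  case False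
  then have pos: "infdist x C > 0"
    using assms by (simp add: infdist_pos_not_in_closed)
  obtain N :: nat where "1 / infdist x C < N"
    using reals_Archimedean2 by blast
  then have "1 < real N * infdist x C" using pos by (simp add: field_simps)
  then have "bump C n x = 0" if "n \<ge> N" for n
    using that mult_right_mono[of "real N" "real n" "infdist x C"] infdist_nonneg[of x C]
    by (simp add: bump_def)
  then show ?thesis
    using False by (auto intro!: tendsto_eventually eventually_sequentiallyI[of N])
qed

lemma measure_eqI_continuous:
  fixes M N :: "'a::metric_space measure"
  assumes "prob_space M" "prob_space N" and sets: "sets M = sets borel" "sets N = sets borel"
    and eq: "\<And>f. continuous_on UNIV f \<Longrightarrow> (\<And>x. 0 \<le> f x) \<Longrightarrow> (\<And>x. f x \<le> 1) \<Longrightarrow>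
      (\<integral>x. f x \<partial>M) = (\<integral>x. f x \<partial>N :: real)"
  shows "M = N"
proof (rule measure_eqI_generator_eq[where E = "Collect closed" and A = "\<lambda>_. UNIV" and \<Omega> = UNIV])
  interpret M: prob_space M by fact
  interpret N: prob_space N by fact
  show "emeasure M C = emeasure N C" if "C \<in> Collect closed" for C
  proof (cases "C = {}")
    case False
    have *: "(\<lambda>n. \<integral>x. bump C n x \<partial>P) \<longlonglongrightarrow> measure P C"
      if "prob_space P" and s: "sets P = sets borel" for P :: "'a measure"
    proof -
      interpret prob_space P by fact
      note s[measurable_cong]
      have [measurable]: "C \<in> sets borel" using that \<open>C \<in> Collect closed\<close> by auto
      have "(\<lambda>n. \<integral>x. bump C n x \<partial>P) \<longlonglongrightarrow> (\<integral>x. indicator C x \<partial>P)"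
        using \<open>C \<in> Collect closed\<close> False bump_bounds[of C]
        by (intro integral_dominated_convergence[where w = "\<lambda>_. 1"])
           (auto intro: bump_tendsto_indicator)
      moreover have "C \<inter> space P = C" using sets_eq_imp_space_eq[OF s] by auto
      ultimately show ?thesis by simp
    qed
    have "(\<lambda>n. \<integral>x. bump C n x \<partial>N) = (\<lambda>n. \<integral>x. bump C n x \<partial>M)"
      by (intro ext eq[symmetric] continuous_on_bump bump_bounds)
    then have "measure M C = measure N C"
      using *[OF assms(1) sets(1)] *[OF assms(2) sets(2)] LIMSEQ_unique by metis
    then show ?thesis by (simp add: M.emeasure_eq_measure N.emeasure_eq_measure)
  qed simp
  show "sets M = sigma_sets UNIV (Collect closed)" "sets N = sigma_sets UNIV (Collect closed)"
    by (simp_all add: sets borel_eq_closed)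
  show "emeasure M UNIV \<noteq> \<infinity>" for i :: nat by simp
qed (auto simp: Int_stable_def)

text \<open>The clauses describe a linear span only, so that equality of integrals passes through
  the induction at once. Closure under products, needed for Stone-Weierstrass, follows afterwards
  from the product-to-sum formulas.\<close>

inductive trig_poly :: "('a::euclidean_space \<Rightarrow> real) \<Rightarrow> bool" where
  cos: "trig_poly (\<lambda>x. cos (x \<bullet> v))"
| sin: "trig_poly (\<lambda>x. sin (x \<bullet> v))"
| add: "trig_poly f \<Longrightarrow> trig_poly g \<Longrightarrow> trig_poly (\<lambda>x. f x + g x)"
| scale: "trig_poly f \<Longrightarrow> trig_poly (\<lambda>x. c * f x)"

lemma trig_poly_const: "trig_poly (\<lambda>x. c)"
  using trig_poly.scale[OF trig_poly.cos[of 0], of c] by simp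

lemma trig_poly_mult_cos: "trig_poly g \<Longrightarrow> trig_poly (\<lambda>x. cos (x \<bullet> v) * g x)"
proof (induction rule: trig_poly.induct)
  case (cos w)
  show ?case
    using trig_poly.scale[OF trig_poly.add[OF trig_poly.cos[of "v - w"] trig_poly.cos[of "v + w"]], of "1/2"]
    by (simp add: cos_times_cos inner_diff_right inner_add_right)
next
  case (sin w)
  show ?case
    using trig_poly.scale[OF trig_poly.add[OF trig_poly.sin[of "v + w"]
        trig_poly.scale[OF trig_poly.sin[of "v - w"], of "-1"]], of "1/2"]
    by (simp add: cos_times_sin inner_diff_right inner_add_right)
next
  case (add f g)
  then show ?case using trig_poly.add[OF add.IH] by (simp add: distrib_left)
next
  case (scale f c)
  then show ?case using trig_poly.scale[OF scale.IH, of c] by (simp add: mult.left_commute)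
qed

lemma trig_poly_mult_sin: "trig_poly g \<Longrightarrow> trig_poly (\<lambda>x. sin (x \<bullet> v) * g x)"
proof (induction rule: trig_poly.induct)
  case (cos w)
  show ?case
    using trig_poly_mult_cos[OF trig_poly.sin[of v], of w] by (simp add: mult.commute)
next
  case (sin w)
  show ?case
    using trig_poly.scale[OF trig_poly.add[OF trig_poly.cos[of "v - w"]
        trig_poly.scale[OF trig_poly.cos[of "v + w"], of "-1"]], of "1/2"]
    by (simp add: sin_times_sin inner_diff_right inner_add_right)
next
  case (add f g)
  then show ?case using trig_poly.add[OF add.IH] by (simp add: distrib_left)
next
  case (scale f c)
  then show ?case using trig_poly.scale[OF scale.IH, of c] by (simp add: mult.left_commute)
qed

lemma trig_poly_mult: "trig_poly f \<Longrightarrow> trig_poly g \<Longrightarrow> trig_poly (\<lambda>x. f x * g x)"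
proof (induction rule: trig_poly.induct)
  case (add f f')
  then show ?case using trig_poly.add[of "\<lambda>x. f x * g x" "\<lambda>x. f' x * g x"] by (simp add: distrib_right)
next
  case (scale f c)
  then show ?case using trig_poly.scale[of "\<lambda>x. f x * g x" c] by (simp add: mult.assoc)
qed (rule trig_poly_mult_cos trig_poly_mult_sin, assumption)+

lemma trig_poly_polynomial:
  fixes p :: "real \<Rightarrow> real"
  assumes "real_polynomial_function p" "trig_poly g"
  shows "trig_poly (\<lambda>x. p (g x))"
  using assms(1)
proof (induction rule: real_polynomial_function.induct)
  case (linear h)
  have "h y = h 1 * y" for y
    using linear_scale[OF bounded_linear.linear[OF linear], of y 1] by (simp add: mult.commute)
  then have "(\<lambda>x. h (g x)) = (\<lambda>x. h 1 * g x)" by (intro ext)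
  then show ?case using trig_poly.scale[OF assms(2), of "h 1"] by (simp only:)
qed (auto intro: trig_poly_const trig_poly.add trig_poly_mult)

lemma trig_poly_continuous: "trig_poly g \<Longrightarrow> continuous_on A g"
  by (induction rule: trig_poly.induct) (auto intro!: continuous_intros)

lemma trig_poly_bounded: "trig_poly g \<Longrightarrow> \<exists>B. \<forall>x. \<bar>g x\<bar> \<le> B"
proof (induction rule: trig_poly.induct)
  case (cos v)
  show ?case by (intro exI[of _ 1]) auto
next
  case (sin v)
  show ?case by (intro exI[of _ 1]) auto
next
  case (add f g)
  then obtain B B' where "\<And>x. \<bar>f x\<bar> \<le> B" "\<And>x. \<bar>g x\<bar> \<le> B'" by blast
  then have "\<bar>f x + g x\<bar> \<le> B + B'" for x
    using abs_triangle_ineq[of "f x" "g x"] by (smt (verit))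
  then show ?case by blast
next
  case (scale f c)
  then obtain B where "\<And>x. \<bar>f x\<bar> \<le> B" by blast
  then have "\<bar>c * f x\<bar> \<le> \<bar>c\<bar> * B" for x by (simp add: abs_mult mult_left_mono)
  then show ?case by blast
qed

lemma prob_integrable_bounded:
  fixes f :: "'a::metric_space \<Rightarrow> real"
  assumes "prob_space M" "sets M = sets borel" "continuous_on UNIV f" "\<And>x. \<bar>f x\<bar> \<le> B"
  shows "integrable M f"
proof -
  interpret prob_space M by fact
  note assms(2)[measurable_cong]
  have [measurable]: "f \<in> borel_measurable borel" by (intro borel_measurable_continuous_onI assms)
  show ?thesis by (rule integrable_const_bound[of _ B]) (auto simp: assms)
qed

text \<open>The approximation of \<open>f\<close> by Stone--Weierstrass on a compact set is composed with a polynomial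
  close to the truncation to \<open>[0, 1]\<close>, which keeps it bounded by about \<open>1\<close> on the whole space.\<close>

lemma trig_poly_approximation:
  fixes f :: "'a::euclidean_space \<Rightarrow> real"
  assumes f: "continuous_on UNIV f" "\<And>x. 0 \<le> f x" "\<And>x. f x \<le> 1" and "e > 0" "compact K"
  obtains g where "trig_poly g" "\<And>x. x \<in> K \<Longrightarrow> \<bar>f x - g x\<bar> \<le> 2 * e" "\<And>x. \<bar>f x - g x\<bar> \<le> 1 + e"
proof -
  interpret function_ring_on "Collect trig_poly" K
  proof
    show "\<exists>f\<in>Collect trig_poly. f x \<noteq> f y" if "x \<in> K" "y \<in> K" "x \<noteq> y" for x y
    proof -
      \<comment> \<open>The frequency is scaled to make the phases of \<open>x\<close> and
        \<open>y\<close> differ by \<open>pi / 2\<close>. Equal sines and cosines would make the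
        sine of that difference 0 instead of 1.\<close>
      define v where "v = (pi / 2 / (norm (x - y))\<^sup>2) *\<^sub>R (x - y)"
      have v: "(x - y) \<bullet> v = pi / 2"
        using that by (simp add: v_def dot_square_norm)
      have "sin (x \<bullet> v) \<noteq> sin (y \<bullet> v) \<or> cos (x \<bullet> v) \<noteq> cos (y \<bullet> v)"
      proof (rule ccontr)
        assume "\<not> ?thesis"
        then have "sin ((x - y) \<bullet> v) = 0" by (simp add: sin_diff inner_diff_left)
        then show False unfolding v by simp
      qed
      then show ?thesis using trig_poly.cos[of v] trig_poly.sin[of v] by auto
    qed
  qed (auto intro: trig_poly.intros trig_poly_const trig_poly_mult trig_poly_continuous assms)
  obtain g where g: "trig_poly g" "\<And>x. x \<in> K \<Longrightarrow> \<bar>f x - g x\<bar> < e"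
    using Stone_Weierstrass_basic[of f e] continuous_on_subset[OF f(1)] \<open>e > 0\<close> by auto
  obtain B where B: "\<And>x. \<bar>g x\<bar> \<le> B" using trig_poly_bounded[OF g(1)] by blast
  define c :: "real \<Rightarrow> real" where "c y = max 0 (min 1 y)" for y
  have "continuous_on {-B..B} c" unfolding c_def[abs_def] by (intro continuous_intros)
  from Stone_Weierstrass_real_polynomial_function[OF compact_Icc this \<open>e > 0\<close>]
  obtain p where p: "real_polynomial_function p" "\<And>y. y \<in> {-B..B} \<Longrightarrow> \<bar>c y - p y\<bar> < e" by blast
  have pe: "\<bar>c (g x) - p (g x)\<bar> < e" for x
    using B[of x] by (intro p(2)) (auto simp: abs_le_iff)
  show thesis
  proof (rule that[OF trig_poly_polynomial[OF p(1) g(1)]])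
    show "\<bar>f x - p (g x)\<bar> \<le> 2 * e" if "x \<in> K" for x
    proof -
      have "\<bar>f x - c (g x)\<bar> \<le> \<bar>f x - g x\<bar>" using f(2,3)[of x] by (auto simp: c_def)
      then show ?thesis using g(2)[OF that] pe[of x] by linarith
    qed
    show "\<bar>f x - p (g x)\<bar> \<le> 1 + e" for x
    proof -
      have "\<bar>f x - c (g x)\<bar> \<le> 1" using f(2,3)[of x] by (auto simp: c_def)
      then show ?thesis using pe[of x] by linarith
    qed
  qed
qed

lemma prob_tight:
  fixes M :: "'a::euclidean_space measure"
  assumes "prob_space M" "sets M = sets borel" "e > 0"
  shows "\<exists>R. measure M {x. norm x > R} < e"
proof -
  interpret prob_space M by fact
  have "(\<lambda>n. measure M {x. norm x > real n}) \<longlonglongrightarrow> measure M (\<Inter>n. {x. norm x > real n})"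
    using assms(2) by (intro finite_Lim_measure_decseq) (force simp: decseq_def)+
  moreover have "(\<Inter>n. {x::'a. norm x > real n}) = {}"
  proof -
    have "\<exists>n. \<not> norm x > real n" for x :: 'a
      using real_arch_simple[of "norm x"] by (auto simp: not_less)
    then show ?thesis by blast
  qed
  ultimately have "(\<lambda>n. measure M {x. norm x > real n}) \<longlonglongrightarrow> 0" by simp
  from eventually_happens[OF order_tendstoD(2)[OF this \<open>e > 0\<close>]] show ?thesis
    by auto
qed

text \<open>The approximating trigonometric polynomial is close to \<open>f\<close> only on a ball.
  Outside, it is within \<open>1 + e\<close> of \<open>f\<close> and the mass is below
  \<open>e\<close>, so each of the two integrals moves by at most
  \<open>2 * e + (1 + e) * e\<close>, which tends to 0.\<close>

theorem measure_eqI_char: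
  fixes M N :: "'a::euclidean_space measure"
  assumes prob: "prob_space M" "prob_space N" and sets: "sets M = sets borel" "sets N = sets borel"
    and cos: "\<And>v. (\<integral>x. cos (x \<bullet> v) \<partial>M) = (\<integral>x. cos (x \<bullet> v) \<partial>N)"
    and sin: "\<And>v. (\<integral>x. sin (x \<bullet> v) \<partial>M) = (\<integral>x. sin (x \<bullet> v) \<partial>N)"
  shows "M = N"
proof (rule measure_eqI_continuous[OF prob sets])
  fix f :: "'a \<Rightarrow> real" assume f: "continuous_on UNIV f" "\<And>x. 0 \<le> f x" "\<And>x. f x \<le> 1"
  have trig: "(\<integral>x. g x \<partial>M) = (\<integral>x. g x \<partial>N)" if "trig_poly g" for g
    using that
  proof (induction rule: trig_poly.induct)
    case (add f g)
    have "integrable P h" if "trig_poly h" "prob_space P" "sets P = sets borel" for P h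
      using trig_poly_bounded[OF that(1)] trig_poly_continuous[OF that(1)] that(2,3)
      by (auto intro: prob_integrable_bounded)
    from this[of f M] this[of g M] this[of f N] this[of g N] add show ?case
      by (simp add: prob sets)
  qed (simp_all add: cos sin)
  have close: "\<bar>(\<integral>x. f x \<partial>P) - (\<integral>x. g x \<partial>P)\<bar> \<le> 2 * e + (1 + e) * e"
    if "trig_poly g" "\<And>x. norm x \<le> R \<Longrightarrow> \<bar>f x - g x\<bar> \<le> 2 * e" "\<And>x. \<bar>f x - g x\<bar> \<le> 1 + e" "e > 0"
      "prob_space P" and s: "sets P = sets borel" and "measure P {x. norm x > R} < e"
    for P :: "'a measure" and g e R
  proof -
    interpret prob_space P by fact
    note s[measurable_cong]
    have int: "integrable P f" "integrable P g"
      using f trig_poly_bounded[OF that(1)] trig_poly_continuous[OF that(1)] that(5,6)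
      by (auto intro: prob_integrable_bounded[where B = 1] prob_integrable_bounded)
    have ind: "integrable P (indicator {x. norm x > R} :: 'a \<Rightarrow> real)"
      by (rule integrable_const_bound[where B = 1]) (auto simp: indicator_def)
    have "\<bar>(\<integral>x. f x \<partial>P) - (\<integral>x. g x \<partial>P)\<bar> = \<bar>\<integral>x. f x - g x \<partial>P\<bar>"
      using int by simp
    also have "\<dots> \<le> (\<integral>x. \<bar>f x - g x\<bar> \<partial>P)" by (rule integral_abs_bound)
    also have "\<dots> \<le> (\<integral>x. 2 * e + (1 + e) * indicator {x. norm x > R} x \<partial>P)"
    proof (intro integral_mono)
      show "integrable P (\<lambda>x. 2 * e + (1 + e) * indicator {x. norm x > R} x)"
        using ind by simp
      show "\<bar>f x - g x\<bar> \<le> 2 * e + (1 + e) * indicator {x. norm x > R} x" for x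
        using that(2)[of x] that(3)[of x] \<open>e > 0\<close> by (auto simp: indicator_def not_less)
    qed (use int in auto)
    also have "\<dots> = 2 * e + (1 + e) * measure P {x. norm x > R}"
      using prob_space ind by (simp add: sets_eq_imp_space_eq[OF s])
    also have "\<dots> \<le> 2 * e + (1 + e) * e"
      using that by (intro add_left_mono mult_left_mono) auto
    finally show ?thesis .
  qed
  have bd: "\<bar>(\<integral>x. f x \<partial>M) - (\<integral>x. f x \<partial>N)\<bar> \<le> 2 * (2 * e + (1 + e) * e)" if "e > 0" for e
  proof -
    obtain R1 where R1: "measure M {x. norm x > R1} < e" using prob_tight[OF prob(1) sets(1) \<open>e > 0\<close>] by blast
    obtain R2 where R2: "measure N {x. norm x > R2} < e" using prob_tight[OF prob(2) sets(2) \<open>e > 0\<close>] by blast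
    define R where "R = max R1 R2"
    interpret M: prob_space M by fact
    interpret N: prob_space N by fact
    have R: "measure M {x. norm x > R} < e" "measure N {x. norm x > R} < e"
      using le_less_trans[OF M.finite_measure_mono R1] le_less_trans[OF N.finite_measure_mono R2]
      by (simp_all add: R_def sets subset_eq)
    obtain g where "trig_poly g" "\<And>x. x \<in> cball 0 R \<Longrightarrow> \<bar>f x - g x\<bar> \<le> 2 * e" "\<And>x. \<bar>f x - g x\<bar> \<le> 1 + e"
      using trig_poly_approximation[OF f \<open>e > 0\<close> compact_cball[of 0 R]] by metis
    then show ?thesis
      using close[of g R e M] close[of g R e N] trig[of g] R prob sets that by auto
  qed
  have "((\<lambda>e. 2 * (2 * e + (1 + e) * e)) \<longlongrightarrow> 2 * (2 * 0 + (1 + 0) * 0)) (at_right (0::real))"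
    by (intro tendsto_intros)
  moreover have "\<forall>\<^sub>F e in at_right 0. \<bar>(\<integral>x. f x \<partial>M) - (\<integral>x. f x \<partial>N)\<bar> \<le> 2 * (2 * e + (1 + e) * e)"
    by (intro eventually_mono[OF eventually_at_right_less[of 0]] bd)
  ultimately have "\<bar>(\<integral>x. f x \<partial>M) - (\<integral>x. f x \<partial>N)\<bar> \<le> 2 * (2 * 0 + (1 + 0) * 0)"
    by (rule tendsto_lowerbound) simp
  then show "(\<integral>x. f x \<partial>M) = (\<integral>x. f x \<partial>N)" by simp
qed

section \<open>Lebesgue norms\<close>

abbreviation Lp_int :: "real \<Rightarrow> ('a::euclidean_space \<Rightarrow> real) \<Rightarrow> ennreal" where
  "Lp_int p f \<equiv> \<integral>\<^sup>+x. ennreal (\<bar>f x\<bar> powr p) \<partial>lborel"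

text \<open>Convexity in the form of a supporting line serves both Minkowski's and Jensen's
  inequality. The point 0 is treated separately, because convexity is applied on the positive
  half-line.\<close>

lemma powr_tangent:
  fixes p c y :: real
  assumes "p \<ge> 1" "c > 0" "y \<ge> 0"
  shows "c powr p + p * c powr (p - 1) * (y - c) \<le> y powr p"
proof (cases "y = 0")
  case True
  have "c powr (p - 1) * c = c powr p"
    using powr_add[of c "p - 1" 1] assms by simp
  then have "c powr p + p * c powr (p - 1) * (y - c) = (1 - p) * c powr p"
    using True by (simp add: algebra_simps)
  also have "\<dots> \<le> 0"
    using assms by (intro mult_nonpos_nonneg) auto
  finally show ?thesis using True by simp
next
  case False
  have "(p * c powr (p - 1)) * (y - c) \<le> y powr p - c powr p"
  proof (rule convex_on_imp_above_tangent[OF powr_convex[OF assms(1)]])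
    show "((\<lambda>x. x powr p) has_real_derivative p * c powr (p - 1)) (at c within {0<..})"
      using assms by (auto intro!: derivative_eq_intros)
    show "c \<in> interior {0<..}"
      using assms interior_open[of "{0::real<..}"] by simp
  qed (use assms False in auto)
  then show ?thesis by simp
qed

lemma powr_convex_combination:
  fixes p s t x y :: real
  assumes "p \<ge> 1" "0 \<le> s" "0 \<le> t" "s + t = 1" "0 \<le> x" "0 \<le> y"
  shows "(s * x + t * y) powr p \<le> s * x powr p + t * y powr p"
proof (cases "s * x + t * y = 0")
  case False
  define c where "c = s * x + t * y"
  have "c > 0" using False assms by (simp add: c_def less_le)
  define k where "k = p * c powr (p - 1)"
  have "s * (c powr p + k * (x - c)) + t * (c powr p + k * (y - c)) \<le> s * x powr p + t * y powr p"
    unfolding k_def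
    by (intro add_mono mult_left_mono powr_tangent assms \<open>c > 0\<close>)
  also have "s * (c powr p + k * (x - c)) + t * (c powr p + k * (y - c))
      = (s + t) * c powr p + k * (s * x + t * y - (s + t) * c)"
    by (simp add: algebra_simps)
  also have "\<dots> = c powr p" using assms(4) by (simp add: c_def)
  finally show ?thesis by (simp add: c_def)
qed (use assms in simp)

lemma Lp_norm_le_iff:
  assumes "p \<ge> 1" "0 \<le> c"
  shows "Lp_norm p f \<le> ennreal c \<longleftrightarrow> Lp_int p f \<le> ennreal (c powr p)"
proof (cases "Lp_int p f")
  case (real r)
  have "r powr (1 / p) \<le> c \<longleftrightarrow> r \<le> c powr p"
  proof
    assume "r powr (1 / p) \<le> c"
    then have "(r powr (1 / p)) powr p \<le> c powr p" using assms by (intro powr_mono2) auto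
    then show "r \<le> c powr p" using assms real by (simp add: powr_powr)
  next
    assume "r \<le> c powr p"
    then have "r powr (1 / p) \<le> (c powr p) powr (1 / p)" using assms real by (intro powr_mono2) auto
    then show "r powr (1 / p) \<le> c" using assms by (simp add: powr_powr)
  qed
  then show ?thesis
    using real assms by (simp add: Lp_norm_def Let_def ennreal_le_iff)
qed (simp add: Lp_norm_def Let_def top_unique)

lemma Lp_norm_finite_iff: "Lp_norm p f < \<infinity> \<longleftrightarrow> Lp_int p f < \<infinity>"
  by (auto simp: Lp_norm_def Let_def less_top[symmetric])

text \<open>After division by (slightly enlarged) norms, the sum is bounded by a multiple of a
  convex combination with weights \<open>a' / (a' + b')\<close> and \<open>b' / (a' + b')\<close>.
  Convexity of the power is then integrated.\<close>

lemma Lp_norm_triangle: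
  assumes p: "p \<ge> 1" and [measurable]: "f \<in> borel_measurable borel" "g \<in> borel_measurable borel"
  shows "Lp_norm p (\<lambda>x. f x + g x) \<le> Lp_norm p f + Lp_norm p g"
proof (cases "Lp_norm p f < \<infinity> \<and> Lp_norm p g < \<infinity>")
  case True
  then obtain a b where ab: "0 \<le> a" "0 \<le> b" "Lp_norm p f = ennreal a" "Lp_norm p g = ennreal b"
    by (cases "Lp_norm p f"; cases "Lp_norm p g") auto
  have "Lp_norm p (\<lambda>x. f x + g x) \<le> ennreal (a + b) + ennreal e" if "e > 0" for e
  proof -
    \<comment> \<open>The extra \<open>e / 2\<close> keeps both divisors positive even if one of the
      norms is 0.\<close>
    define a' b' where "a' = a + e / 2" and "b' = b + e / 2"
    have pos: "a' > 0" "b' > 0" using ab that by (auto simp: a'_def b'_def)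
    have If: "Lp_int p f \<le> ennreal (a' powr p)" "Lp_int p g \<le> ennreal (b' powr p)"
      using ab that p pos by (auto simp flip: Lp_norm_le_iff simp: a'_def b'_def intro!: ennreal_leI)
    define s t where "s = a' / (a' + b')" and "t = b' / (a' + b')"
    have st: "0 \<le> s" "0 \<le> t" "s + t = 1"
      using pos by (auto simp: s_def t_def simp flip: add_divide_distrib)
    define C where "C = (a' + b') powr p"
    have pw: "\<bar>f x + g x\<bar> powr p \<le> C * s / a' powr p * \<bar>f x\<bar> powr p + C * t / b' powr p * \<bar>g x\<bar> powr p" for x
    proof -
      have "\<bar>f x + g x\<bar> \<le> (a' + b') * (s * (\<bar>f x\<bar> / a') + t * (\<bar>g x\<bar> / b'))"
      proof -
        have "(a' + b') * s = a'" "(a' + b') * t = b'" using pos by (simp_all add: s_def t_def)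
        then have "(a' + b') * (s * (\<bar>f x\<bar> / a') + t * (\<bar>g x\<bar> / b')) = a' * (\<bar>f x\<bar> / a') + b' * (\<bar>g x\<bar> / b')"
          by (simp only: distrib_left mult.assoc[symmetric])
        then show ?thesis using pos abs_triangle_ineq[of "f x" "g x"] by simp
      qed
      then have "\<bar>f x + g x\<bar> powr p \<le> ((a' + b') * (s * (\<bar>f x\<bar> / a') + t * (\<bar>g x\<bar> / b'))) powr p"
        using p by (intro powr_mono2) auto
      also have "\<dots> = C * (s * (\<bar>f x\<bar> / a') + t * (\<bar>g x\<bar> / b')) powr p"
        using pos st by (simp add: powr_mult C_def)
      also have "\<dots> \<le> C * (s * (\<bar>f x\<bar> / a') powr p + t * (\<bar>g x\<bar> / b') powr p)"
        using pos st p by (intro mult_left_mono powr_convex_combination) (auto simp: C_def)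
      also have "\<dots> = C * s / a' powr p * \<bar>f x\<bar> powr p + C * t / b' powr p * \<bar>g x\<bar> powr p"
        using pos by (simp add: powr_divide distrib_left)
      finally show ?thesis .
    qed
    have C: "C \<ge> 0" by (simp add: C_def)
    have "Lp_int p (\<lambda>x. f x + g x) \<le>
      (\<integral>\<^sup>+x. ennreal (C * s / a' powr p) * ennreal (\<bar>f x\<bar> powr p)
        + ennreal (C * t / b' powr p) * ennreal (\<bar>g x\<bar> powr p) \<partial>lborel)"
      using pw C st by (intro nn_integral_mono) (simp flip: ennreal_mult ennreal_plus)
    also have "\<dots> = ennreal (C * s / a' powr p) * Lp_int p f + ennreal (C * t / b' powr p) * Lp_int p g"
      by (subst nn_integral_add) (auto simp: nn_integral_cmult)
    also have "\<dots> \<le> ennreal (C * s / a' powr p) * ennreal (a' powr p)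
        + ennreal (C * t / b' powr p) * ennreal (b' powr p)"
      by (intro add_mono mult_left_mono If) auto
    also have "\<dots> = ennreal (C * s + C * t)"
      using C st pos by (simp flip: ennreal_mult ennreal_plus)
    also have "C * s + C * t = C" using st(3) by (simp flip: distrib_left)
    finally have "Lp_norm p (\<lambda>x. f x + g x) \<le> ennreal (a' + b')"
      unfolding C_def using p pos by (subst Lp_norm_le_iff) auto
    also have "a' + b' = a + b + e" by (simp add: a'_def b'_def)
    finally show ?thesis using ab that by (simp flip: ennreal_plus)
  qed
  then have "Lp_norm p (\<lambda>x. f x + g x) \<le> ennreal (a + b)"
    by (rule ennreal_le_epsilon)
  then show ?thesis using ab by simp
next
  case False
  then have "Lp_norm p f + Lp_norm p g = top" by (auto simp: less_top[symmetric])
  then show ?thesis by (simp only: top_greatest)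
qed

lemma Lp_norm_scale:
  assumes p: "p \<ge> 1" and [measurable]: "f \<in> borel_measurable borel"
  shows "Lp_norm p (\<lambda>x. c * f x) = ennreal \<bar>c\<bar> * Lp_norm p f"
proof -
  have I: "Lp_int p (\<lambda>x. c * f x) = ennreal (\<bar>c\<bar> powr p) * Lp_int p f"
    by (subst nn_integral_cmult[symmetric]) (auto simp: abs_mult powr_mult ennreal_mult intro!: nn_integral_cong)
  show ?thesis
  proof (cases "Lp_int p f")
    case (real r)
    then show ?thesis
      using p unfolding Lp_norm_def Let_def I
      by (simp add: enn2real_mult powr_mult powr_powr flip: ennreal_mult)
  next
    case top
    then show ?thesis
      using p unfolding Lp_norm_def Let_def I by (cases "c = 0") (auto simp: ennreal_mult_top)
  qed
qed

lemma nn_integral_lborel_shift: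
  fixes f :: "'a::euclidean_space \<Rightarrow> ennreal"
  assumes "f \<in> borel_measurable borel"
  shows "(\<integral>\<^sup>+x. f (x + z) \<partial>lborel) = (\<integral>\<^sup>+x. f x \<partial>lborel)"
proof -
  have "(\<integral>\<^sup>+x. f x \<partial>distr lborel borel ((+) z)) = (\<integral>\<^sup>+x. f (z + x) \<partial>lborel)"
    using assms by (subst nn_integral_distr) auto
  then show ?thesis by (simp add: lborel_distr_plus add.commute)
qed

lemma Lp_norm_shift:
  "f \<in> borel_measurable borel \<Longrightarrow> Lp_norm p (\<lambda>x. f (x + z)) = Lp_norm p f"
  unfolding Lp_norm_def Let_def
  by (subst (1 2) nn_integral_lborel_shift[of "\<lambda>x. ennreal (\<bar>f x\<bar> powr p)" z]) simp_all

lemma Lp_norm_minus_commute: "Lp_norm p (\<lambda>x. f x - g x) = Lp_norm p (\<lambda>x. g x - f x)"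
  unfolding Lp_norm_def by (subst abs_minus_commute) simp

subsection \<open>Continuity of translation\<close>

text \<open>By regularity \<open>A\<close> lies between a compact \<open>K\<close> and an open
  \<open>U\<close> of nearly the same measure. Shifts shorter than the gap between \<open>K\<close>
  and the complement of \<open>U\<close> keep \<open>K\<close> inside \<open>U\<close>, so the
  indicator can change only if \<open>x\<close> or \<open>x + z\<close> lies in
  \<open>U - K\<close>. Outer regularity of the complement of \<open>A\<close>, cut by a large ball,
  provides \<open>K\<close>.\<close>

lemma L1_translation_indicator:
  fixes A :: "'a::euclidean_space set"
  assumes A: "A \<in> sets borel" "emeasure lborel A < \<infinity>" and "e > (0::real)"
  shows "\<exists>\<delta>>0. \<forall>z. norm z < \<delta> \<longrightarrow>
    (\<integral>\<^sup>+x. ennreal \<bar>indicator A (x + z) - indicator A x\<bar> \<partial>lborel) \<le> ennreal e"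
proof -
  \<comment> \<open>Three errors make up \<open>U - K\<close>: outside \<open>A\<close>, near the
    complement of \<open>A\<close>, and far out. Together they give \<open>e / 2\<close>, and
    \<open>U - K\<close> is counted once for \<open>x\<close> and once for
    \<open>x + z\<close>.\<close>
  have e6: "e / 6 > 0" using \<open>e > 0\<close> by simp
  obtain U where U: "open U" "A \<subseteq> U" "emeasure lborel (U - A) < ennreal (e / 6)"
    using outer_regular_lborel[OF A(1) e6] by blast
  have "- A \<in> sets borel" using A(1) by auto
  from outer_regular_lborel[OF this e6]
  obtain V where V: "open V" "- A \<subseteq> V" "emeasure lborel (V - - A) < ennreal (e / 6)" by blast
  have "(\<lambda>n. emeasure lborel (A - cball 0 (real n))) \<longlonglongrightarrow> emeasure lborel (\<Inter>n. A - cball 0 (real n))"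
  proof (rule Lim_emeasure_decseq)
    show "emeasure lborel (A - cball 0 (real n)) \<noteq> \<infinity>" for n
      using A emeasure_mono[of "A - cball 0 (real n)" A lborel] by (auto simp: top_unique)
  qed (use A in \<open>auto simp: decseq_def\<close>)
  moreover have "(\<Inter>n. A - cball 0 (real n)) = {}"
    using real_arch_simple by (auto simp: not_le not_less)
  ultimately have "(\<lambda>n. emeasure lborel (A - cball 0 (real n))) \<longlonglongrightarrow> 0"
    by (simp only: emeasure_empty)
  from order_tendstoD(2)[OF this, of "ennreal (e / 6)"] e6
  obtain n where n: "emeasure lborel (A - cball 0 (real n)) < ennreal (e / 6)"
    by (auto simp: eventually_sequentially)
  define K where "K = - V \<inter> cball 0 (real n)"
  have K: "compact K" "K \<subseteq> A"
    using V by (auto simp: K_def closed_Int_compact closed_Compl)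
  obtain \<delta> where \<delta>: "\<delta> > 0" "(\<Union>x\<in>K. ball x \<delta>) \<subseteq> U"
    using compact_subset_open_imp_ball_epsilon_subset[OF K(1) U(1)] K(2) U(2) by blast
  have [measurable]: "U - K \<in> sets borel"
    using U(1) compact_imp_closed[OF K(1)] by auto
  have "emeasure lborel (U - K) \<le> emeasure lborel ((U - A) \<union> ((V - - A) \<union> (A - cball 0 (real n))))"
    using U V A by (intro emeasure_mono) (auto simp: K_def)
  also have "\<dots> \<le> emeasure lborel (U - A) + (emeasure lborel (V - - A) + emeasure lborel (A - cball 0 (real n)))"
    using U(1) V(1) A by (intro order_trans[OF emeasure_subadditive] add_left_mono emeasure_subadditive) auto
  also have "\<dots> \<le> ennreal (e / 6) + (ennreal (e / 6) + ennreal (e / 6))"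
    using U V n by (intro add_mono) auto
  also have "\<dots> = ennreal (e / 2)" using \<open>e > 0\<close> by (simp flip: ennreal_plus)
  finally have UK: "emeasure lborel (U - K) \<le> ennreal (e / 2)" .
  have "(\<integral>\<^sup>+x. ennreal \<bar>indicator A (x + z) - indicator A x\<bar> \<partial>lborel) \<le> ennreal e" if "norm z < \<delta>" for z
  proof -
    have near: "x + z \<in> U" "x - z \<in> U" if "x \<in> K" for x
      using \<delta>(2) that \<open>norm z < \<delta>\<close> by (auto simp: subset_eq dist_norm)
    have "ennreal \<bar>indicator A (x + z) - indicator A x\<bar> \<le> indicator (U - K) x + indicator (U - K) (x + z)" for x
    proof (cases "x \<in> A \<longleftrightarrow> x + z \<in> A")
      case False
      then have "x \<in> U - K \<or> x + z \<in> U - K"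
        using near(1)[of x] near(2)[of "x + z"] U(2) K(2) by auto
      then show ?thesis by (auto simp: indicator_def)
    qed (auto simp: indicator_def)
    then have "(\<integral>\<^sup>+x. ennreal \<bar>indicator A (x + z) - indicator A x\<bar> \<partial>lborel)
        \<le> (\<integral>\<^sup>+x. indicator (U - K) x + indicator (U - K) (x + z) \<partial>lborel)"
      by (rule nn_integral_mono)
    also have "\<dots> = emeasure lborel (U - K) + emeasure lborel (U - K)"
      by (subst nn_integral_add) (auto simp: nn_integral_lborel_shift)
    also have "\<dots> \<le> ennreal (e / 2) + ennreal (e / 2)" by (intro add_mono UK)
    also have "\<dots> = ennreal e" using \<open>e > 0\<close> by (simp flip: ennreal_plus)
    finally show ?thesis .
  qed
  with \<delta>(1) show ?thesis by blast
qed

lemma L1_translation: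
  fixes f :: "'a::euclidean_space \<Rightarrow> real"
  assumes "integrable lborel f"
  shows "\<forall>e>0. \<exists>\<delta>>0. \<forall>z. norm z < \<delta> \<longrightarrow> (\<integral>\<^sup>+x. ennreal \<bar>f (x + z) - f x\<bar> \<partial>lborel) \<le> ennreal e"
  using assms
proof (induction rule: integrable_induct)
  case (base A c)
  show ?case
  proof (intro allI impI)
    fix e :: real assume "e > 0"
    obtain \<delta> where \<delta>: "\<delta> > 0" "\<And>z. norm z < \<delta> \<Longrightarrow>
        (\<integral>\<^sup>+x. ennreal \<bar>indicator A (x + z) - indicator A x\<bar> \<partial>lborel) \<le> ennreal (e / (\<bar>c\<bar> + 1))"
      using L1_translation_indicator[of A "e / (\<bar>c\<bar> + 1)"] base \<open>e > 0\<close> by auto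
    have [measurable]: "A \<in> sets borel" using base by simp
    have "(\<integral>\<^sup>+x. ennreal \<bar>indicator A (x + z) *\<^sub>R c - indicator A x *\<^sub>R c\<bar> \<partial>lborel) \<le> ennreal e" if "norm z < \<delta>" for z
    proof -
      have "(\<integral>\<^sup>+x. ennreal \<bar>indicator A (x + z) *\<^sub>R c - indicator A x *\<^sub>R c\<bar> \<partial>lborel)
        = (\<integral>\<^sup>+x. ennreal \<bar>c\<bar> * ennreal \<bar>indicator A (x + z) - indicator A x\<bar> \<partial>lborel)"
      proof (rule nn_integral_cong)
        fix x
        have "indicator A (x + z) *\<^sub>R c - indicator A x *\<^sub>R c = c * (indicator A (x + z) - indicator A x)"
          by (simp add: algebra_simps)
        then show "ennreal \<bar>indicator A (x + z) *\<^sub>R c - indicator A x *\<^sub>R c\<bar>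
            = ennreal \<bar>c\<bar> * ennreal \<bar>indicator A (x + z) - indicator A x\<bar>"
          by (simp add: abs_mult ennreal_mult)
      qed
      also have "\<dots> = ennreal \<bar>c\<bar> * (\<integral>\<^sup>+x. ennreal \<bar>indicator A (x + z) - indicator A x\<bar> \<partial>lborel)"
        by (rule nn_integral_cmult) measurable
      also have "\<dots> \<le> ennreal \<bar>c\<bar> * ennreal (e / (\<bar>c\<bar> + 1))"
        by (intro mult_left_mono \<delta> that) auto
      also have "\<dots> \<le> ennreal e"
        using \<open>e > 0\<close> by (auto simp: field_simps ennreal_le_iff simp flip: ennreal_mult)
      finally show ?thesis .
    qed
    with \<delta>(1) show "\<exists>\<delta>>0. \<forall>z. norm z < \<delta> \<longrightarrow>
        (\<integral>\<^sup>+x. ennreal \<bar>indicator A (x + z) *\<^sub>R c - indicator A x *\<^sub>R c\<bar> \<partial>lborel) \<le> ennreal e" by blast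
  qed
next
  case (add f g)
  have [measurable]: "f \<in> borel_measurable borel" "g \<in> borel_measurable borel"
    using borel_measurable_integrable[OF add.hyps(1)] borel_measurable_integrable[OF add.hyps(2)] by auto
  show ?case
  proof (intro allI impI)
    fix e :: real assume "e > 0"
    then have "e / 2 > 0" by simp
    obtain \<delta>1 where \<delta>1: "\<delta>1 > 0" "\<And>z. norm z < \<delta>1 \<Longrightarrow> (\<integral>\<^sup>+x. ennreal \<bar>f (x + z) - f x\<bar> \<partial>lborel) \<le> ennreal (e / 2)"
      using add \<open>e / 2 > 0\<close> by blast
    obtain \<delta>2 where \<delta>2: "\<delta>2 > 0" "\<And>z. norm z < \<delta>2 \<Longrightarrow> (\<integral>\<^sup>+x. ennreal \<bar>g (x + z) - g x\<bar> \<partial>lborel) \<le> ennreal (e / 2)"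
      using add \<open>e / 2 > 0\<close> by blast
    have "(\<integral>\<^sup>+x. ennreal \<bar>f (x + z) + g (x + z) - (f x + g x)\<bar> \<partial>lborel) \<le> ennreal e" if "norm z < min \<delta>1 \<delta>2" for z
    proof -
      have "(\<integral>\<^sup>+x. ennreal \<bar>f (x + z) + g (x + z) - (f x + g x)\<bar> \<partial>lborel)
          \<le> (\<integral>\<^sup>+x. ennreal \<bar>f (x + z) - f x\<bar> + ennreal \<bar>g (x + z) - g x\<bar> \<partial>lborel)"
        by (intro nn_integral_mono) (auto simp flip: ennreal_plus intro!: ennreal_leI)
      also have "\<dots> = (\<integral>\<^sup>+x. ennreal \<bar>f (x + z) - f x\<bar> \<partial>lborel) + (\<integral>\<^sup>+x. ennreal \<bar>g (x + z) - g x\<bar> \<partial>lborel)"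
        by (rule nn_integral_add) measurable
      also have "\<dots> \<le> ennreal (e / 2) + ennreal (e / 2)" using that by (intro add_mono \<delta>1 \<delta>2) auto
      also have "\<dots> = ennreal e" using \<open>e > 0\<close> by (simp flip: ennreal_plus)
      finally show ?thesis .
    qed
    then show "\<exists>\<delta>>0. \<forall>z. norm z < \<delta> \<longrightarrow> (\<integral>\<^sup>+x. ennreal \<bar>f (x + z) + g (x + z) - (f x + g x)\<bar> \<partial>lborel) \<le> ennreal e"
      using \<delta>1(1) \<delta>2(1) by (intro exI[of _ "min \<delta>1 \<delta>2"]) auto
  qed
next
  case (lim f s)
  have [measurable]: "f \<in> borel_measurable borel" "\<And>i. s i \<in> borel_measurable borel"
    using borel_measurable_integrable[OF lim.hyps(1)] borel_measurable_integrable[OF lim.hyps(4)] by auto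
  show ?case
  proof (intro allI impI)
    fix e :: real assume "e > 0"
    have "(\<lambda>i. \<integral>\<^sup>+x. ennreal (norm (f x - s i x)) \<partial>lborel) \<longlonglongrightarrow> 0"
    proof (rule nn_integral_dominated_convergence_norm[where w = "\<lambda>x. 2 * norm (f x)"])
      show "(\<integral>\<^sup>+x. ennreal (2 * norm (f x)) \<partial>lborel) < \<infinity>"
        using lim.hyps(4) by (simp add: ennreal_mult nn_integral_cmult integrable_iff_bounded ennreal_mult_less_top)
    qed (use lim.hyps in auto)
    from order_tendstoD(2)[OF this, of "ennreal (e / 3)"] \<open>e > 0\<close>
    obtain i where i: "(\<integral>\<^sup>+x. ennreal \<bar>f x - s i x\<bar> \<partial>lborel) < ennreal (e / 3)"
      by (auto simp: eventually_sequentially)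
    obtain \<delta> where \<delta>: "\<delta> > 0" "\<And>z. norm z < \<delta> \<Longrightarrow> (\<integral>\<^sup>+x. ennreal \<bar>s i (x + z) - s i x\<bar> \<partial>lborel) \<le> ennreal (e / 3)"
      using lim.IH[of i] \<open>e > 0\<close> by (meson divide_pos_pos zero_less_numeral)
    have "(\<integral>\<^sup>+x. ennreal \<bar>f (x + z) - f x\<bar> \<partial>lborel) \<le> ennreal e" if "norm z < \<delta>" for z
    proof -
      have "(\<integral>\<^sup>+x. ennreal \<bar>f (x + z) - f x\<bar> \<partial>lborel)
        \<le> (\<integral>\<^sup>+x. ennreal \<bar>f (x + z) - s i (x + z)\<bar> + (ennreal \<bar>s i (x + z) - s i x\<bar> + ennreal \<bar>f x - s i x\<bar>) \<partial>lborel)"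
        by (intro nn_integral_mono) (auto simp flip: ennreal_plus intro!: ennreal_leI)
      also have "\<dots> = (\<integral>\<^sup>+x. ennreal \<bar>f (x + z) - s i (x + z)\<bar> \<partial>lborel)
          + ((\<integral>\<^sup>+x. ennreal \<bar>s i (x + z) - s i x\<bar> \<partial>lborel) + (\<integral>\<^sup>+x. ennreal \<bar>f x - s i x\<bar> \<partial>lborel))"
        by (subst nn_integral_add, simp, simp, subst nn_integral_add) simp_all
      also have "(\<integral>\<^sup>+x. ennreal \<bar>f (x + z) - s i (x + z)\<bar> \<partial>lborel) = (\<integral>\<^sup>+x. ennreal \<bar>f x - s i x\<bar> \<partial>lborel)"
        by (rule nn_integral_lborel_shift) measurable
      also have "(\<integral>\<^sup>+x. ennreal \<bar>f x - s i x\<bar> \<partial>lborel)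
          + ((\<integral>\<^sup>+x. ennreal \<bar>s i (x + z) - s i x\<bar> \<partial>lborel) + (\<integral>\<^sup>+x. ennreal \<bar>f x - s i x\<bar> \<partial>lborel))
          \<le> ennreal (e / 3) + (ennreal (e / 3) + ennreal (e / 3))"
        using i \<delta>(2)[OF that] by (intro add_mono) auto
      also have "\<dots> = ennreal e" using \<open>e > 0\<close> by (simp flip: ennreal_plus)
      finally show ?thesis .
    qed
    with \<delta>(1) show "\<exists>\<delta>>0. \<forall>z. norm z < \<delta> \<longrightarrow> (\<integral>\<^sup>+x. ennreal \<bar>f (x + z) - f x\<bar> \<partial>lborel) \<le> ennreal e" by blast
  qed
qed

lemma integrable_truncated:
  fixes f :: "'a::euclidean_space \<Rightarrow> real"
  assumes "f \<in> borel_measurable borel" "\<And>x. \<bar>f x\<bar> \<le> B" "\<And>x. norm x > R \<Longrightarrow> f x = 0"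
  shows "integrable lborel f"
proof -
  have "integrable lborel (\<lambda>x. indicator (cball 0 R) x *\<^sub>R B)"
    by (intro integrable_indicator) (auto simp: emeasure_bounded_finite[simplified])
  then show ?thesis
  proof (rule Bochner_Integration.integrable_bound)
    show "AE x in lborel. norm (f x) \<le> norm (indicator (cball 0 R) x *\<^sub>R B)"
    proof (rule AE_I2)
      fix x
      have "B \<ge> 0" using assms(2)[of x] by linarith
      then show "norm (f x) \<le> norm (indicator (cball 0 R) x *\<^sub>R B)"
        using assms(2)[of x] assms(3)[of x] by (auto simp: indicator_def not_le)
    qed
  qed (use assms in auto)
qed

text \<open>Truncation in height and in space approximates \<open>f\<close> in \<open>L_p\<close>.
  For bounded functions the p-th power of a difference is at most a constant times the difference,
  which reduces the claim to the integrable case.\<close>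

lemma Lp_translation:
  fixes f :: "'a::euclidean_space \<Rightarrow> real"
  assumes p: "p \<ge> 1" and f: "f \<in> Lp p" and e: "e > 0"
  shows "\<exists>\<delta>>0. \<forall>z. norm z < \<delta> \<longrightarrow> Lp_norm p (\<lambda>x. f (x + z) - f x) \<le> ennreal e"
proof -
  have [measurable]: "f \<in> borel_measurable borel" and fin: "Lp_int p f < \<infinity>"
    using f by (auto simp: Lp_def Lp_norm_finite_iff[simplified])
  define g where "g n x = (if \<bar>f x\<bar> \<le> real n \<and> norm x \<le> real n then f x else 0)" for n x
  have [measurable]: "g n \<in> borel_measurable borel" for n
    unfolding g_def by measurable
  have "(\<lambda>n. Lp_int p (\<lambda>x. f x - g n x)) \<longlonglongrightarrow> (\<integral>\<^sup>+x. 0 \<partial>(lborel :: 'a measure))"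
  proof (rule nn_integral_dominated_convergence[where w = "\<lambda>x. ennreal (\<bar>f x\<bar> powr p)"])
    show "AE x in lborel. (\<lambda>n. ennreal (\<bar>f x - g n x\<bar> powr p)) \<longlonglongrightarrow> 0"
    proof (rule AE_I2, rule tendsto_eventually)
      fix x
      obtain N :: nat where N: "max \<bar>f x\<bar> (norm x) \<le> real N" using real_arch_simple by blast
      show "\<forall>\<^sub>F n in sequentially. ennreal (\<bar>f x - g n x\<bar> powr p) = 0"
      proof (rule eventually_sequentiallyI[of N])
        fix n assume "N \<le> n"
        then have "\<bar>f x\<bar> \<le> real n \<and> norm x \<le> real n" using N by (auto intro: order_trans)
        then show "ennreal (\<bar>f x - g n x\<bar> powr p) = 0" by (simp add: g_def)
      qed
    qed
    show "AE x in lborel. ennreal (\<bar>f x - g n x\<bar> powr p) \<le> ennreal (\<bar>f x\<bar> powr p)" for n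
      by (auto simp: g_def)
  qed (use fin in auto)
  then have "(\<lambda>n. Lp_int p (\<lambda>x. f x - g n x)) \<longlonglongrightarrow> 0" by simp
  from eventually_happens[OF order_tendstoD(2)[OF this, of "ennreal ((e / 3) powr p)"]]
  obtain n where n: "Lp_int p (\<lambda>x. f x - g n x) < ennreal ((e / 3) powr p)"
    using e by auto
  then have n: "Lp_norm p (\<lambda>x. f x - g n x) \<le> ennreal (e / 3)"
    using e p by (subst Lp_norm_le_iff) auto
  \<comment> \<open>Differences of values of \<open>g n\<close> are at most \<open>2 * n\<close>;
    the added 1 keeps the constant positive for \<open>n = 0\<close>.\<close>
  define C where "C = (2 * real n + 1) powr (p - 1)"
  have C: "C > 0" by (simp add: C_def)
  have "integrable lborel (g n)"
    by (rule integrable_truncated[of _ "real n" "real n"]) (auto simp: g_def)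
  from L1_translation[OF this, rule_format, of "(e / 3) powr p / C"] e C
  obtain \<delta> where \<delta>: "\<delta> > 0" "\<And>z. norm z < \<delta> \<Longrightarrow>
      (\<integral>\<^sup>+x. ennreal \<bar>g n (x + z) - g n x\<bar> \<partial>lborel) \<le> ennreal ((e / 3) powr p / C)" by auto
  have "Lp_norm p (\<lambda>x. f (x + z) - f x) \<le> ennreal e" if "norm z < \<delta>" for z
  proof -
    have "\<bar>g n (x + z) - g n x\<bar> powr p \<le> C * \<bar>g n (x + z) - g n x\<bar>" for x
    proof -
      define u where "u = \<bar>g n (x + z) - g n x\<bar>"
      have u: "0 \<le> u" "u \<le> 2 * real n + 1" by (auto simp: u_def g_def)
      have "u powr p = u powr (p - 1) * u"
        using u(1) powr_add[of u "p - 1" 1] by (cases "u = 0") auto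
      also have "\<dots> \<le> C * u"
        unfolding C_def using u p by (intro mult_right_mono powr_mono2) auto
      finally show ?thesis by (simp add: u_def)
    qed
    then have "Lp_int p (\<lambda>x. g n (x + z) - g n x) \<le> (\<integral>\<^sup>+x. ennreal C * ennreal \<bar>g n (x + z) - g n x\<bar> \<partial>lborel)"
      using C by (intro nn_integral_mono) (simp flip: ennreal_mult)
    also have "\<dots> = ennreal C * (\<integral>\<^sup>+x. ennreal \<bar>g n (x + z) - g n x\<bar> \<partial>lborel)"
      by (rule nn_integral_cmult) measurable
    also have "\<dots> \<le> ennreal C * ennreal ((e / 3) powr p / C)"
      by (intro mult_left_mono \<delta> that) auto
    also have "\<dots> = ennreal ((e / 3) powr p)" using C by (simp flip: ennreal_mult)
    finally have g: "Lp_norm p (\<lambda>x. g n (x + z) - g n x) \<le> ennreal (e / 3)"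
      using e p by (subst Lp_norm_le_iff) auto
    have "Lp_norm p (\<lambda>x. f (x + z) - f x)
      = Lp_norm p (\<lambda>x. (f (x + z) - g n (x + z)) + ((g n (x + z) - g n x) + (g n x - f x)))"
      by simp
    also have "\<dots> \<le> Lp_norm p (\<lambda>x. f (x + z) - g n (x + z))
        + (Lp_norm p (\<lambda>x. g n (x + z) - g n x) + Lp_norm p (\<lambda>x. g n x - f x))"
      by (intro order_trans[OF Lp_norm_triangle] add_left_mono Lp_norm_triangle p) measurable
    also have "Lp_norm p (\<lambda>x. f (x + z) - g n (x + z)) = Lp_norm p (\<lambda>x. f x - g n x)"
      by (rule Lp_norm_shift[of "\<lambda>x. f x - g n x"]) measurable
    also have "Lp_norm p (\<lambda>x. g n x - f x) = Lp_norm p (\<lambda>x. f x - g n x)"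
      by (rule Lp_norm_minus_commute)
    also have "Lp_norm p (\<lambda>x. f x - g n x) + (Lp_norm p (\<lambda>x. g n (x + z) - g n x) + Lp_norm p (\<lambda>x. f x - g n x))
      \<le> ennreal (e / 3) + (ennreal (e / 3) + ennreal (e / 3))"
      by (intro add_mono n g)
    also have "\<dots> = ennreal e" using e by (simp flip: ennreal_plus)
    finally show ?thesis .
  qed
  with \<delta>(1) show ?thesis by blast
qed

text \<open>The supporting line at the mean of \<open>\<bar>X\<bar>\<close> is integrated. Without
  integrability the Bochner integral is 0 by convention and the left side vanishes, which is why
  measurability is enough.\<close>

lemma jensen_powr:
  fixes X :: "'a \<Rightarrow> real"
  assumes "prob_space M" and p: "p \<ge> 1" and [measurable]: "X \<in> borel_measurable M"
  shows "ennreal (\<bar>\<integral>x. X x \<partial>M\<bar> powr p) \<le> (\<integral>\<^sup>+x. ennreal (\<bar>X x\<bar> powr p) \<partial>M)"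
proof (cases "integrable M X \<and> (\<integral>\<^sup>+x. ennreal (\<bar>X x\<bar> powr p) \<partial>M) < \<infinity> \<and> (\<integral>x. \<bar>X x\<bar> \<partial>M) > 0")
  case True
  interpret prob_space M by fact
  define c where "c = (\<integral>x. \<bar>X x\<bar> \<partial>M)"
  have intp: "integrable M (\<lambda>x. \<bar>X x\<bar> powr p)"
    using True by (simp add: integrable_iff_bounded)
  have "\<bar>\<integral>x. X x \<partial>M\<bar> powr p \<le> c powr p"
    unfolding c_def using p by (intro powr_mono2 integral_abs_bound) auto
  also have "c powr p = (\<integral>x. c powr p + p * c powr (p - 1) * (\<bar>X x\<bar> - c) \<partial>M)"
    using True by (simp add: c_def prob_space)
  also have "\<dots> \<le> (\<integral>x. \<bar>X x\<bar> powr p \<partial>M)"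
    using True intp p by (intro integral_mono powr_tangent) (auto simp: c_def)
  finally have "ennreal (\<bar>\<integral>x. X x \<partial>M\<bar> powr p) \<le> ennreal (\<integral>x. \<bar>X x\<bar> powr p \<partial>M)"
    by (rule ennreal_leI)
  also have "\<dots> = (\<integral>\<^sup>+x. ennreal (\<bar>X x\<bar> powr p) \<partial>M)"
    using intp by (intro nn_integral_eq_integral[symmetric]) auto
  finally show ?thesis .
next
  case False
  then consider "\<not> integrable M X" | "(\<integral>\<^sup>+x. ennreal (\<bar>X x\<bar> powr p) \<partial>M) = \<infinity>"
      | "integrable M X" "(\<integral>x. \<bar>X x\<bar> \<partial>M) \<le> 0"
    by (force simp: less_top[symmetric] not_less)
  then show ?thesis
  proof cases
    case 1
    then show ?thesis by (simp add: not_integrable_integral_eq)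
  next
    case 3
    then have "(\<integral>x. X x \<partial>M) = 0"
      using integral_abs_bound[of M X] by linarith
    then show ?thesis by simp
  qed simp
qed

lemma tendsto_zero_ennreal_iff:
  "(f \<longlongrightarrow> (0::ennreal)) G \<longleftrightarrow> (\<forall>e>0. eventually (\<lambda>x. f x \<le> ennreal e) G)"
proof
  assume "(f \<longlongrightarrow> 0) G"
  then show "\<forall>e>0. eventually (\<lambda>x. f x \<le> ennreal e) G"
    by (auto dest!: order_tendstoD(2) elim: eventually_mono intro: less_imp_le)
next
  assume *: "\<forall>e>0. eventually (\<lambda>x. f x \<le> ennreal e) G"
  show "(f \<longlongrightarrow> 0) G"
  proof (rule order_tendstoI)
    fix a :: ennreal assume "0 < a"
    then obtain b where "0 < b" "b < a" using dense by blast
    then obtain e where e: "b = ennreal e" "e > 0" by (cases b) (auto simp: top_unique)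
    from *[rule_format, OF e(2)] show "\<forall>\<^sub>F x in G. f x < a"
      by (rule eventually_mono) (use e \<open>b < a\<close> in auto)
  qed simp
qed

lemma tendsto_0_le_ennreal:
  fixes f g :: "'a \<Rightarrow> ennreal"
  assumes "(g \<longlongrightarrow> 0) G" "eventually (\<lambda>x. f x \<le> g x) G"
  shows "(f \<longlongrightarrow> 0) G"
  by (rule tendsto_sandwich[OF _ assms(2) tendsto_const assms(1)]) simp

section \<open>Approximation in shift invariant norms\<close>

text \<open>Convergence to \<open>\<beta>\<close> in this sense, for every \<open>\<delta> > 0\<close>, is convergence in the Prokhorov metric
  (Strassen's theorem).\<close>

definition coupled :: "real \<Rightarrow> 'a::metric_space measure \<Rightarrow> 'a measure \<Rightarrow> bool" where
  "coupled \<delta> \<alpha> \<beta> \<longleftrightarrow> (\<exists>(\<Omega>::real measure) X Y. prob_space \<Omega> \<and>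
     X \<in> borel_measurable \<Omega> \<and> Y \<in> borel_measurable \<Omega> \<and> distr \<Omega> borel X = \<alpha> \<and> distr \<Omega> borel Y = \<beta> \<and>
     measure \<Omega> {\<omega>\<in>space \<Omega>. dist (X \<omega>) (Y \<omega>) \<ge> \<delta>} \<le> \<delta>)"

definition shift_mean :: "'a::ordered_euclidean_space measure \<Rightarrow> ('a \<Rightarrow> real) \<Rightarrow> 'a \<Rightarrow> real" where
  "shift_mean \<nu> f x = (\<integral>y. f (x + y) \<partial>\<nu>)"

text \<open>The filter \<open>G\<close> describes the points that the norm sees: almost all of them for \<open>L\<^sub>p\<close>, all of them
  for the supremum norm.\<close>

locale shift_norm =
  fixes N :: "('a::ordered_euclidean_space \<Rightarrow> real) \<Rightarrow> ennreal" and F :: "('a \<Rightarrow> real) set" and G :: "'a filter"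
  assumes measurable: "f \<in> F \<Longrightarrow> f \<in> borel_measurable borel"
    and add_scale: "f \<in> F \<Longrightarrow> g \<in> F \<Longrightarrow> (\<lambda>x. f x + c * g x) \<in> F"
    and triangle: "f \<in> borel_measurable borel \<Longrightarrow> g \<in> borel_measurable borel \<Longrightarrow> N (\<lambda>x. f x + g x) \<le> N f + N g"
    and scale: "f \<in> borel_measurable borel \<Longrightarrow> N (\<lambda>x. c * f x) = ennreal \<bar>c\<bar> * N f"
    and null: "f \<in> borel_measurable borel \<Longrightarrow> eventually (\<lambda>x. f x = 0) G \<Longrightarrow> N f = 0"
    and integrable: "f \<in> F \<Longrightarrow> prob_space \<nu> \<Longrightarrow> sets \<nu> = sets borel \<Longrightarrow> eventually (\<lambda>x. integrable \<nu> (\<lambda>y. f (x + y))) G"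
    and closed: "f \<in> F \<Longrightarrow> prob_space \<nu> \<Longrightarrow> sets \<nu> = sets borel \<Longrightarrow> shift_mean \<nu> f \<in> F"
    and contraction: "f \<in> F \<Longrightarrow> prob_space \<nu> \<Longrightarrow> sets \<nu> = sets borel \<Longrightarrow> N (shift_mean \<nu> f) \<le> N f"
    and coupling: "f \<in> F \<Longrightarrow> e > 0 \<Longrightarrow>
      \<exists>\<delta>>0. \<forall>\<alpha> \<beta>. coupled \<delta> \<alpha> \<beta> \<longrightarrow> N (\<lambda>x. shift_mean \<alpha> f x - shift_mean \<beta> f x) \<le> ennreal e"

lemma sup_norm_le_iff: "sup_norm f \<le> ennreal c \<longleftrightarrow> (\<forall>x. \<bar>f x\<bar> \<le> c)" if "c \<ge> 0"
  using that by (auto simp: sup_norm_def SUP_le_iff ennreal_le_iff)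

lemma UC_b_measurable: "f \<in> UC_b \<Longrightarrow> f \<in> borel_measurable borel"
  by (auto simp: UC_b_def intro: borel_measurable_continuous_onI uniformly_continuous_imp_continuous)

lemma UC_b_bounded:
  assumes "f \<in> UC_b" obtains B where "B > 0" "\<And>x. \<bar>f x\<bar> \<le> B"
  using assms by (auto simp: UC_b_def bounded_pos)

lemma UC_b_integrable:
  assumes "f \<in> UC_b" "prob_space M" "X \<in> borel_measurable M"
  shows "integrable M (\<lambda>y. f (X y))"
proof -
  interpret prob_space M by fact
  obtain B where B: "\<And>x. \<bar>f x\<bar> \<le> B" using UC_b_bounded[OF assms(1)] by blast
  have [measurable]: "X \<in> borel_measurable M" "f \<in> borel_measurable borel"
    using assms UC_b_measurable by auto
  show ?thesis by (rule integrable_const_bound[of _ B]) (auto simp: B)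
qed

lemma shift_norm_sup: "shift_norm sup_norm (UC_b :: ('a::ordered_euclidean_space \<Rightarrow> real) set) top"
proof
  fix f g :: "'a \<Rightarrow> real" and c
  show "f \<in> UC_b \<Longrightarrow> f \<in> borel_measurable borel" by (rule UC_b_measurable)
  show "(\<lambda>x. f x + c * g x) \<in> UC_b" if "f \<in> UC_b" "g \<in> UC_b"
  proof -
    obtain A where A: "\<And>x. \<bar>f x\<bar> \<le> A" using UC_b_bounded[OF \<open>f \<in> UC_b\<close>] by blast
    obtain B where B: "\<And>x. \<bar>g x\<bar> \<le> B" using UC_b_bounded[OF \<open>g \<in> UC_b\<close>] by blast
    have "\<bar>f x + c * g x\<bar> \<le> A + \<bar>c\<bar> * B" for x
      by (intro order_trans[OF abs_triangle_ineq] add_mono A) (auto simp: abs_mult intro: mult_left_mono B)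
    then have "bounded (range (\<lambda>x. f x + c * g x))" by (auto simp: bounded_iff)
    then show ?thesis
      using that by (auto simp: UC_b_def intro!: uniformly_continuous_on_add uniformly_continuous_on_cmul_left)
  qed
  show "sup_norm (\<lambda>x. f x + g x) \<le> sup_norm f + sup_norm g"
    unfolding sup_norm_def
  proof (rule SUP_least)
    fix x
    have "ennreal \<bar>f x + g x\<bar> \<le> ennreal \<bar>f x\<bar> + ennreal \<bar>g x\<bar>"
      by (auto simp flip: ennreal_plus intro!: ennreal_leI)
    also have "\<dots> \<le> (SUP x. ennreal \<bar>f x\<bar>) + (SUP x. ennreal \<bar>g x\<bar>)"
      by (intro add_mono SUP_upper) auto
    finally show "ennreal \<bar>f x + g x\<bar> \<le> (SUP x. ennreal \<bar>f x\<bar>) + (SUP x. ennreal \<bar>g x\<bar>)" .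
  qed
  show "sup_norm (\<lambda>x. c * f x) = ennreal \<bar>c\<bar> * sup_norm f"
    unfolding sup_norm_def by (simp add: abs_mult ennreal_mult SUP_mult_left_ennreal)
  show "\<forall>\<^sub>F x in top. f x = 0 \<Longrightarrow> sup_norm f = 0"
    by (simp add: sup_norm_def eventually_top bot_ennreal[symmetric])
next
  fix f :: "'a \<Rightarrow> real" and \<nu> :: "'a measure"
  assume f: "f \<in> UC_b" and \<nu>: "prob_space \<nu>" "sets \<nu> = sets borel"
  interpret prob_space \<nu> by fact
  note \<nu>(2)[measurable_cong]
  have int: "integrable \<nu> (\<lambda>y. f (x + y))" for x
    by (rule UC_b_integrable[OF f \<nu>(1)]) measurable
  then show "\<forall>\<^sub>F x in top. integrable \<nu> (\<lambda>y. f (x + y))" by simp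
  have bound: "\<bar>shift_mean \<nu> f x\<bar> \<le> B" if "\<And>x. \<bar>f x\<bar> \<le> B" for B x
  proof -
    have "\<bar>shift_mean \<nu> f x\<bar> \<le> (\<integral>y. \<bar>f (x + y)\<bar> \<partial>\<nu>)"
      unfolding shift_mean_def by (rule integral_abs_bound)
    also have "\<dots> \<le> (\<integral>y. B \<partial>\<nu>)" using int that by (intro integral_mono) auto
    finally show ?thesis by (simp add: prob_space)
  qed
  obtain B where B: "B > 0" "\<And>x. \<bar>f x\<bar> \<le> B" using UC_b_bounded[OF f] by blast
  have "uniformly_continuous_on UNIV (shift_mean \<nu> f)"
    unfolding uniformly_continuous_on_def
  proof (intro allI impI)
    fix e :: real assume "e > 0"
    then have "e / 2 > 0" by simp
    with f obtain d where d: "d > 0" "\<And>x x'. dist x' x < d \<Longrightarrow> dist (f x') (f x) < e / 2"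
      unfolding UC_b_def uniformly_continuous_on_def by blast
    have "dist (shift_mean \<nu> f x') (shift_mean \<nu> f x) < e" if "dist x' x < d" for x x'
    proof -
      have "\<bar>shift_mean \<nu> f x' - shift_mean \<nu> f x\<bar> = \<bar>\<integral>y. f (x' + y) - f (x + y) \<partial>\<nu>\<bar>"
        using int by (simp add: shift_mean_def)
      also have "\<dots> \<le> (\<integral>y. \<bar>f (x' + y) - f (x + y)\<bar> \<partial>\<nu>)" by (rule integral_abs_bound)
      also have "\<dots> \<le> (\<integral>y. e / 2 \<partial>\<nu>)"
        using int d(2)[of "x' + _" "x + _"] that by (intro integral_mono) (auto simp: dist_real_def less_imp_le)
      finally show ?thesis using \<open>e > 0\<close> by (simp add: prob_space dist_real_def)
    qed
    with d(1) show "\<exists>d>0. \<forall>x\<in>UNIV. \<forall>x'\<in>UNIV. dist x' x < d \<longrightarrow>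
        dist (shift_mean \<nu> f x') (shift_mean \<nu> f x) < e" by blast
  qed
  moreover have "bounded (range (shift_mean \<nu> f))"
    using bound[OF B(2)] by (auto simp: bounded_iff)
  ultimately show "shift_mean \<nu> f \<in> UC_b" by (simp add: UC_b_def)
  show "sup_norm (shift_mean \<nu> f) \<le> sup_norm f"
  proof (cases "sup_norm f")
    case (real r)
    then have "\<And>x. \<bar>f x\<bar> \<le> r" using sup_norm_le_iff[of r f] by auto
    from bound[OF this] show ?thesis using real sup_norm_le_iff[of r "shift_mean \<nu> f"] by simp
  qed simp
next
  fix f :: "'a \<Rightarrow> real" and e :: real
  assume f: "f \<in> UC_b" and e: "e > 0"
  obtain B where B: "B > 0" "\<And>x. \<bar>f x\<bar> \<le> B" using UC_b_bounded[OF f] by blast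
  have [measurable]: "f \<in> borel_measurable borel" by (rule UC_b_measurable[OF f])
  from e have "e / 2 > 0" by simp
  with f obtain d where d: "d > 0" "\<And>x x'. dist x' x < d \<Longrightarrow> dist (f x') (f x) < e / 2"
    unfolding UC_b_def uniformly_continuous_on_def by blast
  \<comment> \<open>Close pairs contribute at most \<open>e / 2\<close> by uniform continuity; the
    others have probability at most \<delta> and contribute at most
    \<open>2 * B * \<delta> \<le> e / 2\<close>.\<close>
  define \<delta> where "\<delta> = min d (e / (4 * B))"
  have "\<delta> > 0" using d(1) e B(1) by (simp add: \<delta>_def)
  have "sup_norm (\<lambda>x. shift_mean \<alpha> f x - shift_mean \<beta> f x) \<le> ennreal e" if "coupled \<delta> \<alpha> \<beta>" for \<alpha> \<beta>
  proof -
    obtain \<Omega> :: "real measure" and X Y where \<Omega>: "prob_space \<Omega>"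
      and [measurable]: "X \<in> borel_measurable \<Omega>" "Y \<in> borel_measurable \<Omega>"
      and XY: "distr \<Omega> borel X = \<alpha>" "distr \<Omega> borel Y = \<beta>"
      and close: "measure \<Omega> {\<omega>\<in>space \<Omega>. dist (X \<omega>) (Y \<omega>) \<ge> \<delta>} \<le> \<delta>"
      using \<open>coupled \<delta> \<alpha> \<beta>\<close> unfolding coupled_def by blast
    interpret prob_space \<Omega> by fact
    define E where "E = {\<omega>\<in>space \<Omega>. dist (X \<omega>) (Y \<omega>) \<ge> \<delta>}"
    have [measurable]: "E \<in> sets \<Omega>" unfolding E_def by measurable
    have "\<bar>shift_mean \<alpha> f x - shift_mean \<beta> f x\<bar> \<le> e" for x
    proof -
      have ind: "integrable \<Omega> (indicator E :: real \<Rightarrow> real)"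
        by (rule integrable_const_bound[where B = 1]) (auto simp: indicator_def)
      have int: "integrable \<Omega> (\<lambda>\<omega>. f (x + X \<omega>))" "integrable \<Omega> (\<lambda>\<omega>. f (x + Y \<omega>))"
        by (rule UC_b_integrable[OF f \<Omega>]; measurable)+
      have "\<bar>shift_mean \<alpha> f x - shift_mean \<beta> f x\<bar> = \<bar>\<integral>\<omega>. f (x + X \<omega>) - f (x + Y \<omega>) \<partial>\<Omega>\<bar>"
        unfolding shift_mean_def XY[symmetric] using int by (simp add: integral_distr)
      also have "\<dots> \<le> (\<integral>\<omega>. \<bar>f (x + X \<omega>) - f (x + Y \<omega>)\<bar> \<partial>\<Omega>)" by (rule integral_abs_bound)
      also have "\<dots> \<le> (\<integral>\<omega>. e / 2 + 2 * B * indicator E \<omega> \<partial>\<Omega>)"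
      proof (rule integral_mono)
        fix \<omega> assume "\<omega> \<in> space \<Omega>"
        show "\<bar>f (x + X \<omega>) - f (x + Y \<omega>)\<bar> \<le> e / 2 + 2 * B * indicator E \<omega>"
        proof (cases "\<omega> \<in> E")
          case True
          then show ?thesis using B(2)[of "x + X \<omega>"] B(2)[of "x + Y \<omega>"] e by simp
        next
          case False
          then have "dist (x + X \<omega>) (x + Y \<omega>) < d"
            using \<open>\<omega> \<in> space \<Omega>\<close> by (auto simp: E_def \<delta>_def)
          from d(2)[OF this] False show ?thesis by (simp add: dist_real_def)
        qed
      qed (use int ind in auto)
      also have "\<dots> = e / 2 + 2 * B * measure \<Omega> E"
        using ind sets.sets_into_space[of E \<Omega>] by (simp add: prob_space Int_absorb2)
      also have "\<dots> \<le> e / 2 + 2 * B * (e / (4 * B))"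
        using close B(1) by (intro add_left_mono mult_left_mono) (auto simp: E_def \<delta>_def)
      also have "\<dots> = e" using B(1) by simp
      finally show ?thesis .
    qed
    then show ?thesis using e by (simp add: sup_norm_le_iff)
  qed
  with \<open>\<delta> > 0\<close> show "\<exists>\<delta>>0. \<forall>\<alpha> \<beta>. coupled \<delta> \<alpha> \<beta> \<longrightarrow>
      sup_norm (\<lambda>x. shift_mean \<alpha> f x - shift_mean \<beta> f x) \<le> ennreal e" by blast
qed

lemma Lp_norm_mono_int:
  assumes "p \<ge> 1" "Lp_int p f \<le> Lp_int p g"
  shows "Lp_norm p f \<le> Lp_norm p g"
proof (cases "Lp_norm p g")
  case (real r)
  then have "Lp_int p g \<le> ennreal (r powr p)"
    using Lp_norm_le_iff[OF assms(1), of r g] by simp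
  then have "Lp_int p f \<le> ennreal (r powr p)" using assms(2) by (rule order_trans[rotated])
  then show ?thesis using Lp_norm_le_iff[OF assms(1), of r f] real by simp
qed simp

text \<open>Translation invariance of Lebesgue measure makes the inner integral constant once the
  order of integration is exchanged: random shifts preserve p-th moments on average.\<close>

lemma nn_integral_shift_Fubini:
  fixes f :: "'a::euclidean_space \<Rightarrow> real"
  assumes "prob_space M" and [measurable]: "X \<in> borel_measurable M" "f \<in> borel_measurable borel"
  shows "(\<integral>\<^sup>+x. (\<integral>\<^sup>+\<omega>. ennreal (\<bar>f (x + X \<omega>)\<bar> powr p) \<partial>M) \<partial>lborel) = Lp_int p f"
proof -
  interpret prob_space M by fact
  interpret pair_sigma_finite lborel M ..
  have "(\<integral>\<^sup>+x. (\<integral>\<^sup>+\<omega>. ennreal (\<bar>f (x + X \<omega>)\<bar> powr p) \<partial>M) \<partial>lborel)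
     = (\<integral>\<^sup>+\<omega>. (\<integral>\<^sup>+x. ennreal (\<bar>f (x + X \<omega>)\<bar> powr p) \<partial>lborel) \<partial>M)"
    by (rule Fubini'[symmetric]) measurable
  also have "\<dots> = (\<integral>\<^sup>+\<omega>. Lp_int p f \<partial>M)"
    by (intro nn_integral_cong nn_integral_lborel_shift) measurable
  finally show ?thesis by (simp add: emeasure_space_1)
qed

text \<open>For almost every \<open>x\<close> the p-th moment is finite, and
  \<open>\<bar>u\<bar> \<le> 1 + \<bar>u\<bar> powr p\<close> turns this into integrability because
  the total mass is 1.\<close>

lemma Lp_AE_integrable:
  fixes f :: "'a::euclidean_space \<Rightarrow> real"
  assumes p: "p \<ge> 1" and f: "f \<in> Lp p" and "prob_space M" and [measurable]: "X \<in> borel_measurable M"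
  shows "AE x in lborel. integrable M (\<lambda>\<omega>. f (x + X \<omega>))"
proof -
  interpret prob_space M by fact
  have [measurable]: "f \<in> borel_measurable borel" and fin: "Lp_int p f < \<infinity>"
    using f by (auto simp: Lp_def Lp_norm_finite_iff[simplified])
  have "AE x in lborel. (\<integral>\<^sup>+\<omega>. ennreal (\<bar>f (x + X \<omega>)\<bar> powr p) \<partial>M) \<noteq> \<infinity>"
    using fin by (intro nn_integral_PInf_AE) (simp_all add: nn_integral_shift_Fubini assms)
  then show ?thesis
  proof eventually_elim
    fix x assume "(\<integral>\<^sup>+\<omega>. ennreal (\<bar>f (x + X \<omega>)\<bar> powr p) \<partial>M) \<noteq> \<infinity>"
    then have "integrable M (\<lambda>\<omega>. \<bar>f (x + X \<omega>)\<bar> powr p)"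
      by (simp add: integrable_iff_bounded less_top[symmetric])
    then have "integrable M (\<lambda>\<omega>. 1 + \<bar>f (x + X \<omega>)\<bar> powr p)" by simp
    then show "integrable M (\<lambda>\<omega>. f (x + X \<omega>))"
    proof (rule Bochner_Integration.integrable_bound)
      have "\<bar>u\<bar> \<le> 1 + \<bar>u\<bar> powr p" for u :: real
        using p powr_mono[of 1 p "\<bar>u\<bar>"] by (cases "\<bar>u\<bar> \<le> 1") (auto intro: order_trans[of _ 1])
      then show "AE \<omega> in M. norm (f (x + X \<omega>)) \<le> norm (1 + \<bar>f (x + X \<omega>)\<bar> powr p)" by simp
    qed measurable
  qed
qed

text \<open>For the coupling property, Jensen and Fubini bound the p-th power of the norm by the
  mean of \<open>\<tau> (X - Y)\<close>, where \<tau> measures how far a shift moves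
  \<open>f\<close> in \<open>L_p\<close>. Continuity of translation makes \<tau> small near 0, and
  the triangle inequality bounds it everywhere.\<close>

lemma shift_norm_Lp:
  assumes p: "p \<ge> 1"
  shows "shift_norm (Lp_norm p) (Lp p :: ('a::ordered_euclidean_space \<Rightarrow> real) set) (ae_filter lborel)"
proof
  fix f g :: "'a \<Rightarrow> real" and c
  show m: "f \<in> Lp p \<Longrightarrow> f \<in> borel_measurable borel" for f by (simp add: Lp_def)
  show tri: "f \<in> borel_measurable borel \<Longrightarrow> g \<in> borel_measurable borel \<Longrightarrow>
      Lp_norm p (\<lambda>x. f x + g x) \<le> Lp_norm p f + Lp_norm p g" for f g :: "'a \<Rightarrow> real"
    by (rule Lp_norm_triangle[OF p])
  show sc: "f \<in> borel_measurable borel \<Longrightarrow> Lp_norm p (\<lambda>x. c * f x) = ennreal \<bar>c\<bar> * Lp_norm p f" for f :: "'a \<Rightarrow> real"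
    by (rule Lp_norm_scale[OF p])
  show "(\<lambda>x. f x + c * g x) \<in> Lp p" if "f \<in> Lp p" "g \<in> Lp p"
  proof -
    note [measurable] = m[OF that(1)] m[OF that(2)]
    have "Lp_norm p (\<lambda>x. f x + c * g x) \<le> Lp_norm p f + ennreal \<bar>c\<bar> * Lp_norm p g"
      using tri[of f "\<lambda>x. c * g x"] by (simp add: sc)
    also have "\<dots> < \<infinity>" using that by (auto simp: Lp_def ennreal_mult_less_top)
    finally show ?thesis by (simp add: Lp_def)
  qed
  show "Lp_norm p f = 0" if "f \<in> borel_measurable borel" "AE x in lborel. f x = 0"
  proof -
    have "Lp_int p f = (\<integral>\<^sup>+x. 0 \<partial>(lborel :: 'a measure))"
      using that(2) by (intro nn_integral_cong_AE) auto
    then show ?thesis by (simp add: Lp_norm_def)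
  qed
next
  fix f :: "'a \<Rightarrow> real" and \<nu> :: "'a measure"
  assume f: "f \<in> Lp p" and \<nu>: "prob_space \<nu>" "sets \<nu> = sets borel"
  interpret prob_space \<nu> by fact
  note \<nu>(2)[measurable_cong]
  have [measurable]: "f \<in> borel_measurable borel" using f by (simp add: Lp_def)
  show "AE x in lborel. integrable \<nu> (\<lambda>y. f (x + y))"
    by (rule Lp_AE_integrable[OF p f \<nu>(1)]) measurable
  have "Lp_int p (shift_mean \<nu> f) \<le> (\<integral>\<^sup>+x. (\<integral>\<^sup>+y. ennreal (\<bar>f (x + y)\<bar> powr p) \<partial>\<nu>) \<partial>lborel)"
    unfolding shift_mean_def by (intro nn_integral_mono jensen_powr \<nu>(1) p) measurable
  also have "\<dots> = Lp_int p f"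
    by (rule nn_integral_shift_Fubini[OF \<nu>(1)]) measurable
  finally show *: "Lp_norm p (shift_mean \<nu> f) \<le> Lp_norm p f"
    by (rule Lp_norm_mono_int[OF p])
  have "shift_mean \<nu> f \<in> borel_measurable borel"
    unfolding shift_mean_def[abs_def] by measurable
  with * f show "shift_mean \<nu> f \<in> Lp p" by (auto simp: Lp_def)
next
  fix f :: "'a \<Rightarrow> real" and e :: real
  assume f: "f \<in> Lp p" and e: "e > 0"
  have [measurable]: "f \<in> borel_measurable borel" and fin: "Lp_norm p f < \<infinity>"
    using f by (auto simp: Lp_def)
  define e' where "e' = e powr p / 2"
  have e': "e' > 0" using e by (simp add: e'_def)
  obtain r where r: "Lp_norm p f = ennreal r" "r \<ge> 0" using fin by (cases "Lp_norm p f") auto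
  \<comment> \<open>A shift moves \<open>f\<close> by at most \<open>2 * r\<close> in norm; the 1
    keeps \<open>C\<close> positive, since it becomes a divisor.\<close>
  define C where "C = (2 * r + 1) powr p"
  have C: "C > 0" using r by (simp add: C_def)
  have "e' powr (1 / p) > 0" using e' by simp
  from Lp_translation[OF p f this] obtain d where d: "d > 0"
    "\<And>z. norm z < d \<Longrightarrow> Lp_norm p (\<lambda>x. f (x + z) - f x) \<le> ennreal (e' powr (1 / p))" by blast
  define \<tau> where "\<tau> z = Lp_int p (\<lambda>x. f (x + z) - f x)" for z
  have \<tau>_small: "\<tau> z \<le> ennreal e'" if "norm z < d" for z
    using d(2)[OF that] e' p by (subst (asm) Lp_norm_le_iff) (auto simp: \<tau>_def powr_powr)
  have \<tau>_bound: "\<tau> z \<le> ennreal C" for z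
  proof -
    have "Lp_norm p (\<lambda>x. f (x + z) + (-1) * f x) \<le> Lp_norm p (\<lambda>x. f (x + z)) + Lp_norm p (\<lambda>x. (-1) * f x)"
      by (rule Lp_norm_triangle[OF p]) measurable
    also have "\<dots> = ennreal (2 * r)"
      using r by (simp add: Lp_norm_shift Lp_norm_scale[OF p, of f "-1", simplified] flip: ennreal_plus)
    also have "\<dots> \<le> ennreal (2 * r + 1)" by (intro ennreal_leI) simp
    finally show ?thesis using r p by (subst (asm) Lp_norm_le_iff) (auto simp: \<tau>_def C_def)
  qed
  \<comment> \<open>Near pairs and far pairs contribute at most \<open>e'\<close> each, which is
    half of \<open>e powr p\<close>.\<close>
  define \<delta> where "\<delta> = min d (e' / C)"
  have "\<delta> > 0" using d(1) e' C by (simp add: \<delta>_def)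
  have "Lp_norm p (\<lambda>x. shift_mean \<alpha> f x - shift_mean \<beta> f x) \<le> ennreal e" if "coupled \<delta> \<alpha> \<beta>" for \<alpha> \<beta>
  proof -
    obtain \<Omega> :: "real measure" and X Y where \<Omega>: "prob_space \<Omega>"
      and [measurable]: "X \<in> borel_measurable \<Omega>" "Y \<in> borel_measurable \<Omega>"
      and XY: "distr \<Omega> borel X = \<alpha>" "distr \<Omega> borel Y = \<beta>"
      and close: "measure \<Omega> {\<omega>\<in>space \<Omega>. dist (X \<omega>) (Y \<omega>) \<ge> \<delta>} \<le> \<delta>"
      using \<open>coupled \<delta> \<alpha> \<beta>\<close> unfolding coupled_def by blast
    interpret prob_space \<Omega> by fact
    interpret pair_sigma_finite lborel \<Omega> ..
    define E where "E = {\<omega>\<in>space \<Omega>. dist (X \<omega>) (Y \<omega>) \<ge> \<delta>}"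
    have [measurable]: "E \<in> sets \<Omega>" unfolding E_def by measurable
    have "Lp_int p (\<lambda>x. shift_mean \<alpha> f x - shift_mean \<beta> f x)
       \<le> (\<integral>\<^sup>+x. (\<integral>\<^sup>+\<omega>. ennreal (\<bar>f (x + X \<omega>) - f (x + Y \<omega>)\<bar> powr p) \<partial>\<Omega>) \<partial>lborel)"
    proof (rule nn_integral_mono_AE)
      have "AE x in lborel. integrable \<Omega> (\<lambda>\<omega>. f (x + X \<omega>))" "AE x in lborel. integrable \<Omega> (\<lambda>\<omega>. f (x + Y \<omega>))"
        by (rule Lp_AE_integrable[OF p f \<Omega>]; measurable)+
      then show "AE x in lborel. ennreal (\<bar>shift_mean \<alpha> f x - shift_mean \<beta> f x\<bar> powr p)
          \<le> (\<integral>\<^sup>+\<omega>. ennreal (\<bar>f (x + X \<omega>) - f (x + Y \<omega>)\<bar> powr p) \<partial>\<Omega>)"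
      proof eventually_elim
        fix x assume "integrable \<Omega> (\<lambda>\<omega>. f (x + X \<omega>))" "integrable \<Omega> (\<lambda>\<omega>. f (x + Y \<omega>))"
        then have "shift_mean \<alpha> f x - shift_mean \<beta> f x = (\<integral>\<omega>. f (x + X \<omega>) - f (x + Y \<omega>) \<partial>\<Omega>)"
          unfolding shift_mean_def XY[symmetric] by (simp add: integral_distr)
        then show "ennreal (\<bar>shift_mean \<alpha> f x - shift_mean \<beta> f x\<bar> powr p)
          \<le> (\<integral>\<^sup>+\<omega>. ennreal (\<bar>f (x + X \<omega>) - f (x + Y \<omega>)\<bar> powr p) \<partial>\<Omega>)"
          using jensen_powr[OF \<Omega> p, of "\<lambda>\<omega>. f (x + X \<omega>) - f (x + Y \<omega>)"] by simp
      qed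
    qed
    also have "\<dots> = (\<integral>\<^sup>+\<omega>. (\<integral>\<^sup>+x. ennreal (\<bar>f (x + X \<omega>) - f (x + Y \<omega>)\<bar> powr p) \<partial>lborel) \<partial>\<Omega>)"
      by (rule Fubini'[symmetric]) measurable
    also have "\<dots> \<le> (\<integral>\<^sup>+\<omega>. ennreal e' + ennreal C * indicator E \<omega> \<partial>\<Omega>)"
    proof (rule nn_integral_mono)
      fix \<omega> assume "\<omega> \<in> space \<Omega>"
      have "(\<integral>\<^sup>+x. ennreal (\<bar>f (x + X \<omega>) - f (x + Y \<omega>)\<bar> powr p) \<partial>lborel) = \<tau> (X \<omega> - Y \<omega>)"
        unfolding \<tau>_def
        using nn_integral_lborel_shift[of "\<lambda>x. ennreal (\<bar>f (x + (X \<omega> - Y \<omega>)) - f x\<bar> powr p)" "Y \<omega>"]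
        by simp
      also have "\<dots> \<le> ennreal e' + ennreal C * indicator E \<omega>"
      proof (cases "\<omega> \<in> E")
        case True
        then show ?thesis using \<tau>_bound[of "X \<omega> - Y \<omega>"] by (auto intro: add_increasing)
      next
        case False
        then have "norm (X \<omega> - Y \<omega>) < d"
          using \<open>\<omega> \<in> space \<Omega>\<close> by (auto simp: E_def \<delta>_def dist_norm)
        then show ?thesis using \<tau>_small False by simp
      qed
      finally show "(\<integral>\<^sup>+x. ennreal (\<bar>f (x + X \<omega>) - f (x + Y \<omega>)\<bar> powr p) \<partial>lborel)
          \<le> ennreal e' + ennreal C * indicator E \<omega>" .
    qed
    also have "\<dots> = ennreal e' + ennreal C * emeasure \<Omega> E"
      by (subst nn_integral_add) (auto simp: nn_integral_cmult emeasure_space_1)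
    also have "\<dots> \<le> ennreal e' + ennreal C * ennreal (e' / C)"
      using close C e' by (intro add_left_mono mult_left_mono) (auto simp: E_def \<delta>_def emeasure_eq_measure intro!: ennreal_leI)
    also have "\<dots> = ennreal (e powr p)"
      using C e' by (simp add: e'_def flip: ennreal_mult ennreal_plus)
    finally show ?thesis using e p by (subst Lp_norm_le_iff) auto
  qed
  with \<open>\<delta> > 0\<close> show "\<exists>\<delta>>0. \<forall>\<alpha> \<beta>. coupled \<delta> \<alpha> \<beta> \<longrightarrow>
      Lp_norm p (\<lambda>x. shift_mean \<alpha> f x - shift_mean \<beta> f x) \<le> ennreal e" by blast
qed

section \<open>Convolution and its powers\<close>

lemma prob_space_convolution:
  fixes M N :: "'a::ordered_euclidean_space measure"
  assumes "prob_space M" "prob_space N" "sets M = sets borel" "sets N = sets borel"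
  shows "prob_space (M \<star> N)"
proof -
  interpret M: prob_space M by fact
  interpret N: prob_space N by fact
  interpret pair_prob_space M N ..
  note assms(3,4)[measurable_cong]
  show ?thesis unfolding convolution_def by (rule prob_space_distr) measurable
qed

lemma sets_conv_power [simp]: "sets (conv_power M k) = sets borel"
  by (cases k) simp_all

lemma prob_space_conv_power: "prob_space M \<Longrightarrow> sets M = sets borel \<Longrightarrow> prob_space (conv_power M k)"
  by (induction k) (auto intro: prob_space_return prob_space_convolution)

lemma integral_convolution:
  fixes f :: "'a::ordered_euclidean_space \<Rightarrow> real"
  assumes "prob_space M" "prob_space N" and [measurable_cong]: "sets M = sets borel" "sets N = sets borel"
    and [measurable]: "f \<in> borel_measurable borel" and int: "integrable (M \<star> N) f"
  shows "(\<integral>z. f z \<partial>(M \<star> N)) = (\<integral>y. \<integral>x. f (x + y) \<partial>M \<partial>N)"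
proof -
  interpret M: prob_space M by fact
  interpret N: prob_space N by fact
  interpret pair_prob_space M N ..
  have "integrable (M \<Otimes>\<^sub>M N) (\<lambda>(x, y). f (x + y))"
    using int unfolding convolution_def by (subst (asm) integrable_distr_eq) (auto simp: case_prod_unfold)
  from integral_snd[OF this] show ?thesis
    unfolding convolution_def by (subst integral_distr) (auto simp: case_prod_unfold)
qed

section \<open>General consequences for averaging operators in shift invariant norms\<close>

context shift_norm
begin

lemma norm_diff_sym:
  assumes [measurable]: "f \<in> borel_measurable borel" "g \<in> borel_measurable borel"
  shows "N (\<lambda>x. f x - g x) = N (\<lambda>x. g x - f x)"
  using scale[of "\<lambda>x. g x - f x" "-1"] by simp

lemma norm_triangle_diff:
  assumes [measurable]: "f \<in> borel_measurable borel" "g \<in> borel_measurable borel" "h \<in> borel_measurable borel"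
  shows "N (\<lambda>x. f x - h x) \<le> N (\<lambda>x. f x - g x) + N (\<lambda>x. g x - h x)"
  using triangle[of "\<lambda>x. f x - g x" "\<lambda>x. g x - h x"] by simp

lemma norm_cong:
  assumes [measurable]: "f \<in> borel_measurable borel" "g \<in> borel_measurable borel"
    and eq: "eventually (\<lambda>x. f x = g x) G"
  shows "N f = N g"
proof -
  have le: "N f \<le> N g" if [measurable]: "f \<in> borel_measurable borel" "g \<in> borel_measurable borel"
    and "eventually (\<lambda>x. f x = g x) G" for f g
  proof -
    have "N f \<le> N g + N (\<lambda>x. f x - g x)" using triangle[of g "\<lambda>x. f x - g x"] by simp
    also have "N (\<lambda>x. f x - g x) = 0"
      by (rule null, measurable) (rule eventually_mono[OF that(3)], simp)
    finally show ?thesis by simp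
  qed
  show ?thesis by (intro antisym le eq assms eventually_mono[OF eq]) auto
qed

lemma diff_closed: "f \<in> F \<Longrightarrow> g \<in> F \<Longrightarrow> (\<lambda>x. f x - g x) \<in> F"
  using add_scale[of f g "-1"] by simp

lemma shift_mean_add_scale:
  assumes "f \<in> F" "g \<in> F" "prob_space \<nu>" "sets \<nu> = sets borel"
  shows "eventually (\<lambda>x. shift_mean \<nu> (\<lambda>x. f x + c * g x) x = shift_mean \<nu> f x + c * shift_mean \<nu> g x) G"
  using integrable[OF assms(1,3,4)] integrable[OF assms(2,3,4)]
  by eventually_elim (simp add: shift_mean_def)

lemma contraction_diff:
  assumes "f \<in> F" "g \<in> F" "prob_space \<nu>" "sets \<nu> = sets borel"
  shows "N (\<lambda>x. shift_mean \<nu> f x - shift_mean \<nu> g x) \<le> N (\<lambda>x. f x - g x)"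
proof -
  note [measurable] = measurable[OF closed[OF assms(1,3,4)]] measurable[OF closed[OF assms(2,3,4)]]
    measurable[OF closed[OF diff_closed[OF assms(1,2)] assms(3,4)]]
  have "N (\<lambda>x. shift_mean \<nu> f x - shift_mean \<nu> g x) = N (shift_mean \<nu> (\<lambda>x. f x - g x))"
    by (rule norm_cong, measurable)
       (use shift_mean_add_scale[OF assms, of "-1"] in \<open>auto elim: eventually_mono\<close>)
  also have "\<dots> \<le> N (\<lambda>x. f x - g x)"
    by (rule contraction[OF diff_closed[OF assms(1,2)] assms(3,4)])
  finally show ?thesis .
qed

text \<open>Fubini needs \<open>y \<mapsto> f (x + y)\<close> to be integrable for the convolution,
  so the identity is available only for those \<open>x\<close>; this is one reason for carrying the
  filter \<open>G\<close>.\<close>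

lemma shift_mean_convolution:
  assumes f: "f \<in> F" and M: "prob_space M" "sets M = sets borel" and K: "prob_space K" "sets K = sets borel"
  shows "eventually (\<lambda>x. shift_mean (M \<star> K) f x = shift_mean K (shift_mean M f) x) G"
proof -
  note [measurable] = measurable[OF f]
  have "eventually (\<lambda>x. Bochner_Integration.integrable (M \<star> K) (\<lambda>y. f (x + y))) G"
    by (rule integrable[OF f prob_space_convolution[OF M(1) K(1) M(2) K(2)]]) simp
  then show ?thesis
  proof eventually_elim
    fix x assume "Bochner_Integration.integrable (M \<star> K) (\<lambda>y. f (x + y))"
    then show "shift_mean (M \<star> K) f x = shift_mean K (shift_mean M f) x"
      unfolding shift_mean_def
      by (subst integral_convolution[OF M(1) K(1) M(2) K(2)]) (auto simp: add_ac)
  qed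
qed

text \<open>Contraction allows \<open>fs n\<close> to be replaced by \<open>f\<close> at a cost
  independent of the measure; for the fixed function \<open>f\<close> the coupling property
  applies.\<close>

lemma approximation:
  assumes \<alpha>: "\<And>n. prob_space (\<alpha> n)" "\<And>n. sets (\<alpha> n) = sets borel"
    and \<beta>: "prob_space \<beta>" "sets \<beta> = sets borel"
    and conv: "\<And>\<delta>. \<delta> > 0 \<Longrightarrow> \<forall>\<^sub>F n in sequentially. coupled \<delta> (\<alpha> n) \<beta>"
    and fs: "\<And>n. fs n \<in> F" and f: "f \<in> F" and lim: "(\<lambda>n. N (\<lambda>x. fs n x - f x)) \<longlonglongrightarrow> 0"
  shows "(\<lambda>n. N (\<lambda>x. shift_mean (\<alpha> n) (fs n) x - shift_mean \<beta> f x)) \<longlonglongrightarrow> 0"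
proof (rule tendsto_0_le_ennreal)
  have "(\<lambda>n. N (\<lambda>x. shift_mean (\<alpha> n) f x - shift_mean \<beta> f x)) \<longlonglongrightarrow> 0"
    unfolding tendsto_zero_ennreal_iff
  proof (intro allI impI)
    fix e :: real assume "e > 0"
    from coupling[OF f this] obtain \<delta> where "\<delta> > 0"
      and \<delta>: "\<And>\<alpha> \<beta>. coupled \<delta> \<alpha> \<beta> \<Longrightarrow> N (\<lambda>x. shift_mean \<alpha> f x - shift_mean \<beta> f x) \<le> ennreal e" by blast
    from conv[OF this(1)] show "\<forall>\<^sub>F n in sequentially. N (\<lambda>x. shift_mean (\<alpha> n) f x - shift_mean \<beta> f x) \<le> ennreal e"
      by (rule eventually_mono) (rule \<delta>)
  qed
  then show "(\<lambda>n. N (\<lambda>x. fs n x - f x) + N (\<lambda>x. shift_mean (\<alpha> n) f x - shift_mean \<beta> f x)) \<longlonglongrightarrow> 0"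
    using tendsto_add[OF lim] by simp
  show "\<forall>\<^sub>F n in sequentially. N (\<lambda>x. shift_mean (\<alpha> n) (fs n) x - shift_mean \<beta> f x)
      \<le> N (\<lambda>x. fs n x - f x) + N (\<lambda>x. shift_mean (\<alpha> n) f x - shift_mean \<beta> f x)"
  proof (intro always_eventually allI)
    fix n
    note [measurable] = measurable[OF closed[OF fs \<alpha>]] measurable[OF closed[OF f \<alpha>]] measurable[OF closed[OF f \<beta>]]
    have "N (\<lambda>x. shift_mean (\<alpha> n) (fs n) x - shift_mean \<beta> f x)
      \<le> N (\<lambda>x. shift_mean (\<alpha> n) (fs n) x - shift_mean (\<alpha> n) f x)
        + N (\<lambda>x. shift_mean (\<alpha> n) f x - shift_mean \<beta> f x)"
      by (rule norm_triangle_diff) measurable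
    also have "\<dots> \<le> N (\<lambda>x. fs n x - f x) + N (\<lambda>x. shift_mean (\<alpha> n) f x - shift_mean \<beta> f x)"
      by (rule add_right_mono) (rule contraction_diff[OF fs f \<alpha>])
    finally show "N (\<lambda>x. shift_mean (\<alpha> n) (fs n) x - shift_mean \<beta> f x)
      \<le> N (\<lambda>x. fs n x - f x) + N (\<lambda>x. shift_mean (\<alpha> n) f x - shift_mean \<beta> f x)" .
  qed
qed

end

text \<open>Once the convolution powers converge, a function at which the difference quotients converge lies
  in the domain of the generator of the limit semigroup: the difference of \<open>T\<^sup>n f\<close> and \<open>f + h g\<close> for
  step size \<open>h / n\<close> telescopes, and the \<open>n\<close> error terms are controlled by the continuity of
  \<open>j \<mapsto> T\<^sup>j g\<close> at \<open>0\<close>, which is the case \<open>t = 0\<close> of the convergence.\<close>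

locale chernoff_approximation = shift_norm N F G
  for N :: "('a::ordered_euclidean_space \<Rightarrow> real) \<Rightarrow> ennreal" and F G +
  fixes \<mu> \<nu> :: "real \<Rightarrow> 'a measure"
  assumes \<mu>: "\<And>h. h > 0 \<Longrightarrow> prob_space (\<mu> h)" "\<And>h. h > 0 \<Longrightarrow> sets (\<mu> h) = sets borel"
    and \<nu>: "\<And>t. t \<ge> 0 \<Longrightarrow> prob_space (\<nu> t)" "\<And>t. t \<ge> 0 \<Longrightarrow> sets (\<nu> t) = sets borel"
    and \<nu>_0: "\<nu> 0 = return borel 0"
    and conv: "\<And>h t k \<delta>. (\<And>n. h n > 0) \<Longrightarrow> h \<longlonglongrightarrow> 0 \<Longrightarrow> t \<ge> 0 \<Longrightarrow> (\<lambda>n. real (k n) * h n) \<longlonglongrightarrow> t \<Longrightarrow> \<delta> > 0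
      \<Longrightarrow> \<forall>\<^sub>F n in sequentially. coupled \<delta> (conv_power (\<mu> (h n)) (k n)) (\<nu> t)"
begin

abbreviation T :: "real \<Rightarrow> nat \<Rightarrow> ('a \<Rightarrow> real) \<Rightarrow> 'a \<Rightarrow> real" where
  "T h k \<equiv> shift_mean (conv_power (\<mu> h) k)"

lemma prob_T: "h > 0 \<Longrightarrow> prob_space (conv_power (\<mu> h) k)"
  by (intro prob_space_conv_power \<mu>)

lemma T_closed: "h > 0 \<Longrightarrow> f \<in> F \<Longrightarrow> T h k f \<in> F"
  by (intro closed prob_T sets_conv_power)

lemma approximation_powers:
  assumes "\<And>n. h n > 0" "h \<longlonglongrightarrow> 0" "t \<ge> 0" "(\<lambda>n. real (k n) * h n) \<longlonglongrightarrow> t"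
    and "\<And>n. fs n \<in> F" "f \<in> F" "(\<lambda>n. N (\<lambda>x. fs n x - f x)) \<longlonglongrightarrow> 0"
  shows "(\<lambda>n. N (\<lambda>x. T (h n) (k n) (fs n) x - shift_mean (\<nu> t) f x)) \<longlonglongrightarrow> 0"
  by (intro approximation conv assms prob_T sets_conv_power \<nu>)

lemma shift_mean_\<nu>_0: "f \<in> F \<Longrightarrow> shift_mean (\<nu> 0) f = f"
  unfolding \<nu>_0 shift_mean_def using measurable[of f] by (subst integral_return) auto

text \<open>Convergence along all sequences implies this uniformity in \<open>h\<close> and
  \<open>j\<close>: otherwise there would be offending pairs with \<open>h\<close> and
  \<open>j * h\<close> both below \<open>1 / Suc n\<close>, and they would contradict convergence at
  time 0, where the limit operator is the identity.\<close>

lemma equicontinuous_at_0: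
  assumes g: "g \<in> F" and e: "e > 0"
  obtains \<delta> where "\<delta> > 0"
    "\<And>h j. 0 < h \<Longrightarrow> h < \<delta> \<Longrightarrow> real j * h < \<delta> \<Longrightarrow> N (\<lambda>x. T h j g x - g x) \<le> ennreal e"
proof (rule ccontr)
  assume "\<not> thesis"
  with that have "\<forall>\<delta>>0. \<exists>h j. 0 < h \<and> h < \<delta> \<and> real j * h < \<delta> \<and> \<not> N (\<lambda>x. T h j g x - g x) \<le> ennreal e"
    by metis
  then have "\<exists>h j. 0 < h \<and> h < 1 / Suc n \<and> real j * h < 1 / Suc n \<and> \<not> N (\<lambda>x. T h j g x - g x) \<le> ennreal e" for n
    by (rule allE[of _ "1 / Suc n"]) auto
  then have "\<forall>n. \<exists>q. 0 < fst q \<and> fst q < 1 / Suc n \<and> real (snd q) * fst q < 1 / Suc n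
      \<and> \<not> N (\<lambda>x. T (fst q) (snd q) g x - g x) \<le> ennreal e"
    by simp
  from choice[OF this] obtain q where q: "\<forall>n. 0 < fst (q n) \<and> fst (q n) < 1 / Suc n
      \<and> real (snd (q n)) * fst (q n) < 1 / Suc n
      \<and> \<not> N (\<lambda>x. T (fst (q n)) (snd (q n)) g x - g x) \<le> ennreal e" ..
  define h j where "h n = fst (q n)" and "j n = snd (q n)" for n
  have hj: "\<And>n. 0 < h n" "\<And>n. h n < 1 / Suc n" "\<And>n. real (j n) * h n < 1 / Suc n"
    "\<And>n. \<not> N (\<lambda>x. T (h n) (j n) g x - g x) \<le> ennreal e"
    using q by (auto simp: h_def j_def)
  have bounds: "0 \<le> h n" "h n \<le> 1 / Suc n" "0 \<le> real (j n) * h n" "real (j n) * h n \<le> 1 / Suc n" for n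
    using hj(1,2,3)[of n] by (simp_all only: less_imp_le mult_nonneg_nonneg of_nat_0_le_iff)
  have "h \<longlonglongrightarrow> 0"
    by (rule tendsto_sandwich[OF _ _ tendsto_const LIMSEQ_Suc[OF lim_1_over_n]])
       (intro always_eventually allI bounds)+
  moreover have "(\<lambda>n. real (j n) * h n) \<longlonglongrightarrow> 0"
    by (rule tendsto_sandwich[OF _ _ tendsto_const LIMSEQ_Suc[OF lim_1_over_n]])
       (intro always_eventually allI bounds)+
  moreover have "N (\<lambda>x. g x - g x) = 0" by (rule null) auto
  ultimately have "(\<lambda>n. N (\<lambda>x. T (h n) (j n) g x - g x)) \<longlonglongrightarrow> 0"
    using approximation_powers[of h 0 j "\<lambda>_. g" g] hj(1) g by (simp add: shift_mean_\<nu>_0)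
  then have "\<forall>\<^sub>F n in sequentially. N (\<lambda>x. T (h n) (j n) g x - g x) \<le> ennreal e"
    using e by (simp add: tendsto_zero_ennreal_iff)
  then show False using hj(4) by (auto simp: eventually_sequentially)
qed

lemma T_Suc:
  assumes "h > 0" "f \<in> F"
  shows "eventually (\<lambda>x. T h (Suc k) f x = T h k (shift_mean (\<mu> h) f) x) G"
  using shift_mean_convolution[OF assms(2) \<mu>(1,2)[OF assms(1)] prob_T[OF assms(1)] sets_conv_power, of k]
  by simp

text \<open>Each step costs \<open>2 * h * e\<close>. Inside \<open>T h n\<close> the function
  \<open>shift_mean (\<mu> h) f\<close> is replaced by \<open>f + h * g\<close>, with error
  \<open>h * e\<close> by contraction; then \<open>T h n g\<close> is replaced by \<open>g\<close>,
  again with error \<open>h * e\<close>.\<close>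

lemma T_telescope:
  assumes h: "h > 0" and f: "f \<in> F" and g: "g \<in> F"
    and A: "N (\<lambda>x. shift_mean (\<mu> h) f x - (f x + h * g x)) \<le> ennreal (h * e)"
    and g0: "\<And>j. j < n \<Longrightarrow> N (\<lambda>x. T h j g x - g x) \<le> ennreal e" and "e \<ge> 0"
  shows "N (\<lambda>x. T h n f x - (f x + (real n * h) * g x)) \<le> ennreal (real n * h * (2 * e))"
  using g0
proof (induction n)
  case 0
  have "T h 0 f = f" using measurable[OF f] by (auto simp: shift_mean_def integral_return)
  then have "N (\<lambda>x. T h 0 f x - (f x + (real 0 * h) * g x)) = 0" using null[of "\<lambda>_. 0"] by simp
  then show ?case by simp
next
  case (Suc n)
  define f' where "f' x = f x + h * g x" for x
  have F: "f' \<in> F" "shift_mean (\<mu> h) f \<in> F" "T h n f' \<in> F" "T h n g \<in> F" "T h n f \<in> F"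
      "T h (Suc n) f \<in> F" "T h n (shift_mean (\<mu> h) f) \<in> F"
    unfolding f'_def[abs_def] by (intro add_scale f g closed \<mu> prob_T h sets_conv_power)+
  note [measurable] = F[THEN measurable] measurable[OF f] measurable[OF g]
  have 1: "N (\<lambda>x. T h (Suc n) f x - T h n f' x) \<le> ennreal (h * e)"
  proof -
    have "N (\<lambda>x. T h (Suc n) f x - T h n f' x) = N (\<lambda>x. T h n (shift_mean (\<mu> h) f) x - T h n f' x)"
      by (rule norm_cong, measurable) (use T_Suc[OF h f, of n] in \<open>auto elim: eventually_mono\<close>)
    also have "\<dots> \<le> N (\<lambda>x. shift_mean (\<mu> h) f x - f' x)"
      by (intro contraction_diff F prob_T h sets_conv_power)
    finally show ?thesis using A by (simp add: f'_def)
  qed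
  have 2: "N (\<lambda>x. T h n f' x - (T h n f x + h * g x)) \<le> ennreal (h * e)"
  proof -
    have "N (\<lambda>x. T h n f' x - (T h n f x + h * g x)) = N (\<lambda>x. h * (T h n g x - g x))"
    proof (rule norm_cong, measurable)
      have "\<forall>\<^sub>F x in G. T h n f' x = T h n f x + h * T h n g x"
        unfolding f'_def[abs_def] by (rule shift_mean_add_scale[OF f g prob_T[OF h] sets_conv_power])
      then show "\<forall>\<^sub>F x in G. T h n f' x - (T h n f x + h * g x) = h * (T h n g x - g x)"
        by eventually_elim (simp add: algebra_simps)
    qed
    also have "\<dots> = ennreal h * N (\<lambda>x. T h n g x - g x)"
      using h by (subst scale) auto
    also have "\<dots> \<le> ennreal h * ennreal e" using Suc.prems[of n] by (intro mult_left_mono) auto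
    finally show ?thesis using h \<open>e \<ge> 0\<close> by (simp flip: ennreal_mult)
  qed
  have 3: "N (\<lambda>x. T h n f x - (f x + (real n * h) * g x)) \<le> ennreal (real n * h * (2 * e))"
    using Suc by simp
  have "N (\<lambda>x. T h (Suc n) f x - (f x + (real (Suc n) * h) * g x))
    = N (\<lambda>x. (T h (Suc n) f x - T h n f' x)
        + ((T h n f' x - (T h n f x + h * g x)) + (T h n f x - (f x + (real n * h) * g x))))"
    by (simp add: algebra_simps)
  also have "\<dots> \<le> N (\<lambda>x. T h (Suc n) f x - T h n f' x)
      + (N (\<lambda>x. T h n f' x - (T h n f x + h * g x)) + N (\<lambda>x. T h n f x - (f x + (real n * h) * g x)))"
    by (intro order_trans[OF triangle] add_left_mono triangle) measurable
  also have "\<dots> \<le> ennreal (h * e) + (ennreal (h * e) + ennreal (real n * h * (2 * e)))"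
    by (intro add_mono 1 2 3)
  also have "\<dots> = ennreal (real (Suc n) * h * (2 * e))"
    using h \<open>e \<ge> 0\<close> by (simp add: algebra_simps flip: ennreal_plus)
  finally show ?case .
qed

text \<open>Both operators are compared with \<open>f + h * g\<close>. For \<open>\<mu> h\<close>
  this is the hypothesis; for \<open>\<nu> h\<close> one goes through many steps of size
  \<open>h / Suc n\<close>, whose telescoped error does not depend on \<open>n\<close>.\<close>

theorem generator_approximation:
  assumes f: "f \<in> F" and g: "g \<in> F"
    and lim: "((\<lambda>h. N (\<lambda>x. (\<integral>y. (f (x + y) - f x) / h \<partial>\<mu> h) - g x)) \<longlongrightarrow> 0) (at_right 0)"
  shows "((\<lambda>h. ennreal (1 / h) * N (\<lambda>x. shift_mean (\<mu> h) f x - shift_mean (\<nu> h) f x)) \<longlongrightarrow> 0) (at_right 0)"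
  unfolding tendsto_zero_ennreal_iff
proof (intro allI impI)
  note [measurable] = measurable[OF f] measurable[OF g]
  fix e0 :: real assume "e0 > 0"
  \<comment> \<open>The errors are \<open>h * e\<close> for one step of \<open>\<mu> h\<close>,
    \<open>2 * h * e\<close> for telescoping and \<open>h * e\<close> for passing to the limit
    law.\<close>
  define e where "e = e0 / 4"
  have e: "e > 0" using \<open>e0 > 0\<close> by (simp add: e_def)
  have "\<forall>\<^sub>F h in at_right 0. N (\<lambda>x. (\<integral>y. (f (x + y) - f x) / h \<partial>\<mu> h) - g x) \<le> ennreal e"
    using lim e by (simp add: tendsto_zero_ennreal_iff)
  then obtain h0 where h0: "h0 > 0" "\<And>h. 0 < h \<Longrightarrow> h < h0 \<Longrightarrow>
      N (\<lambda>x. (\<integral>y. (f (x + y) - f x) / h \<partial>\<mu> h) - g x) \<le> ennreal e"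
    by (auto simp: eventually_at_right_field)
  obtain \<delta> where \<delta>: "\<delta> > 0"
    "\<And>h j. 0 < h \<Longrightarrow> h < \<delta> \<Longrightarrow> real j * h < \<delta> \<Longrightarrow> N (\<lambda>x. T h j g x - g x) \<le> ennreal e"
    using equicontinuous_at_0[OF g e] by blast
  have A: "N (\<lambda>x. shift_mean (\<mu> h) f x - (f x + h * g x)) \<le> ennreal (h * e)" if h: "0 < h" "h < h0" for h
  proof -
    interpret prob_space "\<mu> h" by (rule \<mu>[OF h(1)])
    note \<mu>(2)[OF h(1), measurable_cong]
    note [measurable] = measurable[OF closed[OF f \<mu>(1,2)[OF h(1)]]]
    have "N (\<lambda>x. shift_mean (\<mu> h) f x - (f x + h * g x))
      = N (\<lambda>x. h * ((\<integral>y. (f (x + y) - f x) / h \<partial>\<mu> h) - g x))"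
    proof (rule norm_cong, measurable)
      show "\<forall>\<^sub>F x in G. shift_mean (\<mu> h) f x - (f x + h * g x) = h * ((\<integral>y. (f (x + y) - f x) / h \<partial>\<mu> h) - g x)"
        using integrable[OF f \<mu>(1,2)[OF h(1)]]
        by eventually_elim (use h in \<open>simp add: shift_mean_def prob_space field_simps\<close>)
    qed
    also have "\<dots> = ennreal h * N (\<lambda>x. (\<integral>y. (f (x + y) - f x) / h \<partial>\<mu> h) - g x)"
      using h by (subst scale) auto
    also have "\<dots> \<le> ennreal h * ennreal e" by (intro mult_left_mono h0 h) auto
    finally show ?thesis using h e by (simp flip: ennreal_mult)
  qed
  have "ennreal (1 / h) * N (\<lambda>x. shift_mean (\<mu> h) f x - shift_mean (\<nu> h) f x) \<le> ennreal e0"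
    if h: "0 < h" "h < min h0 \<delta>" for h
  proof -
    have F: "shift_mean (\<mu> h) f \<in> F" "shift_mean (\<nu> h) f \<in> F" "\<And>n. T (h / real (Suc n)) (Suc n) f \<in> F"
      using h by (simp_all add: closed f \<mu> \<nu> T_closed del: conv_power.simps of_nat_Suc)
    note [measurable] = F[THEN measurable]
    have U: "N (\<lambda>x. T (h / real (Suc n)) (Suc n) f x - (f x + h * g x)) \<le> ennreal (h * (2 * e))" for n
    proof -
      \<comment> \<open>All times \<open>j * s\<close> with \<open>j \<le> n\<close> stay below
        \<open>h\<close>, hence below \<delta>, so the equicontinuity bound is available at every
        step.\<close>
      define s where "s = h / real (Suc n)"
      have s: "0 < s" "s \<le> h" "real (Suc n) * s = h"
        using h by (auto simp: s_def field_simps)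
      have "real j * s < \<delta>" if "j < Suc n" for j
        using that s h mult_right_mono[of "real j" "real (Suc n)" s] by simp
      then show ?thesis
        using T_telescope[where e = e and n = "Suc n", OF s(1) f g A] \<delta>(2)[OF s(1)] s h e
        unfolding s_def[symmetric] by auto
    qed
    have "(\<lambda>n. N (\<lambda>x. T (h / real (Suc n)) (Suc n) f x - shift_mean (\<nu> h) f x)) \<longlonglongrightarrow> 0"
    proof (rule approximation_powers)
      show "(\<lambda>n. h / real (Suc n)) \<longlonglongrightarrow> 0"
        using tendsto_mult_right_zero[OF LIMSEQ_Suc[OF lim_1_over_n], of h] by simp
      show "(\<lambda>n. N (\<lambda>x. f x - f x)) \<longlonglongrightarrow> 0" using null[of "\<lambda>_. 0"] by simp
    qed (use h f in \<open>auto simp del: of_nat_Suc\<close>)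
    then have "\<forall>\<^sub>F n in sequentially. N (\<lambda>x. T (h / real (Suc n)) (Suc n) f x - shift_mean (\<nu> h) f x) \<le> ennreal (h * e)"
      using e h by (simp add: tendsto_zero_ennreal_iff del: of_nat_Suc)
    \<comment> \<open>This \<open>n\<close> depends on \<open>h\<close>, which does no harm, as the
      bound \<open>U\<close> holds for every \<open>n\<close>.\<close>
    then obtain n where n: "N (\<lambda>x. T (h / real (Suc n)) (Suc n) f x - shift_mean (\<nu> h) f x) \<le> ennreal (h * e)"
      by (auto simp: eventually_sequentially)
    have "N (\<lambda>x. shift_mean (\<mu> h) f x - shift_mean (\<nu> h) f x)
      \<le> N (\<lambda>x. shift_mean (\<mu> h) f x - (f x + h * g x)) + N (\<lambda>x. (f x + h * g x) - shift_mean (\<nu> h) f x)"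
      by (rule norm_triangle_diff) measurable
    also have "\<dots> \<le> N (\<lambda>x. shift_mean (\<mu> h) f x - (f x + h * g x))
       + (N (\<lambda>x. (f x + h * g x) - T (h / real (Suc n)) (Suc n) f x)
          + N (\<lambda>x. T (h / real (Suc n)) (Suc n) f x - shift_mean (\<nu> h) f x))"
      by (intro add_left_mono norm_triangle_diff) measurable
    also have "\<dots> \<le> ennreal (h * e) + (ennreal (h * (2 * e)) + ennreal (h * e))"
    proof (intro add_mono n A)
      show "N (\<lambda>x. (f x + h * g x) - T (h / real (Suc n)) (Suc n) f x) \<le> ennreal (h * (2 * e))"
        using U[of n] by (subst norm_diff_sym) (auto simp del: conv_power.simps of_nat_Suc)
    qed (use h in auto)
    also have "\<dots> = ennreal (h * e0)"
      using e h by (simp add: e_def algebra_simps flip: ennreal_plus)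
    finally have "ennreal (1 / h) * N (\<lambda>x. shift_mean (\<mu> h) f x - shift_mean (\<nu> h) f x) \<le> ennreal (1 / h) * ennreal (h * e0)"
      by (rule mult_left_mono) simp
    also have "\<dots> = ennreal e0" using h \<open>e0 > 0\<close> by (simp flip: ennreal_mult)
    finally show ?thesis .
  qed
  moreover have "min h0 \<delta> > 0" using h0(1) \<delta>(1) by simp
  ultimately show "\<forall>\<^sub>F h in at_right 0. ennreal (1 / h) * N (\<lambda>x. shift_mean (\<mu> h) f x - shift_mean (\<nu> h) f x) \<le> ennreal e0"
    unfolding eventually_at_right_field by blast
qed

end

section \<open>Oscillations of random walks\<close>

text \<open>The number of times a walk with steps \<open>w\<close> has moved by more than \<open>\<epsilon>\<close> since the previous such
  time; \<open>d\<close> is the displacement since the last one.\<close>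

primrec greedy_count :: "real \<Rightarrow> nat \<Rightarrow> 'a::real_normed_vector \<Rightarrow> (nat \<Rightarrow> 'a) \<Rightarrow> nat" where
  "greedy_count \<epsilon> 0 d w = 0"
| "greedy_count \<epsilon> (Suc n) d w =
     (if norm (d + w 0) > \<epsilon> then Suc (greedy_count \<epsilon> n 0 (\<lambda>i. w (Suc i)))
      else greedy_count \<epsilon> n (d + w 0) (\<lambda>i. w (Suc i)))"

text \<open>Two positions more than \<open>2 * \<epsilon>\<close> apart cannot both be within
  \<epsilon> of the last counted position, so each of the listed differences forces another count.
  The condition on the first point supplies the initial one.\<close>

lemma greedy_count_ge_aux:
  fixes w :: "nat \<Rightarrow> 'a::real_normed_vector"
  assumes "\<epsilon> \<ge> 0"
    and "\<And>i. i < p \<Longrightarrow> 1 \<le> c i \<and> c i \<le> n" "\<And>i. Suc i < p \<Longrightarrow> c i < c (Suc i)"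
    and "p > 0 \<Longrightarrow> norm (d + (\<Sum>k<c 0. w k)) > \<epsilon>"
    and "\<And>i. Suc i < p \<Longrightarrow> norm ((\<Sum>k<c (Suc i). w k) - (\<Sum>k<c i. w k)) > 2 * \<epsilon>"
  shows "p \<le> greedy_count \<epsilon> n d w"
  using assms(2-)
proof (induction n arbitrary: p c d w)
  case 0
  then show ?case by (cases p) force+
next
  case (Suc n)
  show ?case
  proof (cases p)
    case (Suc q)
    define w' where "w' i = w (Suc i)" for i
    have S: "(\<Sum>k<c i. w k) = w 0 + (\<Sum>k<c i - 1. w' k)" if "i < p" for i
      using Suc.prems(1)[OF that] by (cases "c i") (auto simp: sum.lessThan_Suc_shift w'_def simp del: sum.lessThan_Suc)
    have diff: "norm ((\<Sum>k<c (Suc i) - 1. w' k) - (\<Sum>k<c i - 1. w' k)) > 2 * \<epsilon>" if "Suc i < p" for i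
      using Suc.prems(4)[OF that] S[of i] S[of "Suc i"] that by simp
    have all: "p \<le> greedy_count \<epsilon> n e w'" if "c 0 \<noteq> 1" "norm (e + (\<Sum>k<c 0 - 1. w' k)) > \<epsilon>" for e
    proof (rule Suc.IH[where c = "\<lambda>i. c i - 1"])
      have "c 0 \<le> c i" if "i < p" for i
        using that by (induction i) (auto dest: Suc.prems(2))
      then show "1 \<le> c i - 1 \<and> c i - 1 \<le> n" if "i < p" for i
        using Suc.prems(1)[of i] Suc.prems(1)[of 0] \<open>c 0 \<noteq> 1\<close> that \<open>p = Suc q\<close> by force
      show "c i - 1 < c (Suc i) - 1" if "Suc i < p" for i
        using Suc.prems(2)[OF that] Suc.prems(1)[of i] that by (intro diff_less_mono) auto
    qed (use that diff in auto)
    show ?thesis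
    proof (cases "norm (d + w 0) > \<epsilon>")
      case True
      \<comment> \<open>The first step has been counted. If the second listed point is far from the
        new origin, the remaining \<open>q\<close> points suffice; if it is near, the first listed
        point must be far, and all \<open>p\<close> points can still be used.\<close>
      have "q \<le> greedy_count \<epsilon> n 0 w'"
      proof (cases "q > 0 \<and> norm (\<Sum>k<c 1 - 1. w' k) \<le> \<epsilon>")
        case True
        then have "norm ((\<Sum>k<c 1 - 1. w' k) - (\<Sum>k<c 0 - 1. w' k)) > 2 * \<epsilon>"
          using diff[of 0] \<open>p = Suc q\<close> by simp
        then have *: "norm (\<Sum>k<c 0 - 1. w' k) > \<epsilon>"
          using True norm_triangle_ineq4[of "\<Sum>k<c 1 - 1. w' k" "\<Sum>k<c 0 - 1. w' k"] by linarith
        then have "c 0 \<noteq> 1" using \<open>\<epsilon> \<ge> 0\<close> by auto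
        from all[OF this, of 0] * show ?thesis using \<open>p = Suc q\<close> by simp
      next
        case False
        show ?thesis
        proof (rule Suc.IH[where c = "\<lambda>i. c (Suc i) - 1"])
          show "1 \<le> c (Suc i) - 1 \<and> c (Suc i) - 1 \<le> n" if "i < q" for i
            using Suc.prems(1)[of i] Suc.prems(1)[of "Suc i"] Suc.prems(2)[of i] that \<open>p = Suc q\<close> by force
          show "c (Suc i) - 1 < c (Suc (Suc i)) - 1" if "Suc i < q" for i
            using Suc.prems(2)[of "Suc i"] Suc.prems(1)[of "Suc i"] that \<open>p = Suc q\<close> by force
        qed (use False diff \<open>p = Suc q\<close> in auto)
      qed
      then show ?thesis using True \<open>p = Suc q\<close> by (simp add: w'_def[abs_def])
    next
      case False
      have "norm (d + (w 0 + (\<Sum>k<c 0 - 1. w' k))) > \<epsilon>"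
        using Suc.prems(3) S[of 0] \<open>p = Suc q\<close> by simp
      moreover from this have "c 0 \<noteq> 1" using False by auto
      ultimately show ?thesis
        using all[of "d + w 0"] False by (simp add: w'_def[abs_def] add.assoc)
    qed
  qed simp
qed

text \<open>Of the first two points at least one is more than \<epsilon> away from the start. It
  begins the list for the auxiliary lemma, which then has at least \<open>p\<close> points.\<close>

lemma greedy_count_ge:
  fixes w :: "nat \<Rightarrow> 'a::real_normed_vector"
  assumes "\<epsilon> \<ge> 0" "\<And>i. i < p \<Longrightarrow> c i < c (Suc i)" "c p \<le> n"
    and "\<And>i. i < p \<Longrightarrow> norm ((\<Sum>k<c (Suc i). w k) - (\<Sum>k<c i. w k)) > 2 * \<epsilon>"
  shows "p \<le> greedy_count \<epsilon> n 0 w"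
proof (cases "p > 0 \<and> norm (\<Sum>k<c 1. w k) \<le> \<epsilon>")
  case True
  have cn: "c i \<le> n" if "i \<le> p" for i
    using that
  proof (induction i rule: inc_induct)
    case (step i)
    then show ?case using assms(2)[of i] by simp
  qed (rule assms(3))
  have "norm ((\<Sum>k<c 1. w k) - (\<Sum>k<c 0. w k)) > 2 * \<epsilon>" using assms(4)[of 0] True by simp
  then have *: "norm (\<Sum>k<c 0. w k) > \<epsilon>"
    using True norm_triangle_ineq4[of "\<Sum>k<c 1. w k" "\<Sum>k<c 0. w k"] by linarith
  then have "c 0 \<noteq> 0" using assms(1) by (intro notI) simp
  moreover have "c 0 \<le> c i" if "i \<le> p" for i
    using that
  proof (induction i)
    case (Suc i)
    then show ?case using assms(2)[of i] by simp
  qed simp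
  ultimately have "1 \<le> c i" if "i \<le> p" for i using that by (metis Suc_leI One_nat_def gr0I le_trans)
  then have "Suc p \<le> greedy_count \<epsilon> n 0 w"
    by (intro greedy_count_ge_aux[where c = c] conjI cn assms(1,2,4)) (simp_all add: * less_Suc_eq_le)
  then show ?thesis by simp
next
  case False
  have cn: "c i \<le> n" if "i \<le> p" for i
    using that
  proof (induction i rule: inc_induct)
    case (step i)
    then show ?case using assms(2)[of i] by simp
  qed (rule assms(3))
  show ?thesis
  proof (rule greedy_count_ge_aux[where c = "\<lambda>i. c (Suc i)"])
    show "1 \<le> c (Suc i) \<and> c (Suc i) \<le> n" if "i < p" for i
      using assms(2)[OF that] cn[of "Suc i"] that by simp
  qed (use assms False in auto)
qed

lemma measurable_greedy_count:
  "(\<lambda>q. greedy_count \<epsilon> n (fst q) (snd q)) \<in>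
     borel \<Otimes>\<^sub>M PiM UNIV (\<lambda>_. borel :: 'a::euclidean_space measure) \<rightarrow>\<^sub>M count_space UNIV"
proof (induction n)
  case (Suc n)
  let ?P = "borel \<Otimes>\<^sub>M PiM UNIV (\<lambda>_. borel :: 'a measure)"
  have tl: "(\<lambda>q. \<lambda>i. snd q (Suc i)) \<in> ?P \<rightarrow>\<^sub>M PiM UNIV (\<lambda>_. borel :: 'a measure)"
    by (rule measurable_PiM_single') auto
  have hd: "(\<lambda>q. snd q 0) \<in> ?P \<rightarrow>\<^sub>M borel" by measurable
  have 1: "(\<lambda>q. greedy_count \<epsilon> n 0 (\<lambda>i. snd q (Suc i))) \<in> ?P \<rightarrow>\<^sub>M count_space UNIV"
    using measurable_compose[OF measurable_Pair[OF measurable_const tl] Suc.IH, of 0] by simp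
  have 2: "(\<lambda>q. greedy_count \<epsilon> n (fst q + snd q 0) (\<lambda>i. snd q (Suc i))) \<in> ?P \<rightarrow>\<^sub>M count_space UNIV"
    using measurable_compose[OF measurable_Pair[OF borel_measurable_add[OF measurable_fst hd] tl] Suc.IH] by simp
  have 3: "Measurable.pred ?P (\<lambda>q. norm (fst q + snd q 0) > \<epsilon>)"
    using hd by measurable
  have "(\<lambda>q. Suc (greedy_count \<epsilon> n 0 (\<lambda>i. snd q (Suc i)))) \<in> ?P \<rightarrow>\<^sub>M count_space UNIV"
    by (rule measurable_compose[OF 1]) simp
  from measurable_If[OF this 2] 3 show ?case by simp
qed simp

lemma measurable_greedy_count' [measurable (raw)]:
  assumes "f \<in> M \<rightarrow>\<^sub>M PiM UNIV (\<lambda>_. borel :: 'a::euclidean_space measure)"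
  shows "(\<lambda>x. greedy_count \<epsilon> n d (f x)) \<in> M \<rightarrow>\<^sub>M count_space UNIV"
  using measurable_compose[OF measurable_Pair[OF measurable_const assms] measurable_greedy_count, of d \<epsilon> n] by simp

locale random_walk =
  fixes K :: "'a::euclidean_space measure"
  assumes prob_step: "prob_space K" and sets_step [measurable_cong]: "sets K = sets borel"
begin

sublocale sequence_space K
  by (intro sequence_space.intro product_prob_spaceI prob_step)

lemma measurable_S [simp]: "measurable S M = measurable (PiM UNIV (\<lambda>_. borel)) M"
  by (intro measurable_cong_sets sets_PiM_cong sets_step) auto

lemma nn_integral_S_first_step:
  assumes [measurable]: "f \<in> borel_measurable (PiM UNIV (\<lambda>_. borel :: 'a measure))"
  shows "(\<integral>\<^sup>+w. f w \<partial>S) = (\<integral>\<^sup>+s. \<integral>\<^sup>+w. f (case_nat s w) \<partial>S \<partial>K)"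
proof -
  interpret K: prob_space K by (rule prob_step)
  interpret KS: pair_prob_space K S ..
  have [measurable]: "f \<in> borel_measurable S" by simp
  have "(\<integral>\<^sup>+w. f w \<partial>S) = (\<integral>\<^sup>+w. f w \<partial>distr (K \<Otimes>\<^sub>M S) S (\<lambda>(s, w). case_nat s w))"
    by (simp only: PiM_iter)
  also have "\<dots> = (\<integral>\<^sup>+q. f (case q of (s, w) \<Rightarrow> case_nat s w) \<partial>(K \<Otimes>\<^sub>M S))"
    by (rule nn_integral_distr) measurable
  also have "\<dots> = (\<integral>\<^sup>+s. \<integral>\<^sup>+w. f (case_nat s w) \<partial>S \<partial>K)"
    by (subst P.nn_integral_fst[symmetric]) auto
  finally show ?thesis .
qed

text \<open>The factor \<open>2\<close> makes the induction close: after a step to distance more than \<open>\<epsilon>\<close> the walk ends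
  at distance more than \<open>\<epsilon> / 2\<close> with probability at least \<open>3 / 4\<close>.\<close>

lemma greedy_count_expectation:
  assumes small: "\<And>m. m < n \<Longrightarrow> (\<integral>\<^sup>+w. indicator {x. norm x > \<epsilon> / 2} (\<Sum>i<m. w i) \<partial>S) \<le> ennreal (1 / 4)"
  shows "(\<integral>\<^sup>+w. of_nat (greedy_count \<epsilon> n d w) \<partial>S)
    \<le> 2 * (\<integral>\<^sup>+w. indicator {x. norm x > \<epsilon> / 2} (d + (\<Sum>i<n. w i)) \<partial>S)"
  using small
proof (induction n arbitrary: d)
  case (Suc n)
  define B where "B = {x::'a. norm x > \<epsilon> / 2}"
  have [measurable]: "B \<in> sets borel" by (simp add: B_def)
  have IH: "(\<integral>\<^sup>+w. of_nat (greedy_count \<epsilon> n d w) \<partial>S) \<le> 2 * (\<integral>\<^sup>+w. indicator B (d + (\<Sum>i<n. w i)) \<partial>S)" for d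
    using Suc by (simp add: B_def)
  have q: "(\<integral>\<^sup>+w. indicator B (\<Sum>i<n. w i) \<partial>S) \<le> ennreal (1 / 4)"
    using Suc.prems[of n] by (simp add: B_def)
  have step: "(\<integral>\<^sup>+w. of_nat (greedy_count \<epsilon> (Suc n) d (case_nat s w)) \<partial>S)
      \<le> 2 * (\<integral>\<^sup>+w. indicator B (d + (s + (\<Sum>i<n. w i))) \<partial>S)" for s
  proof (cases "norm (d + s) > \<epsilon>")
    case True
    have "(\<integral>\<^sup>+w. of_nat (greedy_count \<epsilon> (Suc n) d (case_nat s w)) \<partial>S)
        = (\<integral>\<^sup>+w. 1 + of_nat (greedy_count \<epsilon> n 0 w) \<partial>S)"
      using True by simp
    also have "\<dots> = 1 + (\<integral>\<^sup>+w. of_nat (greedy_count \<epsilon> n 0 w) \<partial>S)"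
      by (subst nn_integral_add) (auto simp: P.emeasure_space_1)
    \<comment> \<open>The new count gives 1 and the restarted walk at most \<open>2 * 1/4\<close>.
      The total \<open>3/2\<close> equals \<open>2 * 3/4\<close>, exactly what the probability of
      ending far away can absorb.\<close>
    also have "\<dots> \<le> 1 + 2 * ennreal (1 / 4)"
      using IH[of 0] q by (intro add_left_mono order_trans[OF IH] mult_left_mono) auto
    also have "\<dots> = ennreal (3 / 2)"
    proof -
      have "ennreal (3 / 2) = ennreal 1 + ennreal 2 * ennreal (1 / 4)"
        by (subst ennreal_mult[symmetric], simp, simp, subst ennreal_plus[symmetric]) simp_all
      then show ?thesis by (simp only: ennreal_1 ennreal_numeral)
    qed
    also have "\<dots> \<le> 2 * (\<integral>\<^sup>+w. indicator B (d + (s + (\<Sum>i<n. w i))) \<partial>S)"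
    proof -
      have "1 = (\<integral>\<^sup>+w. 1 \<partial>S)" by (simp add: P.emeasure_space_1)
      also have "\<dots> \<le> (\<integral>\<^sup>+w. indicator B (d + (s + (\<Sum>i<n. w i))) + indicator B (\<Sum>i<n. w i) \<partial>S)"
      proof (rule nn_integral_mono)
        fix w
        have "norm (d + s) \<le> norm (d + (s + (\<Sum>i<n. w i))) + norm (\<Sum>i<n. w i)"
          using norm_triangle_ineq4[of "d + (s + (\<Sum>i<n. w i))" "\<Sum>i<n. w i"] by (simp add: algebra_simps)
        then show "1 \<le> indicator B (d + (s + (\<Sum>i<n. w i))) + (indicator B (\<Sum>i<n. w i) :: ennreal)"
          using True by (auto simp: B_def indicator_def)
      qed
      also have "\<dots> = (\<integral>\<^sup>+w. indicator B (d + (s + (\<Sum>i<n. w i))) \<partial>S) + (\<integral>\<^sup>+w. indicator B (\<Sum>i<n. w i) \<partial>S)"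
        by (rule nn_integral_add) (simp_all, measurable)
      also have "\<dots> \<le> (\<integral>\<^sup>+w. indicator B (d + (s + (\<Sum>i<n. w i))) \<partial>S) + ennreal (1 / 4)"
        by (intro add_left_mono q)
      finally have *: "1 \<le> (\<integral>\<^sup>+w. indicator B (d + (s + (\<Sum>i<n. w i))) \<partial>S) + ennreal (1 / 4)" .
      show ?thesis
      proof (cases "(\<integral>\<^sup>+w. indicator B (d + (s + (\<Sum>i<n. w i))) \<partial>S)")
        case (real r)
        then have "3 / 4 \<le> r" using * by (simp flip: ennreal_plus ennreal_1)
        then show ?thesis using real
          by (simp flip: ennreal_numeral ennreal_mult)
      qed (simp add: ennreal_mult_top)
    qed
    finally show ?thesis .
  next
    case False
    then show ?thesis using IH[of "d + s"] by (simp add: add.assoc)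
  qed
  have "(\<integral>\<^sup>+w. of_nat (greedy_count \<epsilon> (Suc n) d w) \<partial>S)
      = (\<integral>\<^sup>+s. \<integral>\<^sup>+w. of_nat (greedy_count \<epsilon> (Suc n) d (case_nat s w)) \<partial>S \<partial>K)"
    by (rule nn_integral_S_first_step) measurable
  also have "\<dots> \<le> (\<integral>\<^sup>+s. 2 * (\<integral>\<^sup>+w. indicator B (d + (s + (\<Sum>i<n. w i))) \<partial>S) \<partial>K)"
    by (intro nn_integral_mono step)
  also have "\<dots> = 2 * (\<integral>\<^sup>+s. \<integral>\<^sup>+w. indicator B (d + (s + (\<Sum>i<n. w i))) \<partial>S \<partial>K)"
    by (rule nn_integral_cmult) measurable
  also have "(\<integral>\<^sup>+s. \<integral>\<^sup>+w. indicator B (d + (s + (\<Sum>i<n. w i))) \<partial>S \<partial>K)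
      = (\<integral>\<^sup>+w. indicator B (d + (\<Sum>i<Suc n. w i)) \<partial>S)"
    by (subst nn_integral_S_first_step) (simp_all add: sum.lessThan_Suc_shift del: sum.lessThan_Suc)
  finally show ?case by (simp add: B_def)
qed simp

end

section \<open>Characteristic functions\<close>

definition cf :: "'a::euclidean_space measure \<Rightarrow> 'a \<Rightarrow> complex" where
  "cf M v = (\<integral>x. cis (x \<bullet> v) \<partial>M)"

lemma borel_measurable_cis [measurable]: "cis \<in> borel_measurable borel"
  by (intro borel_measurable_continuous_onI continuous_on_cis continuous_intros)

lemma integrable_cis:
  assumes "prob_space M" and [measurable]: "f \<in> borel_measurable M"
  shows "integrable M (\<lambda>x. cis (f x))"
proof -
  interpret prob_space M by fact
  show ?thesis by (rule integrable_const_bound[of _ 1]) auto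
qed

lemma
  assumes "prob_space M" "sets M = sets borel"
  shows Re_cf: "Re (cf M v) = (\<integral>x. cos (x \<bullet> v) \<partial>M)"
    and Im_cf: "Im (cf M v) = (\<integral>x. sin (x \<bullet> v) \<partial>M)"
    and norm_cf_le_1: "norm (cf M v) \<le> 1"
proof -
  interpret prob_space M by fact
  note assms(2)[measurable_cong]
  have int: "integrable M (\<lambda>x. cis (x \<bullet> v))" by (rule integrable_cis[OF assms(1)]) measurable
  show "Re (cf M v) = (\<integral>x. cos (x \<bullet> v) \<partial>M)" "Im (cf M v) = (\<integral>x. sin (x \<bullet> v) \<partial>M)"
    unfolding cf_def using integral_Re[OF int] integral_Im[OF int] by simp_all
  have "norm (cf M v) \<le> (\<integral>x. norm (cis (x \<bullet> v)) \<partial>M)"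
    unfolding cf_def by (rule integral_norm_bound)
  then show "norm (cf M v) \<le> 1" by (simp add: prob_space)
qed

lemma measure_eqI_cf:
  assumes "prob_space M" "prob_space N" "sets M = sets borel" "sets N = sets borel"
    and "\<And>v. cf M v = cf N v"
  shows "M = N"
  using assms by (intro measure_eqI_char) (auto simp flip: Re_cf Im_cf)

lemma cf_return: "cf (return borel 0) v = 1"
  unfolding cf_def by (subst integral_return) auto

lemma cf_distr: "X \<in> borel_measurable M \<Longrightarrow> cf (distr M borel X) v = (\<integral>\<omega>. cis (X \<omega> \<bullet> v) \<partial>M)"
  unfolding cf_def by (subst integral_distr) auto

lemma cf_convolution:
  fixes M N :: "'a::ordered_euclidean_space measure"
  assumes "prob_space M" "prob_space N" and [measurable_cong]: "sets M = sets borel" "sets N = sets borel"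
  shows "cf (M \<star> N) v = cf M v * cf N v"
proof -
  interpret M: prob_space M by fact
  interpret N: prob_space N by fact
  interpret pair_prob_space M N ..
  have "cf (M \<star> N) v = (\<integral>q. cis (fst q \<bullet> v) * cis (snd q \<bullet> v) \<partial>(M \<Otimes>\<^sub>M N))"
    unfolding convolution_def case_prod_unfold
    by (subst cf_distr) (auto simp: cis_mult inner_add_left)
  also have "\<dots> = (\<integral>x. \<integral>y. cis (x \<bullet> v) * cis (y \<bullet> v) \<partial>N \<partial>M)"
  proof -
    have "integrable (M \<Otimes>\<^sub>M N) (\<lambda>(x, y). cis (x \<bullet> v) * cis (y \<bullet> v))"
      unfolding case_prod_unfold cis_mult by (rule integrable_cis) (unfold_locales, measurable)
    from integral_fst[OF this] show ?thesis by (simp add: case_prod_unfold)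
  qed
  also have "\<dots> = cf M v * cf N v" by (simp add: cf_def)
  finally show ?thesis .
qed

lemma cf_conv_power:
  "prob_space M \<Longrightarrow> sets M = sets borel \<Longrightarrow> cf (conv_power M k) v = cf M v ^ k"
  by (induction k) (simp_all add: cf_return cf_convolution prob_space_conv_power)

lemma cf_tendsto:
  assumes "prob_space \<Omega>" and [measurable]: "\<And>n. X n \<in> borel_measurable \<Omega>" "Y \<in> borel_measurable \<Omega>"
    and lim: "AE \<omega> in \<Omega>. (\<lambda>n. X n \<omega>) \<longlonglongrightarrow> Y \<omega>"
  shows "(\<lambda>n. cf (distr \<Omega> borel (X n)) v) \<longlonglongrightarrow> cf (distr \<Omega> borel Y) v"
proof -
  interpret prob_space \<Omega> by fact
  have "(\<lambda>n. \<integral>\<omega>. cis (X n \<omega> \<bullet> v) \<partial>\<Omega>) \<longlonglongrightarrow> (\<integral>\<omega>. cis (Y \<omega> \<bullet> v) \<partial>\<Omega>)"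
  proof (rule integral_dominated_convergence[where w = "\<lambda>_. 1"])
    show "AE \<omega> in \<Omega>. (\<lambda>n. cis (X n \<omega> \<bullet> v)) \<longlonglongrightarrow> cis (Y \<omega> \<bullet> v)"
      using lim by eventually_elim (auto intro!: tendsto_intros)
  qed auto
  then show ?thesis by (simp add: cf_distr)
qed

section \<open>The weak limits of the convolution powers\<close>

text \<open>Lyapunov function for tightness: its growth under one convolution step is controlled by the
  truncated moments and the tails.\<close>

definition quad_ratio :: "real \<Rightarrow> real" where
  "quad_ratio u = u\<^sup>2 / (1 + u\<^sup>2)"

definition lyapunov :: "real \<Rightarrow> real ^ 'd \<Rightarrow> real" where
  "lyapunov R x = (\<Sum>i\<in>UNIV. quad_ratio (x $ i / R))"

lemma quad_ratio_bounds: "0 \<le> quad_ratio u" "quad_ratio u \<le> 1"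
proof -
  have "1 + u\<^sup>2 > 0" by (simp add: add_pos_nonneg)
  then show "0 \<le> quad_ratio u" "quad_ratio u \<le> 1" by (simp_all add: quad_ratio_def)
qed

text \<open>With \<open>a = 1 + u^2\<close> and \<open>b = 1 + (u + v)^2\<close> the increment is
  \<open>1/a - 1/b\<close>, which equals \<open>(b - a) / a^2\<close> minus a nonnegative term. The
  result is a second-order bound without remainder, valid for all \<open>u\<close> and
  \<open>v\<close>.\<close>

lemma quad_ratio_increment:
  "quad_ratio (u + v) - quad_ratio u \<le> 2 * u / (1 + u\<^sup>2)\<^sup>2 * v + v\<^sup>2"
proof -
  define a b where "a = 1 + u\<^sup>2" and "b = 1 + (u + v)\<^sup>2"
  have ab: "a \<ge> 1" "b \<ge> 1" by (auto simp: a_def b_def)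
  have uv: "2 * u * v = b - a - v\<^sup>2" by (simp add: a_def b_def power2_eq_square algebra_simps)
  have "quad_ratio (u + v) = 1 - 1 / b" "quad_ratio u = 1 - 1 / a"
    using ab by (simp_all add: quad_ratio_def a_def[symmetric] b_def[symmetric] divide_simps)
       (simp_all add: a_def b_def)
  then have "quad_ratio (u + v) - quad_ratio u = 1 / a - 1 / b" by simp
  also have "\<dots> = (b - a) / (a * b)"
    using ab by (subst diff_frac_eq) auto
  also have "\<dots> = (b - a) / a\<^sup>2 - (b - a)\<^sup>2 / (a\<^sup>2 * b)"
    using ab by (simp add: field_simps power2_eq_square)
  also have "\<dots> \<le> (b - a) / a\<^sup>2"
    using ab by simp
  also have "\<dots> = 2 * u * v / a\<^sup>2 + v\<^sup>2 / a\<^sup>2"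
    by (simp add: uv flip: add_divide_distrib)
  also have "v\<^sup>2 / a\<^sup>2 \<le> v\<^sup>2"
    using ab one_le_power[of a 2] by (simp add: divide_le_eq mult_le_cancel_left1)
  finally show ?thesis by (simp add: a_def)
qed

lemma quad_ratio_slope:
  fixes u :: real
  shows "\<bar>2 * u / (1 + u\<^sup>2)\<^sup>2\<bar> \<le> 1"
proof -
  have "2 * \<bar>u\<bar> \<le> 1 + u\<^sup>2"
    using zero_le_power2[of "\<bar>u\<bar> - 1"] by (simp add: power2_eq_square algebra_simps)
  also have "\<dots> \<le> (1 + u\<^sup>2)\<^sup>2"
    using self_le_power[of "1 + u\<^sup>2" 2] by simp
  finally show ?thesis by (simp add: abs_mult divide_le_eq)
qed

lemma lyapunov_bounds: "0 \<le> lyapunov R x" "lyapunov R (x :: real ^ 'd) \<le> real CARD('d)"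
proof -
  show "0 \<le> lyapunov R x" unfolding lyapunov_def by (intro sum_nonneg quad_ratio_bounds)
  have "lyapunov R x \<le> (\<Sum>i\<in>(UNIV::'d set). 1)"
    unfolding lyapunov_def by (intro sum_mono quad_ratio_bounds)
  then show "lyapunov R x \<le> real CARD('d)" by simp
qed

lemma lyapunov_0: "lyapunov R 0 = 0"
  by (simp add: lyapunov_def quad_ratio_def)

lemma continuous_on_lyapunov: "continuous_on A (lyapunov R)"
proof -
  have "1 + (x $ i / R)\<^sup>2 \<noteq> 0" for x :: "real ^ 'd" and i
    using zero_le_power2[of "x $ i / R"] by linarith
  then show ?thesis
    unfolding lyapunov_def[abs_def] quad_ratio_def divide_inverse[of _ R]
    by (intro continuous_intros ballI) (simp only: divide_inverse[symmetric], blast)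
qed

text \<open>The Euclidean norm is at most the sum of the absolute coordinates, so some coordinate
  exceeds \<open>R\<close>; its term alone is at least \<open>1/2\<close>.\<close>

lemma lyapunov_large:
  fixes x :: "real ^ 'd"
  assumes "R > 0" "norm x > real CARD('d) * R"
  shows "lyapunov R x \<ge> 1 / 2"
proof -
  have "\<exists>i. \<bar>x $ i\<bar> > R"
  proof (rule ccontr)
    assume "\<nexists>i. \<bar>x $ i\<bar> > R"
    then have "(\<Sum>i\<in>UNIV. \<bar>x $ i\<bar>) \<le> (\<Sum>i\<in>(UNIV::'d set). R)"
      by (intro sum_mono) (auto simp: not_less)
    then show False using norm_le_l1_cart[of x] assms by simp
  qed
  then obtain i where i: "\<bar>x $ i\<bar> > R" by blast
  define u where "u = x $ i / R"
  have "\<bar>u\<bar> \<ge> 1" using i assms by (simp add: u_def abs_divide)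
  then have "u\<^sup>2 \<ge> 1" using power_mono[of 1 "\<bar>u\<bar>" 2] by simp
  then have "1 / 2 \<le> quad_ratio u" by (simp add: quad_ratio_def field_simps)
  also have "\<dots> \<le> lyapunov R x"
    unfolding lyapunov_def u_def by (rule member_le_sum) (auto intro: quad_ratio_bounds)
  finally show ?thesis .
qed

lemma borel_measurable_lyapunov [measurable]: "lyapunov R \<in> borel_measurable borel"
  by (intro borel_measurable_continuous_onI continuous_on_lyapunov)

lemma integrable_lyapunov:
  fixes X :: "'w \<Rightarrow> real ^ 'd"
  assumes "prob_space M" and [measurable]: "X \<in> borel_measurable M"
  shows "integrable M (\<lambda>\<omega>. lyapunov R (X \<omega>) :: real)"
proof -
  interpret prob_space M by fact
  show ?thesis
    by (rule integrable_const_bound[where B = "real CARD('d)"]) (auto simp: lyapunov_bounds)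
qed

lemma integrable_lyapunov_id:
  fixes M :: "(real ^ 'd) measure"
  assumes "prob_space M" "sets M = sets borel"
  shows "integrable M (lyapunov R)"
  using integrable_lyapunov[OF assms(1) measurable_ident_sets[OF assms(2)]] by simp

text \<open>The approximate limit \<open>L\<close> may change with \<open>e\<close>; completeness
  produces a true one. This form is needed because the cutoff radius, and with it the available
  limit, depends on the accuracy.\<close>

lemma tendsto_at_right_Cauchy:
  fixes f :: "real \<Rightarrow> real"
  assumes "\<And>e. e > 0 \<Longrightarrow> \<exists>L. \<forall>\<^sub>F x in at_right a. \<bar>f x - L\<bar> \<le> e"
  shows "\<exists>L. (f \<longlongrightarrow> L) (at_right a)"
proof -
  have "cauchy_filter (filtermap f (at_right a))"
    unfolding cauchy_filter_metric_filtermap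
  proof (intro allI impI)
    fix e :: real assume "e > 0"
    then obtain L where "\<forall>\<^sub>F x in at_right a. \<bar>f x - L\<bar> \<le> e / 3" using assms[of "e / 3"] by auto
    moreover have "dist (f x) (f y) < e" if "\<bar>f x - L\<bar> \<le> e / 3" "\<bar>f y - L\<bar> \<le> e / 3" for x y
      using that \<open>e > 0\<close> unfolding dist_real_def by linarith
    ultimately show "\<exists>P. eventually P (at_right a) \<and> (\<forall>x y. P x \<and> P y \<longrightarrow> dist (f x) (f y) < e)"
      by (intro exI[of _ "\<lambda>x. \<bar>f x - L\<bar> \<le> e / 3"]) auto
  qed
  moreover have "filtermap f (at_right a) \<noteq> bot"
    by (simp add: filtermap_bot_iff)
  ultimately obtain L where "filtermap f (at_right a) \<le> nhds L"
    using complete_UNIV[where 'a = real] unfolding complete_uniform by auto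
  then show ?thesis by (auto simp: filterlim_def)
qed

section \<open>Small-time estimates for the given family\<close>

locale small_time_family =
  fixes \<mu> :: "real \<Rightarrow> (real ^ 'd) measure"
  assumes prob: "\<And>h. h > 0 \<Longrightarrow> prob_space (\<mu> h)"
    and borel: "\<And>h. h > 0 \<Longrightarrow> sets (\<mu> h) = sets borel"
    and generator: "\<And>\<phi>. \<phi> \<in> Cc_infinity \<Longrightarrow>
      \<exists>L::real. ((\<lambda>h. \<integral>y. (\<phi> y - \<phi> 0) / h \<partial>\<mu> h) \<longlongrightarrow> L) (at_right 0)"
    and tails: "\<And>\<epsilon>::real. \<epsilon> > 0 \<Longrightarrow>
      \<exists>M>0. Limsup (at_right 0) (\<lambda>h. ereal (1 / h * measure (\<mu> h) {y. norm y > M})) < ereal \<epsilon>"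
begin

lemma eventually_at_right_pos: "(\<And>h::real. h > 0 \<Longrightarrow> P h) \<Longrightarrow> \<forall>\<^sub>F h in at_right 0. P h"
  by (rule eventually_mono[OF eventually_at_right_less[of 0]])

lemma tail_bound:
  assumes "\<epsilon> > 0"
  obtains M where "M > 0" "\<forall>\<^sub>F h in at_right 0. measure (\<mu> h) {y. norm y > M} \<le> \<epsilon> * h"
proof -
  obtain M where M: "M > 0"
    "Limsup (at_right 0) (\<lambda>h. ereal (1 / h * measure (\<mu> h) {y. norm y > M})) < ereal \<epsilon>"
    using tails[OF assms] by blast
  have "\<forall>\<^sub>F h in at_right 0. measure (\<mu> h) {y. norm y > M} \<le> \<epsilon> * h"
    using Limsup_lessD[OF M(2)] eventually_at_right_less[of "0::real"]
    by eventually_elim (simp add: field_simps)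
  with M(1) that show thesis by blast
qed

lemma
  fixes f :: "real ^ 'd \<Rightarrow> real"
  assumes "h > 0" "continuous_on UNIV f" "\<And>x. \<bar>f x\<bar> \<le> B"
  shows integrable_bounded: "integrable (\<mu> h) f"
  using prob_integrable_bounded[OF prob borel assms(2,3)] assms(1) by auto

lemma Cc_infinity_continuous: "f \<in> Cc_infinity \<Longrightarrow> continuous_on UNIV f"
  by (auto simp: Cc_infinity_def intro: C_k_continuous)

lemma Cc_infinity_bounded:
  fixes f :: "real ^ 'd \<Rightarrow> real"
  assumes "f \<in> Cc_infinity"
  obtains B where "\<And>x. \<bar>f x\<bar> \<le> B"
proof -
  have c: "continuous_on UNIV f" using assms by (rule Cc_infinity_continuous)
  have "compact (f ` closure {x. f x \<noteq> 0})"
    using assms continuous_on_subset[OF c] by (intro compact_continuous_image) (auto simp: Cc_infinity_def)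
  then have "bounded (f ` closure {x. f x \<noteq> 0})" by (rule compact_imp_bounded)
  then obtain B where B: "B > 0" "\<And>x. x \<in> closure {x. f x \<noteq> 0} \<Longrightarrow> \<bar>f x\<bar> \<le> B"
    by (auto simp: bounded_pos)
  have "\<bar>f x\<bar> \<le> B" for x
    using B closure_subset[of "{x. f x \<noteq> 0}"] by (cases "f x = 0") auto
  then show thesis by (rule that)
qed

text \<open>Cutting off \<open>f - f 0\<close> gives a test function that vanishes at 0 and differs
  from \<open>f - f 0\<close> only beyond radius \<open>M\<close>. There the mass is at most
  \<open>\<epsilon> * h\<close>, so after division by \<open>h\<close> the error is at most
  \<open>2 * B * \<epsilon>\<close>.\<close>

lemma generator_bounded_smooth:
  fixes f :: "real ^ 'd \<Rightarrow> real"
  assumes f: "\<And>k. C_k k f" and B: "\<And>x. \<bar>f x\<bar> \<le> B"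
  shows "\<exists>L. ((\<lambda>h. \<integral>y. (f y - f 0) / h \<partial>\<mu> h) \<longlongrightarrow> L) (at_right 0)"
proof (rule tendsto_at_right_Cauchy)
  fix e :: real assume "e > 0"
  have "B \<ge> 0" using B[of 0] by linarith
  \<comment> \<open>Chosen to make \<open>2 * B * \<epsilon> \<le> e / 2\<close>; the 1 covers
    \<open>B = 0\<close>.\<close>
  define \<epsilon> where "\<epsilon> = e / (4 * (B + 1))"
  have "\<epsilon> > 0" using \<open>e > 0\<close> \<open>B \<ge> 0\<close> by (simp add: \<epsilon>_def)
  then obtain M where M: "M > 0" "\<forall>\<^sub>F h in at_right 0. measure (\<mu> h) {y. norm y > M} \<le> \<epsilon> * h"
    by (rule tail_bound)
  obtain \<kappa> :: "real ^ 'd \<Rightarrow> real" where \<kappa>: "\<kappa> \<in> Cc_infinity" "\<And>x. norm x \<le> M \<Longrightarrow> \<kappa> x = 1"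
      "\<And>x. 0 \<le> \<kappa> x" "\<And>x. \<kappa> x \<le> 1" using smooth_cutoff[of M] by blast
  define \<phi> where "\<phi> y = \<kappa> y * (f y - f 0)" for y
  have df: "C_k k (\<lambda>y. f y - f 0)" for k using C_k_add[OF f C_k_const[of k "- f 0"]] by simp
  have "\<phi> \<in> Cc_infinity"
    unfolding \<phi>_def[abs_def] by (rule Cc_infinity_mult[OF \<kappa>(1) df])
  from generator[OF this] obtain L where L: "((\<lambda>h. \<integral>y. (\<phi> y - \<phi> 0) / h \<partial>\<mu> h) \<longlongrightarrow> L) (at_right 0)" by blast
  from tendstoD[OF L, of "e / 2"] \<open>e > 0\<close>
  have "\<forall>\<^sub>F h in at_right 0. \<bar>(\<integral>y. (\<phi> y - \<phi> 0) / h \<partial>\<mu> h) - L\<bar> < e / 2" by (simp add: dist_real_def)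
  then have "\<forall>\<^sub>F h in at_right 0. \<bar>(\<integral>y. (f y - f 0) / h \<partial>\<mu> h) - L\<bar> \<le> e"
    using M(2) eventually_at_right_less[of "0::real"]
  proof eventually_elim
    case (elim h)
    interpret prob_space "\<mu> h" by (rule prob[OF elim(3)])
    note borel[OF elim(3), measurable_cong]
    have cont: "continuous_on UNIV f" "continuous_on UNIV \<kappa>"
      using C_k_continuous[OF f] Cc_infinity_continuous[OF \<kappa>(1)] by auto
    have bd: "\<bar>f y - f 0\<bar> \<le> 2 * B" for y using B[of y] B[of 0] by linarith
    have bd': "\<bar>\<kappa> y * (f y - f 0)\<bar> \<le> 2 * B" for y
      using mult_mono[OF \<kappa>(4)[of y] bd[of y]] \<kappa>(3)[of y] by (simp add: abs_mult)
    have int: "integrable (\<mu> h) (\<lambda>y. f y - f 0)" "integrable (\<mu> h) (\<lambda>y. \<kappa> y * (f y - f 0))"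
      by (rule integrable_bounded[OF elim(3) _ bd] integrable_bounded[OF elim(3) _ bd'];
          intro continuous_intros cont)+
    have ind: "integrable (\<mu> h) (indicator {y. norm y > M} :: real ^ 'd \<Rightarrow> real)"
      by (rule integrable_const_bound[where B = 1]) (auto simp: indicator_def)
    have "(\<integral>y. (f y - f 0) / h \<partial>\<mu> h) - (\<integral>y. (\<phi> y - \<phi> 0) / h \<partial>\<mu> h)
        = (\<integral>y. (f y - f 0) - \<kappa> y * (f y - f 0) \<partial>\<mu> h) / h"
      unfolding \<phi>_def integral_divide_zero
      by (simp add: Bochner_Integration.integral_diff[OF int] diff_divide_distrib)
    moreover have "\<bar>\<integral>y. (f y - f 0) - \<kappa> y * (f y - f 0) \<partial>\<mu> h\<bar> \<le> 2 * B * (\<epsilon> * h)"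
    proof -
      have "\<bar>\<integral>y. (f y - f 0) - \<kappa> y * (f y - f 0) \<partial>\<mu> h\<bar> \<le> (\<integral>y. \<bar>(f y - f 0) - \<kappa> y * (f y - f 0)\<bar> \<partial>\<mu> h)"
        by (rule integral_abs_bound)
      also have "\<dots> \<le> (\<integral>y. 2 * B * indicator {y. norm y > M} y \<partial>\<mu> h)"
      proof (rule integral_mono)
        fix y
        have "\<bar>(f y - f 0) - \<kappa> y * (f y - f 0)\<bar> = (1 - \<kappa> y) * \<bar>f y - f 0\<bar>"
        proof -
          have "(f y - f 0) - \<kappa> y * (f y - f 0) = (1 - \<kappa> y) * (f y - f 0)" by (simp add: algebra_simps)
          then show ?thesis using \<kappa>(4)[of y] by (simp add: abs_mult)
        qed
        also have "\<dots> \<le> 2 * B * indicator {y. norm y > M} y"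
          using \<kappa>(2)[of y] \<kappa>(3)[of y] \<kappa>(4)[of y] mult_mono[of "1 - \<kappa> y" 1 "\<bar>f y - f 0\<bar>" "2 * B"] bd[of y]
          by (cases "norm y \<le> M") auto
        finally show "\<bar>(f y - f 0) - \<kappa> y * (f y - f 0)\<bar> \<le> 2 * B * indicator {y. norm y > M} y" .
      qed (use int ind in auto)
      also have "\<dots> = 2 * B * measure (\<mu> h) {y. norm y > M}"
        by (simp add: sets_eq_imp_space_eq[OF borel[OF elim(3)]])
      also have "\<dots> \<le> 2 * B * (\<epsilon> * h)" using elim \<open>B \<ge> 0\<close> by (intro mult_left_mono) auto
      finally show ?thesis .
    qed
    then have "\<bar>(\<integral>y. (f y - f 0) - \<kappa> y * (f y - f 0) \<partial>\<mu> h) / h\<bar> \<le> 2 * B * \<epsilon>"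
      using elim(3) by (simp add: abs_divide divide_le_eq mult_ac)
    moreover have "2 * B * \<epsilon> \<le> e / 2"
      using \<open>B \<ge> 0\<close> \<open>e > 0\<close> by (simp add: \<epsilon>_def field_simps)
    ultimately show ?case using elim(1) by linarith
  qed
  then show "\<exists>L. \<forall>\<^sub>F h in at_right 0. \<bar>(\<integral>y. (f y - f 0) / h \<partial>\<mu> h) - L\<bar> \<le> e" by blast
qed

lemma generator_Cc_bound:
  assumes "\<phi> \<in> Cc_infinity" "\<phi> 0 = 0"
  shows "\<exists>C\<ge>0. \<forall>\<^sub>F h in at_right 0. \<bar>\<integral>y. \<phi> y \<partial>\<mu> h\<bar> \<le> C * h"
proof -
  obtain L where "((\<lambda>h. \<integral>y. (\<phi> y - \<phi> 0) / h \<partial>\<mu> h) \<longlongrightarrow> L) (at_right 0)"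
    using generator[OF assms(1)] by blast
  from tendstoD[OF this, of 1] have "\<forall>\<^sub>F h in at_right 0. \<bar>(\<integral>y. \<phi> y \<partial>\<mu> h) / h - L\<bar> < 1"
    using assms(2) by (simp add: dist_real_def)
  then have "\<forall>\<^sub>F h in at_right 0. \<bar>\<integral>y. \<phi> y \<partial>\<mu> h\<bar> \<le> (\<bar>L\<bar> + 1) * h"
    using eventually_at_right_less[of "0::real"]
  proof eventually_elim
    case (elim h)
    then have "\<bar>(\<integral>y. \<phi> y \<partial>\<mu> h) / h\<bar> \<le> \<bar>L\<bar> + 1" by linarith
    then show ?case using elim by (simp add: abs_divide divide_le_eq)
  qed
  then show ?thesis by (intro exI[of _ "\<bar>L\<bar> + 1"]) auto
qed

text \<open>The order of the quantifiers is the point: \<open>C\<close> depends on the cutoff radius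
  belonging to \<epsilon>, but neither on \<open>R\<close> nor on \<open>x\<close>. Thus
  \<open>R\<close> can be chosen afterwards so as to make \<open>C / R\<close> small, and the bound
  can be iterated.\<close>

lemma lyapunov_step:
  assumes "\<epsilon> > 0"
  shows "\<exists>C\<ge>0. \<forall>R>0. \<forall>\<^sub>F h in at_right 0. \<forall>x.
     (\<integral>y. lyapunov R (x + y) \<partial>\<mu> h) \<le> lyapunov R x + (C / R + C / R\<^sup>2 + \<epsilon>) * h"
proof -
  define D where "D = real CARD('d)"
  have "D > 0" by (simp add: D_def)
  \<comment> \<open>Beyond radius \<open>M\<close> each of the \<open>D\<close> coordinates may add
    1 to the Lyapunov function, hence the division by \<open>D\<close>.\<close>
  obtain M where M: "M > 0" "\<forall>\<^sub>F h in at_right 0. measure (\<mu> h) {y. norm y > M} \<le> \<epsilon> / D * h"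
    using tail_bound[of "\<epsilon> / D"] assms \<open>D > 0\<close> by auto
  obtain \<kappa> :: "real ^ 'd \<Rightarrow> real" where \<kappa>: "\<kappa> \<in> Cc_infinity" "\<And>x. norm x \<le> M \<Longrightarrow> \<kappa> x = 1"
      "\<And>x. 0 \<le> \<kappa> x" "\<And>x. \<kappa> x \<le> 1" using smooth_cutoff[of M] by blast
  \<comment> \<open>These are the truncated first and second moments; both vanish at 0, so the first
    hypothesis bounds their integrals by multiples of \<open>h\<close>.\<close>
  define \<phi>1 \<phi>2 where "\<phi>1 i y = \<kappa> y * (y \<bullet> axis i 1)" and "\<phi>2 i y = \<kappa> y * ((y \<bullet> axis i 1) * (y \<bullet> axis i 1))"
    for i and y :: "real ^ 'd"
  have nth: "y \<bullet> axis i 1 = y $ i" for y :: "real ^ 'd" and i by (simp add: inner_axis)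
  have C1: "\<phi>1 i \<in> Cc_infinity" "\<phi>2 i \<in> Cc_infinity" for i
    unfolding \<phi>1_def[abs_def] \<phi>2_def[abs_def]
    by (intro Cc_infinity_mult \<kappa>(1) C_k_mult C_k_inner)+
  have "\<exists>C\<ge>0. \<forall>\<^sub>F h in at_right 0. \<bar>\<integral>y. \<phi>1 i y \<partial>\<mu> h\<bar> \<le> C * h" for i
    by (rule generator_Cc_bound[OF C1(1)]) (simp add: \<phi>1_def)
  then obtain c1 where c1: "\<And>i. c1 i \<ge> 0" "\<And>i. \<forall>\<^sub>F h in at_right 0. \<bar>\<integral>y. \<phi>1 i y \<partial>\<mu> h\<bar> \<le> c1 i * h" by metis
  have "\<exists>C\<ge>0. \<forall>\<^sub>F h in at_right 0. \<bar>\<integral>y. \<phi>2 i y \<partial>\<mu> h\<bar> \<le> C * h" for i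
    by (rule generator_Cc_bound[OF C1(2)]) (simp add: \<phi>2_def)
  then obtain c2 where c2: "\<And>i. c2 i \<ge> 0" "\<And>i. \<forall>\<^sub>F h in at_right 0. \<bar>\<integral>y. \<phi>2 i y \<partial>\<mu> h\<bar> \<le> c2 i * h" by metis
  define C where "C = (\<Sum>i\<in>UNIV. c1 i) + (\<Sum>i\<in>UNIV. c2 i)"
  have sums: "0 \<le> (\<Sum>i\<in>UNIV. c1 i)" "0 \<le> (\<Sum>i\<in>UNIV. c2 i)" by (intro sum_nonneg c1 c2)+
  have "C \<ge> 0" using sums by (simp add: C_def)
  have "\<forall>\<^sub>F h in at_right 0. \<forall>x. (\<integral>y. lyapunov R (x + y) \<partial>\<mu> h) \<le> lyapunov R x + (C / R + C / R\<^sup>2 + \<epsilon>) * h"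
    if "R > 0" for R
  proof -
    have "\<forall>\<^sub>F h in at_right 0. \<forall>i. \<bar>\<integral>y. \<phi>1 i y \<partial>\<mu> h\<bar> \<le> c1 i * h"
      by (rule eventually_all_finite) (rule c1)
    moreover have "\<forall>\<^sub>F h in at_right 0. \<forall>i. \<bar>\<integral>y. \<phi>2 i y \<partial>\<mu> h\<bar> \<le> c2 i * h"
      by (rule eventually_all_finite) (rule c2)
    ultimately show ?thesis
      using M(2) eventually_at_right_less[of "0::real"]
    proof eventually_elim
      case (elim h)
      interpret prob_space "\<mu> h" by (rule prob[OF elim(4)])
      note borel[OF elim(4), measurable_cong]
      have int: "integrable (\<mu> h) (\<phi>1 i)" "integrable (\<mu> h) (\<phi>2 i)" for i
        using Cc_infinity_bounded[OF C1(1)[of i]] Cc_infinity_bounded[OF C1(2)[of i]]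
          Cc_infinity_continuous[OF C1(1)[of i]] Cc_infinity_continuous[OF C1(2)[of i]]
          integrable_bounded[OF elim(4)]
        by metis+
      have ind: "integrable (\<mu> h) (indicator {y. norm y > M} :: real ^ 'd \<Rightarrow> real)"
        by (rule integrable_const_bound[where B = 1]) (auto simp: indicator_def)
      show ?case
      proof
        fix x :: "real ^ 'd"
        define s where "s i = 2 * (x $ i / R) / (1 + (x $ i / R)\<^sup>2)\<^sup>2" for i
        have s: "\<bar>s i\<bar> \<le> 1" for i unfolding s_def by (rule quad_ratio_slope)
        have pw: "lyapunov R (x + y) \<le> lyapunov R x
          + (\<Sum>i\<in>UNIV. s i / R * \<phi>1 i y + 1 / R\<^sup>2 * \<phi>2 i y) + D * indicator {y. norm y > M} y" for y
        proof (cases "norm y \<le> M")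
          case True
          have "lyapunov R (x + y) - lyapunov R x = (\<Sum>i\<in>UNIV. quad_ratio (x $ i / R + y $ i / R) - quad_ratio (x $ i / R))"
            by (simp add: lyapunov_def sum_subtractf add_divide_distrib)
          also have "\<dots> \<le> (\<Sum>i\<in>UNIV. s i * (y $ i / R) + (y $ i / R)\<^sup>2)"
            unfolding s_def by (intro sum_mono quad_ratio_increment)
          also have "\<dots> = (\<Sum>i\<in>UNIV. s i / R * \<phi>1 i y + 1 / R\<^sup>2 * \<phi>2 i y)"
            using \<kappa>(2)[OF True] by (simp add: \<phi>1_def \<phi>2_def nth power2_eq_square)
          finally show ?thesis using True by simp
        next
          case False
          have "quad_ratio (x $ i / R + y $ i / R) - quad_ratio (x $ i / R)
              \<le> s i / R * \<phi>1 i y + 1 / R\<^sup>2 * \<phi>2 i y + 1" for i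
          proof -
            define q where "q = quad_ratio (x $ i / R + y $ i / R) - quad_ratio (x $ i / R)"
            define r where "r = s i * (y $ i / R) + (y $ i / R)\<^sup>2"
            have q: "q \<le> 1" unfolding q_def
              using quad_ratio_bounds[of "x $ i / R + y $ i / R"] quad_ratio_bounds[of "x $ i / R"] by linarith
            have "q \<le> r" unfolding q_def r_def s_def by (rule quad_ratio_increment)
            \<comment> \<open>The two bounds \<open>q \<le> r\<close> and \<open>q \<le> 1\<close>
              are combined with weights given by the cutoff. This turns \<open>r\<close> into the
              truncated moments even where the cutoff lies strictly between 0 and 1.\<close>
            then have "q \<le> \<kappa> y * r + (1 - \<kappa> y) * 1"
              using q mult_left_mono[of q r "\<kappa> y"] mult_left_mono[of q 1 "1 - \<kappa> y"] \<kappa>(3,4)[of y]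
              by (simp add: algebra_simps)
            also have "\<kappa> y * r = s i / R * \<phi>1 i y + 1 / R\<^sup>2 * \<phi>2 i y"
              by (simp add: r_def \<phi>1_def \<phi>2_def nth power2_eq_square algebra_simps)
            finally show ?thesis using \<kappa>(3)[of y] by (simp add: q_def)
          qed
          then have "(\<Sum>i\<in>UNIV. quad_ratio (x $ i / R + y $ i / R) - quad_ratio (x $ i / R))
             \<le> (\<Sum>i\<in>(UNIV::'d set). s i / R * \<phi>1 i y + 1 / R\<^sup>2 * \<phi>2 i y + 1)" by (intro sum_mono)
          then show ?thesis using False
            by (simp add: lyapunov_def sum_subtractf add_divide_distrib sum.distrib D_def)
        qed
        have "(\<integral>y. lyapunov R (x + y) \<partial>\<mu> h) \<le> (\<integral>y. lyapunov R x
          + (\<Sum>i\<in>UNIV. s i / R * \<phi>1 i y + 1 / R\<^sup>2 * \<phi>2 i y) + D * indicator {y. norm y > M} y \<partial>\<mu> h)"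
          using int ind by (intro integral_mono pw integrable_lyapunov prob_space_axioms) auto
        also have "\<dots> = lyapunov R x + (\<Sum>i\<in>UNIV. s i / R * (\<integral>y. \<phi>1 i y \<partial>\<mu> h) + 1 / R\<^sup>2 * (\<integral>y. \<phi>2 i y \<partial>\<mu> h))
          + D * measure (\<mu> h) {y. norm y > M}"
          using int ind prob_space by (simp add: sets_eq_imp_space_eq[OF borel[OF elim(4)]])
        also have "\<dots> \<le> lyapunov R x + (\<Sum>i\<in>UNIV. c1 i * h / R + c2 i * h / R\<^sup>2) + D * (\<epsilon> / D * h)"
        proof (intro add_mono sum_mono order_refl)
          fix i
          have "s i / R * (\<integral>y. \<phi>1 i y \<partial>\<mu> h) \<le> 1 / R * (c1 i * h)"
          proof -
            have "s i / R * (\<integral>y. \<phi>1 i y \<partial>\<mu> h) \<le> \<bar>s i / R\<bar> * \<bar>\<integral>y. \<phi>1 i y \<partial>\<mu> h\<bar>"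
              by (metis abs_ge_self abs_mult)
            also have "\<dots> \<le> 1 / R * (c1 i * h)"
              using s[of i] \<open>R > 0\<close> elim(1) by (intro mult_mono) (auto simp: abs_divide divide_right_mono)
            finally show ?thesis .
          qed
          then show "s i / R * (\<integral>y. \<phi>1 i y \<partial>\<mu> h) \<le> c1 i * h / R" by simp
          have "(\<integral>y. \<phi>2 i y \<partial>\<mu> h) \<le> c2 i * h" using elim(2) abs_ge_self order_trans by blast
          then show "1 / R\<^sup>2 * (\<integral>y. \<phi>2 i y \<partial>\<mu> h) \<le> c2 i * h / R\<^sup>2"
            by (simp add: divide_right_mono)
          show "D * measure (\<mu> h) {y. norm y > M} \<le> D * (\<epsilon> / D * h)"
            using elim(3) \<open>D > 0\<close> by (intro mult_left_mono) auto
        qed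
        also have "\<dots> = lyapunov R x + ((\<Sum>i\<in>UNIV. c1 i) / R + (\<Sum>i\<in>UNIV. c2 i) / R\<^sup>2 + \<epsilon>) * h"
          using \<open>D > 0\<close> by (simp add: sum.distrib sum_divide_distrib sum_distrib_left algebra_simps)
        also have "\<dots> \<le> lyapunov R x + (C / R + C / R\<^sup>2 + \<epsilon>) * h"
          using sums \<open>R > 0\<close> elim(4)
          by (intro add_left_mono mult_right_mono add_right_mono add_mono divide_right_mono) (auto simp: C_def)
        finally show "(\<integral>y. lyapunov R (x + y) \<partial>\<mu> h) \<le> lyapunov R x + (C / R + C / R\<^sup>2 + \<epsilon>) * h" .
      qed
    qed
  qed
  with \<open>C \<ge> 0\<close> show ?thesis by blast
qed

text \<open>The one-step bound is uniform in the starting point, so it can be integrated against the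
  previous power; the Lyapunov function starts at the value 0.\<close>

lemma lyapunov_conv_power:
  assumes "h > 0" and step: "\<And>x. (\<integral>y. lyapunov R (x + y) \<partial>\<mu> h) \<le> lyapunov R x + c * h"
  shows "(\<integral>y. lyapunov R y \<partial>conv_power (\<mu> h) k) \<le> real k * h * c"
proof (induction k)
  case 0
  then show ?case by (simp add: integral_return lyapunov_0)
next
  case (Suc k)
  let ?M = "conv_power (\<mu> h) k"
  note p = prob[OF assms(1)] borel[OF assms(1)]
  interpret prob_space ?M by (rule prob_space_conv_power[OF p])
  have pc: "prob_space (conv_power (\<mu> h) (Suc k))" by (rule prob_space_conv_power[OF p])
  have "(\<integral>y. lyapunov R y \<partial>conv_power (\<mu> h) (Suc k)) = (\<integral>x. \<integral>y. lyapunov R (y + x) \<partial>\<mu> h \<partial>?M)"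
    using pc integrable_lyapunov_id[OF pc sets_conv_power] unfolding conv_power.simps
    by (intro integral_convolution p prob_space_axioms) auto
  also have "\<dots> \<le> (\<integral>x. lyapunov R x + c * h \<partial>?M)"
  proof (rule integral_mono)
    interpret \<mu>: prob_space "\<mu> h" by (rule p(1))
    note p(2)[measurable_cong] sets_conv_power[measurable_cong]
    show "integrable ?M (\<lambda>x. \<integral>y. lyapunov R (y + x) \<partial>\<mu> h)"
    proof (rule integrable_const_bound[where B = "real CARD('d)"])
      have "\<bar>\<integral>y. lyapunov R (y + x) \<partial>\<mu> h\<bar> \<le> real CARD('d)" for x
      proof -
        have "\<bar>\<integral>y. lyapunov R (y + x) \<partial>\<mu> h\<bar> \<le> (\<integral>y. \<bar>lyapunov R (y + x)\<bar> \<partial>\<mu> h)" by (rule integral_abs_bound)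
        also have "\<dots> \<le> (\<integral>y. real CARD('d) \<partial>\<mu> h)"
          using integrable_lyapunov[OF p(1), of "\<lambda>y. y + x"]
          by (intro integral_mono) (auto simp: lyapunov_bounds)
        finally show ?thesis by (simp add: \<mu>.prob_space)
      qed
      then show "AE x in ?M. norm (\<integral>y. lyapunov R (y + x) \<partial>\<mu> h) \<le> real CARD('d)" by simp
    qed measurable
  qed (use step integrable_lyapunov_id[OF prob_space_axioms sets_conv_power] in \<open>auto simp: add.commute\<close>)
  also have "\<dots> = (\<integral>x. lyapunov R x \<partial>?M) + c * h"
    using integrable_lyapunov_id[OF prob_space_axioms sets_conv_power] by (simp add: prob_space)
  also have "\<dots> \<le> real (Suc k) * h * c" using Suc by (simp add: algebra_simps)
  finally show ?case .
qed

lemma measure_le_lyapunov: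
  fixes M :: "(real ^ 'd) measure"
  assumes "prob_space M" and s: "sets M = sets borel" and "R > 0"
  shows "measure M {y. norm y > real CARD('d) * R} \<le> 2 * (\<integral>y. lyapunov R y \<partial>M)"
proof -
  interpret prob_space M by fact
  note s[measurable_cong]
  have "measure M {y. norm y > real CARD('d) * R} = (\<integral>y. indicator {y. norm y > real CARD('d) * R} y \<partial>M)"
    by (simp add: sets_eq_imp_space_eq[OF s])
  also have "\<dots> \<le> (\<integral>y. 2 * lyapunov R y \<partial>M)"
  proof (rule integral_mono)
    show "integrable M (\<lambda>y. indicator {y. norm y > real CARD('d) * R} y :: real)"
      by (rule integrable_const_bound[where B = 1]) (auto simp: indicator_def)
    show "integrable M (\<lambda>y. 2 * lyapunov R y)"
      using integrable_lyapunov_id[OF assms(1,2)] by simp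
    show "indicator {y. norm y > real CARD('d) * R} y \<le> 2 * lyapunov R y" for y :: "real ^ 'd"
      using lyapunov_large[OF \<open>R > 0\<close>, of y] lyapunov_bounds(1)[of R y] by (auto simp: indicator_def)
  qed
  finally show ?thesis by simp
qed

end

section \<open>Tightness of the powers and their limit laws\<close>

context small_time_family
begin

lemma prob_conv: "h > 0 \<Longrightarrow> prob_space (conv_power (\<mu> h) k)"
  by (rule prob_space_conv_power[OF prob borel])

text \<open>Here \<open>R\<close> is fixed and \<open>c\<close> need not be small: the linear growth
  in \<open>k * h\<close> is what survives in the limit and controls small times.\<close>

lemma lyapunov_power_bound:
  assumes "R > 0"
  shows "\<exists>c\<ge>0. \<forall>\<^sub>F h in at_right 0. \<forall>k. (\<integral>y. lyapunov R y \<partial>conv_power (\<mu> h) k) \<le> real k * h * c"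
proof -
  obtain C where C: "C \<ge> 0" "\<And>R. R > 0 \<Longrightarrow> \<forall>\<^sub>F h in at_right 0. \<forall>x.
     (\<integral>y. lyapunov R (x + y) \<partial>\<mu> h) \<le> lyapunov R x + (C / R + C / R\<^sup>2 + 1) * h"
    using lyapunov_step[of 1] by auto
  have "\<forall>\<^sub>F h in at_right 0. \<forall>k. (\<integral>y. lyapunov R y \<partial>conv_power (\<mu> h) k) \<le> real k * h * (C / R + C / R\<^sup>2 + 1)"
    using C(2)[OF assms] eventually_at_right_less[of "0::real"]
    by eventually_elim (auto intro: lyapunov_conv_power)
  moreover have "0 \<le> C / R + C / R\<^sup>2 + 1" using C(1) assms by simp
  ultimately show ?thesis by blast
qed

lemma tight_eventually:
  assumes "e > 0" "T > 0"
  shows "\<exists>R. \<forall>\<^sub>F h in at_right 0. \<forall>k. real k * h \<le> T \<longrightarrow> measure (conv_power (\<mu> h) k) {y. norm y > R} < e"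
proof -
  \<comment> \<open>The final estimate is \<open>2 * T * 2 * \<epsilon>\<close>, which equals
    \<open>e / 2\<close>.\<close>
  define \<epsilon> where "\<epsilon> = e / (8 * T)"
  have \<epsilon>: "\<epsilon> > 0" using assms by (simp add: \<epsilon>_def)
  from lyapunov_step[OF this]
  obtain C where C: "C \<ge> 0" "\<And>R. R > 0 \<Longrightarrow> \<forall>\<^sub>F h in at_right 0. \<forall>x.
     (\<integral>y. lyapunov R (x + y) \<partial>\<mu> h) \<le> lyapunov R x + (C / R + C / R\<^sup>2 + \<epsilon>) * h"
    by blast
  \<comment> \<open>\<open>R \<ge> 1\<close> gives \<open>C / R^2 \<le> C / R\<close>, and both are
    at most \<open>\<epsilon> / 2\<close>, so the growth constant is at most
    \<open>2 * \<epsilon>\<close>.\<close>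
  define R where "R = max 1 (2 * C / \<epsilon>)"
  have R: "R \<ge> 1" "C / R \<le> \<epsilon> / 2"
    using \<epsilon> C(1) by (auto simp: R_def field_simps max_def)
  have Rpos: "R > 0" using R(1) by simp
  have "R \<le> R\<^sup>2" using R(1) by (simp add: self_le_power)
  then have "C / R\<^sup>2 \<le> C / R" using R(1) C(1) by (intro divide_left_mono) auto
  then have c: "C / R + C / R\<^sup>2 + \<epsilon> \<le> 2 * \<epsilon>" using R by linarith
  have "\<forall>\<^sub>F h in at_right 0. \<forall>k. real k * h \<le> T \<longrightarrow>
      measure (conv_power (\<mu> h) k) {y. norm y > real CARD('d) * R} < e"
    using C(2)[OF Rpos] eventually_at_right_less[of "0::real"]
  proof eventually_elim
    case (elim h)
    have "measure (conv_power (\<mu> h) k) {y. norm y > real CARD('d) * R} < e" if "real k * h \<le> T" for k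
    proof -
      have step: "(\<integral>y. lyapunov R (x + y) \<partial>\<mu> h) \<le> lyapunov R x + 2 * \<epsilon> * h" for x
        using elim(1)[rule_format, of x] mult_right_mono[OF c less_imp_le[OF elim(2)]] by linarith
      have "measure (conv_power (\<mu> h) k) {y. norm y > real CARD('d) * R} \<le> 2 * (\<integral>y. lyapunov R y \<partial>conv_power (\<mu> h) k)"
        using R by (intro measure_le_lyapunov prob_conv elim) auto
      also have "\<dots> \<le> 2 * (real k * h * (2 * \<epsilon>))"
        by (intro mult_left_mono lyapunov_conv_power elim step) auto
      also have "\<dots> \<le> 2 * (T * (2 * \<epsilon>))" using that \<epsilon> by (intro mult_left_mono mult_right_mono) auto
      also have "\<dots> < e" using assms by (simp add: \<epsilon>_def field_simps)
      finally show ?thesis .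
    qed
    then show ?case by blast
  qed
  then show ?thesis by blast
qed

lemma eventually_seq:
  assumes "\<forall>\<^sub>F x in at_right 0. P x" "\<And>n. h n > (0::real)" "h \<longlonglongrightarrow> 0"
  shows "\<forall>\<^sub>F n in sequentially. P (h n)"
proof -
  have "filterlim h (at_right 0) sequentially"
    by (rule tendsto_imp_filterlim_at_right[OF assms(3)]) (simp add: assms(2))
  with assms(1) show ?thesis by (simp add: filterlim_iff)
qed

lemma tight_conv_power:
  assumes h: "\<And>n. h n > 0" "h \<longlonglongrightarrow> 0" and k: "(\<lambda>n. real (k n) * h n) \<longlonglongrightarrow> t" and "e > 0"
  shows "\<exists>R. \<forall>n. measure (conv_power (\<mu> (h n)) (k n)) {y. norm y > R} < e"
proof -
  have "\<bar>t\<bar> + 1 > 0" by simp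
  from tight_eventually[OF \<open>e > 0\<close> this] obtain R1 where
    "\<forall>\<^sub>F h in at_right 0. \<forall>k. real k * h \<le> \<bar>t\<bar> + 1 \<longrightarrow> measure (conv_power (\<mu> h) k) {y. norm y > R1} < e" by blast
  from eventually_seq[OF this h]
  have "\<forall>\<^sub>F n in sequentially. \<forall>k. real k * h n \<le> \<bar>t\<bar> + 1 \<longrightarrow> measure (conv_power (\<mu> (h n)) k) {y. norm y > R1} < e" .
  moreover have "\<forall>\<^sub>F n in sequentially. real (k n) * h n < \<bar>t\<bar> + 1"
    using k by (rule order_tendstoD) simp
  ultimately have "\<forall>\<^sub>F n in sequentially. measure (conv_power (\<mu> (h n)) (k n)) {y. norm y > R1} < e"
    by eventually_elim auto
  then obtain n0 where n0: "\<And>n. n \<ge> n0 \<Longrightarrow> measure (conv_power (\<mu> (h n)) (k n)) {y. norm y > R1} < e"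
    by (auto simp: eventually_sequentially)
  \<comment> \<open>The uniform radius covers only large \<open>n\<close>; the finitely many
    remaining measures are tight one by one.\<close>
  have "\<forall>n. \<exists>R. measure (conv_power (\<mu> (h n)) (k n)) {y. norm y > R} < e"
    using prob_tight[OF prob_conv[OF h(1)] sets_conv_power \<open>e > 0\<close>] by blast
  then obtain r where r: "\<And>n. measure (conv_power (\<mu> (h n)) (k n)) {y. norm y > r n} < e" by metis
  define R where "R = Max (insert R1 (r ` {..n0}))"
  have R: "R1 \<le> R" "\<And>n. n \<le> n0 \<Longrightarrow> r n \<le> R" unfolding R_def by (intro Max_ge; simp)+
  have "measure (conv_power (\<mu> (h n)) (k n)) {y. norm y > R} < e" for n
  proof -
    interpret prob_space "conv_power (\<mu> (h n)) (k n)" by (rule prob_conv[OF h(1)])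
    have "measure (conv_power (\<mu> (h n)) (k n)) {y. norm y > R}
        \<le> measure (conv_power (\<mu> (h n)) (k n)) {y. norm y > (if n \<le> n0 then r n else R1)}"
      using R(1) R(2)[of n] by (intro finite_measure_mono) auto
    also have "\<dots> < e" using n0[of n] r[of n] by simp
    finally show ?thesis .
  qed
  then show ?thesis by blast
qed

lemma levy_exponent_exists: "\<exists>l. ((\<lambda>h. (cf (\<mu> h) v - 1) / of_real h) \<longlongrightarrow> l) (at_right 0)"
proof -
  have "\<bar>cos (y \<bullet> v)\<bar> \<le> 1" "\<bar>sin (y \<bullet> v)\<bar> \<le> 1" for y :: "real ^ 'd" by auto
  from generator_bounded_smooth[OF C_k_cos_inner this(1)] generator_bounded_smooth[OF C_k_sin_inner this(2)]
  obtain L1 L2 where L: "((\<lambda>h. \<integral>y. (cos (y \<bullet> v) - cos (0 \<bullet> v)) / h \<partial>\<mu> h) \<longlongrightarrow> L1) (at_right 0)"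
    "((\<lambda>h. \<integral>y. (sin (y \<bullet> v) - sin (0 \<bullet> v)) / h \<partial>\<mu> h) \<longlongrightarrow> L2) (at_right 0)" by blast
  have "((\<lambda>h. Complex (\<integral>y. (cos (y \<bullet> v) - cos (0 \<bullet> v)) / h \<partial>\<mu> h) (\<integral>y. (sin (y \<bullet> v) - sin (0 \<bullet> v)) / h \<partial>\<mu> h))
      \<longlongrightarrow> Complex L1 L2) (at_right 0)"
    by (rule tendsto_Complex[OF L])
  moreover have "\<forall>\<^sub>F h in at_right 0. Complex (\<integral>y. (cos (y \<bullet> v) - cos (0 \<bullet> v)) / h \<partial>\<mu> h)
      (\<integral>y. (sin (y \<bullet> v) - sin (0 \<bullet> v)) / h \<partial>\<mu> h) = (cf (\<mu> h) v - 1) / of_real h"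
  proof (rule eventually_at_right_pos)
    fix h :: real assume h: "h > 0"
    interpret prob_space "\<mu> h" by (rule prob[OF h])
    have "integrable (\<mu> h) (\<lambda>y. cos (y \<bullet> v))"
      by (rule integrable_bounded[OF h, of _ 1]) (auto intro!: continuous_intros)
    then show "Complex (\<integral>y. (cos (y \<bullet> v) - cos (0 \<bullet> v)) / h \<partial>\<mu> h)
      (\<integral>y. (sin (y \<bullet> v) - sin (0 \<bullet> v)) / h \<partial>\<mu> h) = (cf (\<mu> h) v - 1) / of_real h"
      unfolding integral_divide_zero
      by (simp add: complex_eq_iff Re_cf[OF prob borel, OF h h] Im_cf[OF prob borel, OF h h] prob_space)
  qed
  ultimately show ?thesis by (auto intro: Lim_transform_eventually)
qed

text \<open>This becomes the characteristic exponent of the limit process. It is obtained as a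
  limit, without a Levy-Khintchine representation.\<close>

definition levy_exponent :: "real ^ 'd \<Rightarrow> complex" where
  "levy_exponent v = (SOME l. ((\<lambda>h. (cf (\<mu> h) v - 1) / of_real h) \<longlongrightarrow> l) (at_right 0))"

lemma levy_exponent: "((\<lambda>h. (cf (\<mu> h) v - 1) / of_real h) \<longlongrightarrow> levy_exponent v) (at_right 0)"
  unfolding levy_exponent_def by (rule someI_ex[OF levy_exponent_exists])

text \<open>Inherited from \<open>norm (cf (\<mu> h) v) \<le> 1\<close>. It puts
  \<open>exp (h * \<psi>)\<close> into the unit disc, as the comparison of powers requires.\<close>

lemma Re_levy_exponent: "Re (levy_exponent v) \<le> 0"
proof (rule tendsto_upperbound[OF tendsto_Re[OF levy_exponent]])
  show "\<forall>\<^sub>F h in at_right 0. Re ((cf (\<mu> h) v - 1) / of_real h) \<le> 0"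
  proof (rule eventually_at_right_pos)
    fix h :: real assume h: "h > 0"
    have "Re (cf (\<mu> h) v) \<le> 1"
      using norm_cf_le_1[OF prob borel, OF h h, of v] complex_Re_le_cmod order_trans by blast
    then show "Re ((cf (\<mu> h) v - 1) / of_real h) \<le> 0" using h by (simp add: divide_le_0_iff)
  qed
qed simp

text \<open>In the unit disc k-th powers differ by at most \<open>k\<close> times the difference of
  their bases. With the bases \<open>cf (\<mu> h) v\<close> and \<open>exp (h * \<psi>)\<close> this
  bound is \<open>k * h\<close> times the difference of two quotients with the same limit \<psi>, so
  no complex logarithm is needed.\<close>

lemma cf_conv_power_tendsto:
  assumes h: "\<And>n. h n > 0" "h \<longlonglongrightarrow> 0" and k: "(\<lambda>n. real (k n) * h n) \<longlonglongrightarrow> t"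
  shows "(\<lambda>n. cf (conv_power (\<mu> (h n)) (k n)) v) \<longlonglongrightarrow> exp (of_real t * levy_exponent v)"
proof -
  define \<psi> where "\<psi> = levy_exponent v"
  have f: "filterlim h (at_right 0) sequentially"
    by (rule tendsto_imp_filterlim_at_right[OF h(2)]) (simp add: h(1))
  have 1: "(\<lambda>n. (cf (\<mu> (h n)) v - 1) / of_real (h n)) \<longlonglongrightarrow> \<psi>"
    unfolding \<psi>_def by (rule filterlim_compose[OF levy_exponent f])
  have "((\<lambda>z. exp (z * \<psi>)) has_field_derivative \<psi>) (at 0)"
    by (auto intro!: derivative_eq_intros)
  then have "((\<lambda>z. (exp (z * \<psi>) - 1) / z) \<longlongrightarrow> \<psi>) (at 0)"
    by (simp add: has_field_derivative_iff)
  moreover have "filterlim (\<lambda>n. complex_of_real (h n)) (at 0) sequentially"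
    using h(1) tendsto_of_real[OF h(2), where 'a = complex] by (auto simp: filterlim_at less_imp_neq[symmetric])
  ultimately have 2: "(\<lambda>n. (exp (of_real (h n) * \<psi>) - 1) / of_real (h n)) \<longlonglongrightarrow> \<psi>"
    by (rule filterlim_compose)
  have "(\<lambda>n. norm ((cf (\<mu> (h n)) v - 1) / of_real (h n) - (exp (of_real (h n) * \<psi>) - 1) / of_real (h n))) \<longlonglongrightarrow> norm (\<psi> - \<psi>)"
    by (intro tendsto_norm tendsto_diff 1 2)
  then have "(\<lambda>n. real (k n) * h n * norm ((cf (\<mu> (h n)) v - 1) / of_real (h n) - (exp (of_real (h n) * \<psi>) - 1) / of_real (h n)))
     \<longlonglongrightarrow> t * norm (\<psi> - \<psi>)" by (rule tendsto_mult[OF k])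
  then have "(\<lambda>n. real (k n) * h n * norm ((cf (\<mu> (h n)) v - 1) / of_real (h n) - (exp (of_real (h n) * \<psi>) - 1) / of_real (h n)))
     \<longlonglongrightarrow> 0" by simp
  note lim0 = this
  have bnd: "norm (cf (\<mu> (h n)) v ^ k n - exp (of_real (h n) * \<psi>) ^ k n)
      \<le> real (k n) * h n * norm ((cf (\<mu> (h n)) v - 1) / of_real (h n) - (exp (of_real (h n) * \<psi>) - 1) / of_real (h n))" for n
  proof -
    have "norm (exp (of_real (h n) * \<psi>)) \<le> 1"
      using Re_levy_exponent[of v] h(1)[of n] by (simp add: \<psi>_def mult_nonneg_nonpos)
    then have "norm (cf (\<mu> (h n)) v ^ k n - exp (of_real (h n) * \<psi>) ^ k n)
      \<le> real (k n) * norm (cf (\<mu> (h n)) v - exp (of_real (h n) * \<psi>))"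
      by (intro norm_power_diff norm_cf_le_1 prob borel h)
    also have "cf (\<mu> (h n)) v - exp (of_real (h n) * \<psi>)
      = of_real (h n) * ((cf (\<mu> (h n)) v - 1) / of_real (h n) - (exp (of_real (h n) * \<psi>) - 1) / of_real (h n))"
      using h(1)[of n] by (simp add: field_simps)
    finally show ?thesis using h(1)[of n] by (simp add: norm_mult mult_ac)
  qed
  have "(\<lambda>n. cf (\<mu> (h n)) v ^ k n - exp (of_real (h n) * \<psi>) ^ k n) \<longlonglongrightarrow> 0"
    by (rule Lim_null_comparison[OF always_eventually[OF allI[OF bnd]] lim0])
  moreover have "(\<lambda>n. exp (of_real (h n) * \<psi>) ^ k n) \<longlonglongrightarrow> exp (of_real t * \<psi>)"
  proof -
    have "exp (of_real (h n) * \<psi>) ^ k n = exp (of_real (real (k n) * h n) * \<psi>)" for n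
      by (simp add: exp_of_nat_mult[symmetric] mult.assoc)
    moreover have "(\<lambda>n. exp (of_real (real (k n) * h n) * \<psi>)) \<longlonglongrightarrow> exp (of_real t * \<psi>)"
      by (intro tendsto_exp tendsto_mult tendsto_const tendsto_of_real k)
    ultimately show ?thesis by (simp only:)
  qed
  ultimately have "(\<lambda>n. (cf (\<mu> (h n)) v ^ k n - exp (of_real (h n) * \<psi>) ^ k n) + exp (of_real (h n) * \<psi>) ^ k n)
      \<longlonglongrightarrow> 0 + exp (of_real t * \<psi>)"
    by (rule tendsto_add)
  then show ?thesis by (simp add: cf_conv_power prob borel h \<psi>_def)
qed

lemma conv_power_subsequence_limit:
  assumes h: "\<And>n. h n > 0" "h \<longlonglongrightarrow> 0" and k: "(\<lambda>n. real (k n) * h n) \<longlonglongrightarrow> t"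
  obtains r :: "nat \<Rightarrow> nat" and \<Omega> :: "real measure" and X X'
  where "strict_mono r" "prob_space \<Omega>" "\<And>n. X n \<in> borel_measurable \<Omega>" "X' \<in> borel_measurable \<Omega>"
    "\<And>n. distr \<Omega> borel (X n) = conv_power (\<mu> (h (r n))) (k (r n))"
    "\<And>\<omega>. \<omega> \<in> space \<Omega> \<Longrightarrow> (\<lambda>n. X n \<omega>) \<longlonglongrightarrow> X' \<omega>"
    "\<And>v. cf (distr \<Omega> borel X') v = exp (of_real t * levy_exponent v)"
proof -
  obtain r :: "nat \<Rightarrow> nat" and \<Omega> :: "real measure" and X X'
  where *: "strict_mono r" "prob_space \<Omega>" "\<And>n. X n \<in> borel_measurable \<Omega>" "X' \<in> borel_measurable \<Omega>"
    "\<And>n. distr \<Omega> borel (X n) = conv_power (\<mu> (h (r n))) (k (r n))"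
    "\<And>\<omega>. \<omega> \<in> space \<Omega> \<Longrightarrow> (\<lambda>n. X n \<omega>) \<longlonglongrightarrow> X' \<omega>"
    using tight_imp_convergent_coupling[of "\<lambda>n. conv_power (\<mu> (h n)) (k n)",
        OF prob_conv[OF h(1)] sets_conv_power tight_conv_power[OF h k]] by blast
  have "cf (distr \<Omega> borel X') v = exp (of_real t * levy_exponent v)" for v
  proof (rule LIMSEQ_unique)
    show "(\<lambda>n. cf (distr \<Omega> borel (X n)) v) \<longlonglongrightarrow> cf (distr \<Omega> borel X') v"
      by (rule cf_tendsto) (use * in auto)
    have "(\<lambda>n. cf (conv_power (\<mu> (h (r n))) (k (r n))) v) \<longlonglongrightarrow> exp (of_real t * levy_exponent v)"
      using LIMSEQ_subseq_LIMSEQ[OF cf_conv_power_tendsto[OF h k] *(1), of v] by (simp add: comp_def)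
    then show "(\<lambda>n. cf (distr \<Omega> borel (X n)) v) \<longlonglongrightarrow> exp (of_real t * levy_exponent v)"
      by (simp add: *(5))
  qed
  with * show thesis by (rule that)
qed

lemma discretization:
  fixes t :: real
  assumes "t \<ge> 0"
  shows "(\<lambda>n. real (nat \<lfloor>t * real (Suc n)\<rfloor>) * (1 / real (Suc n))) \<longlonglongrightarrow> t"
proof (rule tendsto_sandwich)
  have floor: "x - 1 \<le> real (nat \<lfloor>x\<rfloor>)" "x \<ge> 0 \<Longrightarrow> real (nat \<lfloor>x\<rfloor>) \<le> x" for x :: real
    by linarith+
  have "t - 1 / real (Suc n) \<le> real (nat \<lfloor>t * real (Suc n)\<rfloor>) * (1 / real (Suc n))" for n
  proof -
    have "t - 1 / real (Suc n) = (t * real (Suc n) - 1) * (1 / real (Suc n))"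
      by (simp add: diff_divide_distrib del: of_nat_Suc)
    also have "\<dots> \<le> real (nat \<lfloor>t * real (Suc n)\<rfloor>) * (1 / real (Suc n))"
      by (intro mult_right_mono floor) simp
    finally show ?thesis .
  qed
  then show "\<forall>\<^sub>F n in sequentially. t - 1 / real (Suc n) \<le> real (nat \<lfloor>t * real (Suc n)\<rfloor>) * (1 / real (Suc n))"
    by (intro always_eventually allI)
  have "real (nat \<lfloor>t * real (Suc n)\<rfloor>) * (1 / real (Suc n)) \<le> t" for n
  proof -
    have "real (nat \<lfloor>t * real (Suc n)\<rfloor>) * (1 / real (Suc n)) \<le> t * real (Suc n) * (1 / real (Suc n))"
      using assms by (intro mult_right_mono floor) simp_all
    then show ?thesis by (simp del: of_nat_Suc)
  qed
  then show "\<forall>\<^sub>F n in sequentially. real (nat \<lfloor>t * real (Suc n)\<rfloor>) * (1 / real (Suc n)) \<le> t"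
    by (intro always_eventually allI)
  show "(\<lambda>n. t - 1 / real (Suc n)) \<longlonglongrightarrow> t"
    using tendsto_diff[OF tendsto_const LIMSEQ_Suc[OF lim_1_over_n], of t] by simp
qed simp

lemma unit_fractions: "(\<lambda>n. 1 / real (Suc n)) \<longlonglongrightarrow> 0" "1 / real (Suc n) > 0"
  using LIMSEQ_Suc[OF lim_1_over_n[where 'a = real]] by simp_all

text \<open>The measure is picked by choice afterwards, so the Lyapunov bounds are recorded here
  together with the characteristic function. They pass to the limit by dominated convergence along
  the coupled subsequence.\<close>

lemma limit_law_exists:
  assumes "t \<ge> 0"
  shows "\<exists>M. prob_space M \<and> sets M = sets borel \<and> (\<forall>v. cf M v = exp (of_real t * levy_exponent v)) \<and>
    (\<forall>R c. (\<forall>\<^sub>F h in at_right 0. \<forall>k. (\<integral>y. lyapunov R y \<partial>conv_power (\<mu> h) k) \<le> real k * h * c) \<longrightarrow>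
      (\<integral>y. lyapunov R y \<partial>M) \<le> t * c)"
proof -
  let ?h = "\<lambda>n. 1 / real (Suc n)" and ?k = "\<lambda>n. nat \<lfloor>t * real (Suc n)\<rfloor>"
  obtain r :: "nat \<Rightarrow> nat" and \<Omega> :: "real measure" and X X'
  where *: "strict_mono r" "prob_space \<Omega>" "\<And>n. X n \<in> borel_measurable \<Omega>" "X' \<in> borel_measurable \<Omega>"
    "\<And>n. distr \<Omega> borel (X n) = conv_power (\<mu> (?h (r n))) (?k (r n))"
    "\<And>\<omega>. \<omega> \<in> space \<Omega> \<Longrightarrow> (\<lambda>n. X n \<omega>) \<longlonglongrightarrow> X' \<omega>"
    "\<And>v. cf (distr \<Omega> borel X') v = exp (of_real t * levy_exponent v)"
    by (rule conv_power_subsequence_limit[of ?h ?k t, OF unit_fractions(2,1) discretization[OF assms]]) blast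
  interpret prob_space \<Omega> by fact
  note *(3,4)[measurable]
  have "(\<integral>y. lyapunov R y \<partial>distr \<Omega> borel X') \<le> t * c"
    if ev: "\<forall>\<^sub>F h in at_right 0. \<forall>k. (\<integral>y. lyapunov R y \<partial>conv_power (\<mu> h) k) \<le> real k * h * c" for R c
  proof (rule tendsto_le[OF sequentially_bot])
    have hr: "(\<lambda>n. ?h (r n)) \<longlonglongrightarrow> 0"
      using LIMSEQ_subseq_LIMSEQ[OF unit_fractions(1) *(1)] by (simp add: comp_def)
    have "(\<lambda>n. real (?k (r n)) * ?h (r n)) \<longlonglongrightarrow> t"
      using LIMSEQ_subseq_LIMSEQ[OF discretization[OF assms] *(1)] by (simp add: comp_def)
    then show "(\<lambda>n. real (?k (r n)) * ?h (r n) * c) \<longlonglongrightarrow> t * c"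
      by (intro tendsto_intros)
    have "(\<lambda>n. \<integral>\<omega>. lyapunov R (X n \<omega>) \<partial>\<Omega>) \<longlonglongrightarrow> (\<integral>\<omega>. lyapunov R (X' \<omega>) \<partial>\<Omega>)"
    proof (rule integral_dominated_convergence[where w = "\<lambda>_. real CARD('d)"])
      show "AE \<omega> in \<Omega>. (\<lambda>n. lyapunov R (X n \<omega>)) \<longlonglongrightarrow> lyapunov R (X' \<omega>)"
        by (intro AE_I2 continuous_on_tendsto_compose[OF continuous_on_lyapunov[of UNIV]] *(6)) auto
    qed (auto simp: lyapunov_bounds)
    then show "(\<lambda>n. \<integral>\<omega>. lyapunov R (X n \<omega>) \<partial>\<Omega>) \<longlonglongrightarrow> (\<integral>y. lyapunov R y \<partial>distr \<Omega> borel X')"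
      by (simp add: integral_distr)
    have "(\<integral>\<omega>. lyapunov R (X n \<omega>) \<partial>\<Omega>) = (\<integral>y. lyapunov R y \<partial>conv_power (\<mu> (?h (r n))) (?k (r n)))" for n
      by (simp only: *(5)[symmetric]) (simp add: integral_distr)
    then show "\<forall>\<^sub>F n in sequentially. (\<integral>\<omega>. lyapunov R (X n \<omega>) \<partial>\<Omega>) \<le> real (?k (r n)) * ?h (r n) * c"
      using eventually_seq[OF ev _ hr] by (auto elim: eventually_mono)
  qed
  then show ?thesis using *(7)
    by (intro exI[of _ "distr \<Omega> borel X'"]) (auto intro: prob_space_distr)
qed

definition limit_law :: "real \<Rightarrow> (real ^ 'd) measure" where
  "limit_law t = (SOME M. prob_space M \<and> sets M = sets borel \<and> (\<forall>v. cf M v = exp (of_real t * levy_exponent v)) \<and>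
    (\<forall>R c. (\<forall>\<^sub>F h in at_right 0. \<forall>k. (\<integral>y. lyapunov R y \<partial>conv_power (\<mu> h) k) \<le> real k * h * c) \<longrightarrow>
      (\<integral>y. lyapunov R y \<partial>M) \<le> t * c))"

lemma limit_law:
  assumes "t \<ge> 0"
  shows "prob_space (limit_law t)" "sets (limit_law t) = sets borel"
    "cf (limit_law t) v = exp (of_real t * levy_exponent v)"
    "(\<forall>\<^sub>F h in at_right 0. \<forall>k. (\<integral>y. lyapunov R y \<partial>conv_power (\<mu> h) k) \<le> real k * h * c) \<Longrightarrow>
      (\<integral>y. lyapunov R y \<partial>limit_law t) \<le> t * c"
  using someI_ex[OF limit_law_exists[OF assms]] unfolding limit_law_def[symmetric] by blast+

lemma limit_law_0: "limit_law 0 = return borel 0"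
  by (rule measure_eqI_cf) (auto simp: limit_law cf_return prob_space_return)

lemma limit_law_small:
  assumes "\<delta> > 0"
  shows "\<exists>c\<ge>0. \<forall>t\<ge>0. measure (limit_law t) {y. norm y > \<delta>} \<le> c * t"
proof -
  define R where "R = \<delta> / real CARD('d)"
  have R: "R > 0" "real CARD('d) * R = \<delta>" using assms by (auto simp: R_def)
  obtain c where c: "c \<ge> 0" "\<forall>\<^sub>F h in at_right 0. \<forall>k. (\<integral>y. lyapunov R y \<partial>conv_power (\<mu> h) k) \<le> real k * h * c"
    using lyapunov_power_bound[OF R(1)] by blast
  have "measure (limit_law t) {y. norm y > \<delta>} \<le> (2 * c) * t" if "t \<ge> 0" for t
    using measure_le_lyapunov[OF limit_law(1,2)[OF that] R(1)] limit_law(4)[OF that c(2)] R(2) by (simp add: mult_ac)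
  then show ?thesis using c(1) by (intro exI[of _ "2 * c"]) auto
qed

text \<open>If the coupling failed infinitely often, the failures would have a subsequence
  converging everywhere on one probability space. The limit has the characteristic function of
  \<open>limit_law t\<close>, and convergence in probability on that space yields the very coupling
  that was supposed to fail.\<close>

theorem conv_power_coupled:
  assumes h: "\<And>n. h n > 0" "h \<longlonglongrightarrow> 0" and "t \<ge> 0" and k: "(\<lambda>n. real (k n) * h n) \<longlonglongrightarrow> t" and "\<delta> > 0"
  shows "\<forall>\<^sub>F n in sequentially. coupled \<delta> (conv_power (\<mu> (h n)) (k n)) (limit_law t)"
proof (rule ccontr)
  let ?P = "\<lambda>n. coupled \<delta> (conv_power (\<mu> (h n)) (k n)) (limit_law t)"
  assume "\<not> eventually ?P sequentially"
  then have "\<exists>\<^sub>F n in sequentially. \<not> ?P n" by (simp add: frequently_def)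
  then have "infinite {n. \<not> ?P n}" by (simp add: frequently_cofinite flip: cofinite_eq_sequentially)
  from infinite_enumerate[OF this] obtain s :: "nat \<Rightarrow> nat" where s: "strict_mono s" "\<And>n. \<not> ?P (s n)" by auto
  have h': "h (s n) > 0" "(\<lambda>n. h (s n)) \<longlonglongrightarrow> 0" "(\<lambda>n. real (k (s n)) * h (s n)) \<longlonglongrightarrow> t" for n
    using h(1) LIMSEQ_subseq_LIMSEQ[OF h(2) s(1)] LIMSEQ_subseq_LIMSEQ[OF k s(1)] by (auto simp: comp_def)
  obtain r :: "nat \<Rightarrow> nat" and \<Omega> :: "real measure" and X X'
  where *: "strict_mono r" "prob_space \<Omega>" "\<And>n. X n \<in> borel_measurable \<Omega>" "X' \<in> borel_measurable \<Omega>"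
    "\<And>n. distr \<Omega> borel (X n) = conv_power (\<mu> (h (s (r n)))) (k (s (r n)))"
    "\<And>\<omega>. \<omega> \<in> space \<Omega> \<Longrightarrow> (\<lambda>n. X n \<omega>) \<longlonglongrightarrow> X' \<omega>"
    "\<And>v. cf (distr \<Omega> borel X') v = exp (of_real t * levy_exponent v)"
    by (rule conv_power_subsequence_limit[of "\<lambda>n. h (s n)" "\<lambda>n. k (s n)" t, OF h']) blast
  interpret prob_space \<Omega> by fact
  note *(3,4)[measurable]
  have law: "distr \<Omega> borel X' = limit_law t"
    by (rule measure_eqI_cf) (auto simp: *(7) limit_law \<open>t \<ge> 0\<close> intro!: prob_space_distr)
  define E where "E n = {\<omega>\<in>space \<Omega>. dist (X n \<omega>) (X' \<omega>) \<ge> \<delta>}" for n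
  have [measurable]: "E n \<in> sets \<Omega>" for n unfolding E_def by measurable
  have "(\<lambda>n. \<integral>\<omega>. indicator (E n) \<omega> \<partial>\<Omega>) \<longlonglongrightarrow> (\<integral>\<omega>. (0::real) \<partial>\<Omega>)"
  proof (rule integral_dominated_convergence[where w = "\<lambda>_. 1"])
    show "AE \<omega> in \<Omega>. (\<lambda>n. indicator (E n) \<omega> :: real) \<longlonglongrightarrow> 0"
    proof (rule AE_I2)
      fix \<omega> assume "\<omega> \<in> space \<Omega>"
      from tendstoD[OF *(6)[OF this] \<open>\<delta> > 0\<close>] show "(\<lambda>n. indicator (E n) \<omega> :: real) \<longlonglongrightarrow> 0"
        by (intro tendsto_eventually) (auto elim!: eventually_mono simp: E_def)
    qed
  qed (auto simp: indicator_def)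
  then have "(\<lambda>n. measure \<Omega> (E n)) \<longlonglongrightarrow> 0"
    using sets.sets_into_space by (simp add: Int_absorb2)
  from eventually_happens[OF order_tendstoD(2)[OF this \<open>\<delta> > 0\<close>]] obtain n where "measure \<Omega> (E n) < \<delta>" by auto
  then have "coupled \<delta> (distr \<Omega> borel (X n)) (distr \<Omega> borel X')"
    unfolding coupled_def E_def using *(2-4)
    by (intro exI[of _ \<Omega>] exI[of _ "X n"] exI[of _ X']) auto
  then show False using s(2)[of "r n"] by (simp add: *(5) law)
qed

end

section \<open>The Levy process of a convolution semigroup\<close>

text \<open>Monotonicity without strictness allows empty blocks, which contribute the constant 0;
  they occur when distinct times share an index on a coarse grid.\<close>

lemma (in prob_space) indep_vars_blocks:
  fixes \<xi> :: "nat \<Rightarrow> 'a \<Rightarrow> 'b::euclidean_space"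
  assumes ind: "indep_vars (\<lambda>_. borel) \<xi> UNIV" and "mono c"
  shows "indep_vars (\<lambda>_. borel) (\<lambda>j \<omega>. \<Sum>i\<in>{c j..<c (Suc j)}. \<xi> i \<omega>) UNIV"
proof -
  define K where "K j = {c j..<c (Suc j)}" for j :: nat
  have "i = j" if "x \<in> K i" "x \<in> K j" for i j x
  proof (rule ccontr)
    assume "i \<noteq> j"
    then have "c (Suc i) \<le> c j \<or> c (Suc j) \<le> c i"
      using monoD[OF \<open>mono c\<close>, of "Suc i" j] monoD[OF \<open>mono c\<close>, of "Suc j" i] by linarith
    then show False using that by (auto simp: K_def)
  qed
  then have "disjoint_family_on K UNIV" by (auto simp: disjoint_family_on_def)
  from indep_vars_restrict[OF ind _ this]
  have "indep_vars (\<lambda>j. PiM (K j) (\<lambda>_. borel)) (\<lambda>j \<omega>. restrict (\<lambda>i. \<xi> i \<omega>) (K j)) UNIV" by simp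
  from indep_vars_compose2[OF this, of "\<lambda>j g. \<Sum>i\<in>K j. g i" "\<lambda>_. borel"]
  have "indep_vars (\<lambda>_. borel) (\<lambda>j \<omega>. \<Sum>i\<in>K j. restrict (\<lambda>i. \<xi> i \<omega>) (K j) i) UNIV" by simp
  then show ?thesis by (simp add: K_def)
qed

text \<open>For continuous bumps the factorisation of expectations survives almost sure limits.
  Letting the bumps tend to indicators of closed sets then gives independence on a generating system
  stable under intersections.\<close>

lemma (in prob_space) indep_vars_limit:
  fixes X :: "nat \<Rightarrow> 'i \<Rightarrow> 'a \<Rightarrow> 'b::euclidean_space"
  assumes I: "finite I" and ind: "\<And>m. indep_vars (\<lambda>_. borel) (X m) I"
    and Y: "\<And>i. i \<in> I \<Longrightarrow> Y i \<in> borel_measurable M"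
    and lim: "\<And>i. i \<in> I \<Longrightarrow> AE \<omega> in M. (\<lambda>m. X m i \<omega>) \<longlonglongrightarrow> Y i \<omega>"
  shows "indep_vars (\<lambda>_. borel) Y I"
proof (cases "I = {}")
  case True
  then show ?thesis by (simp add: indep_vars_def2 indep_sets_def)
next
  case False
  have X [measurable]: "X m i \<in> borel_measurable M" if "i \<in> I" for m i
    using ind[of m] that by (auto simp: indep_vars_def)
  note Y[measurable]
  have bump_int: "integrable M (\<lambda>\<omega>. bump C n (Z \<omega>))" if [measurable]: "Z \<in> borel_measurable M"
    for C n and Z :: "'a \<Rightarrow> 'b"
    by (rule integrable_const_bound[of _ 1]) (auto simp: bump_bounds)
  have prod_bounds: "0 \<le> (\<Prod>i\<in>I. bump (A i) n (Z i))" "(\<Prod>i\<in>I. bump (A i) n (Z i)) \<le> 1" for A n and Z :: "'i \<Rightarrow> 'b"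
    by (auto intro!: prod_nonneg prod_le_1 simp: bump_bounds)
  have "(\<integral>\<omega>. (\<Prod>i\<in>I. bump (A i) n (Y i \<omega>)) \<partial>M) = (\<Prod>i\<in>I. \<integral>\<omega>. bump (A i) n (Y i \<omega>) \<partial>M)" for A n
  proof (rule LIMSEQ_unique)
    have AElim: "AE \<omega> in M. (\<lambda>m. bump (A i) n (X m i \<omega>)) \<longlonglongrightarrow> bump (A i) n (Y i \<omega>)" if "i \<in> I" for i
      using lim[OF that]
      by eventually_elim (rule continuous_on_tendsto_compose[OF continuous_on_bump[of UNIV]], auto)
    show "(\<lambda>m. \<integral>\<omega>. (\<Prod>i\<in>I. bump (A i) n (X m i \<omega>)) \<partial>M) \<longlonglongrightarrow> (\<integral>\<omega>. (\<Prod>i\<in>I. bump (A i) n (Y i \<omega>)) \<partial>M)"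
    proof (rule integral_dominated_convergence[where w = "\<lambda>_. 1"])
      have "AE \<omega> in M. \<forall>i\<in>I. (\<lambda>m. bump (A i) n (X m i \<omega>)) \<longlonglongrightarrow> bump (A i) n (Y i \<omega>)"
        using AElim I by (intro AE_finite_allI) auto
      then show "AE \<omega> in M. (\<lambda>m. \<Prod>i\<in>I. bump (A i) n (X m i \<omega>)) \<longlonglongrightarrow> (\<Prod>i\<in>I. bump (A i) n (Y i \<omega>))"
        by eventually_elim (auto intro!: tendsto_prod)
    qed (auto simp: prod_bounds)
    have "(\<integral>\<omega>. (\<Prod>i\<in>I. bump (A i) n (X m i \<omega>)) \<partial>M) = (\<Prod>i\<in>I. \<integral>\<omega>. bump (A i) n (X m i \<omega>) \<partial>M)" for m
    proof (rule indep_vars_lebesgue_integral[OF I])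
      show "indep_vars (\<lambda>_. borel) (\<lambda>i \<omega>. bump (A i) n (X m i \<omega>)) I"
        by (rule indep_vars_compose2[OF ind]) auto
    qed (auto intro!: bump_int)
    moreover have "(\<lambda>m. \<integral>\<omega>. bump (A i) n (X m i \<omega>) \<partial>M) \<longlonglongrightarrow> (\<integral>\<omega>. bump (A i) n (Y i \<omega>) \<partial>M)" if "i \<in> I" for i
      using that AElim[OF that]
      by (intro integral_dominated_convergence[where w = "\<lambda>_. 1"]) (auto simp: bump_bounds)
    ultimately show "(\<lambda>m. \<integral>\<omega>. (\<Prod>i\<in>I. bump (A i) n (X m i \<omega>)) \<partial>M) \<longlonglongrightarrow> (\<Prod>i\<in>I. \<integral>\<omega>. bump (A i) n (Y i \<omega>) \<partial>M)"
      by (auto intro!: tendsto_prod)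
  qed
  note eq = this
  have "prob (\<Inter>j\<in>I. Y j -` A j \<inter> space M) = (\<Prod>j\<in>I. prob (Y j -` A j \<inter> space M))"
    if A: "A \<in> (\<Pi> i\<in>I. Collect closed)" for A
  \<comment> \<open>Bumps of an empty set do not tend to its indicator; in that case both sides are
    0.\<close>
  proof (cases "\<exists>i\<in>I. A i = {}")
    case True
    then obtain i where i: "i \<in> I" "A i = {}" by blast
    then have "(\<Inter>j\<in>I. Y j -` A j \<inter> space M) = {}" by auto
    moreover have "(\<Prod>j\<in>I. prob (Y j -` A j \<inter> space M)) = 0"
      using i I by (intro prod_zero bexI[of _ i]) auto
    ultimately show ?thesis by simp
  next
    case ne: False
    have cl: "closed (A i)" "A i \<noteq> {}" if "i \<in> I" for i using A ne that by auto
    have [measurable]: "A i \<in> sets borel" if "i \<in> I" for i using cl[OF that] by auto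
    have ind: "(\<integral>\<omega>. indicator (A i) (Y i \<omega>) \<partial>M) = prob (Y i -` A i \<inter> space M)" if "i \<in> I" for i
    proof -
      have "(\<integral>\<omega>. indicator (A i) (Y i \<omega>) \<partial>M) = (\<integral>\<omega>. indicator (Y i -` A i \<inter> space M) \<omega> \<partial>M :: real)"
        by (intro Bochner_Integration.integral_cong) (auto simp: indicator_def)
      then show ?thesis by simp
    qed
    have "(\<lambda>n. \<integral>\<omega>. (\<Prod>i\<in>I. bump (A i) n (Y i \<omega>)) \<partial>M) \<longlonglongrightarrow> (\<integral>\<omega>. (\<Prod>i\<in>I. indicator (A i) (Y i \<omega>)) \<partial>M)"
    proof (rule integral_dominated_convergence[where w = "\<lambda>_. 1"])
      show "AE \<omega> in M. (\<lambda>n. \<Prod>i\<in>I. bump (A i) n (Y i \<omega>)) \<longlonglongrightarrow> (\<Prod>i\<in>I. indicator (A i) (Y i \<omega>))"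
        by (intro AE_I2 tendsto_prod bump_tendsto_indicator cl)
    qed (auto simp: prod_bounds)
    moreover have "(\<lambda>n. \<Prod>i\<in>I. \<integral>\<omega>. bump (A i) n (Y i \<omega>) \<partial>M) \<longlonglongrightarrow> (\<Prod>i\<in>I. \<integral>\<omega>. indicator (A i) (Y i \<omega>) \<partial>M)"
    proof (rule tendsto_prod)
      fix i assume i: "i \<in> I"
      show "(\<lambda>n. \<integral>\<omega>. bump (A i) n (Y i \<omega>) \<partial>M) \<longlonglongrightarrow> (\<integral>\<omega>. indicator (A i) (Y i \<omega>) \<partial>M)"
        using i bump_tendsto_indicator[OF cl[OF i]]
        by (intro integral_dominated_convergence[where w = "\<lambda>_. 1"]) (auto simp: bump_bounds)
    qed
    ultimately have "(\<integral>\<omega>. (\<Prod>i\<in>I. indicator (A i) (Y i \<omega>)) \<partial>M) = (\<Prod>i\<in>I. \<integral>\<omega>. indicator (A i) (Y i \<omega>) \<partial>M :: real)"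
      unfolding eq by (rule LIMSEQ_unique)
    also have "\<dots> = (\<Prod>i\<in>I. prob (Y i -` A i \<inter> space M))" by (intro prod.cong refl ind)
    also have "(\<integral>\<omega>. (\<Prod>i\<in>I. indicator (A i) (Y i \<omega>)) \<partial>M) = (\<integral>\<omega>. indicator (\<Inter>j\<in>I. Y j -` A j \<inter> space M) \<omega> \<partial>M :: real)"
    proof (intro Bochner_Integration.integral_cong refl)
      fix \<omega> assume \<omega>: "\<omega> \<in> space M"
      show "(\<Prod>i\<in>I. indicator (A i) (Y i \<omega>)) = (indicator (\<Inter>j\<in>I. Y j -` A j \<inter> space M) \<omega> :: real)"
      proof (cases "\<forall>i\<in>I. Y i \<omega> \<in> A i")
        case False
        then have "(\<Prod>i\<in>I. indicator (A i) (Y i \<omega>)) = (0::real)"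
          using I by (intro prod_zero) (auto simp: indicator_def)
        then show ?thesis using False by (auto simp: indicator_def)
      qed (use \<omega> \<open>I \<noteq> {}\<close> in \<open>auto simp: indicator_def\<close>)
    qed
    also have "\<dots> = prob (\<Inter>j\<in>I. Y j -` A j \<inter> space M)"
      using \<open>I \<noteq> {}\<close> by (simp add: Int_absorb2 INF_le_SUP subset_eq Ball_def inf_commute)
    finally show ?thesis .
  qed
  moreover have "sets (borel :: 'b measure) = sigma_sets (space borel) (Collect closed)"
    by (simp add: borel_eq_closed)
  ultimately show ?thesis
    using False I
    by (subst indep_vars_finite[where E = "\<lambda>_. Collect closed"]) (auto simp: Int_stable_def Y)
qed

section \<open>Walks whose steps come from a convolution semigroup\<close>

locale levy_semigroup =
  fixes \<nu> :: "real \<Rightarrow> 'a::ordered_euclidean_space measure" and \<psi> :: "'a \<Rightarrow> complex"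
  assumes prob_\<nu>: "\<And>t. t \<ge> 0 \<Longrightarrow> prob_space (\<nu> t)"
    and sets_\<nu>: "\<And>t. t \<ge> 0 \<Longrightarrow> sets (\<nu> t) = sets borel"
    and cf_\<nu>: "\<And>t v. t \<ge> 0 \<Longrightarrow> cf (\<nu> t) v = exp (of_real t * \<psi> v)"
    and small_\<nu>: "\<And>\<delta>. \<delta> > 0 \<Longrightarrow> \<exists>c\<ge>0. \<forall>t\<ge>0. measure (\<nu> t) {y. norm y > \<delta>} \<le> c * t"
begin

lemma eq_\<nu>_I:
  assumes "prob_space M" "sets M = sets borel" "t \<ge> 0" "\<And>v. cf M v = exp (of_real t * \<psi> v)"
  shows "M = \<nu> t"
  by (rule measure_eqI_cf) (use assms in \<open>auto simp: prob_\<nu> sets_\<nu> cf_\<nu>\<close>)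

lemma \<nu>_0: "\<nu> 0 = return borel 0"
  by (rule eq_\<nu>_I[symmetric]) (auto simp: cf_return prob_space_return)

definition walk :: "'w measure \<Rightarrow> real \<Rightarrow> (nat \<Rightarrow> 'w \<Rightarrow> 'a) \<Rightarrow> bool" where
  "walk M \<delta> \<xi> \<longleftrightarrow> prob_space M \<and> \<delta> \<ge> 0 \<and> prob_space.indep_vars M (\<lambda>_. borel) \<xi> UNIV \<and>
     (\<forall>i. distr M borel (\<xi> i) = \<nu> \<delta>)"

lemma walk_measurable: "walk M \<delta> \<xi> \<Longrightarrow> \<xi> i \<in> borel_measurable M"
  by (auto simp: walk_def prob_space.indep_vars_def)

lemma walk_sum:
  assumes w: "walk M \<delta> \<xi>" and I: "finite I"
  shows "distr M borel (\<lambda>\<omega>. \<Sum>i\<in>I. \<xi> i \<omega>) = \<nu> (real (card I) * \<delta>)"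
proof -
  note [measurable] = walk_measurable[OF w]
  have \<delta>: "\<delta> \<ge> 0" using w by (simp add: walk_def)
  interpret prob_space M using w by (simp add: walk_def)
  have ind: "indep_vars (\<lambda>_. borel) \<xi> I"
    using w indep_vars_subset[of _ \<xi> UNIV I] by (simp add: walk_def)
  have "cf (distr M borel (\<lambda>\<omega>. \<Sum>i\<in>I. \<xi> i \<omega>)) v = exp (of_real (real (card I) * \<delta>) * \<psi> v)" for v
  proof -
    have cis_sum: "cis ((\<Sum>i\<in>I. \<xi> i \<omega>) \<bullet> v) = (\<Prod>i\<in>I. cis (\<xi> i \<omega> \<bullet> v))" for \<omega>
      using I by (induction I rule: finite_induct) (auto simp: inner_add_left cis_mult[symmetric])
    have "cf (distr M borel (\<lambda>\<omega>. \<Sum>i\<in>I. \<xi> i \<omega>)) v = (\<integral>\<omega>. (\<Prod>i\<in>I. cis (\<xi> i \<omega> \<bullet> v)) \<partial>M)"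
      by (subst cf_distr) (auto simp: cis_sum)
    also have "\<dots> = (\<Prod>i\<in>I. \<integral>\<omega>. cis (\<xi> i \<omega> \<bullet> v) \<partial>M)"
    proof (rule indep_vars_lebesgue_integral[OF I])
      show "indep_vars (\<lambda>_. borel) (\<lambda>i \<omega>. cis (\<xi> i \<omega> \<bullet> v)) I"
        by (rule indep_vars_compose2[OF ind]) auto
    qed (intro integrable_cis prob_space_axioms, measurable)
    also have "\<dots> = (\<Prod>i\<in>I. exp (of_real \<delta> * \<psi> v))"
      using w \<delta> by (intro prod.cong refl) (simp add: cf_distr[symmetric] walk_def cf_\<nu>)
    finally show ?thesis by (simp add: exp_of_nat_mult[symmetric] mult.assoc)
  qed
  then show ?thesis using \<delta> by (intro eq_\<nu>_I prob_space_distr) auto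
qed

lemma walk_blocks:
  assumes w: "walk M \<delta> \<xi>" and "mono c"
  shows "prob_space.indep_vars M (\<lambda>_. borel) (\<lambda>j \<omega>. \<Sum>i\<in>{c j..<c (Suc j)}. \<xi> i \<omega>) UNIV"
  using w \<open>mono c\<close> prob_space.indep_vars_blocks[of M \<xi> c] by (simp add: walk_def)

lemma walk_shift:
  assumes w: "walk M \<delta> \<xi>"
  shows "walk M \<delta> (\<lambda>i. \<xi> (a + i))"
proof -
  have "mono (\<lambda>j. a + j)" by (auto simp: mono_def)
  from walk_blocks[OF w this] show ?thesis using w by (simp add: walk_def)
qed

text \<open>Adding neighbouring steps is the passage from one dyadic level to the next coarser one,
  and the source of the consistency between levels.\<close>

lemma walk_pairs:
  assumes w: "walk M \<delta> \<xi>"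
  shows "walk M (2 * \<delta>) (\<lambda>i \<omega>. \<xi> (2 * i) \<omega> + \<xi> (2 * i + 1) \<omega>)"
proof -
  have "mono (\<lambda>j::nat. 2 * j)" by (auto simp: mono_def)
  from walk_blocks[OF w this]
  have "prob_space.indep_vars M (\<lambda>_. borel) (\<lambda>i \<omega>. \<xi> (2 * i) \<omega> + \<xi> (2 * i + 1) \<omega>) UNIV"
    by simp
  moreover have "distr M borel (\<lambda>\<omega>. \<xi> (2 * i) \<omega> + \<xi> (2 * i + 1) \<omega>) = \<nu> (2 * \<delta>)" for i
    using walk_sum[OF w, of "{2 * i, 2 * i + 1}"] by simp
  ultimately show ?thesis using w by (simp add: walk_def)
qed

lemma walk_distr:
  assumes w: "walk M \<delta> \<xi>"
  shows "distr M (PiM UNIV (\<lambda>_. borel)) (\<lambda>\<omega> i. \<xi> i \<omega>) = PiM UNIV (\<lambda>_. \<nu> \<delta>)"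
proof -
  interpret prob_space M using w by (simp add: walk_def)
  show ?thesis
    using w indep_vars_iff_distr_eq_PiM[where I = UNIV and M' = "\<lambda>_. borel" and X = \<xi>, OF _ walk_measurable[OF w]]
    by (simp add: walk_def restrict_UNIV)
qed

lemma sets_PiM_\<nu>: "\<delta> \<ge> 0 \<Longrightarrow> sets (PiM I (\<lambda>_. \<nu> \<delta>)) = sets (PiM I (\<lambda>_. borel))"
  by (intro sets_PiM_cong refl sets_\<nu>)

lemma walk_PiM:
  assumes "\<delta> \<ge> 0"
  shows "walk (PiM UNIV (\<lambda>_. \<nu> \<delta>)) \<delta> (\<lambda>i w. w i)"
proof -
  interpret prob_space "PiM UNIV (\<lambda>_::nat. \<nu> \<delta>)" by (intro prob_space_PiM prob_\<nu> assms)
  note sets_PiM_\<nu>[OF assms, measurable_cong]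
  have laws: "distr (PiM UNIV (\<lambda>_. \<nu> \<delta>)) borel (\<lambda>w. w i) = \<nu> \<delta>" for i :: nat
    using distr_PiM_component[of UNIV "\<lambda>_. \<nu> \<delta>" i] prob_\<nu>[OF assms]
    by (simp add: sets_\<nu>[OF assms] cong: distr_cong)
  have "distr (PiM UNIV (\<lambda>_::nat. \<nu> \<delta>)) (PiM UNIV (\<lambda>_. borel)) (\<lambda>w. \<lambda>i\<in>UNIV. w i) = PiM UNIV (\<lambda>_. \<nu> \<delta>)"
    unfolding restrict_UNIV by (rule distr_id2[OF sets_PiM_\<nu>[OF assms, symmetric]])
  then have "indep_vars (\<lambda>_. borel) (\<lambda>i w. w i) UNIV"
    by (subst indep_vars_iff_distr_eq_PiM) (auto simp: laws)
  then show ?thesis using assms laws prob_space_axioms by (simp add: walk_def)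
qed

end

section \<open>Dyadic times\<close>

definition grid :: "nat \<Rightarrow> real set" where
  "grid m = range (\<lambda>k::nat. real k / 2 ^ m)"

definition dyadic :: "real set" where
  "dyadic = (\<Union>m. grid m)"

lemma grid_mono: "m \<le> m' \<Longrightarrow> grid m \<subseteq> grid m'"
proof
  fix q assume "m \<le> m'" "q \<in> grid m"
  then obtain k where "q = real k / 2 ^ m" by (auto simp: grid_def)
  also have "\<dots> = real (k * 2 ^ (m' - m)) / 2 ^ m'"
  proof -
    have "(2::real) ^ m' = 2 ^ m * 2 ^ (m' - m)" using \<open>m \<le> m'\<close> by (simp flip: power_add)
    then show ?thesis by simp
  qed
  finally show "q \<in> grid m'" unfolding grid_def by blast
qed

lemma finite_dyadic_grid: "finite J \<Longrightarrow> J \<subseteq> dyadic \<Longrightarrow> \<exists>m. J \<subseteq> grid m"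
proof (induction J rule: finite_induct)
  case (insert q J)
  then obtain m m' where "J \<subseteq> grid m" "q \<in> grid m'" by (auto simp: dyadic_def)
  then have "insert q J \<subseteq> grid (max m m')"
    using grid_mono[of m "max m m'"] grid_mono[of m' "max m m'"] by auto
  then show ?case by blast
qed simp

definition walk_path :: "nat \<Rightarrow> (nat \<Rightarrow> 'a::real_normed_vector) \<Rightarrow> real \<Rightarrow> 'a" where
  "walk_path m w q = (\<Sum>i<nat \<lfloor>q * 2 ^ m\<rfloor>. w i)"

lemma walk_path_grid: "walk_path m w (real k / 2 ^ m) = (\<Sum>i<k. w i)"
  by (simp add: walk_path_def)

lemma walk_path_Suc:
  assumes "q \<in> grid m"
  shows "walk_path (Suc m) w q = walk_path m (\<lambda>i. w (2 * i) + w (2 * i + 1)) q"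
proof -
  obtain k where k: "q = real k / 2 ^ m" using assms by (auto simp: grid_def)
  then have k': "q = real (2 * k) / 2 ^ Suc m" by simp
  have "(\<Sum>i<2 * k. w i) = (\<Sum>i<k. w (2 * i) + w (2 * i + 1))"
    by (induction k) (simp_all add: add.assoc)
  then have "walk_path (Suc m) w (real (2 * k) / 2 ^ Suc m) = walk_path m (\<lambda>i. w (2 * i) + w (2 * i + 1)) (real k / 2 ^ m)"
    by (simp only: walk_path_grid)
  then show ?thesis using k k' by simp
qed

lemma measurable_walk_path:
  fixes J :: "real set"
  shows "(\<lambda>w. \<lambda>q\<in>J. walk_path m w q) \<in> PiM UNIV (\<lambda>_. borel :: 'a::euclidean_space measure) \<rightarrow>\<^sub>M PiM J (\<lambda>_. borel)"
  unfolding walk_path_def by measurable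

definition increment :: "nat \<Rightarrow> nat \<Rightarrow> (real \<Rightarrow> 'a::real_normed_vector) \<Rightarrow> 'a" where
  "increment m i \<omega> = \<omega> (real (Suc i) / 2 ^ m) - \<omega> (real i / 2 ^ m)"

lemma sum_increment: "(\<Sum>i<k. increment m (a + i) \<omega>) = \<omega> (real (a + k) / 2 ^ m) - \<omega> (real a / 2 ^ m)"
  by (induction k) (simp_all add: increment_def algebra_simps)

lemma grid_I: "real k / 2 ^ m \<in> grid m"
  by (auto simp: grid_def)

lemma dyadic_I: "real k / 2 ^ m \<in> dyadic"
  by (auto simp: grid_def dyadic_def)

section \<open>Kolmogorov extension along the dyadic times\<close>

context levy_semigroup
begin

abbreviation W :: "nat \<Rightarrow> (nat \<Rightarrow> 'a) measure" where
  "W m \<equiv> PiM UNIV (\<lambda>_. \<nu> ((1 / 2) ^ m))"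

lemma sets_W [measurable_cong]: "sets (W m) = sets (PiM UNIV (\<lambda>_. borel))"
  by (rule sets_PiM_\<nu>) simp

definition fdd_level :: "nat \<Rightarrow> real set \<Rightarrow> (real \<Rightarrow> 'a) measure" where
  "fdd_level m J = distr (W m) (PiM J (\<lambda>_. borel)) (\<lambda>w. \<lambda>q\<in>J. walk_path m w q)"

lemma measurable_walk_path_W [measurable]:
  "(\<lambda>w. \<lambda>q\<in>J. walk_path m w q) \<in> W n \<rightarrow>\<^sub>M PiM J (\<lambda>_. borel)"
  using measurable_walk_path by (simp add: measurable_cong_sets[OF sets_W refl])

lemma measurable_W_component [measurable]: "(\<lambda>w. w i) \<in> borel_measurable (W n)"
  by (auto simp: measurable_cong_sets[OF sets_W refl] intro: measurable_component_singleton)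

lemma measurable_W_PiM:
  "(\<And>i. (\<lambda>w. f w i) \<in> borel_measurable (W n)) \<Longrightarrow> f \<in> W n \<rightarrow>\<^sub>M PiM UNIV (\<lambda>_. borel :: 'a measure)"
  by (rule measurable_PiM_single') auto

lemma fdd_level_Suc:
  assumes "J \<subseteq> grid m"
  shows "fdd_level (Suc m) J = fdd_level m J"
proof -
  let ?p = "\<lambda>w i. w (2 * i) + w (2 * i + 1) :: 'a"
  have "distr (W (Suc m)) (PiM UNIV (\<lambda>_. borel)) ?p = W m"
    using walk_distr[OF walk_pairs[OF walk_PiM[of "(1 / 2) ^ Suc m"]]] by simp
  then have "fdd_level m J = distr (distr (W (Suc m)) (PiM UNIV (\<lambda>_. borel)) ?p) (PiM J (\<lambda>_. borel)) (\<lambda>w. \<lambda>q\<in>J. walk_path m w q)"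
    by (simp add: fdd_level_def)
  also have "\<dots> = distr (W (Suc m)) (PiM J (\<lambda>_. borel)) (\<lambda>w. \<lambda>q\<in>J. walk_path m (?p w) q)"
    by (subst distr_distr[OF measurable_walk_path measurable_W_PiM])
       (simp_all only: comp_def borel_measurable_add measurable_W_component)
  also have "\<dots> = fdd_level (Suc m) J"
    unfolding fdd_level_def
    by (intro distr_cong refl restrict_ext walk_path_Suc[symmetric]) (use assms in auto)
  finally show ?thesis ..
qed

lemma fdd_level_le: "m \<le> m' \<Longrightarrow> J \<subseteq> grid m \<Longrightarrow> fdd_level m' J = fdd_level m J"
proof (induction m' rule: dec_induct)
  case (step n)
  then show ?case using grid_mono[of m n] by (subst fdd_level_Suc) auto
qed simp

text \<open>Every level whose grid contains \<open>J\<close> gives the same law, so taking the least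
  one is only a way to name it.\<close>

definition fdd :: "real set \<Rightarrow> (real \<Rightarrow> 'a) measure" where
  "fdd J = fdd_level (LEAST m. J \<subseteq> grid m) J"

lemma fdd_eq: "J \<subseteq> grid m \<Longrightarrow> fdd J = fdd_level m J"
  unfolding fdd_def
  by (rule fdd_level_le[symmetric]) (auto intro: Least_le LeastI2[of "\<lambda>m. J \<subseteq> grid m"])

text \<open>Finitely many dyadic times lie on a common grid, so a family and its subfamily can be
  read off from the same walk.\<close>

lemma projective_fdd: "polish_projective dyadic fdd"
  unfolding polish_projective_def projective_family_def
proof (intro conjI allI impI)
  fix J H :: "real set" assume J: "J \<subseteq> H" "finite H" "H \<subseteq> dyadic"
  obtain m where m: "H \<subseteq> grid m" using finite_dyadic_grid J by blast
  have "distr (fdd H) (PiM J (\<lambda>_. borel)) (\<lambda>f. restrict f J)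
      = distr (W m) (PiM J (\<lambda>_. borel)) (\<lambda>w. restrict (\<lambda>q\<in>H. walk_path m w q) J)"
    unfolding fdd_eq[OF m] fdd_level_def
    using J by (subst distr_distr) (auto simp: comp_def intro!: measurable_restrict_subset)
  also have "\<dots> = fdd_level m J"
    unfolding fdd_level_def using J by (intro distr_cong refl) (auto simp: restrict_def fun_eq_iff)
  also have "\<dots> = fdd J" using m J by (intro fdd_eq[symmetric]) auto
  finally show "fdd J = distr (fdd H) (PiM J (\<lambda>_. borel)) (\<lambda>f. restrict f J)" ..
next
  fix J :: "real set" assume "finite J" "J \<subseteq> dyadic"
  interpret prob_space "W m" for m by (intro prob_space_PiM prob_\<nu>) simp
  show "prob_space (fdd J)" unfolding fdd_def fdd_level_def by (rule prob_space_distr) measurable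
qed

definition \<Omega> :: "(real \<Rightarrow> 'a) measure" where
  "\<Omega> = projective_family.lim dyadic fdd (\<lambda>_. borel)"

lemma sets_\<Omega> [measurable_cong]: "sets \<Omega> = sets (PiM dyadic (\<lambda>_. borel))"
proof -
  interpret polish_projective dyadic fdd by (rule projective_fdd)
  show ?thesis by (simp add: \<Omega>_def)
qed

lemma prob_space_\<Omega>: "prob_space \<Omega>"
proof -
  interpret polish_projective dyadic fdd by (rule projective_fdd)
  show ?thesis unfolding \<Omega>_def by unfold_locales
qed

lemma distr_\<Omega>:
  assumes J: "finite J" "J \<subseteq> dyadic"
  shows "distr \<Omega> (PiM J (\<lambda>_. borel)) (\<lambda>\<omega>. restrict \<omega> J) = fdd J"
proof (rule measure_eqI)
  interpret polish_projective dyadic fdd by (rule projective_fdd)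
  show "sets (distr \<Omega> (PiM J (\<lambda>_. borel)) (\<lambda>\<omega>. restrict \<omega> J)) = sets (fdd J)"
    using sets_P[OF J] by simp
  fix A assume "A \<in> sets (distr \<Omega> (PiM J (\<lambda>_. borel)) (\<lambda>\<omega>. restrict \<omega> J))"
  then have A: "A \<in> sets (PiM J (\<lambda>_. borel))" by simp
  have "emeasure (distr \<Omega> (PiM J (\<lambda>_. borel)) (\<lambda>\<omega>. restrict \<omega> J)) A
      = emeasure \<Omega> ((\<lambda>\<omega>. restrict \<omega> J) -` A \<inter> space \<Omega>)"
    using A J by (intro emeasure_distr) (auto simp: measurable_cong_sets[OF sets_\<Omega> refl] intro: measurable_restrict_subset)
  also have "(\<lambda>\<omega>. restrict \<omega> J) -` A \<inter> space \<Omega> = prod_emb dyadic (\<lambda>_. borel) J A"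
    by (auto simp: prod_emb_def sets_eq_imp_space_eq[OF sets_\<Omega>] space_PiM)
  also have "emeasure \<Omega> (prod_emb dyadic (\<lambda>_. borel) J A) = emeasure (fdd J) A"
    unfolding \<Omega>_def by (rule emeasure_lim_emb[OF J(2,1) A])
  finally show "emeasure (distr \<Omega> (PiM J (\<lambda>_. borel)) (\<lambda>\<omega>. restrict \<omega> J)) A = emeasure (fdd J) A" .
qed

lemma measurable_\<Omega>_component [measurable]: "q \<in> dyadic \<Longrightarrow> (\<lambda>\<omega>. \<omega> q) \<in> borel_measurable \<Omega>"
  by (auto simp: measurable_cong_sets[OF sets_\<Omega> refl] intro: measurable_component_singleton)

lemma measurable_increment [measurable]: "increment m i \<in> borel_measurable \<Omega>"
  unfolding increment_def[abs_def]
  by (intro borel_measurable_diff measurable_\<Omega>_component dyadic_I)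

lemma distr_\<Omega>_image:
  assumes J: "finite J" "J \<subseteq> grid m" and f: "f \<in> PiM J (\<lambda>_. borel) \<rightarrow>\<^sub>M N"
  shows "distr \<Omega> N (\<lambda>\<omega>. f (restrict \<omega> J)) = distr (W m) N (\<lambda>w. f (\<lambda>q\<in>J. walk_path m w q))"
proof -
  have J': "J \<subseteq> dyadic" using J by (auto simp: dyadic_def)
  have "distr \<Omega> N (\<lambda>\<omega>. f (restrict \<omega> J)) = distr (distr \<Omega> (PiM J (\<lambda>_. borel)) (\<lambda>\<omega>. restrict \<omega> J)) N f"
    using J' f by (subst distr_distr) (auto simp: comp_def measurable_cong_sets[OF sets_\<Omega> refl] intro: measurable_restrict_subset)
  also have "\<dots> = distr (fdd_level m J) N f" by (simp only: distr_\<Omega>[OF J(1) J'] fdd_eq[OF J(2)])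
  also have "\<dots> = distr (W m) N (\<lambda>w. f (\<lambda>q\<in>J. walk_path m w q))"
    unfolding fdd_level_def using f by (subst distr_distr) (auto simp: comp_def)
  finally show ?thesis .
qed

lemma AE_start: "AE \<omega> in \<Omega>. \<omega> 0 = 0"
proof -
  have z: "{0} \<subseteq> grid 0" using grid_I[of 0 0] by simp
  interpret W: prob_space "W m" for m by (intro prob_space_PiM prob_\<nu>) simp
  have "distr \<Omega> borel (\<lambda>\<omega>. (restrict \<omega> {0}) 0) = distr (W 0) borel (\<lambda>w. (\<lambda>q\<in>{0}. walk_path 0 w q) 0)"
    by (rule distr_\<Omega>_image[OF _ z]) auto
  then have eq: "distr \<Omega> borel (\<lambda>\<omega>. \<omega> 0) = distr (W 0) borel (\<lambda>w. 0)"
    by (simp add: walk_path_def)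
  have "AE x in distr \<Omega> borel (\<lambda>\<omega>. \<omega> 0). x = 0"
    unfolding eq by (subst AE_distr_iff) auto
  then show ?thesis using dyadic_I[of 0 0] by (subst (asm) AE_distr_iff) auto
qed

lemma increments_distr:
  assumes J: "finite (J :: nat set)"
  shows "distr \<Omega> (PiM J (\<lambda>_. borel)) (\<lambda>\<omega>. \<lambda>j\<in>J. increment m j \<omega>) = distr (W m) (PiM J (\<lambda>_. borel)) (\<lambda>w. \<lambda>j\<in>J. w j)"
proof -
  define K where "K = (\<lambda>i. real i / 2 ^ m) ` (J \<union> Suc ` J)"
  have K: "finite K" "K \<subseteq> grid m" using J by (auto simp: K_def intro: grid_I)
  have mem: "real j / 2 ^ m \<in> K" "real (Suc j) / 2 ^ m \<in> K" if "j \<in> J" for j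
    using that by (auto simp: K_def simp del: of_nat_Suc)
  have "(\<lambda>g. \<lambda>j\<in>J. increment m j g) \<in> PiM K (\<lambda>_. borel) \<rightarrow>\<^sub>M PiM J (\<lambda>_. borel :: 'a measure)"
    unfolding increment_def using mem by (intro measurable_restrict borel_measurable_diff measurable_component_singleton)
  from distr_\<Omega>_image[OF K this]
  have "distr \<Omega> (PiM J (\<lambda>_. borel)) (\<lambda>\<omega>. \<lambda>j\<in>J. increment m j (restrict \<omega> K))
     = distr (W m) (PiM J (\<lambda>_. borel)) (\<lambda>w. \<lambda>j\<in>J. increment m j (\<lambda>q\<in>K. walk_path m w q))" .
  moreover have "(\<lambda>j\<in>J. increment m j (restrict \<omega> K)) = (\<lambda>j\<in>J. increment m j \<omega>)" for \<omega> :: "real \<Rightarrow> 'a"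
    using mem by (auto simp: fun_eq_iff increment_def simp del: of_nat_Suc)
  moreover have "(\<lambda>j\<in>J. increment m j (\<lambda>q\<in>K. walk_path m w q)) = (\<lambda>j\<in>J. w j)" for w :: "nat \<Rightarrow> 'a"
    using mem by (auto simp: fun_eq_iff increment_def walk_path_grid simp del: of_nat_Suc)
  ultimately show ?thesis by simp
qed

text \<open>The extension determines only finitely many coordinates at a time, so the law of the
  whole sequence of increments is identified on cylinder sets.\<close>

lemma walk_increment: "walk \<Omega> ((1 / 2) ^ m) (increment m)"
proof -
  interpret \<Omega>: prob_space \<Omega> by (rule prob_space_\<Omega>)
  let ?\<delta> = "(1 / 2 :: real) ^ m"
  have \<delta>: "?\<delta> \<ge> 0" by simp
  note sets_\<nu>[OF \<delta>, measurable_cong]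
  interpret product_prob_space "\<lambda>_. \<nu> ?\<delta>" "UNIV :: nat set" by (intro product_prob_spaceI prob_\<nu> \<delta>)
  have D: "distr \<Omega> (PiM UNIV (\<lambda>_. borel)) (\<lambda>\<omega> i. increment m i \<omega>) = W m"
  proof (rule PiM_eq)
    fix J :: "nat set" and F assume J: "finite J" and F: "\<And>j. j \<in> J \<Longrightarrow> F j \<in> sets (\<nu> ?\<delta>)"
    have F': "PiE J F \<in> sets (PiM J (\<lambda>_. borel))"
      using F by (intro sets_PiM_I_finite J) (simp add: sets_\<nu>)
    have Fe: "prod_emb UNIV (\<lambda>_. \<nu> ?\<delta>) J (PiE J F) \<in> sets (PiM UNIV (\<lambda>_. borel))"
      using F J by (subst sets_W[of m, symmetric]) (intro sets_PiM_I, auto)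
    have sp: "space (\<nu> ?\<delta>) = UNIV" using sets_eq_imp_space_eq[OF sets_\<nu>[OF \<delta>]] by simp
    have Xi: "(\<lambda>\<omega> i. increment m i \<omega>) \<in> \<Omega> \<rightarrow>\<^sub>M PiM UNIV (\<lambda>_. borel)"
      by (intro measurable_PiM_single') auto
    have "emeasure (distr \<Omega> (PiM UNIV (\<lambda>_. borel)) (\<lambda>\<omega> i. increment m i \<omega>)) (prod_emb UNIV (\<lambda>_. \<nu> ?\<delta>) J (PiE J F))
      = emeasure \<Omega> ((\<lambda>\<omega> i. increment m i \<omega>) -` prod_emb UNIV (\<lambda>_. \<nu> ?\<delta>) J (PiE J F) \<inter> space \<Omega>)"
      by (rule emeasure_distr[OF Xi Fe])
    also have "(\<lambda>\<omega> i. increment m i \<omega>) -` prod_emb UNIV (\<lambda>_. \<nu> ?\<delta>) J (PiE J F) \<inter> space \<Omega>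
      = (\<lambda>\<omega>. \<lambda>j\<in>J. increment m j \<omega>) -` PiE J F \<inter> space \<Omega>"
      by (auto simp: prod_emb_def sp restrict_def)
    also have "emeasure \<Omega> \<dots> = emeasure (distr \<Omega> (PiM J (\<lambda>_. borel)) (\<lambda>\<omega>. \<lambda>j\<in>J. increment m j \<omega>)) (PiE J F)"
      using F' by (subst emeasure_distr) (auto intro!: measurable_restrict)
    also have "\<dots> = emeasure (distr (W m) (PiM J (\<lambda>_. borel)) (\<lambda>w. \<lambda>j\<in>J. w j)) (PiE J F)"
      by (simp only: increments_distr[OF J])
    also have "\<dots> = emeasure (W m) ((\<lambda>w. \<lambda>j\<in>J. w j) -` PiE J F \<inter> space (W m))"
      using F' by (subst emeasure_distr) (auto intro!: measurable_restrict)
    also have "(\<lambda>w. \<lambda>j\<in>J. w j) -` PiE J F \<inter> space (W m) = prod_emb UNIV (\<lambda>_. \<nu> ?\<delta>) J (PiE J F)"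
      by (auto simp: prod_emb_def space_PiM)
    also have "emeasure (W m) \<dots> = (\<Prod>j\<in>J. emeasure (\<nu> ?\<delta>) (F j))"
      using F J by (intro emeasure_PiM_emb) auto
    finally show "emeasure (distr \<Omega> (PiM UNIV (\<lambda>_. borel)) (\<lambda>\<omega> i. increment m i \<omega>)) (prod_emb UNIV (\<lambda>_. \<nu> ?\<delta>) J (PiE J F))
      = (\<Prod>j\<in>J. emeasure (\<nu> ?\<delta>) (F j))" .
  qed (simp add: sets_W)
  have laws: "distr \<Omega> borel (increment m i) = \<nu> ?\<delta>" for i
  proof -
    have "distr \<Omega> borel (increment m i) = distr (distr \<Omega> (PiM UNIV (\<lambda>_. borel)) (\<lambda>\<omega> i. increment m i \<omega>)) borel (\<lambda>w. w i)"
      by (subst distr_distr) (auto simp: comp_def intro!: measurable_PiM_single')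
    also have "\<dots> = \<nu> ?\<delta>" unfolding D using walk_PiM[OF \<delta>] by (simp add: walk_def)
    finally show ?thesis .
  qed
  have "\<Omega>.indep_vars (\<lambda>_. borel) (increment m) UNIV"
    by (subst \<Omega>.indep_vars_iff_distr_eq_PiM) (auto simp: laws restrict_UNIV D)
  then show ?thesis using laws \<Omega>.prob_space_axioms by (simp add: walk_def)
qed

end

section \<open>Oscillations and one-sided limits of dyadic paths\<close>

definition osc_bounded :: "(real \<Rightarrow> 'a::real_normed_vector) \<Rightarrow> real \<Rightarrow> real \<Rightarrow> real \<Rightarrow> bool" where
  "osc_bounded f \<epsilon> a b \<longleftrightarrow> (\<exists>K. \<forall>p c.
     (\<forall>i\<le>p. c i \<in> dyadic \<and> a \<le> c i \<and> c i \<le> b) \<and> (\<forall>i<p. c i < c (Suc i)) \<and>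
     (\<forall>i<p. norm (f (c (Suc i)) - f (c i)) > 2 * \<epsilon>) \<longrightarrow> p \<le> (K::nat))"

text \<open>A chain has finitely many points and hence lies on some grid and on all finer ones. A
  bound that holds for infinitely many levels is therefore enough, and this weak form is what
  Fatou's lemma delivers.\<close>

lemma osc_bounded_I:
  fixes f :: "real \<Rightarrow> 'a::real_normed_vector"
  assumes "\<epsilon> \<ge> 0"
    and K: "\<And>n0. \<exists>n\<ge>n0. greedy_count \<epsilon> (2 ^ n) 0 (\<lambda>i. increment (l + n) (j * 2 ^ n + i) f) \<le> K"
  shows "osc_bounded f \<epsilon> (real j / 2 ^ l) (real (Suc j) / 2 ^ l)"
  unfolding osc_bounded_def
proof (intro exI[of _ K] allI impI, elim conjE)
  fix p :: nat and c :: "nat \<Rightarrow> real"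
  assume c: "\<forall>i\<le>p. c i \<in> dyadic \<and> real j / 2 ^ l \<le> c i \<and> c i \<le> real (Suc j) / 2 ^ l"
    and mono: "\<forall>i<p. c i < c (Suc i)" and jump: "\<forall>i<p. norm (f (c (Suc i)) - f (c i)) > 2 * \<epsilon>"
  have "finite (c ` {..p})" "c ` {..p} \<subseteq> dyadic" using c by auto
  from finite_dyadic_grid[OF this] obtain m0 where m0: "c ` {..p} \<subseteq> grid m0" by blast
  obtain n where n: "n \<ge> m0" "greedy_count \<epsilon> (2 ^ n) 0 (\<lambda>i. increment (l + n) (j * 2 ^ n + i) f) \<le> K"
    using K by blast
  let ?m = "l + n" and ?a = "j * 2 ^ n"
  have "c i \<in> grid ?m" if "i \<le> p" for i
    using m0 grid_mono[of m0 ?m] n that by auto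
  then have "\<forall>i. \<exists>k. i \<le> p \<longrightarrow> c i = real k / 2 ^ ?m" by (auto simp: grid_def)
  then obtain k where k: "\<And>i. i \<le> p \<Longrightarrow> c i = real (k i) / 2 ^ ?m" by metis
  have bounds: "?a \<le> k i" "k i \<le> ?a + 2 ^ n" if "i \<le> p" for i
  proof -
    have "real ?a / 2 ^ ?m \<le> real (k i) / 2 ^ ?m" "real (k i) / 2 ^ ?m \<le> real (?a + 2 ^ n) / 2 ^ ?m"
    proof -
      have "real ?a / 2 ^ ?m = real j / 2 ^ l" by (simp add: power_add)
      moreover have "real (?a + 2 ^ n) = real (Suc j) * 2 ^ n" by (simp add: algebra_simps)
      then have "real (?a + 2 ^ n) / 2 ^ ?m = real (Suc j) / 2 ^ l" by (simp add: power_add)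
      ultimately show "real ?a / 2 ^ ?m \<le> real (k i) / 2 ^ ?m" "real (k i) / 2 ^ ?m \<le> real (?a + 2 ^ n) / 2 ^ ?m"
        using c k[OF that] that by (metis, metis)
    qed
    then show "?a \<le> k i" "k i \<le> ?a + 2 ^ n"
      by (simp_all only: divide_le_cancel of_nat_le_iff) auto
  qed
  have "p \<le> greedy_count \<epsilon> (2 ^ n) 0 (\<lambda>i. increment ?m (?a + i) f)"
  proof (rule greedy_count_ge[where c = "\<lambda>i. k i - ?a"])
    show "k i - ?a < k (Suc i) - ?a" if "i < p" for i
    proof -
      have "real (k i) / 2 ^ ?m < real (k (Suc i)) / 2 ^ ?m"
        using mono that k[of i] k[of "Suc i"] by auto
      then have "k i < k (Suc i)" by (simp add: divide_less_cancel)
      then show ?thesis using bounds(1)[of i] that by (intro diff_less_mono) auto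
    qed
    show "k p - ?a \<le> 2 ^ n" using bounds(2)[of p] by simp
    show "norm ((\<Sum>i<k (Suc i) - ?a. increment ?m (?a + i) f) - (\<Sum>i<k i - ?a. increment ?m (?a + i) f)) > 2 * \<epsilon>"
      if "i < p" for i
      using jump[rule_format, OF that] that k[of i] k[of "Suc i"] bounds(1)[of i] bounds(1)[of "Suc i"]
      by (simp add: sum_increment del: of_nat_add)
  qed (rule assms(1))
  with n(2) show "p \<le> K" by simp
qed

text \<open>An infinite chain is cut off after more than \<open>K\<close> jumps; a decreasing one is
  first read backwards.\<close>

lemma osc_bounded_no_chain:
  assumes "osc_bounded f \<epsilon> a b"
    and c: "\<And>i. c i \<in> dyadic \<and> a \<le> c i \<and> c i \<le> b" "\<And>i. norm (f (c (Suc i)) - f (c i)) > 2 * \<epsilon>"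
    and mono: "(\<forall>i. c i < c (Suc i)) \<or> (\<forall>i. c (Suc i) < c i)"
  shows False
proof -
  obtain K where K: "\<And>p c. \<forall>i\<le>p. c i \<in> dyadic \<and> a \<le> c i \<and> c i \<le> b \<Longrightarrow> \<forall>i<p. c i < c (Suc i) \<Longrightarrow>
      \<forall>i<p. norm (f (c (Suc i)) - f (c i)) > 2 * \<epsilon> \<Longrightarrow> p \<le> (K::nat)"
    using assms(1) unfolding osc_bounded_def by metis
  from mono show False
  proof
    assume "\<forall>i. c i < c (Suc i)"
    then show False using K[of "Suc K" c] c by auto
  next
    assume dec: "\<forall>i. c (Suc i) < c i"
    have "c (Suc K - i) < c (Suc K - Suc i) \<and> norm (f (c (Suc K - Suc i)) - f (c (Suc K - i))) > 2 * \<epsilon>"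
      if "i < Suc K" for i
    proof -
      have "Suc K - i = Suc (Suc K - Suc i)" using that by simp
      then show ?thesis using dec c(2)[of "Suc K - Suc i"] by (simp add: norm_minus_commute)
    qed
    then show False using K[of "Suc K" "\<lambda>i. c (Suc K - i)"] c(1) by auto
  qed
qed

lemma dyadic_between:
  assumes "0 \<le> s" "s < t"
  obtains q where "q \<in> dyadic" "s < q" "q < t"
proof -
  obtain m where m: "1 / (t - s) < 2 ^ m" using real_arch_pow[of 2 "1 / (t - s)"] by auto
  define k where "k = nat \<lfloor>s * 2 ^ m\<rfloor> + 1"
  have "s * 2 ^ m < real k" "real k \<le> s * 2 ^ m + 1"
    using assms by (auto simp: k_def) linarith+
  moreover have "1 < (t - s) * 2 ^ m" using m assms by (simp add: field_simps)
  ultimately have "s < real k / 2 ^ m" "real k / 2 ^ m < t"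
    by (auto simp: field_simps)
  then show thesis using that dyadic_I by blast
qed

text \<open>If the oscillation at \<open>t\<close> did not vanish, one could pick a sequence tending to \<open>t\<close> with
  infinitely many jumps.\<close>

lemma osc_bounded_right:
  fixes f :: "real \<Rightarrow> 'a::real_normed_vector"
  assumes osc: "osc_bounded f \<epsilon> a b" and t: "0 \<le> a" "a \<le> t" "t < b"
  shows "\<exists>\<delta>>0. \<forall>q\<in>dyadic \<inter> {t<..<t + \<delta>}. \<forall>q'\<in>dyadic \<inter> {t<..<t + \<delta>}. norm (f q - f q') \<le> 4 * \<epsilon>"
proof (rule ccontr)
  assume not: "\<not> ?thesis"
  have step: "\<exists>s'. (s' \<in> dyadic \<and> t < s' \<and> s' < b) \<and> s' < s \<and> norm (f s' - f s) > 2 * \<epsilon>" if "s \<in> dyadic \<and> t < s \<and> s < b" for s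
  proof -
    have "s - t > 0" using that by simp
    with not have "\<not> (\<forall>q\<in>dyadic \<inter> {t<..<t + (s - t)}. \<forall>q'\<in>dyadic \<inter> {t<..<t + (s - t)}. norm (f q - f q') \<le> 4 * \<epsilon>)"
      by blast
    then obtain q q' where q: "q \<in> dyadic" "q' \<in> dyadic" "t < q" "q < s" "t < q'" "q' < s" "norm (f q - f q') > 4 * \<epsilon>"
      by (auto simp: not_le)
    \<comment> \<open>Of two values more than \<open>4 * \<epsilon>\<close> apart, at least one is
      more than \<open>2 * \<epsilon>\<close> away from the value at \<open>s\<close>. It extends
      the chain.\<close>
    have "norm (f q - f q') \<le> norm (f q - f s) + norm (f q' - f s)"
      using norm_triangle_ineq4[of "f q - f s" "f q' - f s"] by simp
    then have "norm (f q - f s) > 2 * \<epsilon> \<or> norm (f q' - f s) > 2 * \<epsilon>" using q(7) by linarith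
    then show ?thesis using q that by (metis less_trans)
  qed
  have ex: "\<exists>s. s \<in> dyadic \<and> t < s \<and> s < b" using dyadic_between[of t b] t by auto
  from dependent_nat_choice[where P = "\<lambda>_ s. s \<in> dyadic \<and> t < s \<and> s < b" and Q = "\<lambda>_ s s'. s' < s \<and> norm (f s' - f s) > 2 * \<epsilon>",
      OF ex step]
  obtain c where c: "\<And>n. c n \<in> dyadic \<and> t < c n \<and> c n < b" "\<And>n. c (Suc n) < c n \<and> norm (f (c (Suc n)) - f (c n)) > 2 * \<epsilon>"
    by auto
  show False
  proof (rule osc_bounded_no_chain[OF osc, of c])
    show "c i \<in> dyadic \<and> a \<le> c i \<and> c i \<le> b" for i using c(1)[of i] t by auto
  qed (use c(2) in auto)
qed

lemma osc_bounded_left: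
  fixes f :: "real \<Rightarrow> 'a::real_normed_vector"
  assumes osc: "osc_bounded f \<epsilon> a b" and t: "0 \<le> a" "a < t" "t \<le> b"
  shows "\<exists>\<delta>>0. \<forall>q\<in>dyadic \<inter> {t - \<delta><..<t}. \<forall>q'\<in>dyadic \<inter> {t - \<delta><..<t}. norm (f q - f q') \<le> 4 * \<epsilon>"
proof (rule ccontr)
  assume not: "\<not> ?thesis"
  have step: "\<exists>s'. (s' \<in> dyadic \<and> a < s' \<and> s' < t) \<and> s < s' \<and> norm (f s' - f s) > 2 * \<epsilon>" if "s \<in> dyadic \<and> a < s \<and> s < t" for s
  proof -
    have "t - s > 0" using that by simp
    with not have "\<not> (\<forall>q\<in>dyadic \<inter> {t - (t - s)<..<t}. \<forall>q'\<in>dyadic \<inter> {t - (t - s)<..<t}. norm (f q - f q') \<le> 4 * \<epsilon>)"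
      by blast
    then obtain q q' where q: "q \<in> dyadic" "q' \<in> dyadic" "s < q" "q < t" "s < q'" "q' < t" "norm (f q - f q') > 4 * \<epsilon>"
      by (auto simp: not_le)
    have "norm (f q - f q') \<le> norm (f q - f s) + norm (f q' - f s)"
      using norm_triangle_ineq4[of "f q - f s" "f q' - f s"] by simp
    then have "norm (f q - f s) > 2 * \<epsilon> \<or> norm (f q' - f s) > 2 * \<epsilon>" using q(7) by linarith
    then show ?thesis using q that by (metis less_trans)
  qed
  have ex: "\<exists>s. s \<in> dyadic \<and> a < s \<and> s < t" using dyadic_between[of a t] t by auto
  from dependent_nat_choice[where P = "\<lambda>_ s. s \<in> dyadic \<and> a < s \<and> s < t" and Q = "\<lambda>_ s s'. s < s' \<and> norm (f s' - f s) > 2 * \<epsilon>",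
      OF ex step]
  obtain c where c: "\<And>n. c n \<in> dyadic \<and> a < c n \<and> c n < t" "\<And>n. c n < c (Suc n) \<and> norm (f (c (Suc n)) - f (c n)) > 2 * \<epsilon>"
    by auto
  show False
  proof (rule osc_bounded_no_chain[OF osc, of c])
    show "c i \<in> dyadic \<and> a \<le> c i \<and> c i \<le> b" for i using c(1)[of i] t by auto
  qed (use c(2) in auto)
qed

text \<open>The added 1 makes the approximation strictly larger than \<open>t\<close> even when
  \<open>t\<close> is dyadic, so limits along it are genuine right limits.\<close>

definition next_dyadic :: "nat \<Rightarrow> real \<Rightarrow> real" where
  "next_dyadic m t = real (nat \<lfloor>t * 2 ^ m\<rfloor> + 1) / 2 ^ m"

lemma next_dyadic:
  assumes "t \<ge> 0"
  shows "t < next_dyadic m t" "next_dyadic m t \<le> t + 1 / 2 ^ m" "next_dyadic m t \<in> dyadic"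
proof -
  have "t * 2 ^ m < real (nat \<lfloor>t * 2 ^ m\<rfloor> + 1)" "real (nat \<lfloor>t * 2 ^ m\<rfloor> + 1) \<le> t * 2 ^ m + 1"
  proof -
    have "t * 2 ^ m \<ge> 0" using assms by simp
    then show "t * 2 ^ m < real (nat \<lfloor>t * 2 ^ m\<rfloor> + 1)" "real (nat \<lfloor>t * 2 ^ m\<rfloor> + 1) \<le> t * 2 ^ m + 1"
      by linarith+
  qed
  then show "t < next_dyadic m t" "next_dyadic m t \<le> t + 1 / 2 ^ m"
    unfolding next_dyadic_def by (simp_all add: less_divide_eq divide_le_eq distrib_right)
qed (unfold next_dyadic_def, rule dyadic_I)

lemma next_dyadic_tendsto: "t \<ge> 0 \<Longrightarrow> (\<lambda>m. next_dyadic m t) \<longlonglongrightarrow> t"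
proof (rule tendsto_sandwich)
  assume "t \<ge> 0"
  then show "\<forall>\<^sub>F m in sequentially. t \<le> next_dyadic m t" "\<forall>\<^sub>F m in sequentially. next_dyadic m t \<le> t + (1 / 2) ^ m"
    using next_dyadic[of t] by (auto simp: power_one_over less_imp_le intro!: always_eventually)
  show "(\<lambda>m. t + (1 / 2) ^ m) \<longlonglongrightarrow> t"
    using tendsto_add[OF tendsto_const LIMSEQ_realpow_zero[of "1 / 2"], of t] by simp
qed simp

text \<open>One explicit sequence of dyadic times makes the value measurable in the path; on
  irregular paths it is whatever \<open>lim\<close> returns.\<close>

definition right_limit :: "(real \<Rightarrow> 'a::real_normed_vector) \<Rightarrow> real \<Rightarrow> 'a" where
  "right_limit f t = lim (\<lambda>m. f (next_dyadic m t))"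

definition regular_path :: "(real \<Rightarrow> 'a::real_normed_vector) \<Rightarrow> bool" where
  "regular_path f \<longleftrightarrow> (\<forall>\<epsilon>>0. \<exists>l. \<forall>j. osc_bounded f \<epsilon> (real j / 2 ^ l) (real (Suc j) / 2 ^ l))"

lemma regular_path_right:
  assumes "regular_path f" "t \<ge> 0" "e > 0"
  shows "\<exists>\<delta>>0. \<forall>q\<in>dyadic \<inter> {t<..<t + \<delta>}. \<forall>q'\<in>dyadic \<inter> {t<..<t + \<delta>}. norm (f q - f q') \<le> e"
proof -
  have "e / 4 > 0" using assms(3) by simp
  with assms(1) obtain l where l: "\<And>j. osc_bounded f (e / 4) (real j / 2 ^ l) (real (Suc j) / 2 ^ l)"
    unfolding regular_path_def by blast
  define j where "j = nat \<lfloor>t * 2 ^ l\<rfloor>"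
  have "t * 2 ^ l \<ge> 0" using assms(2) by simp
  then have "real j \<le> t * 2 ^ l" "t * 2 ^ l < real (Suc j)" unfolding j_def by linarith+
  then have "real j / 2 ^ l \<le> t" "t < real (Suc j) / 2 ^ l"
    by (simp_all add: less_divide_eq divide_le_eq)
  from osc_bounded_right[OF l _ this] show ?thesis by simp
qed

lemma regular_path_left:
  assumes "regular_path f" "t > 0" "e > 0"
  shows "\<exists>\<delta>>0. \<forall>q\<in>dyadic \<inter> {t - \<delta><..<t}. \<forall>q'\<in>dyadic \<inter> {t - \<delta><..<t}. norm (f q - f q') \<le> e"
proof -
  have "e / 4 > 0" using assms(3) by simp
  with assms(1) obtain l where l: "\<And>j. osc_bounded f (e / 4) (real j / 2 ^ l) (real (Suc j) / 2 ^ l)"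
    unfolding regular_path_def by blast
  \<comment> \<open>A left limit at \<open>t\<close> needs room below \<open>t\<close>, so the
    interval is open on the left and closed on the right; hence the ceiling instead of the
    floor.\<close>
  define j where "j = nat (\<lceil>t * 2 ^ l\<rceil> - 1)"
  have "t * 2 ^ l > 0" using assms(2) by simp
  then have "real j < t * 2 ^ l" "t * 2 ^ l \<le> real (Suc j)" unfolding j_def by linarith+
  then have "real j / 2 ^ l < t" "t \<le> real (Suc j) / 2 ^ l"
    by (simp_all add: le_divide_eq divide_less_eq)
  from osc_bounded_left[OF l _ this] show ?thesis by simp
qed

lemma right_limit_tendsto:
  fixes f :: "real \<Rightarrow> 'a::banach"
  assumes "regular_path f" "t \<ge> 0"
  shows "(\<lambda>m. f (next_dyadic m t)) \<longlonglongrightarrow> right_limit f t"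
proof -
  have "Cauchy (\<lambda>m. f (next_dyadic m t))"
  proof (rule metric_CauchyI)
    fix e :: real assume "e > 0"
    then have "e / 2 > 0" by simp
    from regular_path_right[OF assms this] obtain \<delta> where \<delta>: "\<delta> > 0"
      "\<And>q q'. q \<in> dyadic \<inter> {t<..<t + \<delta>} \<Longrightarrow> q' \<in> dyadic \<inter> {t<..<t + \<delta>} \<Longrightarrow> norm (f q - f q') \<le> e / 2" by blast
    have "\<forall>\<^sub>F m in sequentially. next_dyadic m t < t + \<delta>"
      using next_dyadic_tendsto[OF assms(2)] by (rule order_tendstoD) (use \<delta> in simp)
    then obtain M where "\<And>m. m \<ge> M \<Longrightarrow> next_dyadic m t < t + \<delta>"
      by (auto simp: eventually_sequentially)
    then have M: "next_dyadic m t \<in> dyadic \<inter> {t<..<t + \<delta>}" if "m \<ge> M" for m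
      using next_dyadic[OF assms(2), of m] that by simp
    have "dist (f (next_dyadic m t)) (f (next_dyadic n t)) < e" if "m \<ge> M" "n \<ge> M" for m n
      using \<delta>(2)[OF M[OF that(1)] M[OF that(2)]] \<open>e > 0\<close> by (simp add: dist_norm)
    then show "\<exists>M. \<forall>m\<ge>M. \<forall>n\<ge>M. dist (f (next_dyadic m t)) (f (next_dyadic n t)) < e" by blast
  qed
  then show ?thesis
    unfolding right_limit_def by (simp add: Cauchy_convergent_iff convergent_LIMSEQ_iff)
qed

text \<open>Bounds at dyadic points carry over to right limits. Equality of \<open>u\<close> and
  \<open>s\<close> is allowed since the approximating times are strictly larger than
  \<open>s\<close>.\<close>

lemma right_limit_near:
  fixes f :: "real \<Rightarrow> 'a::banach"
  assumes f: "regular_path f" and s: "s \<ge> 0" "u \<le> s" "s < v"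
    and near: "\<And>q. q \<in> dyadic \<Longrightarrow> u < q \<Longrightarrow> q < v \<Longrightarrow> norm (f q - x) \<le> e"
  shows "norm (right_limit f s - x) \<le> e"
proof (rule tendsto_upperbound)
  show "(\<lambda>m. norm (f (next_dyadic m s) - x)) \<longlonglongrightarrow> norm (right_limit f s - x)"
    by (intro tendsto_intros right_limit_tendsto f s)
  have "\<forall>\<^sub>F m in sequentially. next_dyadic m s < v"
    using next_dyadic_tendsto[OF s(1)] by (rule order_tendstoD) (use s in simp)
  then show "\<forall>\<^sub>F m in sequentially. norm (f (next_dyadic m s) - x) \<le> e"
  proof (rule eventually_mono)
    fix m assume "next_dyadic m s < v"
    then show "norm (f (next_dyadic m s) - x) \<le> e"
      using next_dyadic[OF s(1), of m] s(2) by (intro near) auto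
  qed
qed simp

lemma cadlag_right_limit:
  fixes f :: "real \<Rightarrow> 'a::banach"
  assumes f: "regular_path f"
  shows "cadlag (right_limit f)"
  unfolding cadlag_def
proof (intro conjI allI impI)
  fix t :: real assume t: "t \<ge> 0"
  show "(right_limit f \<longlongrightarrow> right_limit f t) (at_right t)"
  proof (rule tendstoI)
    fix e :: real assume "e > 0"
    then have "e / 2 > 0" by simp
    from regular_path_right[OF f t this] obtain \<delta> where \<delta>: "\<delta> > 0"
      "\<And>q q'. q \<in> dyadic \<inter> {t<..<t + \<delta>} \<Longrightarrow> q' \<in> dyadic \<inter> {t<..<t + \<delta>} \<Longrightarrow> norm (f q - f q') \<le> e / 2" by blast
    have 1: "norm (right_limit f t - f q) \<le> e / 2" if "q \<in> dyadic" "t < q" "q < t + \<delta>" for q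
      by (rule right_limit_near[OF f t, of t "t + \<delta>"]) (use \<delta> that in auto)
    have 2: "norm (right_limit f s - right_limit f t) \<le> e / 2" if "t < s" "s < t + \<delta>" for s
      by (rule right_limit_near[OF f, of s t "t + \<delta>"]) (use 1 t that in \<open>auto simp: norm_minus_commute\<close>)
    have "dist (right_limit f s) (right_limit f t) < e" if "t < s" "s < t + \<delta>" for s
      using 2[OF that] \<open>e > 0\<close> by (simp add: dist_norm)
    then show "\<forall>\<^sub>F s in at_right t. dist (right_limit f s) (right_limit f t) < e"
      using \<delta>(1) unfolding eventually_at_right_field by (intro exI[of _ "t + \<delta>"]) auto
  qed
next
  fix t :: real assume t: "t > 0"
  have "cauchy_filter (filtermap (right_limit f) (at_left t))"
    unfolding cauchy_filter_metric_filtermap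
  proof (intro allI impI)
    fix e :: real assume "e > 0"
    then have "e / 2 > 0" by simp
    from regular_path_left[OF f t this] obtain \<delta> where \<delta>: "\<delta> > 0"
      "\<And>q q'. q \<in> dyadic \<inter> {t - \<delta><..<t} \<Longrightarrow> q' \<in> dyadic \<inter> {t - \<delta><..<t} \<Longrightarrow> norm (f q - f q') \<le> e / 2" by blast
    define u where "u = max 0 (t - \<delta>)"
    have u: "0 \<le> u" "t - \<delta> \<le> u" "u < t" using t \<delta>(1) by (auto simp: u_def)
    have 1: "norm (right_limit f s - f q) \<le> e / 2" if "q \<in> dyadic" "u < q" "q < t" "u < s" "s < t" for q s
      by (rule right_limit_near[OF f, of s u t]) (use \<delta>(2) u that in auto)
    have 2: "norm (right_limit f s - right_limit f s') \<le> e / 2" if "u < s" "s < t" "u < s'" "s' < t" for s s'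
      by (rule right_limit_near[OF f, of s u t]) (use 1[of _ s'] u that in \<open>auto simp: norm_minus_commute\<close>)
    have "dist (right_limit f s) (right_limit f s') < e" if "u < s" "s < t" "u < s'" "s' < t" for s s'
      using 2[OF that] \<open>e > 0\<close> by (simp add: dist_norm)
    moreover have "\<forall>\<^sub>F s in at_left t. u < s \<and> s < t"
      unfolding eventually_at_left_field using u(3) by blast
    ultimately show "\<exists>P. eventually P (at_left t) \<and> (\<forall>x y. P x \<and> P y \<longrightarrow> dist (right_limit f x) (right_limit f y) < e)"
      by (intro exI[of _ "\<lambda>s. u < s \<and> s < t"]) auto
  qed
  moreover have "filtermap (right_limit f) (at_left t) \<noteq> bot" by (simp add: filtermap_bot_iff)
  ultimately obtain l where "filtermap (right_limit f) (at_left t) \<le> nhds l"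
    using complete_UNIV[where 'a = 'a] unfolding complete_uniform by auto
  then show "\<exists>l. (right_limit f \<longlongrightarrow> l) (at_left t)" by (auto simp: filterlim_def)
qed

lemma osc_bounded_mono:
  assumes "osc_bounded f \<epsilon>' a b" "\<epsilon>' \<le> \<epsilon>"
  shows "osc_bounded f \<epsilon> a b"
proof -
  obtain K where K: "\<And>p c. \<forall>i\<le>p. c i \<in> dyadic \<and> a \<le> c i \<and> c i \<le> b \<Longrightarrow> \<forall>i<p. c i < c (Suc i) \<Longrightarrow>
      \<forall>i<p. norm (f (c (Suc i)) - f (c i)) > 2 * \<epsilon>' \<Longrightarrow> p \<le> (K::nat)"
    using assms(1) unfolding osc_bounded_def by metis
  show ?thesis
    unfolding osc_bounded_def
  proof (intro exI[of _ K] allI impI, elim conjE)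
    fix p and c :: "nat \<Rightarrow> real"
    assume *: "\<forall>i\<le>p. c i \<in> dyadic \<and> a \<le> c i \<and> c i \<le> b" "\<forall>i<p. c i < c (Suc i)"
      and "\<forall>i<p. norm (f (c (Suc i)) - f (c i)) > 2 * \<epsilon>"
    then have "\<forall>i<p. norm (f (c (Suc i)) - f (c i)) > 2 * \<epsilon>'" using assms(2) by fastforce
    with * show "p \<le> K" by (rule K)
  qed
qed

definition dyadic_index :: "nat \<Rightarrow> real \<Rightarrow> nat" where
  "dyadic_index m t = nat \<lfloor>t * 2 ^ m\<rfloor> + 1"

lemma next_dyadic_index: "next_dyadic m t = real (dyadic_index m t) / 2 ^ m"
  by (simp only: next_dyadic_def dyadic_index_def)

lemma dyadic_index_mono: "s \<le> t \<Longrightarrow> dyadic_index m s \<le> dyadic_index m t"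
  by (auto simp: dyadic_index_def intro!: nat_mono floor_mono)

lemma sum_increment_interval:
  "a \<le> b \<Longrightarrow> (\<Sum>i\<in>{a..<b}. increment m i \<omega>) = \<omega> (real b / 2 ^ m) - \<omega> (real a / 2 ^ m)"
  unfolding increment_def by (rule sum_Suc_diff')

section \<open>Regularity of the dyadic paths and the process of right limits\<close>

context levy_semigroup
begin

text \<open>Over an interval of length \<open>1 / 2 ^ l\<close> every partial sum of the increments
  has a law \<open>\<nu> t\<close> with \<open>t \<le> 1 / 2 ^ l\<close>, so the smallness condition
  of the counting lemma holds at every mesh. The bound 2 is independent of \<open>n\<close> because
  the probability in that lemma is at most 1.\<close>

lemma greedy_count_\<Omega>:
  assumes "\<epsilon> > 0" and l: "\<And>t. 0 \<le> t \<Longrightarrow> t \<le> 1 / 2 ^ l \<Longrightarrow> measure (\<nu> t) {y. norm y > \<epsilon> / 2} \<le> 1 / 4"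
  shows "(\<integral>\<^sup>+\<omega>. of_nat (greedy_count \<epsilon> (2 ^ n) 0 (\<lambda>i. increment (l + n) (a + i) \<omega>)) \<partial>\<Omega>) \<le> 2"
proof -
  define \<delta> where "\<delta> = (1 / 2 :: real) ^ (l + n)"
  have \<delta>: "\<delta> \<ge> 0" by (simp add: \<delta>_def)
  let ?W = "PiM UNIV (\<lambda>_::nat. \<nu> \<delta>)"
  interpret random_walk "\<nu> \<delta>" by (rule random_walk.intro) (auto simp: prob_\<nu> sets_\<nu> \<delta>)
  have w: "walk \<Omega> \<delta> (\<lambda>i. increment (l + n) (a + i))"
    unfolding \<delta>_def by (rule walk_shift[OF walk_increment])
  have Xi: "(\<lambda>\<omega> i. increment (l + n) (a + i) \<omega>) \<in> \<Omega> \<rightarrow>\<^sub>M PiM UNIV (\<lambda>_. borel)"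
    by (rule measurable_PiM_single') auto
  have "(\<integral>\<^sup>+\<omega>. of_nat (greedy_count \<epsilon> (2 ^ n) 0 (\<lambda>i. increment (l + n) (a + i) \<omega>)) \<partial>\<Omega>)
     = (\<integral>\<^sup>+w. of_nat (greedy_count \<epsilon> (2 ^ n) 0 w) \<partial>distr \<Omega> (PiM UNIV (\<lambda>_. borel)) (\<lambda>\<omega> i. increment (l + n) (a + i) \<omega>))"
    by (subst nn_integral_distr[OF Xi]) simp_all
  also have "\<dots> = (\<integral>\<^sup>+w. of_nat (greedy_count \<epsilon> (2 ^ n) 0 w) \<partial>?W)"
    by (simp only: walk_distr[OF w])
  also have "\<dots> \<le> 2 * (\<integral>\<^sup>+w. indicator {x. norm x > \<epsilon> / 2} (0 + (\<Sum>i<2 ^ n. w i)) \<partial>?W)"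
  proof (rule greedy_count_expectation)
    fix k :: nat assume k: "k < 2 ^ n"
    have [measurable]: "(\<lambda>w. \<Sum>i<k. w i) \<in> borel_measurable ?W"
      by (intro borel_measurable_sum walk_measurable[OF walk_PiM[OF \<delta>]])
    have "real k * \<delta> \<le> 2 ^ n * \<delta>" using k \<delta> by (intro mult_right_mono) auto
    then have t: "0 \<le> real k * \<delta>" "real k * \<delta> \<le> 1 / 2 ^ l"
      using \<delta> by (simp_all add: \<delta>_def power_add power_one_over)
    interpret \<nu>: prob_space "\<nu> (real k * \<delta>)" by (rule prob_\<nu>[OF t(1)])
    have "(\<integral>\<^sup>+w. indicator {x. norm x > \<epsilon> / 2} (\<Sum>i<k. w i) \<partial>?W)
       = (\<integral>\<^sup>+x. indicator {x. norm x > \<epsilon> / 2} x \<partial>distr ?W borel (\<lambda>w. \<Sum>i<k. w i))"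
      by (subst nn_integral_distr) auto
    also have "distr ?W borel (\<lambda>w. \<Sum>i<k. w i) = \<nu> (real k * \<delta>)"
      using walk_sum[OF walk_PiM[OF \<delta>], of "{..<k}"] by simp
    also have "(\<integral>\<^sup>+x. indicator {x. norm x > \<epsilon> / 2} x \<partial>\<nu> (real k * \<delta>)) = ennreal (measure (\<nu> (real k * \<delta>)) {x. norm x > \<epsilon> / 2})"
      by (subst nn_integral_indicator) (auto simp: sets_\<nu> t \<nu>.emeasure_eq_measure)
    also have "\<dots> \<le> ennreal (1 / 4)" by (intro ennreal_leI l t)
    finally show "(\<integral>\<^sup>+w. indicator {x. norm x > \<epsilon> / 2} (\<Sum>i<k. w i) \<partial>?W) \<le> ennreal (1 / 4)" .
  qed
  also have "\<dots> \<le> 2 * (\<integral>\<^sup>+w. 1 \<partial>?W)"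
    by (intro mult_left_mono nn_integral_mono) (auto simp: indicator_def)
  also have "\<dots> = 2" by (simp add: P.emeasure_space_1)
  finally show ?thesis .
qed

text \<open>The counts at all meshes have expectation at most 2. By Fatou their lower limit is
  almost surely finite, which bounds the count by one number at infinitely many levels.\<close>

lemma AE_osc_bounded:
  assumes "\<epsilon> > 0"
  shows "\<exists>l. \<forall>j. AE \<omega> in \<Omega>. osc_bounded \<omega> \<epsilon> (real j / 2 ^ l) (real (Suc j) / 2 ^ l)"
proof -
  obtain c where c: "c \<ge> 0" "\<And>t. t \<ge> 0 \<Longrightarrow> measure (\<nu> t) {y. norm y > \<epsilon> / 2} \<le> c * t"
    using small_\<nu>[of "\<epsilon> / 2"] assms by auto
  \<comment> \<open>This makes \<open>c / 2 ^ l\<close> at most \<open>1/4\<close>, the threshold of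
    the counting lemma.\<close>
  obtain l where l: "4 * c < 2 ^ l" using real_arch_pow[of 2 "4 * c"] by auto
  have small: "measure (\<nu> t) {y. norm y > \<epsilon> / 2} \<le> 1 / 4" if "0 \<le> t" "t \<le> 1 / 2 ^ l" for t
  proof -
    have "c * t \<le> c * (1 / 2 ^ l)" using that c by (intro mult_left_mono)
    also have "\<dots> \<le> 1 / 4" using l by (simp add: field_simps)
    finally show ?thesis using c(2)[OF that(1)] by linarith
  qed
  have "AE \<omega> in \<Omega>. osc_bounded \<omega> \<epsilon> (real j / 2 ^ l) (real (Suc j) / 2 ^ l)" for j
  proof -
    define N where "N n \<omega> = greedy_count \<epsilon> (2 ^ n) 0 (\<lambda>i. increment (l + n) (j * 2 ^ n + i) \<omega>)"
      for n and \<omega> :: "real \<Rightarrow> 'a"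
    have [measurable]: "(\<lambda>\<omega>. of_nat (N n \<omega>) :: ennreal) \<in> borel_measurable \<Omega>" for n
    proof -
      have "(\<lambda>\<omega> i. increment (l + n) (j * 2 ^ n + i) \<omega>) \<in> \<Omega> \<rightarrow>\<^sub>M PiM UNIV (\<lambda>_. borel)"
        by (rule measurable_PiM_single') auto
      from measurable_greedy_count'[OF this] show ?thesis unfolding N_def by simp
    qed
    have "(\<integral>\<^sup>+\<omega>. liminf (\<lambda>n. of_nat (N n \<omega>)) \<partial>\<Omega>) \<le> liminf (\<lambda>n. \<integral>\<^sup>+\<omega>. of_nat (N n \<omega>) \<partial>\<Omega>)"
      by (rule nn_integral_liminf) measurable
    also have "\<dots> \<le> liminf (\<lambda>n::nat. 2)"
      by (intro Liminf_mono always_eventually allI) (unfold N_def, rule greedy_count_\<Omega>[OF assms small])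
    also have "\<dots> < \<infinity>" by (simp add: Liminf_const)
    finally have "AE \<omega> in \<Omega>. liminf (\<lambda>n. of_nat (N n \<omega>)) \<noteq> (\<infinity> :: ennreal)"
      by (intro nn_integral_PInf_AE) auto
    then show ?thesis
    proof eventually_elim
      fix \<omega> assume "liminf (\<lambda>n. of_nat (N n \<omega>)) \<noteq> (\<infinity> :: ennreal)"
      then obtain K :: nat where K: "liminf (\<lambda>n. of_nat (N n \<omega>)) < (of_nat K :: ennreal)"
        using ennreal_Ex_less_of_nat by (metis infinity_ennreal_def less_top)
      have "\<exists>n\<ge>n0. N n \<omega> \<le> K" for n0
      proof (rule ccontr)
        assume "\<not> (\<exists>n\<ge>n0. N n \<omega> \<le> K)"
        then have "\<forall>n\<ge>n0. K \<le> N n \<omega>" by (meson linear)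
        then have "\<forall>\<^sub>F n in sequentially. (of_nat K :: ennreal) \<le> of_nat (N n \<omega>)"
          unfolding eventually_sequentially by (intro exI[of _ n0]) simp
        then have "(of_nat K :: ennreal) \<le> liminf (\<lambda>n. of_nat (N n \<omega>))" by (rule Liminf_bounded)
        with K show False by simp
      qed
      then show "osc_bounded \<omega> \<epsilon> (real j / 2 ^ l) (real (Suc j) / 2 ^ l)"
        using assms unfolding N_def by (intro osc_bounded_I[where K = K]) auto
    qed
  qed
  then show ?thesis by blast
qed

lemma AE_regular_path: "AE \<omega> in \<Omega>. regular_path \<omega>"
proof -
  have "\<forall>e::nat. \<exists>l. \<forall>j. AE \<omega> in \<Omega>. osc_bounded \<omega> (1 / real (Suc e)) (real j / 2 ^ l) (real (Suc j) / 2 ^ l)"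
    by (intro allI AE_osc_bounded) simp
  then obtain l where "\<And>e j. AE \<omega> in \<Omega>. osc_bounded \<omega> (1 / real (Suc e)) (real j / 2 ^ l e) (real (Suc j) / 2 ^ l e)"
    by metis
  then have "AE \<omega> in \<Omega>. \<forall>e j. osc_bounded \<omega> (1 / real (Suc e)) (real j / 2 ^ l e) (real (Suc j) / 2 ^ l e)"
    by (simp only: AE_all_countable) blast
  then show ?thesis
  proof eventually_elim
    fix \<omega> assume *: "\<forall>e j. osc_bounded \<omega> (1 / real (Suc e)) (real j / 2 ^ l e) (real (Suc j) / 2 ^ l e)"
    show "regular_path \<omega>"
      unfolding regular_path_def
    proof (intro allI impI)
      fix \<epsilon> :: real assume "\<epsilon> > 0"
      then obtain e where "1 / real (Suc e) < \<epsilon>" using nat_approx_posE by blast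
      then show "\<exists>l. \<forall>j. osc_bounded \<omega> \<epsilon> (real j / 2 ^ l) (real (Suc j) / 2 ^ l)"
        using * osc_bounded_mono less_imp_le by blast
    qed
  qed
qed

definition Y :: "real \<Rightarrow> (real \<Rightarrow> 'a) \<Rightarrow> 'a" where
  "Y t \<omega> = right_limit \<omega> t"

lemma measurable_next_dyadic [measurable]: "t \<ge> 0 \<Longrightarrow> (\<lambda>\<omega>. \<omega> (next_dyadic m t)) \<in> borel_measurable \<Omega>"
  by (intro measurable_\<Omega>_component next_dyadic)

lemma measurable_Y [measurable]: "t \<ge> 0 \<Longrightarrow> Y t \<in> borel_measurable \<Omega>"
  unfolding Y_def right_limit_def by (rule borel_measurable_lim_metric) measurable

lemma AE_Y_limit: "t \<ge> 0 \<Longrightarrow> AE \<omega> in \<Omega>. (\<lambda>m. \<omega> (next_dyadic m t)) \<longlonglongrightarrow> Y t \<omega>"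
  using AE_regular_path unfolding Y_def by eventually_elim (rule right_limit_tendsto)

lemma distr_dyadic_increment:
  assumes "a \<le> b"
  shows "distr \<Omega> borel (\<lambda>\<omega>. \<omega> (real b / 2 ^ m) - \<omega> (real a / 2 ^ m)) = \<nu> (real b / 2 ^ m - real a / 2 ^ m)"
proof -
  have "(real b - real a) * (1 / 2) ^ m = real b / 2 ^ m - real a / 2 ^ m"
    by (simp add: power_one_over diff_divide_distrib)
  then show ?thesis
    using walk_sum[OF walk_increment[of m], of "{a..<b}"] assms
    by (simp add: sum_increment_interval of_nat_diff)
qed

lemma cf_limit:
  assumes Z: "Z \<in> borel_measurable \<Omega>" and X: "\<And>m. X m \<in> borel_measurable \<Omega>"
    and lim: "AE \<omega> in \<Omega>. (\<lambda>m. X m \<omega>) \<longlonglongrightarrow> Z \<omega>"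
    and t: "\<And>m. t m \<ge> 0" "t \<longlonglongrightarrow> t'" "t' \<ge> 0" and law: "\<And>m. distr \<Omega> borel (X m) = \<nu> (t m)"
  shows "distr \<Omega> borel Z = \<nu> t'"
proof (rule eq_\<nu>_I)
  interpret prob_space \<Omega> by (rule prob_space_\<Omega>)
  show "prob_space (distr \<Omega> borel Z)" by (rule prob_space_distr[OF Z])
  fix v
  have "(\<lambda>m. cf (distr \<Omega> borel (X m)) v) \<longlonglongrightarrow> cf (distr \<Omega> borel Z) v"
    by (rule cf_tendsto[OF prob_space_axioms X Z lim])
  moreover have "(\<lambda>m. exp (of_real (t m) * \<psi> v)) \<longlonglongrightarrow> exp (of_real t' * \<psi> v)"
    by (intro tendsto_exp tendsto_mult tendsto_of_real tendsto_const t)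
  then have "(\<lambda>m. cf (distr \<Omega> borel (X m)) v) \<longlonglongrightarrow> exp (of_real t' * \<psi> v)"
    by (simp only: law cf_\<nu>[OF t(1)])
  ultimately show "cf (distr \<Omega> borel Z) v = exp (of_real t' * \<psi> v)" by (rule LIMSEQ_unique)
qed (use t in auto)

lemma distr_Y_increment:
  assumes "0 \<le> s" "s \<le> t"
  shows "distr \<Omega> borel (\<lambda>\<omega>. Y t \<omega> - Y s \<omega>) = \<nu> (t - s)"
proof (rule cf_limit)
  have t: "t \<ge> 0" using assms by simp
  note [measurable] = measurable_Y[OF assms(1)] measurable_Y[OF t]
    measurable_next_dyadic[OF assms(1)] measurable_next_dyadic[OF t]
  show "(\<lambda>\<omega>. Y t \<omega> - Y s \<omega>) \<in> borel_measurable \<Omega>" by measurable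
  show "(\<lambda>\<omega>. \<omega> (next_dyadic m t) - \<omega> (next_dyadic m s)) \<in> borel_measurable \<Omega>" for m by measurable
  show "AE \<omega> in \<Omega>. (\<lambda>m. \<omega> (next_dyadic m t) - \<omega> (next_dyadic m s)) \<longlonglongrightarrow> Y t \<omega> - Y s \<omega>"
    using AE_Y_limit[OF assms(1)] AE_Y_limit[OF t] by eventually_elim (rule tendsto_diff)
  show "0 \<le> next_dyadic m t - next_dyadic m s" for m
    using dyadic_index_mono[OF assms(2), of m] by (simp add: next_dyadic_index divide_right_mono)
  show "(\<lambda>m. next_dyadic m t - next_dyadic m s) \<longlonglongrightarrow> t - s"
    by (intro tendsto_diff next_dyadic_tendsto assms t)
  show "distr \<Omega> borel (\<lambda>\<omega>. \<omega> (next_dyadic m t) - \<omega> (next_dyadic m s)) = \<nu> (next_dyadic m t - next_dyadic m s)" for m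
    unfolding next_dyadic_index by (rule distr_dyadic_increment[OF dyadic_index_mono[OF assms(2)]])
qed (use assms in auto)

text \<open>\<open>Y 0\<close> is a limit over positive times, so it has to be compared with the
  coordinate at 0: their difference has law \<open>\<nu> 0\<close>, the unit mass at 0.\<close>

lemma AE_Y_0: "AE \<omega> in \<Omega>. Y 0 \<omega> = 0"
proof -
  have d0: "(\<lambda>\<omega>. \<omega> 0) \<in> borel_measurable \<Omega>" using dyadic_I[of 0 0] by (intro measurable_\<Omega>_component) simp
  note [measurable] = d0 measurable_Y[OF order_refl]
  have law: "distr \<Omega> borel (\<lambda>\<omega>. Y 0 \<omega> - \<omega> 0) = \<nu> 0"
  proof (rule cf_limit)
    show "AE \<omega> in \<Omega>. (\<lambda>m. \<omega> (next_dyadic m 0) - \<omega> 0) \<longlonglongrightarrow> Y 0 \<omega> - \<omega> 0"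
      using AE_Y_limit[OF order_refl] by eventually_elim (intro tendsto_intros)
    show "0 \<le> next_dyadic m 0" for m by (simp add: next_dyadic_index)
    show "(\<lambda>m. next_dyadic m 0) \<longlonglongrightarrow> 0" by (rule next_dyadic_tendsto) simp
    show "distr \<Omega> borel (\<lambda>\<omega>. \<omega> (next_dyadic m 0) - \<omega> 0) = \<nu> (next_dyadic m 0)" for m
      using distr_dyadic_increment[of 0 "dyadic_index m 0" m] by (simp add: next_dyadic_index)
    show "(\<lambda>\<omega>. \<omega> (next_dyadic m 0) - \<omega> 0) \<in> borel_measurable \<Omega>" for m
      by (intro borel_measurable_diff measurable_next_dyadic d0) simp
    show "(\<lambda>\<omega>. Y 0 \<omega> - \<omega> 0) \<in> borel_measurable \<Omega>"
      by (intro borel_measurable_diff measurable_Y d0) simp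
  qed simp
  have "AE x in distr \<Omega> borel (\<lambda>\<omega>. Y 0 \<omega> - \<omega> 0). x = 0"
    unfolding law \<nu>_0 by (subst AE_return) auto
  then have "AE \<omega> in \<Omega>. Y 0 \<omega> - \<omega> 0 = 0"
    by (subst (asm) AE_distr_iff) auto
  then show ?thesis using AE_start by eventually_elim simp
qed

lemma indep_Y_increments:
  fixes n :: nat and \<tau> :: "nat \<Rightarrow> real"
  assumes \<tau>: "0 \<le> \<tau> 0" "\<forall>i<n. \<tau> i < \<tau> (Suc i)"
  shows "prob_space.indep_vars \<Omega> (\<lambda>_. borel) (\<lambda>i \<omega>. Y (\<tau> (Suc i)) \<omega> - Y (\<tau> i) \<omega>) {..<n}"
proof -
  interpret prob_space \<Omega> by (rule prob_space_\<Omega>)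
  have mono: "\<tau> i \<le> \<tau> j" if "i \<le> j" "j \<le> n" for i j
    using that
  proof (induction j rule: dec_induct)
    case (step k)
    then have "\<tau> i \<le> \<tau> k" "\<tau> k < \<tau> (Suc k)" using \<tau>(2) by auto
    then show ?case by simp
  qed simp
  have pos: "0 \<le> \<tau> i" if "i \<le> n" for i using mono[of 0 i] \<tau>(1) that by simp
  show ?thesis
  proof (rule indep_vars_limit)
    fix m
    \<comment> \<open>The times are controlled only up to \<open>n\<close>; freezing the index there
      makes \<open>c\<close> monotone on all natural numbers, as the block lemma demands.\<close>
    define c where "c i = dyadic_index m (\<tau> (min i n))" for i
    have "mono c" unfolding mono_def c_def by (intro allI impI dyadic_index_mono mono) auto
    from indep_vars_subset[OF walk_blocks[OF walk_increment[of m] this], of "{..<n}"]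
    have "indep_vars (\<lambda>_. borel) (\<lambda>j \<omega>. \<Sum>i\<in>{c j..<c (Suc j)}. increment m i \<omega>) {..<n}" by simp
    moreover have "(\<Sum>i\<in>{c j..<c (Suc j)}. increment m i \<omega>) = \<omega> (next_dyadic m (\<tau> (Suc j))) - \<omega> (next_dyadic m (\<tau> j))"
      if "j \<in> {..<n}" for j and \<omega> :: "real \<Rightarrow> 'a"
    proof -
      have "c j = dyadic_index m (\<tau> j)" "c (Suc j) = dyadic_index m (\<tau> (Suc j))" "c j \<le> c (Suc j)"
        using that monoD[OF \<open>mono c\<close>, of j "Suc j"] by (auto simp: c_def min_def)
      then show ?thesis by (simp add: sum_increment_interval next_dyadic_index)
    qed
    ultimately show "indep_vars (\<lambda>_. borel) (\<lambda>j \<omega>. \<omega> (next_dyadic m (\<tau> (Suc j))) - \<omega> (next_dyadic m (\<tau> j))) {..<n}"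
      by (subst (asm) indep_vars_cong[OF refl _ refl]) auto
  next
    fix i assume i: "i \<in> {..<n}"
    have p: "0 \<le> \<tau> i" "0 \<le> \<tau> (Suc i)" using i by (auto intro: pos)
    show "(\<lambda>\<omega>. Y (\<tau> (Suc i)) \<omega> - Y (\<tau> i) \<omega>) \<in> borel_measurable \<Omega>"
      using p by measurable
    show "AE \<omega> in \<Omega>. (\<lambda>m. \<omega> (next_dyadic m (\<tau> (Suc i))) - \<omega> (next_dyadic m (\<tau> i))) \<longlonglongrightarrow> Y (\<tau> (Suc i)) \<omega> - Y (\<tau> i) \<omega>"
      using AE_Y_limit[OF p(1)] AE_Y_limit[OF p(2)] by eventually_elim (rule tendsto_diff)
  qed simp
qed

lemma measure_Y_increment_le:
  assumes "\<epsilon> > 0"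
  shows "\<exists>c\<ge>0. \<forall>s\<ge>0. \<forall>t\<ge>0. measure \<Omega> {\<omega>\<in>space \<Omega>. norm (Y s \<omega> - Y t \<omega>) > \<epsilon>} \<le> c * \<bar>s - t\<bar>"
proof -
  obtain c where c: "c \<ge> 0" "\<And>t. t \<ge> 0 \<Longrightarrow> measure (\<nu> t) {y. norm y > \<epsilon>} \<le> c * t"
    using small_\<nu>[OF assms] by blast
  have le: "measure \<Omega> {\<omega>\<in>space \<Omega>. norm (Y t \<omega> - Y s \<omega>) > \<epsilon>} \<le> c * \<bar>t - s\<bar>" if "0 \<le> s" "s \<le> t" for s t
  proof -
    have [measurable]: "Y t \<in> borel_measurable \<Omega>" "Y s \<in> borel_measurable \<Omega>" using that by auto
    have "measure \<Omega> {\<omega>\<in>space \<Omega>. norm (Y t \<omega> - Y s \<omega>) > \<epsilon>} = measure (distr \<Omega> borel (\<lambda>\<omega>. Y t \<omega> - Y s \<omega>)) {y. norm y > \<epsilon>}"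
      by (subst measure_distr) (auto intro!: arg_cong[where f = "measure \<Omega>"])
    then show ?thesis using c(2)[of "t - s"] that by (simp add: distr_Y_increment)
  qed
  have "measure \<Omega> {\<omega>\<in>space \<Omega>. norm (Y s \<omega> - Y t \<omega>) > \<epsilon>} \<le> c * \<bar>s - t\<bar>" if "0 \<le> s" "0 \<le> t" for s t
    using le[of s t] le[of t s] that by (cases "s \<le> t") (auto simp: norm_minus_commute abs_minus_commute)
  then show ?thesis using c(1) by blast
qed

theorem levy_process_Y: "levy_process \<Omega> Y"
  unfolding levy_process_def
proof (intro conjI allI impI)
  show "prob_space \<Omega>" by (rule prob_space_\<Omega>)
  show "Y t \<in> borel_measurable \<Omega>" if "0 \<le> t" for t using that by simp
  show "AE \<omega> in \<Omega>. Y 0 \<omega> = 0" by (rule AE_Y_0)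
  show "distr \<Omega> borel (\<lambda>\<omega>. Y (s + t) \<omega> - Y s \<omega>) = distr \<Omega> borel (\<lambda>\<omega>. Y t \<omega> - Y 0 \<omega>)" if "0 \<le> s" "0 \<le> t" for s t
    using that by (simp add: distr_Y_increment)
  show "prob_space.indep_vars \<Omega> (\<lambda>_. borel) (\<lambda>i \<omega>. Y (\<tau> (Suc i)) \<omega> - Y (\<tau> i) \<omega>) {..<n}"
    if "0 \<le> \<tau> 0" "\<forall>i<n. \<tau> i < \<tau> (Suc i)" for n and \<tau> :: "nat \<Rightarrow> real"
    by (rule indep_Y_increments[OF that])
  show "((\<lambda>s. measure \<Omega> {\<omega>\<in>space \<Omega>. norm (Y s \<omega> - Y t \<omega>) > \<epsilon>}) \<longlongrightarrow> 0) (at t within {0..})"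
    if "0 \<le> t" and \<epsilon>: "0 < \<epsilon>" for t \<epsilon>
  proof -
    obtain c where c: "c \<ge> 0" "\<And>s t. 0 \<le> s \<Longrightarrow> 0 \<le> t \<Longrightarrow>
        measure \<Omega> {\<omega>\<in>space \<Omega>. norm (Y s \<omega> - Y t \<omega>) > \<epsilon>} \<le> c * \<bar>s - t\<bar>"
      using measure_Y_increment_le[OF \<epsilon>] by blast
    have "((\<lambda>s. c * \<bar>s - t\<bar>) \<longlongrightarrow> c * \<bar>t - t\<bar>) (at t within {0..})" by (intro tendsto_intros)
    then have lim: "((\<lambda>s. c * \<bar>s - t\<bar>) \<longlongrightarrow> 0) (at t within {0..})" by simp
    have "\<forall>\<^sub>F s in at t within {0..}.
        norm (measure \<Omega> {\<omega>\<in>space \<Omega>. norm (Y s \<omega> - Y t \<omega>) > \<epsilon>}) \<le> c * \<bar>s - t\<bar>"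
      using c(2) \<open>0 \<le> t\<close> by (simp add: eventually_at_filter)
    from Lim_null_comparison[OF this lim] show ?thesis .
  qed
  show "AE \<omega> in \<Omega>. cadlag (\<lambda>t. Y t \<omega>)"
    using AE_regular_path unfolding Y_def by eventually_elim (rule cadlag_right_limit)
qed

lemma distr_Y: "t \<ge> 0 \<Longrightarrow> distr \<Omega> borel (Y t) = \<nu> t"
proof -
  assume t: "t \<ge> 0"
  have [measurable]: "Y t \<in> borel_measurable \<Omega>" "Y 0 \<in> borel_measurable \<Omega>" using t by auto
  have "distr \<Omega> borel (Y t) = distr \<Omega> borel (\<lambda>\<omega>. Y t \<omega> - Y 0 \<omega>)"
    using AE_Y_0 by (intro distr_cong_AE) auto
  then show ?thesis using distr_Y_increment[of 0 t] t by simp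
qed

end

section \<open>Uniqueness in law\<close>

text \<open>Positions are partial sums of independent increments along a partition that starts at 0.
  By stationarity the right side depends on the process only through its one-dimensional laws, which
  is the whole point of this form.\<close>

lemma levy_process_fdd:
  fixes Y :: "real \<Rightarrow> 'w \<Rightarrow> 'a::euclidean_space" and n :: nat
  assumes levy: "levy_process P Y" and n: "n > 0" and \<tau>: "\<tau> 0 = 0" "\<forall>i<n. \<tau> i < \<tau> (Suc i)"
    and J: "finite J" "\<And>t. t \<in> J \<Longrightarrow> k t \<le> n \<and> \<tau> (k t) = t"
    and A: "\<And>t. t \<in> J \<Longrightarrow> A t \<in> sets borel"
  shows "emeasure P {\<omega>\<in>space P. \<forall>t\<in>J. Y t \<omega> \<in> A t}
    = emeasure (PiM {..<n} (\<lambda>i. distr P borel (Y (\<tau> (Suc i) - \<tau> i))))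
        {d \<in> space (PiM {..<n} (\<lambda>_. borel)). \<forall>t\<in>J. (\<Sum>i<k t. d i) \<in> A t}"
proof -
  interpret prob_space P using levy by (simp add: levy_process_def)
  have Ym: "Y t \<in> borel_measurable P" if "t \<ge> 0" for t using levy that by (simp add: levy_process_def)
  have Y0: "AE \<omega> in P. Y 0 \<omega> = 0" using levy by (simp add: levy_process_def)
  have stat: "distr P borel (\<lambda>\<omega>. Y (s + t) \<omega> - Y s \<omega>) = distr P borel (\<lambda>\<omega>. Y t \<omega> - Y 0 \<omega>)"
    if "0 \<le> s" "0 \<le> t" for s t
    using levy that unfolding levy_process_def by blast
  have ind: "indep_vars (\<lambda>_. borel) (\<lambda>i \<omega>. Y (\<tau> (Suc i)) \<omega> - Y (\<tau> i) \<omega>) {..<n}"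
  proof -
    have "\<forall>n::nat. \<forall>\<tau>::nat \<Rightarrow> real. 0 \<le> \<tau> 0 \<longrightarrow> (\<forall>i<n. \<tau> i < \<tau> (Suc i)) \<longrightarrow>
        indep_vars (\<lambda>_. borel) (\<lambda>i \<omega>. Y (\<tau> (Suc i)) \<omega> - Y (\<tau> i) \<omega>) {..<n}"
      using levy unfolding levy_process_def by (elim conjE)
    from this[rule_format, of \<tau> n] show ?thesis using \<tau> by simp
  qed
  have mono: "\<tau> i \<le> \<tau> j" if "i \<le> j" "j \<le> n" for i j
    using that
  proof (induction j rule: dec_induct)
    case (step k)
    then have "\<tau> i \<le> \<tau> k" "\<tau> k < \<tau> (Suc k)" using \<tau>(2) by auto
    then show ?case by simp
  qed simp
  have pos: "0 \<le> \<tau> i" if "i \<le> n" for i using mono[of 0 i] \<tau>(1) that by simp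
  have Y\<tau>: "Y (\<tau> i) \<in> borel_measurable P" if "i \<le> n" for i using Ym[OF pos[OF that]] .
  define D where "D i \<omega> = Y (\<tau> (Suc i)) \<omega> - Y (\<tau> i) \<omega>" for i \<omega>
  have Dm: "D i \<in> borel_measurable P" if "i \<in> {..<n}" for i
    unfolding D_def[abs_def] using that Y\<tau> by (intro borel_measurable_diff) auto
  have law: "distr P borel (D i) = distr P borel (Y (\<tau> (Suc i) - \<tau> i))" if "i \<in> {..<n}" for i
  proof -
    have i: "0 \<le> \<tau> i" "0 \<le> \<tau> (Suc i) - \<tau> i" using that pos[of i] mono[of i "Suc i"] by auto
    then have "distr P borel (D i) = distr P borel (\<lambda>\<omega>. Y (\<tau> (Suc i) - \<tau> i) \<omega> - Y 0 \<omega>)"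
      using stat[OF i] by (simp add: D_def[abs_def])
    also have "\<dots> = distr P borel (Y (\<tau> (Suc i) - \<tau> i))"
      using Y0 Ym[OF i(2)] Ym[of 0] by (intro distr_cong_AE) auto
    finally show ?thesis .
  qed
  have "indep_vars (\<lambda>_. borel) D {..<n}"
    using ind by (simp add: D_def[abs_def])
  then have "distr P (PiM {..<n} (\<lambda>_. borel)) (\<lambda>\<omega>. \<lambda>i\<in>{..<n}. D i \<omega>) = PiM {..<n} (\<lambda>i. distr P borel (D i))"
    using n Dm by (subst (asm) indep_vars_iff_distr_eq_PiM') auto
  also have "\<dots> = PiM {..<n} (\<lambda>i. distr P borel (Y (\<tau> (Suc i) - \<tau> i)))"
    by (intro PiM_cong refl law)
  finally have joint: "distr P (PiM {..<n} (\<lambda>_. borel)) (\<lambda>\<omega>. \<lambda>i\<in>{..<n}. D i \<omega>)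
      = PiM {..<n} (\<lambda>i. distr P borel (Y (\<tau> (Suc i) - \<tau> i)))" .
  define B where "B = {d \<in> space (PiM {..<n} (\<lambda>_. borel :: 'a measure)). \<forall>t\<in>J. (\<Sum>i<k t. d i) \<in> A t}"
  have B: "B \<in> sets (PiM {..<n} (\<lambda>_. borel))"
  proof -
    have "{d \<in> space (PiM {..<n} (\<lambda>_. borel)). (\<Sum>i<k t. d i) \<in> A t} \<in> sets (PiM {..<n} (\<lambda>_. borel))"
      if "t \<in> J" for t
    proof -
      have "(\<lambda>d. \<Sum>i<k t. d i) \<in> borel_measurable (PiM {..<n} (\<lambda>_. borel :: 'a measure))"
        using J(2)[OF that] by (intro borel_measurable_sum measurable_component_singleton) auto
      from measurable_sets[OF this A[OF that]] show ?thesis by (simp add: vimage_def Int_def conj_commute)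
    qed
    then show ?thesis unfolding B_def using J(1) by (intro sets.sets_Collect_finite_All) auto
  qed
  have Dr: "(\<lambda>\<omega>. \<lambda>i\<in>{..<n}. D i \<omega>) \<in> P \<rightarrow>\<^sub>M PiM {..<n} (\<lambda>_. borel)"
    by (intro measurable_restrict Dm)
  have "emeasure P {\<omega>\<in>space P. \<forall>t\<in>J. Y t \<omega> \<in> A t} = emeasure P ((\<lambda>\<omega>. \<lambda>i\<in>{..<n}. D i \<omega>) -` B \<inter> space P)"
  proof (rule emeasure_eq_AE)
    show "AE \<omega> in P. \<omega> \<in> {\<omega>\<in>space P. \<forall>t\<in>J. Y t \<omega> \<in> A t} \<longleftrightarrow> \<omega> \<in> (\<lambda>\<omega>. \<lambda>i\<in>{..<n}. D i \<omega>) -` B \<inter> space P"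
      using Y0
    proof eventually_elim
      fix \<omega> assume "Y 0 \<omega> = 0"
      have "(\<Sum>i<j. D i \<omega>) = Y (\<tau> j) \<omega>" for j
        using \<open>Y 0 \<omega> = 0\<close> \<tau>(1) by (induction j) (simp_all add: D_def)
      moreover have "(\<Sum>i<k t. (\<lambda>i\<in>{..<n}. D i \<omega>) i) = (\<Sum>i<k t. D i \<omega>)" if "t \<in> J" for t
        using J(2)[OF that] by (intro sum.cong) auto
      ultimately have "(\<Sum>i<k t. (\<lambda>i\<in>{..<n}. D i \<omega>) i) = Y t \<omega>" if "t \<in> J" for t
        using J(2)[OF that] that by simp
      then show "\<omega> \<in> {\<omega>\<in>space P. \<forall>t\<in>J. Y t \<omega> \<in> A t} \<longleftrightarrow> \<omega> \<in> (\<lambda>\<omega>. \<lambda>i\<in>{..<n}. D i \<omega>) -` B \<inter> space P"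
        by (auto simp: B_def space_PiM)
    qed
    have "{\<omega>\<in>space P. Y t \<omega> \<in> A t} \<in> sets P" if "t \<in> J" for t
    proof -
      have "t \<ge> 0" using J(2)[OF that] pos[of "k t"] by simp
      from measurable_sets[OF Ym[OF this] A[OF that]] show ?thesis by (simp add: vimage_def Int_def conj_commute)
    qed
    then show "{\<omega>\<in>space P. \<forall>t\<in>J. Y t \<omega> \<in> A t} \<in> sets P"
      using J(1) by (intro sets.sets_Collect_finite_All) auto
  qed (rule measurable_sets[OF Dr B])
  also have "\<dots> = emeasure (distr P (PiM {..<n} (\<lambda>_. borel)) (\<lambda>\<omega>. \<lambda>i\<in>{..<n}. D i \<omega>)) B"
    by (rule emeasure_distr[OF Dr B, symmetric])
  finally show ?thesis unfolding joint B_def .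
qed

lemma levy_process_law_unique:
  fixes Y :: "real \<Rightarrow> 'w \<Rightarrow> 'a::euclidean_space" and Z :: "real \<Rightarrow> 'v \<Rightarrow> 'a"
  assumes P: "levy_process P Y" and Q: "levy_process Q Z"
    and law: "\<And>t. t \<ge> 0 \<Longrightarrow> distr P borel (Y t) = distr Q borel (Z t)"
  shows "process_law P Y = process_law Q Z"
proof -
  have meas: "(\<lambda>\<omega>. \<lambda>t\<in>{0..}. U t \<omega>) \<in> R \<rightarrow>\<^sub>M PiM {0..} (\<lambda>_. borel)" if "levy_process R U"
    for R :: "'x measure" and U :: "real \<Rightarrow> 'x \<Rightarrow> 'a"
    using that by (intro measurable_restrict) (auto simp: levy_process_def)
  show ?thesis
    unfolding process_law_def
  proof (rule measure_eqI_PiM_infinite[where I = "{0..}" and M = "\<lambda>_. borel"])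
    interpret prob_space P using P by (simp add: levy_process_def)
    interpret L: prob_space "distr P (PiM {0..} (\<lambda>_. borel)) (\<lambda>\<omega>. \<lambda>t\<in>{0..}. Y t \<omega>)"
      by (rule prob_space_distr[OF meas[OF P]])
    show "finite_measure (distr P (PiM {0..} (\<lambda>_. borel)) (\<lambda>\<omega>. \<lambda>t\<in>{0..}. Y t \<omega>))" by unfold_locales
  next
    fix A and J :: "real set" assume J: "finite J" "J \<subseteq> {0..}" and A: "\<And>t. t \<in> J \<Longrightarrow> A t \<in> sets (borel :: 'a measure)"
    \<comment> \<open>The point 0 makes the partition start at 0; the point 1 guarantees at least
      one increment even when \<open>J\<close> contains no positive time.\<close>
    define xs where "xs = sorted_list_of_set (insert 0 (insert 1 J))"
    have fin: "finite (insert 0 (insert 1 J))" using J(1) by simp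
    have xs: "set xs = insert 0 (insert 1 J)" "sorted_wrt (<) xs"
      unfolding xs_def by (rule set_sorted_list_of_set[OF fin], rule strict_sorted_list_of_set)
    have len: "length xs \<ge> 2"
    proof -
      have "card {0, 1 :: real} \<le> card (set xs)" by (intro card_mono) (auto simp: xs(1) J(1))
      then show ?thesis using card_length[of xs] by simp
    qed
    define n where "n = length xs - 1"
    define \<tau> where "\<tau> i = xs ! i" for i
    have n: "n > 0" "length xs = Suc n" using len by (auto simp: n_def)
    have mono: "\<forall>i<n. \<tau> i < \<tau> (Suc i)"
      using sorted_wrt_nth_less[OF xs(2)] n by (auto simp: \<tau>_def)
    have ex: "\<exists>j\<le>n. \<tau> j = t" if "t \<in> insert 0 (insert 1 J)" for t
      using that n unfolding xs(1)[symmetric] in_set_conv_nth \<tau>_def by (auto simp: less_Suc_eq_le)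
    have "\<tau> 0 = 0"
    proof -
      obtain j where j: "j \<le> n" "\<tau> j = 0" using ex[of 0] by auto
      have "\<tau> 0 \<in> set xs" using n by (auto simp: \<tau>_def)
      then have "\<tau> 0 \<ge> 0" using J by (auto simp: xs(1))
      moreover have "j \<noteq> 0 \<Longrightarrow> \<tau> 0 < \<tau> j"
        using sorted_wrt_nth_less[OF xs(2), of 0 j] j n by (simp add: \<tau>_def)
      ultimately show ?thesis using j by (cases "j = 0") auto
    qed
    have "\<forall>t. \<exists>j. t \<in> J \<longrightarrow> j \<le> n \<and> \<tau> j = t" using ex by auto
    then obtain k where k: "\<And>t. t \<in> J \<Longrightarrow> k t \<le> n \<and> \<tau> (k t) = t" by metis
    have fdd: "emeasure (distr R (PiM {0..} (\<lambda>_. borel)) (\<lambda>\<omega>. \<lambda>t\<in>{0..}. U t \<omega>)) (prod_emb {0..} (\<lambda>_. borel) J (PiE J A))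
      = emeasure (PiM {..<n} (\<lambda>i. distr R borel (U (\<tau> (Suc i) - \<tau> i))))
        {d \<in> space (PiM {..<n} (\<lambda>_. borel)). \<forall>t\<in>J. (\<Sum>i<k t. d i) \<in> A t}"
      if R: "levy_process R U" for R :: "'x measure" and U :: "real \<Rightarrow> 'x \<Rightarrow> 'a"
    proof -
      have "emeasure (distr R (PiM {0..} (\<lambda>_. borel)) (\<lambda>\<omega>. \<lambda>t\<in>{0..}. U t \<omega>)) (prod_emb {0..} (\<lambda>_. borel) J (PiE J A))
        = emeasure R ((\<lambda>\<omega>. \<lambda>t\<in>{0..}. U t \<omega>) -` prod_emb {0..} (\<lambda>_. borel) J (PiE J A) \<inter> space R)"
        using J A by (intro emeasure_distr meas R sets_PiM_I) auto
      also have "(\<lambda>\<omega>. \<lambda>t\<in>{0..}. U t \<omega>) -` prod_emb {0..} (\<lambda>_. borel) J (PiE J A) \<inter> space R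
          = {\<omega>\<in>space R. \<forall>t\<in>J. U t \<omega> \<in> A t}"
        using J(2) by (auto simp: prod_emb_def PiE_iff subset_eq)
      also have "emeasure R \<dots> = emeasure (PiM {..<n} (\<lambda>i. distr R borel (U (\<tau> (Suc i) - \<tau> i))))
        {d \<in> space (PiM {..<n} (\<lambda>_. borel)). \<forall>t\<in>J. (\<Sum>i<k t. d i) \<in> A t}"
        by (rule levy_process_fdd[OF R n(1) \<open>\<tau> 0 = 0\<close> mono J(1) k A])
      finally show ?thesis .
    qed
    have "PiM {..<n} (\<lambda>i. distr P borel (Y (\<tau> (Suc i) - \<tau> i))) = PiM {..<n} (\<lambda>i. distr Q borel (Z (\<tau> (Suc i) - \<tau> i)))"
      using mono by (intro PiM_cong refl law) (auto simp: less_imp_le)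
    then show "emeasure (distr P (PiM {0..} (\<lambda>_. borel)) (\<lambda>\<omega>. \<lambda>t\<in>{0..}. Y t \<omega>)) (prod_emb {0..} (\<lambda>_. borel) J (PiE J A))
      = emeasure (distr Q (PiM {0..} (\<lambda>_. borel)) (\<lambda>\<omega>. \<lambda>t\<in>{0..}. Z t \<omega>)) (prod_emb {0..} (\<lambda>_. borel) J (PiE J A))"
      by (simp only: fdd[OF P] fdd[OF Q])
  qed simp_all
qed

section \<open>One-dimensional laws determined by uniformly continuous functions\<close>

lemma UC_b_lipschitz_inner:
  fixes f :: "real \<Rightarrow> real" and v :: "'a::euclidean_space"
  assumes "\<And>x y. \<bar>f x - f y\<bar> \<le> \<bar>x - y\<bar>" "\<And>x. \<bar>f x\<bar> \<le> 1"
  shows "(\<lambda>x. f (x \<bullet> v)) \<in> UC_b"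
proof -
  have "uniformly_continuous_on UNIV (\<lambda>x. f (x \<bullet> v))"
    unfolding uniformly_continuous_on_def
  proof (intro allI impI)
    fix e :: real assume "e > 0"
    have p: "norm v + 1 > 0" by (simp add: add_nonneg_pos)
    have "dist (f (x' \<bullet> v)) (f (x \<bullet> v)) < e" if "dist x' x < e / (norm v + 1)" for x x'
    proof -
      have "\<bar>f (x' \<bullet> v) - f (x \<bullet> v)\<bar> \<le> \<bar>(x' - x) \<bullet> v\<bar>" using assms(1) by (simp add: inner_diff_left)
      also have "\<dots> \<le> norm (x' - x) * norm v" by (rule Cauchy_Schwarz_ineq2)
      also have "\<dots> \<le> norm (x' - x) * (norm v + 1)" by (intro mult_left_mono) auto
      also have "\<dots> < e" using that p by (simp add: dist_norm pos_less_divide_eq)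
      finally show ?thesis by (simp add: dist_real_def)
    qed
    then show "\<exists>d>0. \<forall>x\<in>UNIV. \<forall>x'\<in>UNIV. dist x' x < d \<longrightarrow> dist (f (x' \<bullet> v)) (f (x \<bullet> v)) < e"
      using \<open>e > 0\<close> p by (intro exI[of _ "e / (norm v + 1)"]) auto
  qed
  moreover have "bounded (range (\<lambda>x. f (x \<bullet> v)))" using assms(2) by (auto simp: bounded_iff)
  ultimately show ?thesis by (simp add: UC_b_def)
qed

lemma UC_b_cos: "(\<lambda>x. cos (x \<bullet> v)) \<in> UC_b" and UC_b_sin: "(\<lambda>x. sin (x \<bullet> v)) \<in> UC_b"
proof -
  have "\<bar>cos x - cos y\<bar> \<le> 1 * \<bar>x - y\<bar>" "\<bar>sin x - sin y\<bar> \<le> 1 * \<bar>x - y\<bar>" for x y :: real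
    unfolding real_norm_def[symmetric]
    by (rule field_differentiable_bound[of UNIV _ "\<lambda>x. - sin x"] field_differentiable_bound[of UNIV _ cos];
        auto intro!: derivative_eq_intros)+
  then show "(\<lambda>x. cos (x \<bullet> v)) \<in> UC_b" "(\<lambda>x. sin (x \<bullet> v)) \<in> UC_b"
    by (auto intro!: UC_b_lipschitz_inner)
qed

text \<open>The supremum norm dominates the value at 0, so the expectation of \<open>f\<close> at
  time \<open>t\<close> is the limit of integrals against convolution powers, in which the process
  does not occur. Sines and cosines then determine the law.\<close>

lemma UC_b_approximation_unique:
  fixes \<mu> :: "real \<Rightarrow> 'a::ordered_euclidean_space measure"
  assumes P: "prob_space P" "UC_b_approximation \<mu> P Y" "Y t \<in> borel_measurable P"
    and Q: "prob_space Q" "UC_b_approximation \<mu> Q Z" "Z t \<in> borel_measurable Q" and t: "t \<ge> 0"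
    and disc: "\<And>n. h n > 0" "h \<longlonglongrightarrow> 0" "(\<lambda>n. real (k n) * h n) \<longlonglongrightarrow> t"
  shows "distr P borel (Y t) = distr Q borel (Z t)"
proof -
  have lim: "(\<lambda>n. \<integral>y. f y \<partial>conv_power (\<mu> (h n)) (k n)) \<longlonglongrightarrow> (\<integral>\<omega>. f (U t \<omega>) \<partial>R)"
    if approx: "UC_b_approximation \<mu> R U" and f: "f \<in> UC_b" for R :: "'x measure" and U f
  proof -
    have "sup_norm (\<lambda>x. f x - f x) = 0" for f :: "'a \<Rightarrow> real" by (simp add: sup_norm_def bot_ennreal[symmetric])
    then have "(\<lambda>n. sup_norm (\<lambda>x. (\<integral>y. f (x + y) \<partial>conv_power (\<mu> (h n)) (k n)) - (\<integral>\<omega>. f (x + U t \<omega>) \<partial>R))) \<longlonglongrightarrow> 0"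
      using approx[unfolded UC_b_approximation_def, rule_format, of h t f k "\<lambda>_. f"] disc t f by simp
    then have "(\<lambda>n. ennreal \<bar>(\<integral>y. f (0 + y) \<partial>conv_power (\<mu> (h n)) (k n)) - (\<integral>\<omega>. f (0 + U t \<omega>) \<partial>R)\<bar>) \<longlonglongrightarrow> 0"
      by (rule tendsto_0_le_ennreal) (intro always_eventually allI, unfold sup_norm_def, rule SUP_upper, simp)
    then have "(\<lambda>n. \<bar>(\<integral>y. f (0 + y) \<partial>conv_power (\<mu> (h n)) (k n)) - (\<integral>\<omega>. f (0 + U t \<omega>) \<partial>R)\<bar>) \<longlonglongrightarrow> 0"
      by (simp add: tendsto_ennreal_iff flip: ennreal_0)
    then show ?thesis by (simp add: tendsto_rabs_zero_iff LIM_zero_iff)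
  qed
  have eq: "(\<integral>\<omega>. f (Y t \<omega>) \<partial>P) = (\<integral>\<omega>. f (Z t \<omega>) \<partial>Q)" if "f \<in> UC_b" for f
    by (rule LIMSEQ_unique[OF lim[OF P(2) that] lim[OF Q(2) that]])
  interpret P: prob_space P by fact
  interpret Q: prob_space Q by fact
  note [measurable] = P(3) Q(3)
  show ?thesis
  proof (rule measure_eqI_char)
    show "prob_space (distr P borel (Y t))" "prob_space (distr Q borel (Z t))"
      by (rule P.prob_space_distr Q.prob_space_distr, measurable)+
  qed (simp_all add: integral_distr eq[OF UC_b_cos] eq[OF UC_b_sin])
qed

section \<open>The approximation statements for the constructed process\<close>

context small_time_family
begin

sublocale levy_semigroup limit_law levy_exponent
  by (intro levy_semigroup.intro limit_law limit_law_small)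

lemma chernoff_approximation:
  assumes N: "shift_norm N F G"
  shows "chernoff_approximation N F G \<mu> limit_law"
  by (intro chernoff_approximation.intro chernoff_approximation_axioms.intro N prob borel limit_law limit_law_0
      conv_power_coupled)

lemma expectation_Y:
  assumes "t \<ge> 0" "f \<in> borel_measurable borel"
  shows "(\<integral>\<omega>. f (x + Y t \<omega>) \<partial>\<Omega>) = shift_mean (limit_law t) f x"
  unfolding shift_mean_def distr_Y[OF assms(1), symmetric]
  using assms by (subst integral_distr) auto

lemma shift_norm_approximation:
  assumes N: "shift_norm N F G"
    and "\<And>n. h n > 0" "h \<longlonglongrightarrow> 0" "t \<ge> 0" "(\<lambda>n. real (k n) * h n) \<longlonglongrightarrow> t"
    and "\<And>n. fs n \<in> F" "f \<in> F" "(\<lambda>n. N (\<lambda>x. fs n x - f x)) \<longlonglongrightarrow> 0"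
  shows "(\<lambda>n. N (\<lambda>x. (\<integral>y. fs n (x + y) \<partial>conv_power (\<mu> (h n)) (k n)) - (\<integral>\<omega>. f (x + Y t \<omega>) \<partial>\<Omega>))) \<longlonglongrightarrow> 0"
proof -
  interpret chernoff_approximation N F G \<mu> limit_law by (rule chernoff_approximation[OF N])
  show ?thesis
    unfolding expectation_Y[OF assms(4) measurable[OF assms(7)]] shift_mean_def[symmetric]
    by (rule approximation_powers[OF assms(2-8)])
qed

lemma shift_norm_generator:
  assumes N: "shift_norm N F G" and f: "f \<in> F" and "g \<in> F"
    and "((\<lambda>h. N (\<lambda>x. (\<integral>y. (f (x + y) - f x) / h \<partial>\<mu> h) - g x)) \<longlongrightarrow> 0) (at_right 0)"
  shows "((\<lambda>h. ennreal (1 / h) * N (\<lambda>x. (\<integral>y. f (x + y) \<partial>\<mu> h) - (\<integral>\<omega>. f (x + Y h \<omega>) \<partial>\<Omega>))) \<longlongrightarrow> 0) (at_right 0)"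
proof -
  interpret chernoff_approximation N F G \<mu> limit_law by (rule chernoff_approximation[OF N])
  show ?thesis
  proof (rule Lim_transform_eventually[OF generator_approximation[OF assms(2-4)]])
    show "\<forall>\<^sub>F h in at_right 0. ennreal (1 / h) * N (\<lambda>x. shift_mean (\<mu> h) f x - shift_mean (limit_law h) f x)
      = ennreal (1 / h) * N (\<lambda>x. (\<integral>y. f (x + y) \<partial>\<mu> h) - (\<integral>\<omega>. f (x + Y h \<omega>) \<partial>\<Omega>))"
      by (rule eventually_at_right_pos) (simp add: expectation_Y measurable[OF f] shift_mean_def[of "\<mu> _"])
  qed
qed

lemma Lp_approximation_Y: "Lp_approximation \<mu> \<Omega> Y"
  unfolding Lp_approximation_def
proof (intro allI impI)
  fix h :: "nat \<Rightarrow> real" and p t :: real and f and k :: "nat \<Rightarrow> nat" and fs :: "nat \<Rightarrow> real ^ 'd \<Rightarrow> real"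
  assume *: "\<forall>n. 0 < h n" "h \<longlonglongrightarrow> 0" "1 \<le> p" "0 \<le> t" "f \<in> Lp p" "(\<lambda>n. real (k n) * h n) \<longlonglongrightarrow> t"
    "\<forall>n. fs n \<in> Lp p" "(\<lambda>n. Lp_norm p (\<lambda>x. fs n x - f x)) \<longlonglongrightarrow> 0"
  then show "(\<lambda>n. Lp_norm p (\<lambda>x. (\<integral>y. fs n (x + y) \<partial>conv_power (\<mu> (h n)) (k n)) - (\<integral>\<omega>. f (x + Y t \<omega>) \<partial>\<Omega>))) \<longlonglongrightarrow> 0"
    by (intro shift_norm_approximation[OF shift_norm_Lp]) auto
qed

lemma UC_b_approximation_Y: "UC_b_approximation \<mu> \<Omega> Y"
  unfolding UC_b_approximation_def
proof (intro allI impI)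
  fix h :: "nat \<Rightarrow> real" and t :: real and f and k :: "nat \<Rightarrow> nat" and fs :: "nat \<Rightarrow> real ^ 'd \<Rightarrow> real"
  assume *: "\<forall>n. 0 < h n" "h \<longlonglongrightarrow> 0" "0 \<le> t" "f \<in> UC_b" "(\<lambda>n. real (k n) * h n) \<longlonglongrightarrow> t"
    "\<forall>n. fs n \<in> UC_b" "(\<lambda>n. sup_norm (\<lambda>x. fs n x - f x)) \<longlonglongrightarrow> 0"
  then show "(\<lambda>n. sup_norm (\<lambda>x. (\<integral>y. fs n (x + y) \<partial>conv_power (\<mu> (h n)) (k n)) - (\<integral>\<omega>. f (x + Y t \<omega>) \<partial>\<Omega>))) \<longlonglongrightarrow> 0"
    by (intro shift_norm_approximation[OF shift_norm_sup]) auto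
qed

lemma law_unique:
  assumes "levy_process Q Z" "UC_b_approximation \<mu> Q Z"
  shows "process_law Q Z = process_law \<Omega> Y"
proof (rule levy_process_law_unique[OF assms(1) levy_process_Y])
  fix t :: real assume t: "t \<ge> 0"
  show "distr Q borel (Z t) = distr \<Omega> borel (Y t)"
  proof (rule UC_b_approximation_unique[OF _ assms(2) _ prob_space_\<Omega> UC_b_approximation_Y measurable_Y[OF t] t
        unit_fractions(2,1) discretization[OF t]])
    show "prob_space Q" "Z t \<in> borel_measurable Q" using assms(1) t by (auto simp: levy_process_def)
  qed
qed

end

theorem corollary2p4:
  fixes \<mu> :: "real \<Rightarrow> (real ^ 'd) measure"
  assumes prob: "\<And>h. h > 0 \<Longrightarrow> prob_space (\<mu> h)"
    and borel: "\<And>h. h > 0 \<Longrightarrow> sets (\<mu> h) = sets borel"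
    and generator: "\<And>\<phi>. \<phi> \<in> Cc_infinity \<Longrightarrow>
      \<exists>L::real. ((\<lambda>h. \<integral>y. (\<phi> y - \<phi> 0) / h \<partial>\<mu> h) \<longlongrightarrow> L) (at_right 0)"
    and tails: "\<And>\<epsilon>::real. \<epsilon> > 0 \<Longrightarrow>
      \<exists>M>0. Limsup (at_right 0) (\<lambda>h. ereal (1 / h * measure (\<mu> h) {y. norm y > M})) < ereal \<epsilon>"
  shows "\<exists>(P :: (real \<Rightarrow> real ^ 'd) measure) (Y :: real \<Rightarrow> (real \<Rightarrow> real ^ 'd) \<Rightarrow> real ^ 'd).
    levy_process P Y \<and> Lp_approximation \<mu> P Y \<and> UC_b_approximation \<mu> P Y \<and>
    (\<forall>(Q :: 'w measure) (Z :: real \<Rightarrow> 'w \<Rightarrow> real ^ 'd).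
       levy_process Q Z \<and> Lp_approximation \<mu> Q Z \<and> UC_b_approximation \<mu> Q Z \<longrightarrow>
       process_law Q Z = process_law P Y) \<and>
    (\<forall>p\<ge>1. \<forall>f\<in>Lp p.
       (\<exists>g\<in>Lp p. ((\<lambda>h. Lp_norm p (\<lambda>x. (\<integral>y. (f (x + y) - f x) / h \<partial>\<mu> h) - g x)) \<longlongrightarrow> 0)
          (at_right 0)) \<longrightarrow>
       ((\<lambda>h. ennreal (1 / h) *
            Lp_norm p (\<lambda>x. (\<integral>y. f (x + y) \<partial>\<mu> h) - (\<integral>\<omega>. f (x + Y h \<omega>) \<partial>P))) \<longlongrightarrow> 0)
         (at_right 0)) \<and>
    (\<forall>f\<in>UC_b.
       (\<exists>g\<in>UC_b. ((\<lambda>h. sup_norm (\<lambda>x. (\<integral>y. (f (x + y) - f x) / h \<partial>\<mu> h) - g x)) \<longlongrightarrow> 0)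
          (at_right 0)) \<longrightarrow>
       ((\<lambda>h. ennreal (1 / h) *
            sup_norm (\<lambda>x. (\<integral>y. f (x + y) \<partial>\<mu> h) - (\<integral>\<omega>. f (x + Y h \<omega>) \<partial>P))) \<longlongrightarrow> 0)
         (at_right 0))"
proof -
  interpret small_time_family \<mu>
    by (intro small_time_family.intro prob borel generator tails)
  show ?thesis
  proof (intro exI[of _ \<Omega>] exI[of _ Y] conjI allI ballI impI)
    show "levy_process \<Omega> Y" by (rule levy_process_Y)
    show "Lp_approximation \<mu> \<Omega> Y" by (rule Lp_approximation_Y)
    show "UC_b_approximation \<mu> \<Omega> Y" by (rule UC_b_approximation_Y)
    show "process_law Q Z = process_law \<Omega> Y"
      if "levy_process Q Z \<and> Lp_approximation \<mu> Q Z \<and> UC_b_approximation \<mu> Q Z"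
      for Q :: "'w measure" and Z :: "real \<Rightarrow> 'w \<Rightarrow> real ^ 'd"
      using that by (intro law_unique) auto
  qed (auto intro: shift_norm_generator[OF shift_norm_Lp] shift_norm_generator[OF shift_norm_sup])
qed

end
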